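(* Let $k$ be a field, $V$ a $k$-vector space of finite dimension $n\ge1$, $f\neq0$ an element of $V\otimes V$, $R=kf$, and $A=A(V,R)=T(V)/I(R)$. Let $M$ be the matrix of coefficients of $f$ relative to a basis of $V$. Assume that the rank of $f$ is $>1$. Then (i) every nonzero element of $V$ is neither a left nor a right zerodivisor in $A$; (ii) the global dimension of $A$ is $2$; (iii) $A$ is Koszul; (iv) $A$ is AS-Gorenstein if and only if $M$ is invertible.
   Context: $T(V)$ is the tensor algebra ($V$ in degree $1$), $I(R)$ the two-sided ideal generated by $R$. For a basis $(x_1,\dots,x_n)$ of $V$, write $f=\sum_{1\le i,j\le n}f_{ij}x_ix_j$; the matrix $M=(f_{ij})$ is the matrix of coefficients of $f$ relative to this basis, and its rank (independent of the basis) is the rank of $f$. Koszul: for $m\ge0$ let $W_m=\bigcap_{i+2+j=m}V^{\otimes i}\otimes R\otimes V^{\otimes j}\subseteq V^{\otimes m}$ ($W_0=k$, $W_1=V$, $W_2=R$). The Koszul complex $K(A)$ has $K_i=A\otimes W_i$ with left $A$-linear differential $K_i\to K_{i-1}$ induced by the inclusion $W_i\subseteq V\otimes W_{i-1}$ followed by multiplication into $A$. $A$ is Koszul if $K(A)$ has zero homology in every degree $i>0$. AS-Gorenstein: a connected graded $k$-algebra $A$ of finite global dimension $d\ge1$ is AS-Gorenstein if $\mathrm{Ext}^i_A(k,A)=0$ for $i\ne d$ and $\mathrm{Ext}^d_A(k,A)\cong k$ as right $A$-modules (Ext of left modules). *)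

theory Defs
  imports
    "HOL-Analysis.Analysis"
    "HOL-Algebra.QuotRing"
    "HOL-Algebra.Generated_Groups"
    "HOL-Algebra.Module"
    "HOL-Library.Poly_Mapping"
    "HOL-Library.Extended_Nat"
begin

section \<open>Left modules over a noncommutative ring\<close>

text \<open>
  The locale \<^locale>\<open>Module.module\<close> of HOL-Algebra requires a commutative ring of scalars; its
  record type is reused here.  A right module is represented by the same record type, with
  \<open>smult M a m\<close> standing for \<open>m \<cdot> a\<close>.  The ring fields \<open>mult\<close> and \<open>one\<close> of a module carry no
  information.
\<close>

locale left_module = R?: ring R + M?: abelian_group M
  for R (structure) and M (structure) +
  assumes smult_closed:
      "\<lbrakk>a \<in> carrier R; m \<in> carrier M\<rbrakk> \<Longrightarrow> a \<odot>\<^bsub>M\<^esub> m \<in> carrier M"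
    and smult_l_distr:
      "\<lbrakk>a \<in> carrier R; b \<in> carrier R; m \<in> carrier M\<rbrakk> \<Longrightarrow>
        (a \<oplus>\<^bsub>R\<^esub> b) \<odot>\<^bsub>M\<^esub> m = a \<odot>\<^bsub>M\<^esub> m \<oplus>\<^bsub>M\<^esub> b \<odot>\<^bsub>M\<^esub> m"
    and smult_r_distr:
      "\<lbrakk>a \<in> carrier R; m \<in> carrier M; m' \<in> carrier M\<rbrakk> \<Longrightarrow>
        a \<odot>\<^bsub>M\<^esub> (m \<oplus>\<^bsub>M\<^esub> m') = a \<odot>\<^bsub>M\<^esub> m \<oplus>\<^bsub>M\<^esub> a \<odot>\<^bsub>M\<^esub> m'"
    and smult_assoc:
      "\<lbrakk>a \<in> carrier R; b \<in> carrier R; m \<in> carrier M\<rbrakk> \<Longrightarrow>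
        (a \<otimes>\<^bsub>R\<^esub> b) \<odot>\<^bsub>M\<^esub> m = a \<odot>\<^bsub>M\<^esub> (b \<odot>\<^bsub>M\<^esub> m)"
    and smult_one: "m \<in> carrier M \<Longrightarrow> \<one>\<^bsub>R\<^esub> \<odot>\<^bsub>M\<^esub> m = m"

definition module_homs ::
    "('a, 'x) ring_scheme \<Rightarrow> ('a, 'm) module \<Rightarrow> ('a, 'n) module \<Rightarrow> ('m \<Rightarrow> 'n) set"
  where "module_homs A M N =
    {h \<in> carrier M \<rightarrow> carrier N.
      (\<forall>p\<in>carrier M. \<forall>q\<in>carrier M. h (p \<oplus>\<^bsub>M\<^esub> q) = h p \<oplus>\<^bsub>N\<^esub> h q) \<and>
      (\<forall>a\<in>carrier A. \<forall>p\<in>carrier M. h (a \<odot>\<^bsub>M\<^esub> p) = a \<odot>\<^bsub>N\<^esub> h p)}"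

definition module_isomorphic ::
    "('a, 'x) ring_scheme \<Rightarrow> ('a, 'm) module \<Rightarrow> ('a, 'n) module \<Rightarrow> bool"
  where "module_isomorphic A M N \<longleftrightarrow>
    (\<exists>h\<in>module_homs A M N. bij_betw h (carrier M) (carrier N))"

definition quotient_module :: "('a, 'm) module \<Rightarrow> 'm set \<Rightarrow> ('a, 'm set) module"
  where "quotient_module M N =
    \<lparr>carrier = a_rcosets\<^bsub>M\<^esub> N, mult = undefined, one = undefined, zero = N, add = set_add M,
     smult = (\<lambda>a X. N <+>\<^bsub>M\<^esub> ((\<lambda>m. a \<odot>\<^bsub>M\<^esub> m) ` X))\<rparr>"

definition left_regular :: "('a, 'x) ring_scheme \<Rightarrow> ('a, 'a) module"
  where "left_regular A =
    \<lparr>carrier = carrier A, mult = undefined, one = undefined, zero = \<zero>\<^bsub>A\<^esub>, add = add A,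
     smult = (\<lambda>a b. a \<otimes>\<^bsub>A\<^esub> b)\<rparr>"

definition right_regular :: "('a, 'x) ring_scheme \<Rightarrow> ('a, 'a) module"
  where "right_regular A =
    \<lparr>carrier = carrier A, mult = undefined, one = undefined, zero = \<zero>\<^bsub>A\<^esub>, add = add A,
     smult = (\<lambda>a b. b \<otimes>\<^bsub>A\<^esub> a)\<rparr>"


section \<open>Projective resolutions, global dimension, Ext\<close>

text \<open>
  Higher-order logic cannot quantify over modules of all types inside a definition, so carrier
  types are chosen large enough.  In \<open>projective\<close>, the lifting property is tested against all
  surjections from modules on \<open>'p \<Rightarrow> 'a\<close> onto modules on \<open>'p\<close>; this includes the
  canonical surjection onto \<open>P\<close> from the free module of finitely supported functions on the
  carrier of \<open>P\<close>, whose splitting implies the lifting property in every type.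
\<close>

definition projective :: "('a, 'x) ring_scheme \<Rightarrow> ('a, 'p) module \<Rightarrow> bool"
  where "projective A P \<longleftrightarrow> left_module A P \<and>
    (\<forall>(X :: ('a, 'p \<Rightarrow> 'a) module) (Y :: ('a, 'p) module) g h.
      left_module A X \<and> left_module A Y \<and>
      g \<in> module_homs A X Y \<and> g ` carrier X = carrier Y \<and> h \<in> module_homs A P Y \<longrightarrow>
      (\<exists>l\<in>module_homs A P X. \<forall>p\<in>carrier P. g (l p) = h p))"

text \<open>\<open>\<dots> \<rightarrow> P 2 \<rightarrow> P 1 \<rightarrow> P 0 \<rightarrow> M \<rightarrow> 0\<close> with \<open>d i : P (i + 1) \<rightarrow> P i\<close> and augmentation \<open>e\<close>.\<close>

definition projective_resolution ::
    "('a, 'x) ring_scheme \<Rightarrow> ('a, 'm) module \<Rightarrow>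
     (nat \<Rightarrow> ('a, 'p) module) \<Rightarrow> (nat \<Rightarrow> 'p \<Rightarrow> 'p) \<Rightarrow> ('p \<Rightarrow> 'm) \<Rightarrow> bool"
  where "projective_resolution A M P d e \<longleftrightarrow>
    (\<forall>i. projective A (P i)) \<and>
    (\<forall>i. d i \<in> module_homs A (P (Suc i)) (P i)) \<and>
    e \<in> module_homs A (P 0) M \<and> e ` carrier (P 0) = carrier M \<and>
    {p \<in> carrier (P 0). e p = \<zero>\<^bsub>M\<^esub>} = d 0 ` carrier (P 1) \<and>
    (\<forall>i. {p \<in> carrier (P (Suc i)). d i p = \<zero>\<^bsub>P i\<^esub>} = d (Suc i) ` carrier (P (Suc (Suc i))))"

text \<open>
  For a module on the type \<open>'m\<close> the resolving modules live on \<open>nat \<times> 'a \<times> 'm \<Rightarrow> 'a\<close>.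
  This type contains the free modules of finitely supported functions on any subset of
  \<open>nat \<times> 'a \<times> 'm\<close>, an infinite type at least as large as the ring and the module.  Every
  module on \<open>'m\<close> therefore has a projective resolution of this kind, of the least possible
  length.
\<close>

definition proj_dim :: "('a, 'x) ring_scheme \<Rightarrow> ('a, 'm) module \<Rightarrow> enat"
  where "proj_dim A M = Inf {enat n | n.
    \<exists>(P :: nat \<Rightarrow> ('a, nat \<times> 'a \<times> 'm \<Rightarrow> 'a) module) d e.
      projective_resolution A M P d e \<and> (\<forall>i>n. carrier (P i) = {\<zero>\<^bsub>P i\<^esub>})}"

text \<open>
  The left global dimension is the supremum of the projective dimensions of the left modules
  on the type \<open>'u + 'a set\<close>.  The summand \<open>'a set\<close> accommodates all cyclic modules
  \<open>A / J\<close> (which by Auslander's theorem already determine the supremum); the parameter type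
  \<open>'u\<close> is arbitrary, so that a statement made for all \<open>'u\<close> covers every left module.
\<close>

definition left_global_dim :: "'u itself \<Rightarrow> ('a, 'x) ring_scheme \<Rightarrow> enat"
  where "left_global_dim U A = Sup (proj_dim A ` {M :: ('a, 'u + 'a set) module. left_module A M})"

text \<open>\<open>Hom\<^sub>A(P, A)\<close> with the right action \<open>(h \<cdot> a)(p) = h(p) a\<close>.\<close>

definition hom_to_ring :: "('a, 'x) ring_scheme \<Rightarrow> ('a, 'p) module \<Rightarrow> ('a, 'p \<Rightarrow> 'a) module"
  where "hom_to_ring A P =
    \<lparr>carrier = module_homs A P (left_regular A) \<inter> extensional (carrier P),
     mult = undefined, one = undefined,
     zero = restrict (\<lambda>p. \<zero>\<^bsub>A\<^esub>) (carrier P),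
     add = (\<lambda>g h. restrict (\<lambda>p. g p \<oplus>\<^bsub>A\<^esub> h p) (carrier P)),
     smult = (\<lambda>a h. restrict (\<lambda>p. h p \<otimes>\<^bsub>A\<^esub> a) (carrier P))\<rparr>"

definition hom_cocycles ::
    "('a, 'x) ring_scheme \<Rightarrow> (nat \<Rightarrow> ('a, 'p) module) \<Rightarrow> (nat \<Rightarrow> 'p \<Rightarrow> 'p) \<Rightarrow> nat \<Rightarrow>
     ('p \<Rightarrow> 'a) set"
  where "hom_cocycles A P d i =
    {h \<in> carrier (hom_to_ring A (P i)). \<forall>p\<in>carrier (P (Suc i)). h (d i p) = \<zero>\<^bsub>A\<^esub>}"

definition hom_coboundaries ::
    "('a, 'x) ring_scheme \<Rightarrow> (nat \<Rightarrow> ('a, 'p) module) \<Rightarrow> (nat \<Rightarrow> 'p \<Rightarrow> 'p) \<Rightarrow> nat \<Rightarrow>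
     ('p \<Rightarrow> 'a) set"
  where "hom_coboundaries A P d i =
    (case i of
       0 \<Rightarrow> {\<zero>\<^bsub>hom_to_ring A (P 0)\<^esub>}
     | Suc j \<Rightarrow> (\<lambda>g. restrict (\<lambda>p. g (d j p)) (carrier (P i))) ` carrier (hom_to_ring A (P j)))"

definition hom_cohomology ::
    "('a, 'x) ring_scheme \<Rightarrow> (nat \<Rightarrow> ('a, 'p) module) \<Rightarrow> (nat \<Rightarrow> 'p \<Rightarrow> 'p) \<Rightarrow> nat \<Rightarrow>
     ('a, ('p \<Rightarrow> 'a) set) module"
  where "hom_cohomology A P d i =
    quotient_module (hom_to_ring A (P i) \<lparr>carrier := hom_cocycles A P d i\<rparr>)
      (hom_coboundaries A P d i)"

text \<open>\<open>Ext\<^sup>i\<^sub>A(M, A)\<close>, a right \<open>A\<close>-module, computed from a chosen projective resolution of \<open>M\<close>.\<close>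

definition Ext_to_ring ::
    "('a, 'x) ring_scheme \<Rightarrow> ('a, 'm) module \<Rightarrow> nat \<Rightarrow>
     ('a, ((nat \<times> 'a \<times> 'm \<Rightarrow> 'a) \<Rightarrow> 'a) set) module"
  where "Ext_to_ring A M i =
    (let (P, d, e) = (SOME (P, d, e). projective_resolution A M P d e)
     in hom_cohomology A P d i)"


section \<open>Connected graded algebras and the AS-Gorenstein property\<close>

definition type_ring :: "'a::ring_1 ring"
  where "type_ring = \<lparr>carrier = UNIV, mult = (*), one = 1, zero = 0, add = (+)\<rparr>"

text \<open>A \<open>k\<close>-algebra is a ring \<open>A\<close> with a central ring homomorphism \<open>\<eta> : k \<rightarrow> A\<close>.\<close>

definition k_algebra :: "('a, 'x) ring_scheme \<Rightarrow> ('k::field \<Rightarrow> 'a) \<Rightarrow> bool"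
  where "k_algebra A \<eta> \<longleftrightarrow> ring A \<and> \<eta> \<in> ring_hom type_ring A \<and>
    (\<forall>c. \<forall>a\<in>carrier A. \<eta> c \<otimes>\<^bsub>A\<^esub> a = a \<otimes>\<^bsub>A\<^esub> \<eta> c)"

definition connected_graded ::
    "('a, 'x) ring_scheme \<Rightarrow> ('k::field \<Rightarrow> 'a) \<Rightarrow> (nat \<Rightarrow> 'a set) \<Rightarrow> bool"
  where "connected_graded A \<eta> G \<longleftrightarrow> k_algebra A \<eta> \<and>
    (\<forall>m. subgroup (G m) (add_monoid A)) \<and>
    (\<forall>i j. \<forall>a\<in>G i. \<forall>b\<in>G j. a \<otimes>\<^bsub>A\<^esub> b \<in> G (i + j)) \<and>
    (\<forall>a\<in>carrier A. \<exists>!c. (\<forall>m. c m \<in> G m) \<and> finite {m. c m \<noteq> \<zero>\<^bsub>A\<^esub>} \<and>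
      a = (\<Oplus>\<^bsub>A\<^esub>m\<in>{m. c m \<noteq> \<zero>\<^bsub>A\<^esub>}. c m)) \<and>
    inj \<eta> \<and> G 0 = range \<eta>"

definition positive_part :: "('a, 'x) ring_scheme \<Rightarrow> (nat \<Rightarrow> 'a set) \<Rightarrow> 'a set"
  where "positive_part A G = generate (add_monoid A) (\<Union>m\<in>{1..}. G m)"

text \<open>The \<open>A\<close>-module \<open>k\<close> is \<open>A / A\<^sub>+\<close>.\<close>

definition trivial_left :: "('a, 'x) ring_scheme \<Rightarrow> (nat \<Rightarrow> 'a set) \<Rightarrow> ('a, 'a set) module"
  where "trivial_left A G = quotient_module (left_regular A) (positive_part A G)"

definition trivial_right :: "('a, 'x) ring_scheme \<Rightarrow> (nat \<Rightarrow> 'a set) \<Rightarrow> ('a, 'a set) module"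
  where "trivial_right A G = quotient_module (right_regular A) (positive_part A G)"

definition AS_Gorenstein ::
    "'u itself \<Rightarrow> ('a, 'x) ring_scheme \<Rightarrow> ('k::field \<Rightarrow> 'a) \<Rightarrow> (nat \<Rightarrow> 'a set) \<Rightarrow> bool"
  where "AS_Gorenstein U A \<eta> G \<longleftrightarrow> connected_graded A \<eta> G \<and>
    (\<exists>d\<ge>1. left_global_dim U A = enat d \<and>
      (\<forall>i. i \<noteq> d \<longrightarrow> carrier (Ext_to_ring A (trivial_left A G) i) =
                      {\<zero>\<^bsub>Ext_to_ring A (trivial_left A G) i\<^esub>}) \<and>
      module_isomorphic A (Ext_to_ring A (trivial_left A G) d) (trivial_right A G))"


section \<open>The tensor algebra\<close>

datatype 'v tword = TWord "'v list"

instantiation tword :: (type) monoid_add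
begin

definition zero_tword :: "'a tword" where "zero_tword = TWord []"

fun plus_tword :: "'a tword \<Rightarrow> 'a tword \<Rightarrow> 'a tword"
  where "plus_tword (TWord u) (TWord v) = TWord (u @ v)"

instance
proof
  fix a b c :: "'a tword"
  show "a + b + c = a + (b + c)" by (cases a; cases b; cases c) simp
  show "0 + a = a" by (cases a) (simp add: zero_tword_def)
  show "a + 0 = a" by (cases a) (simp add: zero_tword_def)
qed

end

text \<open>
  The product of \<^typ>\<open>'v tword \<Rightarrow>\<^sub>0 'k\<close> is concatenation of words, so this type is the free
  associative \<open>k\<close>-algebra on the set of all vectors of \<open>V\<close>.  Dividing by the relations below,
  which make the insertion of \<open>V\<close> linear, gives \<open>T(V)\<close>.
\<close>

definition linearity_relations ::
    "('k::field \<Rightarrow> 'v::ab_group_add \<Rightarrow> 'v) \<Rightarrow> ('v tword \<Rightarrow>\<^sub>0 'k) set"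
  where "linearity_relations sc =
    {Poly_Mapping.single (TWord [u + v]) 1 - Poly_Mapping.single (TWord [u]) 1
       - Poly_Mapping.single (TWord [v]) 1 | u v. True} \<union>
    {Poly_Mapping.single (TWord [sc c v]) 1 - Poly_Mapping.single (TWord [v]) c | c v. True}"

type_synonym ('k, 'v) tensor = "('v tword \<Rightarrow>\<^sub>0 'k) set"

definition tensor_algebra ::
    "('k::field \<Rightarrow> 'v::ab_group_add \<Rightarrow> 'v) \<Rightarrow> ('k, 'v) tensor ring"
  where "tensor_algebra sc =
    type_ring Quot (Idl\<^bsub>type_ring\<^esub> (linearity_relations sc))"

definition tensor_unit ::
    "('k::field \<Rightarrow> 'v::ab_group_add \<Rightarrow> 'v) \<Rightarrow> 'k \<Rightarrow> ('k, 'v) tensor"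
  where "tensor_unit sc c =
    (Idl\<^bsub>type_ring\<^esub> (linearity_relations sc)) +>\<^bsub>type_ring\<^esub> Poly_Mapping.single (TWord []) c"

definition tensor_vec ::
    "('k::field \<Rightarrow> 'v::ab_group_add \<Rightarrow> 'v) \<Rightarrow> 'v \<Rightarrow> ('k, 'v) tensor"
  where "tensor_vec sc v =
    (Idl\<^bsub>type_ring\<^esub> (linearity_relations sc)) +>\<^bsub>type_ring\<^esub> Poly_Mapping.single (TWord [v]) 1"

text \<open>
  The product \<open>S \<cdot> S'\<close> of two linear subspaces of an algebra: all sums of products.  In \<open>T(V)\<close>,
  when \<open>S\<close> and \<open>S'\<close> consist of homogeneous elements of fixed degrees, it is \<open>S \<otimes> S'\<close>.
\<close>

definition subspace_prod :: "('a, 'x) ring_scheme \<Rightarrow> 'a set \<Rightarrow> 'a set \<Rightarrow> 'a set"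
  where "subspace_prod A S S' =
    generate (add_monoid A) {s \<otimes>\<^bsub>A\<^esub> s' | s s'. s \<in> S \<and> s' \<in> S'}"

text \<open>\<open>V\<^sup>\<otimes>\<^sup>m\<close> as a subspace of \<open>T(V)\<close>.\<close>

fun tensor_power ::
    "('k::field \<Rightarrow> 'v::ab_group_add \<Rightarrow> 'v) \<Rightarrow> nat \<Rightarrow> ('k, 'v) tensor set"
  where
    "tensor_power sc 0 = range (tensor_unit sc)"
  | "tensor_power sc (Suc m) =
       subspace_prod (tensor_algebra sc) (range (tensor_vec sc)) (tensor_power sc m)"

text \<open>\<open>\<Sum>\<^sub>i\<^sub>j M\<^sub>i\<^sub>j x\<^sub>i x\<^sub>j\<close> in \<open>V \<otimes> V\<close>.\<close>

definition tensor_of_matrix ::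
    "('k::field \<Rightarrow> 'v::ab_group_add \<Rightarrow> 'v) \<Rightarrow> ('n::finite \<Rightarrow> 'v) \<Rightarrow> 'k^'n^'n \<Rightarrow> ('k, 'v) tensor"
  where "tensor_of_matrix sc x M =
    (\<Oplus>\<^bsub>tensor_algebra sc\<^esub>i\<in>UNIV. \<Oplus>\<^bsub>tensor_algebra sc\<^esub>j\<in>UNIV.
       tensor_unit sc (M $ i $ j) \<otimes>\<^bsub>tensor_algebra sc\<^esub>
       (tensor_vec sc (x i) \<otimes>\<^bsub>tensor_algebra sc\<^esub> tensor_vec sc (x j)))"

definition tensor_line ::
    "('k::field \<Rightarrow> 'v::ab_group_add \<Rightarrow> 'v) \<Rightarrow> ('k, 'v) tensor \<Rightarrow> ('k, 'v) tensor set"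
  where "tensor_line sc f =
    range (\<lambda>c. tensor_unit sc c \<otimes>\<^bsub>tensor_algebra sc\<^esub> f)"

definition is_basis ::
    "('k::field \<Rightarrow> 'v::ab_group_add \<Rightarrow> 'v) \<Rightarrow> ('n \<Rightarrow> 'v) \<Rightarrow> bool"
  where "is_basis sc x \<longleftrightarrow> inj x \<and> \<not> Modules.module.dependent sc (range x) \<and>
    Modules.module.span sc (range x) = UNIV"


section \<open>Quadratic algebras\<close>

definition quad_proj ::
    "('k::field \<Rightarrow> 'v::ab_group_add \<Rightarrow> 'v) \<Rightarrow> ('k, 'v) tensor set \<Rightarrow>
     ('k, 'v) tensor \<Rightarrow> ('k, 'v) tensor set"
  where "quad_proj sc R t =
    (Idl\<^bsub>tensor_algebra sc\<^esub> R) +>\<^bsub>tensor_algebra sc\<^esub> t"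

definition quad_algebra ::
    "('k::field \<Rightarrow> 'v::ab_group_add \<Rightarrow> 'v) \<Rightarrow> ('k, 'v) tensor set \<Rightarrow>
     ('k, 'v) tensor set ring"
  where "quad_algebra sc R = tensor_algebra sc Quot (Idl\<^bsub>tensor_algebra sc\<^esub> R)"

definition quad_unit ::
    "('k::field \<Rightarrow> 'v::ab_group_add \<Rightarrow> 'v) \<Rightarrow> ('k, 'v) tensor set \<Rightarrow>
     'k \<Rightarrow> ('k, 'v) tensor set"
  where "quad_unit sc R c = quad_proj sc R (tensor_unit sc c)"

definition quad_vec ::
    "('k::field \<Rightarrow> 'v::ab_group_add \<Rightarrow> 'v) \<Rightarrow> ('k, 'v) tensor set \<Rightarrow>
     'v \<Rightarrow> ('k, 'v) tensor set"
  where "quad_vec sc R v = quad_proj sc R (tensor_vec sc v)"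

definition quad_grading ::
    "('k::field \<Rightarrow> 'v::ab_group_add \<Rightarrow> 'v) \<Rightarrow> ('k, 'v) tensor set \<Rightarrow>
     nat \<Rightarrow> ('k, 'v) tensor set set"
  where "quad_grading sc R m = quad_proj sc R ` tensor_power sc m"

definition left_zerodivisor :: "('a, 'x) ring_scheme \<Rightarrow> 'a \<Rightarrow> bool"
  where "left_zerodivisor A a \<longleftrightarrow> (\<exists>b\<in>carrier A. b \<noteq> \<zero>\<^bsub>A\<^esub> \<and> a \<otimes>\<^bsub>A\<^esub> b = \<zero>\<^bsub>A\<^esub>)"

definition right_zerodivisor :: "('a, 'x) ring_scheme \<Rightarrow> 'a \<Rightarrow> bool"
  where "right_zerodivisor A a \<longleftrightarrow> (\<exists>b\<in>carrier A. b \<noteq> \<zero>\<^bsub>A\<^esub> \<and> b \<otimes>\<^bsub>A\<^esub> a = \<zero>\<^bsub>A\<^esub>)"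


section \<open>The tensor product of an algebra with a vector space\<close>

text \<open>
  \<open>A \<otimes>\<^sub>k W\<close> for a \<open>k\<close>-algebra \<open>(A, \<eta>)\<close> and a \<open>k\<close>-vector space \<open>W\<close>: the \<open>k\<close>-vector space
  with basis the pairs \<open>(a, w)\<close>, modulo the subspace spanned by the bilinearity relations.
  The relations carry an arbitrary coefficient \<open>e\<close>, so their additive span is a subspace.  The
  left \<open>A\<close>-action is \<open>a \<cdot> (b \<otimes> w) = ab \<otimes> w\<close>.
\<close>

definition pairs_module ::
    "('a, 'x) ring_scheme \<Rightarrow> ('k::field, 'w) module \<Rightarrow> ('a, 'a \<times> 'w \<Rightarrow>\<^sub>0 'k) module"
  where "pairs_module A W =
    \<lparr>carrier = {g. Poly_Mapping.keys g \<subseteq> carrier A \<times> carrier W},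
     mult = undefined, one = undefined, zero = 0, add = (+),
     smult = (\<lambda>a g. \<Sum>(b, w)\<in>Poly_Mapping.keys g.
       Poly_Mapping.single (a \<otimes>\<^bsub>A\<^esub> b, w) (Poly_Mapping.lookup g (b, w)))\<rparr>"

definition bilinearity_relations ::
    "('a, 'x) ring_scheme \<Rightarrow> ('k::field \<Rightarrow> 'a) \<Rightarrow> ('k, 'w) module \<Rightarrow> ('a \<times> 'w \<Rightarrow>\<^sub>0 'k) set"
  where "bilinearity_relations A \<eta> W =
    {Poly_Mapping.single (a \<oplus>\<^bsub>A\<^esub> b, w) e - Poly_Mapping.single (a, w) e
       - Poly_Mapping.single (b, w) e
     | a b w e. a \<in> carrier A \<and> b \<in> carrier A \<and> w \<in> carrier W} \<union>
    {Poly_Mapping.single (a, u \<oplus>\<^bsub>W\<^esub> w) e - Poly_Mapping.single (a, u) e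
       - Poly_Mapping.single (a, w) e
     | a u w e. a \<in> carrier A \<and> u \<in> carrier W \<and> w \<in> carrier W} \<union>
    {Poly_Mapping.single (\<eta> c \<otimes>\<^bsub>A\<^esub> a, w) e - Poly_Mapping.single (a, w) (c * e)
     | a w c e. a \<in> carrier A \<and> w \<in> carrier W} \<union>
    {Poly_Mapping.single (a, c \<odot>\<^bsub>W\<^esub> w) e - Poly_Mapping.single (a, w) (c * e)
     | a w c e. a \<in> carrier A \<and> w \<in> carrier W}"

definition tensor_null ::
    "('a, 'x) ring_scheme \<Rightarrow> ('k::field \<Rightarrow> 'a) \<Rightarrow> ('k, 'w) module \<Rightarrow> ('a \<times> 'w \<Rightarrow>\<^sub>0 'k) set"
  where "tensor_null A \<eta> W =
    generate (add_monoid (pairs_module A W)) (bilinearity_relations A \<eta> W)"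

definition tensor_product ::
    "('a, 'x) ring_scheme \<Rightarrow> ('k::field \<Rightarrow> 'a) \<Rightarrow> ('k, 'w) module \<Rightarrow>
     ('a, ('a \<times> 'w \<Rightarrow>\<^sub>0 'k) set) module"
  where "tensor_product A \<eta> W = quotient_module (pairs_module A W) (tensor_null A \<eta> W)"

definition pure_tensor ::
    "('a, 'x) ring_scheme \<Rightarrow> ('k::field \<Rightarrow> 'a) \<Rightarrow> ('k, 'w) module \<Rightarrow> 'a \<Rightarrow> 'w \<Rightarrow>
     ('a \<times> 'w \<Rightarrow>\<^sub>0 'k) set"
  where "pure_tensor A \<eta> W a w =
    tensor_null A \<eta> W +>\<^bsub>pairs_module A W\<^esub> Poly_Mapping.single (a, w) 1"


section \<open>The Koszul complex\<close>

definition koszul_W ::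
    "('k::field \<Rightarrow> 'v::ab_group_add \<Rightarrow> 'v) \<Rightarrow> ('k, 'v) tensor set \<Rightarrow>
     nat \<Rightarrow> ('k, 'v) tensor set"
  where "koszul_W sc R m = tensor_power sc m \<inter>
    (\<Inter>(i, j)\<in>{(i, j). i + 2 + j = m}.
       subspace_prod (tensor_algebra sc) (tensor_power sc i)
         (subspace_prod (tensor_algebra sc) R (tensor_power sc j)))"

definition koszul_space ::
    "('k::field \<Rightarrow> 'v::ab_group_add \<Rightarrow> 'v) \<Rightarrow> ('k, 'v) tensor set \<Rightarrow>
     nat \<Rightarrow> ('k, ('k, 'v) tensor) module"
  where "koszul_space sc R m =
    \<lparr>carrier = koszul_W sc R m, mult = undefined, one = undefined,
     zero = \<zero>\<^bsub>tensor_algebra sc\<^esub>, add = add (tensor_algebra sc),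
     smult = (\<lambda>c t. tensor_unit sc c \<otimes>\<^bsub>tensor_algebra sc\<^esub> t)\<rparr>"

abbreviation koszul_tensor ::
    "('k::field \<Rightarrow> 'v::ab_group_add \<Rightarrow> 'v) \<Rightarrow> ('k, 'v) tensor set \<Rightarrow> nat \<Rightarrow>
     ('k, 'v) tensor set \<Rightarrow> ('k, 'v) tensor \<Rightarrow>
     (('k, 'v) tensor set \<times> ('k, 'v) tensor \<Rightarrow>\<^sub>0 'k) set"
  where "koszul_tensor sc R m \<equiv>
    pure_tensor (quad_algebra sc R) (quad_unit sc R) (koszul_space sc R m)"

definition koszul_module ::
    "('k::field \<Rightarrow> 'v::ab_group_add \<Rightarrow> 'v) \<Rightarrow> ('k, 'v) tensor set \<Rightarrow> nat \<Rightarrow>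
     (('k, 'v) tensor set, (('k, 'v) tensor set \<times> ('k, 'v) tensor \<Rightarrow>\<^sub>0 'k) set) module"
  where "koszul_module sc R m =
    tensor_product (quad_algebra sc R) (quad_unit sc R) (koszul_space sc R m)"

text \<open>
  The differential \<open>K\<^sub>m\<^sub>+\<^sub>1 \<rightarrow> K\<^sub>m\<close>: an element of \<open>W\<^sub>m\<^sub>+\<^sub>1 \<subseteq> V \<otimes> W\<^sub>m\<close> is written as a sum of
  products \<open>v\<^sub>j w\<^sub>j\<close> with \<open>v\<^sub>j \<in> V\<close>, \<open>w\<^sub>j \<in> W\<^sub>m\<close>, and
  \<open>a \<otimes> (\<Sum>\<^sub>j v\<^sub>j w\<^sub>j)\<close> is sent to \<open>\<Sum>\<^sub>j a v\<^sub>j \<otimes> w\<^sub>j\<close>.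
\<close>

definition is_koszul_differential ::
    "('k::field \<Rightarrow> 'v::ab_group_add \<Rightarrow> 'v) \<Rightarrow> ('k, 'v) tensor set \<Rightarrow> nat \<Rightarrow>
     ((('k, 'v) tensor set \<times> ('k, 'v) tensor \<Rightarrow>\<^sub>0 'k) set \<Rightarrow>
      (('k, 'v) tensor set \<times> ('k, 'v) tensor \<Rightarrow>\<^sub>0 'k) set) \<Rightarrow> bool"
  where "is_koszul_differential sc R m d \<longleftrightarrow>
    d \<in> module_homs (quad_algebra sc R) (koszul_module sc R (Suc m))
          (koszul_module sc R m) \<and>
    d \<in> extensional (carrier (koszul_module sc R (Suc m))) \<and>
    (\<forall>a\<in>carrier (quad_algebra sc R). \<forall>(N :: nat) (v :: nat \<Rightarrow> 'v) w.
      (\<forall>j<N. w j \<in> koszul_W sc R m) \<and>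
      (\<Oplus>\<^bsub>tensor_algebra sc\<^esub>j\<in>{..<N}. tensor_vec sc (v j) \<otimes>\<^bsub>tensor_algebra sc\<^esub> w j)
        \<in> koszul_W sc R (Suc m) \<longrightarrow>
      d (koszul_tensor sc R (Suc m) a
          (\<Oplus>\<^bsub>tensor_algebra sc\<^esub>j\<in>{..<N}.
             tensor_vec sc (v j) \<otimes>\<^bsub>tensor_algebra sc\<^esub> w j)) =
      (\<Oplus>\<^bsub>koszul_module sc R m\<^esub>j\<in>{..<N}.
         koszul_tensor sc R m (a \<otimes>\<^bsub>quad_algebra sc R\<^esub> quad_vec sc R (v j)) (w j)))"

definition koszul_differential ::
    "('k::field \<Rightarrow> 'v::ab_group_add \<Rightarrow> 'v) \<Rightarrow> ('k, 'v) tensor set \<Rightarrow> nat \<Rightarrow>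
     (('k, 'v) tensor set \<times> ('k, 'v) tensor \<Rightarrow>\<^sub>0 'k) set \<Rightarrow>
     (('k, 'v) tensor set \<times> ('k, 'v) tensor \<Rightarrow>\<^sub>0 'k) set"
  where "koszul_differential sc R m = (THE d. is_koszul_differential sc R m d)"

definition koszul ::
    "('k::field \<Rightarrow> 'v::ab_group_add \<Rightarrow> 'v) \<Rightarrow> ('k, 'v) tensor set \<Rightarrow> bool"
  where "koszul sc R \<longleftrightarrow>
    (\<forall>m. {z \<in> carrier (koszul_module sc R (Suc m)).
            koszul_differential sc R m z = \<zero>\<^bsub>koszul_module sc R m\<^esub>} =
         koszul_differential sc R (Suc m) ` carrier (koszul_module sc R (Suc (Suc m))))"

end

theory Submission
  imports Defs
begin

text \<open>
  Let \<open>F = k\<langle>x\<^sub>1, \<dots>, x\<^sub>n\<rangle>\<close>, which is \<open>T(V)\<close> once a basis of \<open>V\<close> is chosen, let \<open>I = F f F\<close> and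
  \<open>A = F / I\<close>.  Grouping the terms of \<open>f = \<Sum> M\<^sub>i\<^sub>j x\<^sub>i x\<^sub>j\<close> by the last or by the first letter gives
  \<open>f = \<Sum> y\<^sub>j x\<^sub>j = \<Sum> x\<^sub>i z\<^sub>i\<close>, where the linear forms \<open>y\<^sub>j\<close> and \<open>z\<^sub>i\<close> are the columns and the rows of \<open>M\<close>.

  Everything rests on one observation, \<open>qid_tail\<close>: if \<open>\<Sum> a\<^sub>j x\<^sub>j\<close> lies in \<open>I\<close>, then there is one \<open>c\<close> with
  \<open>a\<^sub>j \<equiv> c y\<^sub>j\<close> modulo \<open>I\<close> for all \<open>j\<close>.  Indeed \<open>I = F f + \<Sum> I x\<^sub>j\<close>, because in a product \<open>u f w\<close> either
  \<open>w\<close> is a scalar or its last letter can be split off; and if \<open>\<Sum> a\<^sub>j x\<^sub>j = c f + \<Sum> b\<^sub>j x\<^sub>j\<close> with \<open>b\<^sub>j \<in> I\<close>, then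
  \<open>a\<^sub>j = c y\<^sub>j + b\<^sub>j\<close>.  Reversal of words turns this into the mirror
  statement \<open>qid_head\<close> for \<open>\<Sum> x\<^sub>i a\<^sub>i\<close>, with \<open>M\<close> transposed.

  (i) Let \<open>v = \<Sum> v\<^sub>j x\<^sub>j\<close> with \<open>v\<^sub>l \<noteq> 0\<close>, and suppose \<open>a v \<in> I\<close> with \<open>a\<close> homogeneous.  Then \<open>v\<^sub>j a \<equiv> c y\<^sub>j\<close>
  for all \<open>j\<close>, hence \<open>c (v\<^sub>l y\<^sub>j - v\<^sub>j y\<^sub>l) \<equiv> 0\<close>.  If \<open>M\<close> has rank above \<open>1\<close>, one of these linear forms is not
  zero, and \<open>c\<close> has smaller degree than \<open>a\<close>; by induction \<open>c \<in> I\<close>, and then \<open>a \<in> I\<close> (\<open>qid_nzd\<close>).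

  (ii) For every left module \<open>N\<close> there is a complex
  \<open>0 \<rightarrow> A \<otimes> N \<rightarrow> A \<otimes> V \<otimes> N \<rightarrow> A \<otimes> N \<rightarrow> N \<rightarrow> 0\<close> (tensor products over \<open>k\<close>) with
  \<open>d\<^sub>0(a \<otimes> x\<^sub>j \<otimes> e) = a x\<^sub>j \<otimes> e - a \<otimes> x\<^sub>j e\<close> and
  \<open>d\<^sub>1(a \<otimes> e) = \<Sum> a y\<^sub>j \<otimes> x\<^sub>j \<otimes> e + \<Sum> a \<otimes> x\<^sub>i \<otimes> z\<^sub>i e\<close>.  For the filtration by the degree of the left factor,
  the leading terms of \<open>d\<^sub>0\<close> and \<open>d\<^sub>1\<close> are \<open>(a\<^sub>j) \<mapsto> \<Sum> a\<^sub>j x\<^sub>j\<close> and \<open>a \<mapsto> (a y\<^sub>j)\<^sub>j\<close>; the tail statement and (i)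
  make the leading terms exact, and induction on the degree makes the complex a free resolution.
  Hence the global dimension is at most \<open>2\<close>.  For \<open>N = k\<close> the maps dual to \<open>d\<^sub>0\<close> and \<open>d\<^sub>1\<close> are
  \<open>a \<mapsto> (x\<^sub>j a)\<^sub>j\<close> and \<open>(b\<^sub>j) \<mapsto> \<Sum> y\<^sub>j b\<^sub>j\<close>, and the second one misses \<open>1\<close>.  So the second cohomology of this
  resolution is not zero; since \<open>Ext\<close> does not depend on the resolution (\<open>cohomology_independent\<close>), \<open>k\<close> has
  projective dimension exactly \<open>2\<close>.

  (iv) With the same dual complex, \<open>Ext\<^sup>0 = 0\<close> by (i), and \<open>Ext\<^sup>2 = A / \<Sum> y\<^sub>j A\<close>.  If \<open>M\<close> is invertible, the \<open>y\<^sub>j\<close>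
  span \<open>V\<close>, so \<open>Ext\<^sup>2 = A / A\<^sub>+ = k\<close>, and \<open>qid_head\<close> gives \<open>Ext\<^sup>1 = 0\<close>.  Conversely, if \<open>Ext\<^sup>2 \<cong> k\<close>, then the
  \<open>x\<^sub>i\<close> annihilate the class of \<open>1\<close>, that is \<open>x\<^sub>i \<in> \<Sum> y\<^sub>j A\<close>, and comparing linear parts gives a right inverse
  of \<open>M\<close>.

  (iii) The intersections \<open>W\<^sub>m\<close> vanish for \<open>m \<ge> 3\<close>: an equation \<open>f p = \<Sum> x\<^sub>i f q\<^sub>i\<close> can be stripped of its
  first three letters, and unless \<open>p = 0\<close> it then exhibits \<open>M\<close> as a matrix of rank at most \<open>1\<close>
  (\<open>W3_trivial\<close>).  So the Koszul complex is \<open>0 \<rightarrow> A \<otimes> k f \<rightarrow> A \<otimes> V \<rightarrow> A\<close>, and its exactness is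
  once more the tail statement together with (i).
\<close>

section \<open>The free algebra and its derivatives\<close>

abbreviation "lookup \<equiv> Poly_Mapping.lookup"
abbreviation "keys \<equiv> Poly_Mapping.keys"

lemma pm_induct [case_names single add]:
  fixes p :: "'a \<Rightarrow>\<^sub>0 'b::comm_monoid_add"
  assumes "\<And>w c. P (Poly_Mapping.single w c)"
    and "\<And>p q. P p \<Longrightarrow> P q \<Longrightarrow> P (p + q)"
  shows "P p"
proof (induction p rule: update_induct)
  case const
  show ?case using assms(1)[of undefined 0] by simp
next
  case (update p a b)
  have "Poly_Mapping.update a b p = p + Poly_Mapping.single a b"
    by (rule poly_mapping_eqI)
      (use update in \<open>auto simp: lookup_update lookup_add lookup_single in_keys_iff when_def\<close>)
  then show ?case using assms update by metis
qed

lemma pm_additive_sum: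
  fixes h :: "('a \<Rightarrow>\<^sub>0 'b::comm_monoid_add) \<Rightarrow> 'c::ab_group_add"
  assumes "\<And>p q. h (p + q) = h p + h q"
  shows "h (\<Sum>i\<in>S. g i) = (\<Sum>i\<in>S. h (g i))"
proof -
  have "h 0 = 0" using assms[of 0 0] by simp
  then show ?thesis by (induction S rule: infinite_finite_induct) (auto simp: assms)
qed

text \<open>
  A word in the indices \<open>'n\<close> stands for a word in the generators \<open>x\<^sub>j\<close>, so this is the free algebra on
  \<open>x\<^sub>1, \<dots>, x\<^sub>n\<close>.
\<close>

type_synonym ('n, 'k) fralg = "'n tword \<Rightarrow>\<^sub>0 'k"

fun wlen :: "'n tword \<Rightarrow> nat" where "wlen (TWord u) = length u"

lemma wlen_plus [simp]: "wlen (u + v) = wlen u + wlen v"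
  by (cases u; cases v) simp

lemma wlen_0 [simp]: "wlen 0 = 0"
  by (simp add: zero_tword_def)

lemma wlen_eq_0 [simp]: "wlen u = 0 \<longleftrightarrow> u = 0"
  by (cases u) (simp add: zero_tword_def)

definition cst :: "'k::zero \<Rightarrow> ('n, 'k) fralg" where "cst c = Poly_Mapping.single 0 c"

definition gen :: "'n \<Rightarrow> ('n, 'k::field) fralg" where "gen j = Poly_Mapping.single (TWord [j]) 1"

definition lf :: "('n::finite \<Rightarrow> 'k::field) \<Rightarrow> ('n, 'k) fralg"
  where "lf c = (\<Sum>j\<in>UNIV. cst (c j) * gen j)"

definition eps :: "('n, 'k::field) fralg \<Rightarrow> 'k" where "eps p = lookup p 0"

lemma cst_simps:
  fixes a b :: "'k::field"
  shows "cst (a + b) = cst a + cst b" "cst (a - b) = cst a - cst b" "cst (- a) = - cst a"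
    "cst (0::'k) = 0" "cst (1::'k) = 1" "(cst (a * b) :: ('n,'k) fralg) = cst a * cst b"
  by (simp_all add: cst_def single_add single_diff single_uminus mult_single)

lemma cst_comm: "cst c * p = p * (cst c :: ('n, 'k::field) fralg)"
  by (induction p rule: pm_induct) (simp_all add: cst_def mult_single algebra_simps)

lemma cst_left: "a * (cst c * b) = cst c * (a * b :: ('n, 'k::field) fralg)"
  by (metis cst_comm mult.assoc)

lemma cst_sum: "cst (\<Sum>i\<in>S. g i :: 'k::field) = (\<Sum>i\<in>S. cst (g i))"
  by (induction S rule: infinite_finite_induct) (auto simp: cst_simps)

lemma cst_cancel:
  assumes "cst c * p = (0 :: ('n, 'k::field) fralg)" "c \<noteq> 0" shows "p = 0"
proof -
  have "p = cst (inverse c) * (cst c * p)"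
    using assms(2) by (simp add: mult.assoc[symmetric] cst_simps(6)[symmetric] cst_simps(5))
  then show ?thesis using assms(1) by simp
qed

lemma lookup_cst_mult [simp]: "lookup (cst c * p :: ('n, 'k::field) fralg) w = c * lookup p w"
  by (induction p rule: pm_induct)
    (simp_all add: cst_def mult_single algebra_simps lookup_add lookup_single when_def)

lemma eps_simps [simp]:
  "eps (p + q) = eps p + eps q" "eps (cst c) = c" "eps (0 :: ('n, 'k) fralg) = 0"
  "eps (1 :: ('n, 'k) fralg) = 1" "eps (gen j :: ('n, 'k::field) fralg) = 0" "eps (- p) = - eps p"
  "eps (p - q) = eps p - eps q"
  by (simp_all add: eps_def lookup_add cst_def gen_def lookup_single zero_tword_def lookup_minus lookup_one)

lemma plus_tword_eq_0 [simp]: "u + v = (0::'n tword) \<longleftrightarrow> u = 0 \<and> v = 0"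
  by (cases u; cases v) (simp add: zero_tword_def)

lemma eps_mult [simp]: "eps (p * q) = eps p * eps (q :: ('n, 'k::field) fralg)"
proof (induction p rule: pm_induct)
  case (single w c)
  show ?case
    by (induction q rule: pm_induct)
      (auto simp: eps_def mult_single lookup_single lookup_add algebra_simps when_def)
qed (simp add: algebra_simps)

lemma eps_sum: "eps (\<Sum>i\<in>S. g i) = (\<Sum>i\<in>S. eps (g i))"
  by (rule pm_additive_sum) simp

lemma eps_lf [simp]: "eps (lf c) = 0"
  by (simp add: lf_def eps_sum)

text \<open>
  Reversal of words is an anti-automorphism \<open>rv\<close>.  It sends the form with matrix \<open>M\<close> to the form with the
  transposed matrix, and so transfers every statement about right multiplication to left multiplication.
\<close>

fun revw :: "'n tword \<Rightarrow> 'n tword" where "revw (TWord u) = TWord (rev u)"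

lemma revw_plus: "revw (u + v) = revw v + revw u"
  by (cases u; cases v) simp

lemma revw_revw [simp]: "revw (revw u) = u" by (cases u) simp

lemma inj_revw: "inj revw" by (metis injI revw_revw)

definition rv :: "('n, 'k::field) fralg \<Rightarrow> ('n, 'k) fralg" where "rv = Poly_Mapping.map_key revw"

lemma rv_add [simp]: "rv (p + q) = rv p + rv q"
  by (simp add: rv_def map_key_plus inj_revw)

lemma rv_single [simp]: "rv (Poly_Mapping.single w c) = Poly_Mapping.single (revw w) c"
  using map_key_single[OF inj_revw, of "revw w" c] by (simp add: rv_def)

lemma rv_mult: "rv (p * q) = rv q * rv p"
proof (induction p rule: pm_induct)
  case (single w c)
  show ?case
    by (induction q rule: pm_induct) (simp_all add: mult_single revw_plus algebra_simps)
qed (simp add: algebra_simps)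

lemma rv_rv [simp]: "rv (rv p) = p"
  by (induction p rule: pm_induct) simp_all

lemma rv_gen [simp]: "rv (gen j) = gen j" by (simp add: gen_def)
lemma rv_cst [simp]: "rv (cst c) = cst c" by (simp add: cst_def zero_tword_def)
lemma rv_0 [simp]: "rv 0 = 0" by (metis add_cancel_right_right rv_add)
lemma rv_minus [simp]: "rv (p - q) = rv p - rv q"
  by (metis add_diff_cancel diff_add_cancel rv_add)
lemma rv_sum: "rv (\<Sum>i\<in>S. g i) = (\<Sum>i\<in>S. rv (g i))"
  by (rule pm_additive_sum) simp
lemma rv_lf [simp]: "rv (lf c) = lf c"
  by (simp add: lf_def rv_sum rv_mult cst_comm)
lemma eps_rv [simp]: "eps (rv p) = eps p"
proof (induction p rule: pm_induct)
  case (single w c)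
  then show ?case by (cases w) (simp add: eps_def lookup_single zero_tword_def when_def)
qed simp

text \<open>
  The right derivative \<open>rder j\<close> keeps the words that end in \<open>x\<^sub>j\<close> and deletes that letter; the left
  derivative \<open>lder j\<close> does the same with the first letter.
\<close>

lemma inj_snoc: "inj (\<lambda>w. w + TWord [j])"
proof (rule injI)
  fix u v assume "u + TWord [j] = v + TWord [j]" then show "u = v" by (cases u; cases v) simp
qed

definition rder :: "'n \<Rightarrow> ('n, 'k::field) fralg \<Rightarrow> ('n, 'k) fralg"
  where "rder j = Poly_Mapping.map_key (\<lambda>w. w + TWord [j])"

definition lder :: "'n \<Rightarrow> ('n, 'k::field) fralg \<Rightarrow> ('n, 'k) fralg"
  where "lder j p = rv (rder j (rv p))"

lemma lookup_rder: "lookup (rder j p) w = lookup p (w + TWord [j])"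
  by (simp add: rder_def map_key.rep_eq inj_snoc)

lemma rder_add [simp]: "rder j (p + q) = rder j p + rder j q"
  by (simp add: rder_def map_key_plus inj_snoc)

lemma rder_minus [simp]: "rder j (p - q) = rder j p - rder j q"
  by (metis add_diff_cancel diff_add_cancel rder_add)

lemma rder_0 [simp]: "rder j 0 = 0" by (metis add_cancel_right_right rder_add)

lemma rder_sum: "rder j (\<Sum>i\<in>S. g i) = (\<Sum>i\<in>S. rder j (g i))"
  by (rule pm_additive_sum) simp

lemma rder_single_snoc:
  "rder j (Poly_Mapping.single (w + TWord [i]) c) = (if i = j then Poly_Mapping.single w c else 0)"
proof (cases "i = j")
  case True then show ?thesis using map_key_single[OF inj_snoc] by (auto simp: rder_def)
next
  case False
  have "w + TWord [i] \<noteq> u + TWord [j]" for u using False by (cases w; cases u) simp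
  then show ?thesis using False by (intro poly_mapping_eqI) (simp add: lookup_rder lookup_single)
qed

lemma rder_cst [simp]: "rder j (cst c) = 0"
  by (intro poly_mapping_eqI) (simp add: lookup_rder cst_def lookup_single zero_tword_def[symmetric] when_def,
     metis list.distinct(1) tword.inject zero_tword_def plus_tword_eq_0)

lemma tword_snoc_cases: obtains "w = 0" | u i where "w = u + TWord [i]"
proof (cases w)
  case (TWord l)
  show ?thesis
  proof (cases l rule: rev_cases)
    case Nil then show ?thesis using that TWord by (simp add: zero_tword_def)
  next
    case (snoc u i) then show ?thesis using that(2)[of "TWord u" i] TWord by simp
  qed
qed

text \<open>
  The last letter of a product comes from \<open>q\<close>, unless \<open>q\<close> contributes its constant term.
\<close>

lemma rder_mult: "rder j (p * q) = p * rder j q + cst (eps q) * rder j p"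
proof (induction p rule: pm_induct)
  case (single w c)
  show ?case
  proof (induction q rule: pm_induct)
    case (single v d)
    show ?case
    proof (cases v rule: tword_snoc_cases)
      case 1
      have "rder j (Poly_Mapping.single w c * cst d) = cst d * rder j (Poly_Mapping.single w c)"
        unfolding cst_comm[symmetric]
        by (rule poly_mapping_eqI) (simp add: lookup_rder)
      moreover have "Poly_Mapping.single v d = cst d" using 1 by (simp add: cst_def)
      ultimately show ?thesis by simp
    next
      case (2 u i)
      have e: "eps (Poly_Mapping.single v d) = 0"
        using 2 by (cases u) (simp add: eps_def lookup_single zero_tword_def)
      have "Poly_Mapping.single w c * Poly_Mapping.single v d
          = Poly_Mapping.single ((w + u) + TWord [i]) (c * d)"
        using 2 by (simp add: mult_single add.assoc)
      then show ?thesis using 2 e by (simp add: rder_single_snoc cst_simps mult_single)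
    qed
  qed (simp add: algebra_simps cst_simps)
qed (simp add: algebra_simps)

lemma rder_gen [simp]: "rder j (gen i :: ('n, 'k::field) fralg) = (if i = j then 1 else 0)"
  using rder_single_snoc[of j 0 i "1::'k"] by (simp add: gen_def)

lemma rder_mult_gen: "rder j (p * gen i) = (if i = j then p else 0)"
  by (simp add: rder_mult cst_simps)

lemma rder_sum_gen: "rder j (\<Sum>i\<in>UNIV. a i * gen i) = a (j::'n::finite)"
  by (simp add: rder_sum rder_mult_gen)

lemma rder_lf [simp]: "rder j (lf c) = cst (c j)"
  by (simp add: lf_def rder_sum_gen)

lemma rder_decomp:
  fixes p :: "('n::finite, 'k::field) fralg"
  shows "p = cst (eps p) + (\<Sum>j\<in>UNIV. rder j p * gen j)"
proof (induction p rule: pm_induct)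
  case (single w c)
  show ?case
  proof (cases w rule: tword_snoc_cases)
    case 1
    then have "Poly_Mapping.single w c = cst c" by (simp add: cst_def)
    then show ?thesis by simp
  next
    case (2 u i)
    have e: "eps (Poly_Mapping.single w c) = 0"
      using 2 by (cases u) (simp add: eps_def lookup_single zero_tword_def)
    have "(\<Sum>j\<in>UNIV. rder j (Poly_Mapping.single w c) * gen j)
        = (\<Sum>j\<in>UNIV. if j = i then Poly_Mapping.single u c * gen j else 0)"
      by (intro sum.cong) (auto simp: 2 rder_single_snoc)
    also have "\<dots> = Poly_Mapping.single w c" by (simp add: 2 gen_def mult_single)
    finally show ?thesis using e by (simp add: cst_simps)
  qed
next
  case (add p q)
  have "p + q = (cst (eps p) + (\<Sum>j\<in>UNIV. rder j p * gen j)) + (cst (eps q) + (\<Sum>j\<in>UNIV. rder j q * gen j))"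
    by (rule arg_cong2[OF add])
  also have "\<dots> = cst (eps (p + q)) + (\<Sum>j\<in>UNIV. rder j (p + q) * gen j)"
    by (simp only: cst_simps eps_simps rder_add distrib_right sum.distrib add.assoc add.left_commute)
  finally show ?case .
qed

lemma lder_add [simp]: "lder j (p + q) = lder j p + lder j q" by (simp add: lder_def)
lemma lder_0 [simp]: "lder j 0 = 0" by (simp add: lder_def)
lemma lder_cst [simp]: "lder j (cst c) = 0" by (simp add: lder_def)
lemma lder_sum: "lder j (\<Sum>i\<in>S. g i) = (\<Sum>i\<in>S. lder j (g i))"
  by (rule pm_additive_sum) simp
lemma lder_mult: "lder j (p * q) = lder j p * q + cst (eps p) * lder j q"
  by (simp add: lder_def rv_mult rder_mult cst_comm)
lemma lder_gen_mult: "lder j (gen i * p) = (if i = j then p else 0)"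
  by (simp add: lder_def rv_mult rder_mult_gen)
lemma lder_sum_gen: "lder j (\<Sum>i\<in>UNIV. gen i * a i) = a (j::'n::finite)"
  by (simp add: lder_sum lder_gen_mult)
lemma lder_lf [simp]: "lder j (lf c) = cst (c j)" by (simp add: lder_def)
lemma lder_decomp:
  fixes p :: "('n::finite, 'k::field) fralg"
  shows "p = cst (eps p) + (\<Sum>j\<in>UNIV. gen j * lder j p)"
proof -
  have "rv (rv p) = rv (cst (eps (rv p)) + (\<Sum>j\<in>UNIV. rder j (rv p) * gen j))"
    using rder_decomp[of "rv p"] by simp
  then show ?thesis by (simp add: rv_sum rv_mult lder_def)
qed

subsection \<open>Homogeneous components\<close>

text \<open>
  \<open>hc m\<close> is the homogeneous component of degree \<open>m\<close>, \<open>homs m\<close> the space of forms of degree \<open>m\<close>, and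
  \<open>fil m\<close> the space of elements of degree less than \<open>m\<close>, so that \<open>fil 0\<close> is zero.
\<close>

definition hc :: "nat \<Rightarrow> ('n, 'k::field) fralg \<Rightarrow> ('n, 'k) fralg"
  where "hc m = Poly_Mapping.mapp (\<lambda>w c. if wlen w = m then c else 0)"

definition homs :: "nat \<Rightarrow> ('n, 'k::field) fralg set"
  where "homs m = {p. \<forall>w. lookup p w \<noteq> 0 \<longrightarrow> wlen w = m}"

definition fil :: "nat \<Rightarrow> ('n, 'k::field) fralg set"
  where "fil m = {p. \<forall>w. lookup p w \<noteq> 0 \<longrightarrow> wlen w < m}"

lemma lookup_hc: "lookup (hc m p) w = (if wlen w = m then lookup p w else 0)"
  by (simp add: hc_def Poly_Mapping.lookup_mapp in_keys_iff when_def)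

lemma hc_add [simp]: "hc m (p + q) = hc m p + hc m q"
  by (rule poly_mapping_eqI) (simp add: lookup_hc lookup_add)
lemma hc_minus [simp]: "hc m (p - q) = hc m p - hc m q"
  by (rule poly_mapping_eqI) (simp add: lookup_hc lookup_minus)
lemma hc_0 [simp]: "hc m 0 = 0"
  by (rule poly_mapping_eqI) (simp add: lookup_hc)
lemma hc_sum: "hc m (\<Sum>i\<in>S. g i) = (\<Sum>i\<in>S. hc m (g i))"
  by (rule pm_additive_sum) simp
lemma hc_single: "hc m (Poly_Mapping.single w c) = (if wlen w = m then Poly_Mapping.single w c else 0)"
  by (rule poly_mapping_eqI) (auto simp: lookup_hc lookup_single when_def)
lemma hc_homs [simp]: "hc m p \<in> homs m" by (auto simp: homs_def lookup_hc)
lemma hc_homs_eq: "p \<in> homs m \<Longrightarrow> hc i p = (if i = m then p else 0)"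
  by (rule poly_mapping_eqI) (auto simp: lookup_hc homs_def)
lemma hc_cst_mult: "hc m (cst c * p) = cst c * hc m p"
  by (rule poly_mapping_eqI) (simp add: lookup_hc)
lemma homsI_hc: "hc m p = p \<Longrightarrow> p \<in> homs m" by (metis hc_homs)

lemma homs_0 [simp]: "0 \<in> homs m" by (simp add: homs_def)
lemma homs_add: "p \<in> homs m \<Longrightarrow> q \<in> homs m \<Longrightarrow> p + q \<in> homs m"
  by (rule homsI_hc) (simp add: hc_homs_eq)
lemma homs_minus: "p \<in> homs m \<Longrightarrow> q \<in> homs m \<Longrightarrow> p - q \<in> homs m"
  by (rule homsI_hc) (simp add: hc_homs_eq)
lemma homs_sum: "(\<And>i. i \<in> S \<Longrightarrow> g i \<in> homs m) \<Longrightarrow> (\<Sum>i\<in>S. g i) \<in> homs m"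
  by (induction S rule: infinite_finite_induct) (auto simp: homs_add)
lemma homs_single: "Poly_Mapping.single w c \<in> homs (wlen w)"
  by (simp add: homs_def lookup_single when_def)
lemma homs_gen [simp]: "gen j \<in> homs 1" using homs_single[of "TWord [j]" 1] by (simp add: gen_def)
lemma homs_cst [simp]: "cst c \<in> homs 0" using homs_single[of 0 c] by (simp add: cst_def)
lemma homs_0_cst: "p \<in> homs 0 \<Longrightarrow> p = cst (eps p)"
  by (rule poly_mapping_eqI) (auto simp: homs_def cst_def lookup_single eps_def when_def)
lemma homs_cst_mult: "p \<in> homs m \<Longrightarrow> cst c * p \<in> homs m"
  by (rule homsI_hc) (simp add: hc_homs_eq hc_cst_mult)
lemma homs_lf [simp]: "lf c \<in> homs 1"
  unfolding lf_def by (intro homs_sum homs_cst_mult homs_gen)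

lemma homs_sum_keys: "p = (\<Sum>w\<in>keys p. Poly_Mapping.single w (lookup p w))"
  by (rule poly_mapping_eqI) (simp add: lookup_sum lookup_single when_def in_keys_iff)

lemma hc_mult_single:
  "hc (wlen w + m) (Poly_Mapping.single w c * q) = Poly_Mapping.single w c * hc m q"
  by (induction q rule: pm_induct) (auto simp: mult_single hc_single algebra_simps)

lemma homs_mult: assumes "p \<in> homs i" "q \<in> homs j" shows "p * q \<in> homs (i + j)"
proof -
  have p: "p = (\<Sum>w\<in>keys p. Poly_Mapping.single w (lookup p w))" by (rule homs_sum_keys)
  have "Poly_Mapping.single w (lookup p w) * q \<in> homs (i + j)" if "w \<in> keys p" for w
  proof -
    have "wlen w = i" using that assms(1) by (auto simp: homs_def in_keys_iff)
    then show ?thesis using hc_mult_single[of w j "lookup p w" q] assms(2)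
      by (intro homsI_hc) (simp add: hc_homs_eq)
  qed
  then have "(\<Sum>w\<in>keys p. Poly_Mapping.single w (lookup p w) * q) \<in> homs (i + j)"
    by (rule homs_sum)
  then show ?thesis by (subst p) (simp add: sum_distrib_right)
qed

lemma hc_mult_homs:
  assumes "q \<in> homs j" shows "hc (m + j) (p * q) = hc m p * q"
proof (induction p rule: pm_induct)
  case (single w c)
  have "Poly_Mapping.single w c * q \<in> homs (wlen w + j)"
    by (intro homs_mult assms homs_single)
  then show ?case by (simp add: hc_homs_eq hc_single)
qed (simp add: algebra_simps)

lemma fil_add: "p \<in> fil m \<Longrightarrow> q \<in> fil m \<Longrightarrow> p + q \<in> fil m"
  unfolding fil_def mem_Collect_eq lookup_add by (metis add_0)
lemma fil_cst_mult: "p \<in> fil m \<Longrightarrow> cst c * p \<in> fil m"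
  by (auto simp: fil_def)
lemma fil_mono: "p \<in> fil m \<Longrightarrow> m \<le> i \<Longrightarrow> p \<in> fil i" by (fastforce simp: fil_def)
lemma fil_0 [simp]: "p \<in> fil 0 \<longleftrightarrow> p = 0"
  by (auto simp: fil_def intro: poly_mapping_eqI)
lemma fil_exists: "\<exists>m. p \<in> fil m"
proof -
  have "finite (wlen ` keys p)" by simp
  then obtain m where "\<forall>i\<in>wlen ` keys p. i < m" using finite_nat_set_iff_bounded by blast
  then show ?thesis by (auto simp: fil_def in_keys_iff intro!: exI[of _ m])
qed
lemma homs_fil: "p \<in> homs m \<Longrightarrow> p \<in> fil (Suc m)" by (simp add: fil_def homs_def)
lemma fil_minus_hc: "p \<in> fil (Suc m) \<Longrightarrow> p - hc m p \<in> fil m"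
  by (auto simp: fil_def lookup_minus lookup_hc less_Suc_eq)
lemma hc_fil: "p \<in> fil m \<Longrightarrow> hc m p = 0"
  by (rule poly_mapping_eqI) (auto simp: lookup_hc fil_def)

subsection \<open>The ideal of a quadratic form\<close>

text \<open>
  The two-sided ideal generated by \<open>f\<close>, built up one product \<open>u f w\<close> at a time.
\<close>

inductive_set qid :: "('n, 'k::field) fralg \<Rightarrow> ('n, 'k) fralg set" for f
  where zero: "0 \<in> qid f" | step: "p \<in> qid f \<Longrightarrow> p + u * f * w \<in> qid f"

lemma qid_base: "u * f * w \<in> qid f" using qid.step[OF qid.zero] by simp

lemma qid_add: assumes "p \<in> qid f" "q \<in> qid f" shows "p + q \<in> qid f"
  using assms(2) by (induction) (auto simp: assms(1) add.assoc[symmetric] intro: qid.step)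

lemma qid_mult_left: assumes "p \<in> qid f" shows "q * p \<in> qid f"
  using assms
proof induction
  case (step p u w)
  then show ?case using qid.step[of "q * p" f "q * u" w] by (simp add: algebra_simps)
qed (simp add: qid.zero)

lemma qid_mult_right: assumes "p \<in> qid f" shows "p * q \<in> qid f"
  using assms
proof induction
  case (step p u w)
  then show ?case using qid.step[of "p * q" f "u" "w * q"] by (simp add: algebra_simps)
qed (simp add: qid.zero)

lemma qid_uminus: "p \<in> qid f \<Longrightarrow> - p \<in> qid f" using qid_mult_left[of p f "- 1"] by simp
lemma qid_minus: "p \<in> qid f \<Longrightarrow> q \<in> qid f \<Longrightarrow> p - q \<in> qid f"
  using qid_add[of p f "- q"] qid_uminus[of q] by simp
lemma qid_sum: "(\<And>i. i \<in> S \<Longrightarrow> g i \<in> qid f) \<Longrightarrow> (\<Sum>i\<in>S. g i) \<in> qid f"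
  by (induction S rule: infinite_finite_induct) (auto simp: qid_add qid.zero)
lemma qid_cong: "p - q \<in> qid f \<Longrightarrow> q \<in> qid f \<Longrightarrow> p \<in> qid f" using qid_add by fastforce

lemma qid_rv: assumes "p \<in> qid f" shows "rv p \<in> qid (rv f)"
  using assms
proof induction
  case (step p u w)
  then show ?case using qid.step[of "rv p" "rv f" "rv w" "rv u"]
    by (simp add: rv_mult algebra_simps)
qed (simp add: qid.zero)

lemma qid_rv_iff: "rv p \<in> qid f \<longleftrightarrow> p \<in> qid (rv f)"
  using qid_rv[of p "rv f"] qid_rv[of "rv p" f] by auto

lemma qid_hc:
  assumes "p \<in> qid f" "f \<in> homs 2" shows "hc m p \<in> qid f"
  using assms(1)
proof induction
  case (step p u w)
  have "hc m (u * f * w) \<in> qid f"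
  proof (induction w rule: pm_induct)
    case (single w c)
    show ?case
    proof (induction u rule: pm_induct)
      case (single u d)
      have "Poly_Mapping.single u d * f * Poly_Mapping.single w c \<in> homs (wlen u + 2 + wlen w)"
        by (intro homs_mult assms homs_single)
      then show ?case by (auto simp: hc_homs_eq qid_base qid.zero)
    qed (simp add: algebra_simps qid_add)
  qed (simp add: algebra_simps qid_add)
  then show ?case using step by (simp add: qid_add)
qed (simp add: qid.zero)

lemma qid_low:
  assumes "p \<in> qid f" "f \<in> homs 2" "m < 2" shows "hc m p = 0"
  using assms(1)
proof induction
  case (step p u w)
  have "hc m (u * f * w) = 0"
  proof (induction w rule: pm_induct)
    case (single w c)
    show ?case
    proof (induction u rule: pm_induct)
      case (single u d)
      have "Poly_Mapping.single u d * f * Poly_Mapping.single w c \<in> homs (wlen u + 2 + wlen w)"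
        by (intro homs_mult assms homs_single)
      then show ?case using assms(3) by (auto simp: hc_homs_eq)
    qed (simp add: algebra_simps)
  qed (simp add: algebra_simps)
  then show ?case using step by simp
qed simp

text \<open>
  Column \<open>j\<close> of \<open>M\<close> is the linear form that multiplies the last letter \<open>x\<^sub>j\<close> in the quadratic form, row \<open>i\<close>
  the one that is multiplied by the first letter \<open>x\<^sub>i\<close>.
\<close>

definition ycol :: "'k::field^'n^'n \<Rightarrow> 'n::finite \<Rightarrow> ('n, 'k) fralg" where "ycol M j = lf (\<lambda>i. M $ i $ j)"
definition zrow :: "'k::field^'n^'n \<Rightarrow> 'n::finite \<Rightarrow> ('n, 'k) fralg" where "zrow M i = lf (\<lambda>j. M $ i $ j)"
definition qform :: "'k::field^'n^'n \<Rightarrow> ('n::finite, 'k) fralg"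
  where "qform M = (\<Sum>i\<in>UNIV. \<Sum>j\<in>UNIV. cst (M $ i $ j) * (gen i * gen j))"

lemma qform_zrow: "qform M = (\<Sum>i\<in>UNIV. gen i * zrow M i)"
  by (simp add: qform_def zrow_def lf_def sum_distrib_left cst_left)
lemma qform_ycol: "qform M = (\<Sum>j\<in>UNIV. ycol M j * gen j)"
  unfolding qform_def ycol_def lf_def sum_distrib_right
  by (subst sum.swap) (simp add: mult.assoc)
lemma homs_qform [simp]: "qform M \<in> homs 2"
  using homs_mult[OF homs_gen homs_gen] by (auto simp: qform_def numeral_2_eq_2 intro!: homs_sum homs_cst_mult)
lemma rv_qform: "rv (qform M) = qform (transpose M)"
  unfolding qform_def rv_sum rv_mult
  by (subst sum.swap) (simp add: transpose_def cst_comm)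
lemma rder_qform: "rder j (qform M) = ycol M j" by (simp add: qform_ycol rder_sum_gen)
lemma lder_qform: "lder j (qform M) = zrow M j" by (simp add: qform_zrow lder_sum_gen)
lemma ycol_transpose: "ycol (transpose M) j = zrow M j" by (simp add: ycol_def zrow_def transpose_def)
lemma eps_qform [simp]: "eps (qform M) = 0" by (simp add: qform_def eps_sum)

text \<open>
  A right derivative moves an element of the ideal out of the ideal only through the summands \<open>u f w\<close> with
  \<open>w\<close> a scalar, where it produces \<open>u y\<^sub>j\<close>.  The coefficient \<open>c\<close> collects these \<open>u\<close>, which are the same for every
  \<open>j\<close>.
\<close>

lemma qid_rder:
  assumes "p \<in> qid (qform M)" shows "\<exists>c. \<forall>j. rder j p - c * ycol M j \<in> qid (qform M)"
  using assms
proof induction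
  case zero
  show ?case by (rule exI[of _ 0]) (simp add: qid.zero)
next
  case (step p u w)
  then obtain c where c: "rder j p - c * ycol M j \<in> qid (qform M)" for j by blast
  have "rder j (p + u * qform M * w) - (c + cst (eps w) * u) * ycol M j \<in> qid (qform M)" for j
  proof -
    have "rder j (p + u * qform M * w) - (c + cst (eps w) * u) * ycol M j
        = (rder j p - c * ycol M j) + u * qform M * rder j w"
      by (simp add: rder_mult rder_qform cst_simps algebra_simps cst_left)
    then show ?thesis using qid_add[OF c[of j] qid_base] by (simp only:)
  qed
  then show ?case by blast
qed

text \<open>
  The observation on which the whole development rests: apart from the evident relation
  \<open>\<Sum> c y\<^sub>j x\<^sub>j = c f\<close>, the \<open>x\<^sub>j\<close> are independent, as right
  factors, modulo the ideal.
\<close>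

lemma qid_tail:
  assumes "(\<Sum>j\<in>UNIV. a j * gen j) \<in> qid (qform M)"
  shows "\<exists>c. \<forall>j. a j - c * ycol M j \<in> qid (qform M)"
  using qid_rder[OF assms] by (simp add: rder_sum_gen)

lemma qid_rv_qform: "rv p \<in> qid (qform M) \<longleftrightarrow> p \<in> qid (qform (transpose M))"
  by (simp add: qid_rv_iff rv_qform)

lemma qid_head:
  assumes "(\<Sum>i\<in>UNIV. gen i * a i) \<in> qid (qform M)"
  shows "\<exists>c. \<forall>i. a i - zrow M i * c \<in> qid (qform M)"
proof -
  have "rv (\<Sum>i\<in>UNIV. gen i * a i) \<in> qid (qform (transpose M))"
    using assms by (simp add: qid_rv_qform transpose_transpose)
  then have "(\<Sum>i\<in>UNIV. rv (a i) * gen i) \<in> qid (qform (transpose M))"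
    by (simp add: rv_sum rv_mult)
  from qid_tail[OF this] obtain c where c: "rv (a i) - c * zrow M i \<in> qid (qform (transpose M))" for i
    by (auto simp: ycol_transpose)
  have "a i - zrow M i * rv c \<in> qid (qform M)" for i
  proof -
    have "rv (rv (a i) - c * zrow M i) \<in> qid (qform M)"
      unfolding qid_rv_qform by (rule c)
    then show ?thesis unfolding rv_minus rv_mult rv_rv by (simp add: zrow_def)
  qed
  then show ?thesis by blast
qed

text \<open>
  The matrices of rank at most one.
\<close>

definition rank1 :: "'k::field^'n^'n \<Rightarrow> bool"
  where "rank1 M \<longleftrightarrow> (\<exists>a b. \<forall>i j. M $ i $ j = a i * b j)"

lemma rank1_transpose: "rank1 (transpose M) \<longleftrightarrow> rank1 M"
  unfolding rank1_def transpose_def by (auto; metis mult.commute)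

lemma lf_mult: "a * lf v = (\<Sum>j\<in>UNIV. cst (v j) * a * gen j)"
  by (simp add: lf_def sum_distrib_left cst_left mult.assoc)
lemma lf_scale: "cst c * lf v = lf (\<lambda>j. c * v j)"
  by (simp add: lf_def sum_distrib_left mult.assoc[symmetric] cst_simps)
lemma lf_minus: "lf u - lf v = lf (\<lambda>j. u j - v j)"
  by (simp add: lf_def cst_simps algebra_simps sum_subtractf)
lemma lf_add: "lf u + lf v = lf (\<lambda>j. u j + v j)"
  by (simp add: lf_def cst_simps algebra_simps sum.distrib)

lemma qid_scale: "cst c * p \<in> qid f \<Longrightarrow> c \<noteq> 0 \<Longrightarrow> p \<in> qid f"
  using qid_mult_left[of "cst c * p" f "cst (inverse c)"]
  by (simp add: mult.assoc[symmetric] cst_simps(6)[symmetric] cst_simps(5))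

text \<open>
  If \<open>a v\<close> is a relation, the tail statement gives \<open>v\<^sub>j a \<equiv> c y\<^sub>j\<close>.  Eliminating \<open>a\<close> leaves
  \<open>c (v\<^sub>l y\<^sub>j - v\<^sub>j y\<^sub>l) \<equiv> 0\<close>.  One of these linear forms is not zero, for otherwise all columns of \<open>M\<close> would be
  proportional; since \<open>c\<close> has lower degree than \<open>a\<close>, induction applies to it.
\<close>

lemma qid_nzd_homs:
  assumes "\<not> rank1 M" "v j0 \<noteq> 0" "a \<in> homs m" "a * lf v \<in> qid (qform M)"
  shows "a \<in> qid (qform M)"
  using assms(2-)
proof (induction m arbitrary: a v j0)
  case 0
  \<comment> \<open>the ideal has no elements of degree one\<close>
  have "hc 1 (a * lf v) = 0" using qid_low[OF 0(3)] by simp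
  moreover have "a * lf v \<in> homs 1" using homs_mult[OF 0(2) homs_lf[of v]] by simp
  ultimately have "a * lf v = 0" by (simp add: hc_homs_eq)
  then have "rder j0 (a * lf v) = 0" by simp
  then have "cst (v j0) * a = 0" by (simp add: rder_mult cst_simps cst_comm)
  then have "a = 0" using cst_cancel 0(1) by blast
  then show ?case by (simp add: qid.zero)
next
  case (Suc m)
  let ?I = "qid (qform M)"
  from Suc.prems(3) obtain c' where c': "cst (v j) * a - c' * ycol M j \<in> ?I" for j
    using qid_tail[of "\<lambda>j. cst (v j) * a"] by (auto simp: lf_mult)
  \<comment> \<open>the component of degree \<open>m\<close>, one less than the degree of \<open>a\<close>, also serves as coefficient\<close>
  define c where "c = hc m c'"
  have c: "cst (v j) * a - c * ycol M j \<in> ?I" for j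
  proof -
    have "hc (m + 1) (cst (v j) * a - c' * ycol M j) \<in> ?I" using qid_hc[OF c'] by simp
    moreover have "hc (m + 1) (c' * ycol M j) = c * ycol M j"
      unfolding c_def ycol_def by (rule hc_mult_homs) (rule homs_lf)
    ultimately show ?thesis using Suc.prems(2) by (simp add: hc_cst_mult hc_homs_eq)
  qed
  \<comment> \<open>otherwise every column of \<open>M\<close> is a multiple of column \<open>j0\<close>\<close>
  obtain i j where ij: "M $ i $ j * v j0 \<noteq> M $ i $ j0 * v j"
  proof (rule ccontr)
    assume "\<not> thesis"
    then have *: "M $ i $ j * v j0 = M $ i $ j0 * v j" for i j using that by blast
    have "M $ i $ j = (M $ i $ j0 / v j0) * v j" for i j
      using *[of i j] Suc.prems(1) by (simp add: field_simps)
    then have "rank1 M"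
      unfolding rank1_def by (intro exI[of _ "\<lambda>i. M $ i $ j0 / v j0"] exI[of _ v] allI)
    then show False using assms(1) by simp
  qed
  define u where "u = (\<lambda>i. v j0 * (M $ i $ j) - v j * (M $ i $ j0))"
  have "u i \<noteq> 0" using ij by (simp add: u_def algebra_simps)
  moreover have "c \<in> homs m" by (simp add: c_def)
  moreover have "c * lf u \<in> ?I"
  proof -
    have "c * lf u = c * (cst (v j0) * ycol M j - cst (v j) * ycol M j0)"
      by (simp add: u_def ycol_def lf_scale lf_minus)
    also have "\<dots> = cst (v j) * (cst (v j0) * a - c * ycol M j0) - cst (v j0) * (cst (v j) * a - c * ycol M j)"
    proof -
      have 1: "cst (v j) * (cst (v j0) * a) = cst (v j0) * (cst (v j) * a)"
        by (simp add: mult.assoc[symmetric] cst_simps(6)[symmetric] mult.commute)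
      have 2: "c * (cst s * y) = cst s * (c * y)" for s y
        by (rule cst_left)
      show ?thesis unfolding right_diff_distrib 1 2 by simp
    qed
    finally show ?thesis using c by (simp add: qid_minus qid_mult_left)
  qed
  ultimately have "c \<in> ?I" using Suc.IH by blast
  then have "cst (v j0) * a \<in> ?I" using c[of j0] qid_cong qid_mult_right by blast
  then show ?case using Suc.prems(1) qid_scale by blast
qed

lemma hc_sum_all: assumes "p \<in> fil m" shows "p = (\<Sum>i<m. hc i p)"
  by (rule poly_mapping_eqI) (use assms in \<open>auto simp: lookup_sum lookup_hc fil_def sum.delta\<close>)

lemma qid_nzd:
  assumes "\<not> rank1 M" "v j0 \<noteq> 0" "a * lf v \<in> qid (qform M)"
  shows "a \<in> qid (qform M)"
proof -
  obtain m where m: "a \<in> fil m" using fil_exists by blast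
  have "hc i a \<in> qid (qform M)" for i
  proof (rule qid_nzd_homs[of M v j0, OF assms(1,2)])
    show "hc i a * lf v \<in> qid (qform M)"
      using qid_hc[OF assms(3), of "i + 1"] hc_mult_homs[OF homs_lf[of v], of i a] by simp
  qed (rule hc_homs)
  then have "(\<Sum>i<m. hc i a) \<in> qid (qform M)" by (intro qid_sum)
  then show ?thesis using hc_sum_all[OF m] by simp
qed

lemma qid_nzd_left:
  assumes "\<not> rank1 M" "v j0 \<noteq> 0" "lf v * a \<in> qid (qform M)"
  shows "a \<in> qid (qform M)"
proof -
  have "rv (lf v * a) \<in> qid (qform (transpose M))"
    using assms(3) by (simp add: qid_rv_qform transpose_transpose)
  then have "rv a \<in> qid (qform (transpose M))"
    using qid_nzd[of "transpose M" v j0 "rv a"] assms by (simp add: rv_mult rank1_transpose)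
  then show ?thesis by (simp add: qid_rv_qform transpose_transpose)
qed

lemma rank1_swap: "\<forall>i l. M $ i $ l = a i * M $ l $ j \<Longrightarrow> rank1 M"
  unfolding rank1_def by (rule exI[of _ a], rule exI[of _ "\<lambda>l. M $ l $ j"], assumption)

text \<open>
  Stripping the first letter, the second letter and the third letter of the equation gives in turn
  \<open>z\<^sub>i p = f q\<^sub>i\<close>, then \<open>M\<^sub>i\<^sub>l p = z\<^sub>l q\<^sub>i\<close>, and then \<open>M\<^sub>i\<^sub>l \<partial>\<^sub>j p = M\<^sub>l\<^sub>j q\<^sub>i\<close>.  A nonzero coefficient of \<open>\<partial>\<^sub>j p\<close> would
  therefore express \<open>M\<^sub>i\<^sub>l\<close> as a product of a factor depending on \<open>i\<close> and the factor \<open>M\<^sub>l\<^sub>j\<close>.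
\<close>

lemma W3_trivial:
  assumes "\<not> rank1 M" "qform M * p = (\<Sum>i\<in>UNIV. gen i * (qform M * q i))" "eps p = 0"
  shows "p = 0"
proof -
  have 1: "zrow M i * p = qform M * q i" for i
  proof -
    have "lder i (qform M * p) = qform M * q i" using assms(2) by (simp add: lder_sum_gen)
    then show ?thesis by (simp add: lder_mult lder_qform cst_simps)
  qed
  have 2: "cst (M $ i $ l) * p = zrow M l * q i" for i l
    using arg_cong[OF 1[of i], of "lder l"]
    by (simp add: lder_mult lder_qform cst_simps zrow_def)
  have 3: "cst (M $ i $ l) * lder j p = cst (M $ l $ j) * q i" for i l j
    using arg_cong[OF 2[of i l], of "lder j"]
    by (simp add: lder_mult zrow_def cst_simps)
  have "lder j p = 0" for j
  proof (rule ccontr)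
    assume "lder j p \<noteq> 0"
    then obtain w where w: "lookup (lder j p) w \<noteq> 0" by (metis lookup_zero poly_mapping_eqI)
    have *: "M $ i $ l * lookup (lder j p) w = M $ l $ j * lookup (q i) w" for i l
      using arg_cong[OF 3[of i l j], of "\<lambda>p. lookup p w"] by simp
    have "M $ i $ l = (lookup (q i) w / lookup (lder j p) w) * M $ l $ j" for i l
      using *[of i l] w by (simp add: nonzero_eq_divide_eq mult.commute)
    then have "rank1 M" by (intro rank1_swap[of M "\<lambda>i. lookup (q i) w / lookup (lder j p) w" j] allI)
    then show False using assms(1) by simp
  qed
  then show ?thesis using lder_decomp[of p] assms(3) by (simp add: cst_simps)
qed

section \<open>Free and projective modules\<close>

text \<open>
  \<open>hom_to_ring A P\<close> carries a right action, written on the left, so it satisfies the axioms of a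
  left module except for the associative law.  What such modules and left modules have in common
  is an additive action of each scalar.
\<close>

locale additive_action = M?: abelian_group M
  for R (structure) and M (structure) +
  assumes act_closed: "\<lbrakk>a \<in> carrier R; m \<in> carrier M\<rbrakk> \<Longrightarrow> a \<odot>\<^bsub>M\<^esub> m \<in> carrier M"
    and act_add: "\<lbrakk>a \<in> carrier R; m \<in> carrier M; m' \<in> carrier M\<rbrakk> \<Longrightarrow>
        a \<odot>\<^bsub>M\<^esub> (m \<oplus>\<^bsub>M\<^esub> m') = a \<odot>\<^bsub>M\<^esub> m \<oplus>\<^bsub>M\<^esub> a \<odot>\<^bsub>M\<^esub> m'"
begin

lemma act_zero: "a \<in> carrier R \<Longrightarrow> a \<odot>\<^bsub>M\<^esub> \<zero>\<^bsub>M\<^esub> = \<zero>\<^bsub>M\<^esub>"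
  using act_add[of a "\<zero>\<^bsub>M\<^esub>" "\<zero>\<^bsub>M\<^esub>"] act_closed[of a "\<zero>\<^bsub>M\<^esub>"]
  by (metis M.add.l_cancel_one' M.l_zero M.zero_closed)

lemma act_finsum:
  assumes "a \<in> carrier R" "f \<in> S \<rightarrow> carrier M"
  shows "a \<odot>\<^bsub>M\<^esub> (\<Oplus>\<^bsub>M\<^esub>i\<in>S. f i) = (\<Oplus>\<^bsub>M\<^esub>i\<in>S. a \<odot>\<^bsub>M\<^esub> f i)"
  using assms(2)
proof (induction S rule: infinite_finite_induct)
  case (insert x F)
  then have "f \<in> F \<rightarrow> carrier M" "f x \<in> carrier M" by auto
  then show ?case using insert assms(1)
    by (simp add: act_add act_closed Pi_def M.finsum_insert M.finsum_closed)
qed (simp_all add: act_zero assms)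

lemma act_minus:
  assumes "a \<in> carrier R" "m \<in> carrier M" "m' \<in> carrier M"
  shows "a \<odot>\<^bsub>M\<^esub> (m \<ominus>\<^bsub>M\<^esub> m') = a \<odot>\<^bsub>M\<^esub> m \<ominus>\<^bsub>M\<^esub> a \<odot>\<^bsub>M\<^esub> m'"
proof -
  have "a \<odot>\<^bsub>M\<^esub> m = a \<odot>\<^bsub>M\<^esub> ((m \<ominus>\<^bsub>M\<^esub> m') \<oplus>\<^bsub>M\<^esub> m')"
    using assms by (simp add: M.minus_eq M.a_assoc M.l_neg)
  also have "\<dots> = a \<odot>\<^bsub>M\<^esub> (m \<ominus>\<^bsub>M\<^esub> m') \<oplus>\<^bsub>M\<^esub> a \<odot>\<^bsub>M\<^esub> m'"
    using assms by (intro act_add) auto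
  finally show ?thesis
    using assms by (simp add: M.minus_eq M.a_assoc M.r_neg act_closed)
qed

end

sublocale left_module \<subseteq> additive_action R M
  by unfold_locales (auto simp: smult_closed smult_r_distr)

context left_module
begin

lemma smult_zero_left: assumes "m \<in> carrier M" shows "\<zero> \<odot>\<^bsub>M\<^esub> m = \<zero>\<^bsub>M\<^esub>"
  using smult_l_distr[of \<zero> \<zero> m] assms smult_closed[of \<zero> m]
  by (metis M.add.l_cancel_one' R.l_zero R.zero_closed)

lemma smult_finsum_left:
  assumes "m \<in> carrier M" "f \<in> S \<rightarrow> carrier R"
  shows "(\<Oplus>i\<in>S. f i) \<odot>\<^bsub>M\<^esub> m = (\<Oplus>\<^bsub>M\<^esub>i\<in>S. f i \<odot>\<^bsub>M\<^esub> m)"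
  using assms(2)
proof (induction S rule: infinite_finite_induct)
  case (insert x F)
  then have "f \<in> F \<rightarrow> carrier R" "f x \<in> carrier R" by auto
  then show ?case using insert assms(1)
    by (simp add: smult_l_distr smult_closed Pi_def M.finsum_insert M.finsum_closed R.finsum_insert R.finsum_closed)
qed (simp_all add: smult_zero_left assms)

end

subsection \<open>Homomorphisms\<close>

lemma module_homsI:
  assumes "\<And>p. p \<in> carrier M \<Longrightarrow> h p \<in> carrier N"
    and "\<And>p q. p \<in> carrier M \<Longrightarrow> q \<in> carrier M \<Longrightarrow> h (p \<oplus>\<^bsub>M\<^esub> q) = h p \<oplus>\<^bsub>N\<^esub> h q"
    and "\<And>a p. a \<in> carrier A \<Longrightarrow> p \<in> carrier M \<Longrightarrow> h (a \<odot>\<^bsub>M\<^esub> p) = a \<odot>\<^bsub>N\<^esub> h p"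
  shows "h \<in> module_homs A M N"
  using assms by (auto simp: module_homs_def)

lemma hom_closed: "h \<in> module_homs A M N \<Longrightarrow> p \<in> carrier M \<Longrightarrow> h p \<in> carrier N"
  by (auto simp: module_homs_def)
lemma hom_add: "h \<in> module_homs A M N \<Longrightarrow> p \<in> carrier M \<Longrightarrow> q \<in> carrier M \<Longrightarrow>
    h (p \<oplus>\<^bsub>M\<^esub> q) = h p \<oplus>\<^bsub>N\<^esub> h q"
  by (auto simp: module_homs_def)
lemma hom_act: "h \<in> module_homs A M N \<Longrightarrow> a \<in> carrier A \<Longrightarrow> p \<in> carrier M \<Longrightarrow>
    h (a \<odot>\<^bsub>M\<^esub> p) = a \<odot>\<^bsub>N\<^esub> h p"
  by (auto simp: module_homs_def)

lemma hom_group_hom: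
  assumes "h \<in> module_homs A M N" "abelian_group M" "abelian_group N"
  shows "abelian_group_hom M N h"
  using assms unfolding module_homs_def
  by (intro abelian_group_homI) (auto simp: hom_def group_hom_def group_hom_axioms_def abelian_group.a_group)

lemma hom_zero:
  assumes "h \<in> module_homs A M N" "abelian_group M" "abelian_group N"
  shows "h \<zero>\<^bsub>M\<^esub> = \<zero>\<^bsub>N\<^esub>"
  using abelian_group_hom.hom_zero[OF hom_group_hom[OF assms]] .

lemma hom_minus:
  assumes "h \<in> module_homs A M N" "abelian_group M" "abelian_group N" "p \<in> carrier M" "q \<in> carrier M"
  shows "h (p \<ominus>\<^bsub>M\<^esub> q) = h p \<ominus>\<^bsub>N\<^esub> h q"
proof -
  interpret abelian_group_hom M N h by (rule hom_group_hom[OF assms(1-3)])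
  show ?thesis using assms by (simp add: G.minus_eq H.minus_eq)
qed

lemma hom_finsum:
  assumes "h \<in> module_homs A M N" "abelian_group M" "abelian_group N" "f \<in> S \<rightarrow> carrier M"
  shows "h (\<Oplus>\<^bsub>M\<^esub>i\<in>S. f i) = (\<Oplus>\<^bsub>N\<^esub>i\<in>S. h (f i))"
proof -
  interpret abelian_group_hom M N h by (rule hom_group_hom[OF assms(1-3)])
  show ?thesis using assms(4)
  proof (induction S rule: infinite_finite_induct)
    case (insert x F)
    then have "f \<in> F \<rightarrow> carrier M" "f x \<in> carrier M" by auto
    then show ?case using insert
      by (simp add: Pi_def G.finsum_insert H.finsum_insert G.finsum_closed)
  qed simp_all
qed

lemma hom_comp:
  assumes "h \<in> module_homs A M N" "g \<in> module_homs A N P"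
  shows "(\<lambda>p. g (h p)) \<in> module_homs A M P"
  by (rule module_homsI) (simp_all add: hom_closed[OF assms(1)] hom_closed[OF assms(2)]
      hom_add[OF assms(1)] hom_add[OF assms(2)] hom_act[OF assms(1)] hom_act[OF assms(2)])

lemma hom_id: "(\<lambda>p. p) \<in> module_homs A M M"
  by (auto simp: module_homs_def)

lemma hom_const_zero:
  assumes "additive_action A N" shows "(\<lambda>p. \<zero>\<^bsub>N\<^esub>) \<in> module_homs A M N"
proof -
  interpret additive_action A N by fact
  show ?thesis by (rule module_homsI) (auto simp: act_zero)
qed

lemma hom_plus:
  assumes "additive_action A N" "g \<in> module_homs A M N" "h \<in> module_homs A M N"
  shows "(\<lambda>p. g p \<oplus>\<^bsub>N\<^esub> h p) \<in> module_homs A M N"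
proof -
  interpret additive_action A N by fact
  show ?thesis
    by (rule module_homsI)
      (use assms in \<open>auto simp: hom_closed hom_add hom_act act_add M.a_ac\<close>)
qed

lemma hom_diff:
  assumes "additive_action A N" "g \<in> module_homs A M N" "h \<in> module_homs A M N"
  shows "(\<lambda>p. g p \<ominus>\<^bsub>N\<^esub> h p) \<in> module_homs A M N"
proof -
  interpret additive_action A N by fact
  show ?thesis
    by (rule module_homsI)
      (use assms in \<open>auto simp: hom_closed hom_add hom_act act_minus[unfolded M.minus_eq] M.a_ac M.minus_eq M.minus_add\<close>)
qed

subsection \<open>Free modules\<close>

text \<open>
  The free module on \<open>S\<close>: finitely supported functions that vanish outside \<open>S\<close>.  Since \<open>S\<close> is a set and not a type, the free
  modules on different index sets share a type.
\<close>

definition free_mod :: "('a, 'x) ring_scheme \<Rightarrow> 's set \<Rightarrow> ('a, 's \<Rightarrow> 'a) module"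
  where "free_mod A S =
    \<lparr>carrier = {u. (\<forall>s. u s \<in> carrier A) \<and> (\<forall>s. s \<notin> S \<longrightarrow> u s = \<zero>\<^bsub>A\<^esub>) \<and> finite {s. u s \<noteq> \<zero>\<^bsub>A\<^esub>}},
     mult = undefined, one = undefined, zero = (\<lambda>s. \<zero>\<^bsub>A\<^esub>), add = (\<lambda>u v s. u s \<oplus>\<^bsub>A\<^esub> v s),
     smult = (\<lambda>a u s. a \<otimes>\<^bsub>A\<^esub> u s)\<rparr>"

definition fbasis :: "('a, 'x) ring_scheme \<Rightarrow> 's \<Rightarrow> 's \<Rightarrow> 'a"
  where "fbasis A s = (\<lambda>t. if t = s then \<one>\<^bsub>A\<^esub> else \<zero>\<^bsub>A\<^esub>)"

definition lincomb :: "('a, 'x) ring_scheme \<Rightarrow> ('a, 'm) module \<Rightarrow> ('s \<Rightarrow> 'm) \<Rightarrow> ('s \<Rightarrow> 'a) \<Rightarrow> 'm"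
  where "lincomb A N y u = (\<Oplus>\<^bsub>N\<^esub>s\<in>{s. u s \<noteq> \<zero>\<^bsub>A\<^esub>}. u s \<odot>\<^bsub>N\<^esub> y s)"

lemma free_mod_simps [simp]:
  "zero (free_mod A S) = (\<lambda>s. \<zero>\<^bsub>A\<^esub>)"
  "add (free_mod A S) u v = (\<lambda>s. u s \<oplus>\<^bsub>A\<^esub> v s)"
  "smult (free_mod A S) a u = (\<lambda>s. a \<otimes>\<^bsub>A\<^esub> u s)"
  by (simp_all add: free_mod_def)

lemma free_mod_carrier:
  "u \<in> carrier (free_mod A S) \<longleftrightarrow>
    (\<forall>s. u s \<in> carrier A) \<and> (\<forall>s. s \<notin> S \<longrightarrow> u s = \<zero>\<^bsub>A\<^esub>) \<and> finite {s. u s \<noteq> \<zero>\<^bsub>A\<^esub>}"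
  by (simp add: free_mod_def)

context ring
begin

lemma left_module_free_mod: "left_module R (free_mod R S)"
proof -
  have "abelian_group (free_mod R S)"
  proof (rule abelian_groupI, goal_cases)
    case (1 u v)
    have "finite ({s. u s \<noteq> \<zero>} \<union> {s. v s \<noteq> \<zero>})" using 1 by (simp add: free_mod_carrier)
    moreover have "{s. u s \<oplus> v s \<noteq> \<zero>} \<subseteq> {s. u s \<noteq> \<zero>} \<union> {s. v s \<noteq> \<zero>}"
      using 1 by (auto simp: free_mod_carrier)
    ultimately have "finite {s. u s \<oplus> v s \<noteq> \<zero>}" by (rule finite_subset[rotated])
    then show ?case using 1 by (auto simp: free_mod_carrier)
  next
    case (6 u)
    have "{s. \<ominus> u s \<noteq> \<zero>} \<subseteq> {s. u s \<noteq> \<zero>}" by auto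
    then have "finite {s. \<ominus> u s \<noteq> \<zero>}" using 6 finite_subset by (auto simp: free_mod_carrier)
    then show ?case using 6 by (intro bexI[of _ "\<lambda>s. \<ominus> u s"]) (auto simp: free_mod_carrier l_neg)
  qed (auto simp: free_mod_carrier a_ac)
  then interpret F: abelian_group "free_mod R S" .
  show ?thesis
  proof (unfold_locales, goal_cases)
    case (1 a u)
    have "{s. a \<otimes> u s \<noteq> \<zero>} \<subseteq> {s. u s \<noteq> \<zero>}" using 1 by auto
    then have "finite {s. a \<otimes> u s \<noteq> \<zero>}" using 1 finite_subset by (auto simp: free_mod_carrier)
    then show ?case using 1 by (auto simp: free_mod_carrier)
  qed (auto simp: free_mod_carrier l_distr r_distr m_assoc)
qed

lemma fbasis_closed: "s \<in> S \<Longrightarrow> fbasis R s \<in> carrier (free_mod R S)"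
  by (auto simp: fbasis_def free_mod_carrier)

lemma free_mod_finsum_apply:
  assumes "g \<in> I \<rightarrow> carrier (free_mod R S)" "finite I"
  shows "(\<Oplus>\<^bsub>free_mod R S\<^esub>i\<in>I. g i) s = (\<Oplus>i\<in>I. g i s)"
proof -
  interpret F: left_module R "free_mod R S" by (rule left_module_free_mod)
  show ?thesis using assms(2,1)
  proof (induction I rule: finite_induct)
    case (insert x I)
    then have 1: "g x s \<in> carrier R" "(\<lambda>i. g i s) \<in> I \<rightarrow> carrier R"
      by (auto simp: free_mod_carrier Pi_def)
    have 2: "(\<Oplus>\<^bsub>free_mod R S\<^esub>i\<in>insert x I. g i) = g x \<oplus>\<^bsub>free_mod R S\<^esub> (\<Oplus>\<^bsub>free_mod R S\<^esub>i\<in>I. g i)"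
      using insert by (intro F.M.finsum_insert) auto
    show ?case using insert 1 unfolding 2
      by (simp add: Pi_def)
  qed simp
qed

lemma free_mod_minus_apply:
  assumes "u \<in> carrier (free_mod R S)" "v \<in> carrier (free_mod R S)"
  shows "(u \<ominus>\<^bsub>free_mod R S\<^esub> v) s = u s \<ominus> v s"
proof -
  interpret F: left_module R "free_mod R S" by (rule left_module_free_mod)
  have 1: "u \<ominus>\<^bsub>free_mod R S\<^esub> v \<in> carrier (free_mod R S)" using assms by simp
  have "(u \<ominus>\<^bsub>free_mod R S\<^esub> v) \<oplus>\<^bsub>free_mod R S\<^esub> v = u"
    using assms by (simp only: F.M.minus_eq F.M.a_assoc F.M.l_neg F.M.r_zero F.M.a_inv_closed)
  then have "(u \<ominus>\<^bsub>free_mod R S\<^esub> v) s \<oplus> v s = u s" by (metis free_mod_simps(2))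
  moreover have "(u \<ominus>\<^bsub>free_mod R S\<^esub> v) s \<in> carrier R" "v s \<in> carrier R"
    using 1 assms unfolding free_mod_carrier by auto
  ultimately show ?thesis by (metis add.inv_solve_right' a_minus_def a_closed)
qed

end

locale lmod = left_module R M for R :: "('a, 'x) ring_scheme" (structure) and M :: "('a, 'm) module" (structure)

context lmod
begin

lemma lincomb_superset:
  assumes "u \<in> carrier (free_mod R S)" "y \<in> S \<rightarrow> carrier M"
    and "finite T" "{s. u s \<noteq> \<zero>} \<subseteq> T" "T \<subseteq> S"
  shows "lincomb R M y u = (\<Oplus>\<^bsub>M\<^esub>s\<in>T. u s \<odot>\<^bsub>M\<^esub> y s)"
  unfolding lincomb_def
proof (rule M.add.finprod_mono_neutral_cong_left)
  show "\<And>i. i \<in> T - {s. u s \<noteq> \<zero>} \<Longrightarrow> u i \<odot>\<^bsub>M\<^esub> y i = \<zero>\<^bsub>M\<^esub>"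
    using assms(2,5) by (auto intro!: smult_zero_left)
qed (use assms in \<open>auto simp: free_mod_carrier intro!: smult_closed\<close>)

lemma lincomb_hom:
  assumes y: "y \<in> S \<rightarrow> carrier M"
  shows "lincomb R M y \<in> module_homs R (free_mod R S) M"
proof (rule module_homsI)
  interpret F: left_module R "free_mod R S" by (rule R.left_module_free_mod)
  fix u assume u: "u \<in> carrier (free_mod R S)"
  have uS: "{s. u s \<noteq> \<zero>} \<subseteq> S" "finite {s. u s \<noteq> \<zero>}" and uc: "u s \<in> carrier R" for s
    using u by (auto simp: free_mod_carrier)
  have yc: "y s \<in> carrier M" if "s \<in> S" for s using y that by auto
  show "lincomb R M y u \<in> carrier M"
    unfolding lincomb_def using uS by (intro M.finsum_closed) (auto simp: uc yc intro!: smult_closed)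
  show "lincomb R M y (a \<odot>\<^bsub>free_mod R S\<^esub> u) = a \<odot>\<^bsub>M\<^esub> lincomb R M y u" if a: "a \<in> carrier R" for a
  proof -
    have "lincomb R M y (a \<odot>\<^bsub>free_mod R S\<^esub> u)
        = (\<Oplus>\<^bsub>M\<^esub>s\<in>{s. u s \<noteq> \<zero>}. (a \<odot>\<^bsub>free_mod R S\<^esub> u) s \<odot>\<^bsub>M\<^esub> y s)"
      using uS y a by (intro lincomb_superset[where S = S] F.smult_closed u) auto
    also have "\<dots> = (\<Oplus>\<^bsub>M\<^esub>s\<in>{s. u s \<noteq> \<zero>}. a \<odot>\<^bsub>M\<^esub> (u s \<odot>\<^bsub>M\<^esub> y s))"
      using uS a by (intro M.finsum_cong') (auto simp: smult_assoc uc yc subset_iff intro!: smult_closed)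
    also have "\<dots> = a \<odot>\<^bsub>M\<^esub> lincomb R M y u"
      unfolding lincomb_def using uS a by (intro act_finsum[symmetric]) (auto simp: uc yc intro!: smult_closed)
    finally show ?thesis .
  qed
  show "lincomb R M y (u \<oplus>\<^bsub>free_mod R S\<^esub> v) = lincomb R M y u \<oplus>\<^bsub>M\<^esub> lincomb R M y v"
    if v: "v \<in> carrier (free_mod R S)" for v
  proof -
    have vS: "{s. v s \<noteq> \<zero>} \<subseteq> S" "finite {s. v s \<noteq> \<zero>}" and vc: "v s \<in> carrier R" for s
      using v by (auto simp: free_mod_carrier)
    define T where "T = {s. u s \<noteq> \<zero>} \<union> {s. v s \<noteq> \<zero>}"
    have T: "finite T" "T \<subseteq> S" "{s. u s \<noteq> \<zero>} \<subseteq> T" "{s. v s \<noteq> \<zero>} \<subseteq> T"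
      using uS vS by (auto simp: T_def)
    have "lincomb R M y (u \<oplus>\<^bsub>free_mod R S\<^esub> v)
        = (\<Oplus>\<^bsub>M\<^esub>s\<in>T. (u \<oplus>\<^bsub>free_mod R S\<^esub> v) s \<odot>\<^bsub>M\<^esub> y s)"
      using T y u v by (intro lincomb_superset[where S = S] F.M.a_closed) (auto simp: T_def)
    also have "\<dots> = (\<Oplus>\<^bsub>M\<^esub>s\<in>T. u s \<odot>\<^bsub>M\<^esub> y s \<oplus>\<^bsub>M\<^esub> v s \<odot>\<^bsub>M\<^esub> y s)"
      using T by (intro M.finsum_cong') (auto simp: smult_l_distr uc vc yc subset_iff intro!: smult_closed)
    also have "\<dots> = (\<Oplus>\<^bsub>M\<^esub>s\<in>T. u s \<odot>\<^bsub>M\<^esub> y s) \<oplus>\<^bsub>M\<^esub> (\<Oplus>\<^bsub>M\<^esub>s\<in>T. v s \<odot>\<^bsub>M\<^esub> y s)"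
      using T by (intro M.finsum_addf) (auto simp: uc vc yc subset_iff intro!: smult_closed)
    finally show ?thesis
      using lincomb_superset[OF u y T(1,3,2)] lincomb_superset[OF v y T(1,4,2)] by simp
  qed
qed

lemma lincomb_fbasis:
  assumes "y \<in> S \<rightarrow> carrier M" "s \<in> S"
  shows "lincomb R M y (fbasis R s) = y s"
proof -
  have "lincomb R M y (fbasis R s) = (\<Oplus>\<^bsub>M\<^esub>t\<in>{s}. fbasis R s t \<odot>\<^bsub>M\<^esub> y t)"
    using assms by (intro lincomb_superset[where S = S] R.fbasis_closed) (auto simp: fbasis_def)
  also have "\<dots> = y s"
    using assms by (subst M.finsum_insert) (auto simp: fbasis_def smult_one Pi_def intro!: smult_closed)
  finally show ?thesis .
qed

end

context ring
begin

lemma free_mod_expand: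
  assumes "u \<in> carrier (free_mod R S)"
  shows "lincomb R (free_mod R S) (fbasis R) u = u"
proof
  fix t
  interpret F: left_module R "free_mod R S" by (rule left_module_free_mod)
  have u: "{s. u s \<noteq> \<zero>} \<subseteq> S" "finite {s. u s \<noteq> \<zero>}" "\<And>s. u s \<in> carrier R"
    using assms by (auto simp: free_mod_carrier)
  have "lincomb R (free_mod R S) (fbasis R) u t = (\<Oplus>s\<in>{s. u s \<noteq> \<zero>}. u s \<otimes> fbasis R s t)"
    unfolding lincomb_def using u
    by (subst free_mod_finsum_apply) (auto intro!: F.smult_closed fbasis_closed simp del: free_mod_simps, simp)
  also have "\<dots> = (\<Oplus>s\<in>{s. u s \<noteq> \<zero>}. if t = s then u s else \<zero>)"
    using u by (intro finsum_cong') (auto simp: fbasis_def)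
  also have "\<dots> = u t"
  proof (cases "u t = \<zero>")
    case True
    then have "(\<Oplus>s\<in>{s. u s \<noteq> \<zero>}. if t = s then u s else \<zero>) = (\<Oplus>s\<in>{s. u s \<noteq> \<zero>}. \<zero>)"
      by (intro finsum_cong') auto
    then show ?thesis using True by (simp add: finsum_zero)
  next
    case False
    then show ?thesis using u by (intro finsum_singleton) auto
  qed
  finally show "lincomb R (free_mod R S) (fbasis R) u t = u t" .
qed

end

lemma (in lmod) free_hom_eq_lincomb:
  assumes h: "h \<in> module_homs R (free_mod R S) M" and u: "u \<in> carrier (free_mod R S)"
  shows "h u = lincomb R M (\<lambda>s. h (fbasis R s)) u"
proof -
  interpret F: left_module R "free_mod R S" by (rule R.left_module_free_mod)
  have uS: "{s. u s \<noteq> \<zero>} \<subseteq> S" "finite {s. u s \<noteq> \<zero>}" "\<And>s. u s \<in> carrier R"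
    using u by (auto simp: free_mod_carrier)
  have c: "(\<lambda>s. u s \<odot>\<^bsub>free_mod R S\<^esub> fbasis R s) \<in> {s. u s \<noteq> \<zero>} \<rightarrow> carrier (free_mod R S)"
    using uS by (auto intro!: F.smult_closed R.fbasis_closed simp del: free_mod_simps)
  have "h u = h (lincomb R (free_mod R S) (fbasis R) u)" by (simp only: R.free_mod_expand[OF u])
  also have "\<dots> = (\<Oplus>\<^bsub>M\<^esub>s\<in>{s. u s \<noteq> \<zero>}. h (u s \<odot>\<^bsub>free_mod R S\<^esub> fbasis R s))"
    unfolding lincomb_def by (intro hom_finsum[OF h] F.M.abelian_group_axioms M.abelian_group_axioms c)
  also have "\<dots> = lincomb R M (\<lambda>s. h (fbasis R s)) u"
    unfolding lincomb_def using uS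
    by (intro M.finsum_cong') (auto simp del: free_mod_simps simp: hom_act[OF h] hom_closed[OF h] R.fbasis_closed subset_iff intro!: smult_closed)
  finally show ?thesis .
qed

lemma (in lmod) free_hom_eqI:
  assumes "h \<in> module_homs R (free_mod R S) M" "g \<in> module_homs R (free_mod R S) M"
    and "\<And>s. s \<in> S \<Longrightarrow> h (fbasis R s) = g (fbasis R s)" and u: "u \<in> carrier (free_mod R S)"
  shows "h u = g u"
proof -
  have uS: "{s. u s \<noteq> \<zero>} \<subseteq> S" "\<And>s. u s \<in> carrier R" using u by (auto simp: free_mod_carrier)
  have "lincomb R M (\<lambda>s. h (fbasis R s)) u = lincomb R M (\<lambda>s. g (fbasis R s)) u"
    unfolding lincomb_def using uS assms(3)
    by (intro M.finsum_cong') (auto simp: subset_iff intro!: smult_closed hom_closed[OF assms(2)] R.fbasis_closed)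
  then show ?thesis
    by (simp only: free_hom_eq_lincomb[OF assms(1) u] free_hom_eq_lincomb[OF assms(2) u])
qed

text \<open>
  Only the images of the basis elements have to be lifted; in contrast to the definition of
  \<open>projective\<close>, \<open>g\<close> may fail to be surjective and its modules may have any type.
\<close>

lemma free_lift:
  assumes X: "left_module A X" and Y: "left_module A Y"
    and g: "g \<in> module_homs A X Y" and h: "h \<in> module_homs A (free_mod A S) Y"
    and sub: "\<And>s. s \<in> S \<Longrightarrow> h (fbasis A s) \<in> g ` carrier X"
  shows "\<exists>l\<in>module_homs A (free_mod A S) X. \<forall>p\<in>carrier (free_mod A S). g (l p) = h p"
proof -
  interpret X: lmod A X using X by (rule lmod.intro)
  interpret Y: lmod A Y using Y by (rule lmod.intro)
  have "\<forall>s\<in>S. \<exists>x\<in>carrier X. g x = h (fbasis A s)" using sub by (metis imageE)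
  then obtain y where y: "\<And>s. s \<in> S \<Longrightarrow> y s \<in> carrier X" "\<And>s. s \<in> S \<Longrightarrow> g (y s) = h (fbasis A s)"
    by metis
  have yS: "y \<in> S \<rightarrow> carrier X" using y(1) by auto
  note l = X.lincomb_hom[OF yS]
  have "g (lincomb A X y p) = h p" if "p \<in> carrier (free_mod A S)" for p
    using Y.free_hom_eqI[OF hom_comp[OF l g] h _ that] X.lincomb_fbasis[OF yS] y(2) by simp
  then show ?thesis using l by blast
qed

lemma projective_free: assumes "ring A" shows "projective A (free_mod A S)"
proof -
  interpret ring A by fact
  show ?thesis unfolding projective_def
  proof (intro conjI allI impI, rule left_module_free_mod, elim conjE, goal_cases)
    case (1 X Y g h)
    show ?case by (rule free_lift[OF 1(1-3,5)]) (simp add: 1(4) hom_closed[OF 1(5)] fbasis_closed)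
  qed
qed

text \<open>
  The lifting property in the definition of \<open>projective\<close> speaks about modules of special types and
  about surjections.  Applied to the surjection from the free module on the carrier of \<open>P\<close> onto \<open>P\<close>, it splits
  that surjection; the lift is then obtained by composing the splitting with a lift from the free
  module.
\<close>

lemma projective_lift:
  assumes P: "projective A P" and X: "left_module A X" and Y: "left_module A Y"
    and g: "g \<in> module_homs A X Y" and h: "h \<in> module_homs A P Y"
    and sub: "\<And>p. p \<in> carrier P \<Longrightarrow> h p \<in> g ` carrier X"
  shows "\<exists>l\<in>module_homs A P X. \<forall>p\<in>carrier P. g (l p) = h p"
proof -
  interpret P: lmod A P using P by (simp add: projective_def lmod_def)
  let ?F = "free_mod A (carrier P)"
  interpret F: left_module A ?F by (rule P.R.left_module_free_mod)
  have idP: "(\<lambda>p. p) \<in> carrier P \<rightarrow> carrier P" by auto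
  note e = P.lincomb_hom[OF idP]
  have "lincomb A P (\<lambda>p. p) ` carrier ?F = carrier P"
  proof
    show "carrier P \<subseteq> lincomb A P (\<lambda>p. p) ` carrier ?F"
    proof
      fix p assume p: "p \<in> carrier P"
      show "p \<in> lincomb A P (\<lambda>p. p) ` carrier ?F"
        using P.lincomb_fbasis[OF idP p] P.R.fbasis_closed[OF p] by (metis imageI)
    qed
  qed (use hom_closed[OF e] in auto)
  \<comment> \<open>a section of the canonical surjection\<close>
  then obtain s where s: "s \<in> module_homs A P ?F" "\<And>p. p \<in> carrier P \<Longrightarrow> lincomb A P (\<lambda>p. p) (s p) = p"
    using P e hom_id[of A P] F.left_module_axioms P.left_module_axioms unfolding projective_def by metis
  have he: "(\<lambda>u. h (lincomb A P (\<lambda>p. p) u)) \<in> module_homs A ?F Y" by (rule hom_comp[OF e h])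
  obtain l where l: "l \<in> module_homs A ?F X"
    "\<And>u. u \<in> carrier ?F \<Longrightarrow> g (l u) = h (lincomb A P (\<lambda>p. p) u)"
    using free_lift[OF X Y g he] sub hom_closed[OF e] P.R.fbasis_closed by (metis (no_types, lifting))
  show ?thesis
    using hom_comp[OF s(1) l(1)] l(2) s(2) hom_closed[OF s(1)] by (intro bexI[of _ "\<lambda>p. l (s p)"]) auto
qed

section \<open>Quotients, duals and the cohomology of a complex\<close>

lemma (in abelian_group) minus_cancel_mid: "\<lbrakk>x \<in> carrier G; y \<in> carrier G\<rbrakk> \<Longrightarrow> (x \<ominus> y) \<oplus> y = x"
  by (simp add: minus_eq a_assoc l_neg)

lemma (in abelian_group) minus_eq_zero_iff: "\<lbrakk>x \<in> carrier G; y \<in> carrier G\<rbrakk> \<Longrightarrow> x \<ominus> y = \<zero> \<longleftrightarrow> x = y"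
  using minus_cancel_mid[of x y] by (auto simp: minus_eq r_neg)

subsection \<open>Quotient modules\<close>

lemma abelian_group_subset:
  assumes "abelian_group H" "subgroup Z (add_monoid H)"
  shows "abelian_group (H\<lparr>carrier := Z\<rparr>)"
proof -
  interpret abelian_group H by fact
  note s = subgroup.subset[OF assms(2)] subgroup.m_closed[OF assms(2)] subgroup.one_closed[OF assms(2)]
    subgroup.m_inv_closed[OF assms(2)]
  show ?thesis
  proof (rule abelian_groupI, goal_cases)
    case (6 x)
    then have "\<ominus>\<^bsub>H\<^esub> x \<in> Z" using s(4)[of x] by (simp add: a_inv_def)
    then show ?case using 6 s(1) by (intro bexI[of _ "\<ominus>\<^bsub>H\<^esub> x"]) (auto simp: l_neg)
  qed (use s(1-3) in \<open>auto simp: a_ac subset_iff\<close>)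
qed

locale sub_action = additive_action R M for R :: "('a, 'x) ring_scheme" (structure) and M :: "('a, 'm) module" (structure) +
  fixes N
  assumes sub: "subgroup N (add_monoid M)"
    and stable: "\<lbrakk>a \<in> carrier R; n \<in> N\<rbrakk> \<Longrightarrow> a \<odot>\<^bsub>M\<^esub> n \<in> N"
begin

sublocale S: abelian_subgroup N M
  by (intro abelian_subgroupI3 additive_subgroupI sub M.abelian_group_axioms)

lemma N_carrier: "n \<in> N \<Longrightarrow> n \<in> carrier M" using S.a_subset by auto

lemma quot_carrier: "carrier (quotient_module M N) = (\<lambda>m. N +>\<^bsub>M\<^esub> m) ` carrier M"
  by (auto simp: quotient_module_def A_RCOSETS_def')

lemma quot_carrierE:
  assumes "X \<in> carrier (quotient_module M N)"
  obtains m where "m \<in> carrier M" "X = N +>\<^bsub>M\<^esub> m"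
  using assms by (auto simp: quot_carrier)

lemma coset_closed: "m \<in> carrier M \<Longrightarrow> N +>\<^bsub>M\<^esub> m \<in> carrier (quotient_module M N)"
  by (auto simp: quot_carrier)

lemma coset_eq_iff:
  assumes "m \<in> carrier M" "m' \<in> carrier M"
  shows "N +>\<^bsub>M\<^esub> m = N +>\<^bsub>M\<^esub> m' \<longleftrightarrow> m \<ominus>\<^bsub>M\<^esub> m' \<in> N"
proof -
  have "m \<in> N +>\<^bsub>M\<^esub> m' \<longleftrightarrow> m \<ominus>\<^bsub>M\<^esub> m' \<in> N"
    using assms by (simp add: M.minus_eq S.a_rcos_module)
  moreover have "N +>\<^bsub>M\<^esub> m = N +>\<^bsub>M\<^esub> m' \<longleftrightarrow> m \<in> N +>\<^bsub>M\<^esub> m'"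
    using S.a_rcos_self[OF assms(1)] M.a_repr_independence[OF _ assms(2) sub] by metis
  ultimately show ?thesis by simp
qed

lemma quot_zero: "\<zero>\<^bsub>quotient_module M N\<^esub> = N" by (simp add: quotient_module_def)

lemma coset_zero: "N +>\<^bsub>M\<^esub> \<zero>\<^bsub>M\<^esub> = N"
  using S.a_subset by (rule M.a_coset_add_zero)

lemma coset_eq_zero_iff: "m \<in> carrier M \<Longrightarrow> N +>\<^bsub>M\<^esub> m = N \<longleftrightarrow> m \<in> N"
  using coset_eq_iff[of m "\<zero>\<^bsub>M\<^esub>"] M.minus_cancel_mid[of m "\<zero>\<^bsub>M\<^esub>"]
  by (simp add: coset_zero)

lemma quot_add:
  assumes "m \<in> carrier M" "m' \<in> carrier M"
  shows "(N +>\<^bsub>M\<^esub> m) \<oplus>\<^bsub>quotient_module M N\<^esub> (N +>\<^bsub>M\<^esub> m') = N +>\<^bsub>M\<^esub> (m \<oplus>\<^bsub>M\<^esub> m')"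
  using S.a_rcos_sum[OF assms] by (simp add: quotient_module_def)

lemma quot_act:
  assumes a: "a \<in> carrier R" and m: "m \<in> carrier M"
  shows "a \<odot>\<^bsub>quotient_module M N\<^esub> (N +>\<^bsub>M\<^esub> m) = N +>\<^bsub>M\<^esub> (a \<odot>\<^bsub>M\<^esub> m)"
proof -
  have "N <+>\<^bsub>M\<^esub> ((\<lambda>m. a \<odot>\<^bsub>M\<^esub> m) ` (N +>\<^bsub>M\<^esub> m)) = N +>\<^bsub>M\<^esub> (a \<odot>\<^bsub>M\<^esub> m)" (is "?L = ?R")
  proof
    show "?L \<subseteq> ?R"
    proof
      fix x assume "x \<in> ?L"
      then obtain n n' where n: "n \<in> N" "n' \<in> N" "x = n \<oplus>\<^bsub>M\<^esub> a \<odot>\<^bsub>M\<^esub> (n' \<oplus>\<^bsub>M\<^esub> m)"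
        by (auto simp: set_add_def' a_r_coset_def')
      then have "x = (n \<oplus>\<^bsub>M\<^esub> a \<odot>\<^bsub>M\<^esub> n') \<oplus>\<^bsub>M\<^esub> a \<odot>\<^bsub>M\<^esub> m"
        using a m by (simp add: act_add N_carrier act_closed M.a_assoc)
      then show "x \<in> ?R" using n a by (auto simp: a_r_coset_def' intro!: bexI[of _ "n \<oplus>\<^bsub>M\<^esub> a \<odot>\<^bsub>M\<^esub> n'"] stable S.a_closed)
    qed
    show "?R \<subseteq> ?L"
    proof
      fix x assume "x \<in> ?R"
      then obtain n where n: "n \<in> N" "x = n \<oplus>\<^bsub>M\<^esub> a \<odot>\<^bsub>M\<^esub> m" by (auto simp: a_r_coset_def')
      then show "x \<in> ?L" using S.a_rcos_self[OF m] by (auto simp: set_add_def')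
    qed
  qed
  then show ?thesis by (simp add: quotient_module_def)
qed

lemma quot_action: "additive_action R (quotient_module M N)"
proof -
  let ?Q = "quotient_module M N"
  have "abelian_group ?Q"
  proof (rule abelian_groupI, goal_cases)
    case (1 x y) then show ?case by (auto elim!: quot_carrierE simp: quot_add coset_closed)
  next
    case 2 then show ?case using coset_closed[OF M.zero_closed] by (simp add: quot_zero coset_zero)
  next
    case (3 x y z) then show ?case by (auto elim!: quot_carrierE simp: quot_add M.a_assoc)
  next
    case (4 x y) then show ?case by (auto elim!: quot_carrierE simp: quot_add M.a_comm)
  next
    case (5 x)
    then obtain m where m: "m \<in> carrier M" "x = N +>\<^bsub>M\<^esub> m" by (rule quot_carrierE)
    then show ?case using quot_add[OF M.zero_closed m(1)] by (simp add: quot_zero coset_zero)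
  next
    case (6 x)
    then obtain m where m: "m \<in> carrier M" "x = N +>\<^bsub>M\<^esub> m" by (rule quot_carrierE)
    then show ?case using quot_add[OF M.a_inv_closed[OF m(1)] m(1)]
      by (intro bexI[of _ "N +>\<^bsub>M\<^esub> (\<ominus>\<^bsub>M\<^esub> m)"]) (auto simp: quot_zero coset_zero M.l_neg coset_closed)
  qed
  then interpret Q: abelian_group ?Q .
  show ?thesis
    by unfold_locales (auto elim!: quot_carrierE simp: quot_act quot_add act_add act_closed coset_closed)
qed

lemma coset_hom: "(\<lambda>m. N +>\<^bsub>M\<^esub> m) \<in> module_homs R M (quotient_module M N)"
  by (rule module_homsI) (auto simp: coset_closed quot_add quot_act)

lemma quot_hom_exists:
  assumes P: "additive_action R P" and h: "h \<in> module_homs R M P"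
    and 0: "\<And>n. n \<in> N \<Longrightarrow> h n = \<zero>\<^bsub>P\<^esub>"
  shows "\<exists>g\<in>module_homs R (quotient_module M N) P. \<forall>m\<in>carrier M. g (N +>\<^bsub>M\<^esub> m) = h m"
proof -
  interpret P: additive_action R P by fact
  define g where "g X = h (SOME m. m \<in> carrier M \<and> X = N +>\<^bsub>M\<^esub> m)" for X
  have g: "g (N +>\<^bsub>M\<^esub> m) = h m" if m: "m \<in> carrier M" for m
  proof -
    define m' where "m' = (SOME m'. m' \<in> carrier M \<and> N +>\<^bsub>M\<^esub> m = N +>\<^bsub>M\<^esub> m')"
    have m': "m' \<in> carrier M \<and> N +>\<^bsub>M\<^esub> m = N +>\<^bsub>M\<^esub> m'"
      unfolding m'_def by (rule someI[of _ m]) (use m in auto)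
    then have "m \<ominus>\<^bsub>M\<^esub> m' \<in> N" using m coset_eq_iff by blast
    then have "h m \<ominus>\<^bsub>P\<^esub> h m' = \<zero>\<^bsub>P\<^esub>"
      using 0 hom_minus[OF h M.abelian_group_axioms P.M.abelian_group_axioms, of m m'] m m' by simp
    then have "h m = h m'" using m m' hom_closed[OF h] P.M.minus_eq_zero_iff by blast
    then show ?thesis by (simp add: g_def m'_def)
  qed
  have "g \<in> module_homs R (quotient_module M N) P"
    by (rule module_homsI)
      (auto elim!: quot_carrierE simp: g quot_add quot_act hom_closed[OF h] hom_add[OF h] hom_act[OF h] act_closed)
  then show ?thesis using g by blast
qed

end

lemma quot_left_module:
  assumes "left_module R M" "sub_action R M N" shows "left_module R (quotient_module M N)"
proof -
  interpret L: left_module R M by fact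
  interpret sub_action R M N by fact
  interpret Q: additive_action R "quotient_module M N" by (rule quot_action)
  show ?thesis
    by unfold_locales (auto elim!: quot_carrierE simp: quot_act quot_add coset_closed L.smult_l_distr
        L.smult_r_distr L.smult_assoc L.smult_one L.smult_closed)
qed

text \<open>
  An isomorphism of subquotients given by maps in both directions that are inverse to each other only up
  to elements of the subgroups divided out, as comparison maps between resolutions are.
\<close>

lemma module_isomorphic_quotients:
  assumes "sub_action A Z B" "sub_action A Z' B'"
    and \<alpha>: "\<alpha> \<in> module_homs A Z Z'" and \<beta>: "\<beta> \<in> module_homs A Z' Z"
    and \<alpha>B: "\<And>b. b \<in> B \<Longrightarrow> \<alpha> b \<in> B'" and \<beta>B: "\<And>b. b \<in> B' \<Longrightarrow> \<beta> b \<in> B"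
    and \<beta>\<alpha>: "\<And>z. z \<in> carrier Z \<Longrightarrow> \<beta> (\<alpha> z) \<ominus>\<^bsub>Z\<^esub> z \<in> B"
    and \<alpha>\<beta>: "\<And>z. z \<in> carrier Z' \<Longrightarrow> \<alpha> (\<beta> z) \<ominus>\<^bsub>Z'\<^esub> z \<in> B'"
  shows "module_isomorphic A (quotient_module Z B) (quotient_module Z' B')"
proof -
  interpret Z: sub_action A Z B by fact
  interpret Z': sub_action A Z' B' by fact
  obtain g where g: "g \<in> module_homs A (quotient_module Z B) (quotient_module Z' B')"
    "\<And>z. z \<in> carrier Z \<Longrightarrow> g (B +>\<^bsub>Z\<^esub> z) = B' +>\<^bsub>Z'\<^esub> \<alpha> z"
    using Z.quot_hom_exists[OF Z'.quot_action hom_comp[OF \<alpha> Z'.coset_hom]]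
    using \<alpha>B by (auto simp: Z'.quot_zero Z'.coset_eq_zero_iff hom_closed[OF \<alpha>] Z.N_carrier)
  obtain g' where g': "g' \<in> module_homs A (quotient_module Z' B') (quotient_module Z B)"
    "\<And>z. z \<in> carrier Z' \<Longrightarrow> g' (B' +>\<^bsub>Z'\<^esub> z) = B +>\<^bsub>Z\<^esub> \<beta> z"
    using Z'.quot_hom_exists[OF Z.quot_action hom_comp[OF \<beta> Z.coset_hom]]
    using \<beta>B by (auto simp: Z.quot_zero Z.coset_eq_zero_iff hom_closed[OF \<beta>] Z'.N_carrier)
  have e: "B +>\<^bsub>Z\<^esub> \<beta> (\<alpha> z) = B +>\<^bsub>Z\<^esub> z" if "z \<in> carrier Z" for z
    using that \<beta>\<alpha>[OF that] by (simp add: Z.coset_eq_iff hom_closed[OF \<alpha>] hom_closed[OF \<beta>])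
  have e': "B' +>\<^bsub>Z'\<^esub> \<alpha> (\<beta> z) = B' +>\<^bsub>Z'\<^esub> z" if "z \<in> carrier Z'" for z
    using that \<alpha>\<beta>[OF that] by (simp add: Z'.coset_eq_iff hom_closed[OF \<alpha>] hom_closed[OF \<beta>])
  have "bij_betw g (carrier (quotient_module Z B)) (carrier (quotient_module Z' B'))"
  proof (rule bij_betw_byWitness[of _ g'])
    show "\<forall>X\<in>carrier (quotient_module Z B). g' (g X) = X"
      by (intro ballI, elim Z.quot_carrierE) (simp add: g(2) g'(2) hom_closed[OF \<alpha>] e)
    show "\<forall>X\<in>carrier (quotient_module Z' B'). g (g' X) = X"
      by (intro ballI, elim Z'.quot_carrierE) (simp add: g(2) g'(2) hom_closed[OF \<beta>] e')
  qed (use hom_closed[OF g(1)] hom_closed[OF g'(1)] in auto)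
  then show ?thesis using g(1) unfolding module_isomorphic_def by blast
qed

lemma module_isomorphic_trans:
  assumes "module_isomorphic A M N" "module_isomorphic A N P"
  shows "module_isomorphic A M P"
proof -
  obtain g h where g: "g \<in> module_homs A M N" "bij_betw g (carrier M) (carrier N)"
    and h: "h \<in> module_homs A N P" "bij_betw h (carrier N) (carrier P)"
    using assms unfolding module_isomorphic_def by blast
  show ?thesis unfolding module_isomorphic_def
    using hom_comp[OF g(1) h(1)] bij_betw_trans[OF g(2) h(2)] by (auto simp: comp_def)
qed

lemma module_isomorphic_sym:
  assumes "module_isomorphic A M N" "additive_action A M" shows "module_isomorphic A N M"
proof -
  interpret M: additive_action A M by fact
  obtain g where g: "g \<in> module_homs A M N" "bij_betw g (carrier M) (carrier N)"
    using assms unfolding module_isomorphic_def by blast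
  define h where "h = inv_into (carrier M) g"
  have gh: "g (h y) = y" "h y \<in> carrier M" if "y \<in> carrier N" for y
    using that g(2) unfolding h_def by (auto simp: bij_betw_def f_inv_into_f inv_into_into)
  have hg: "h (g x) = x" if "x \<in> carrier M" for x
    using that g(2) unfolding h_def by (auto simp: bij_betw_def)
  have "h \<in> module_homs A N M"
  proof (rule module_homsI)
    show "h (p \<oplus>\<^bsub>N\<^esub> q) = h p \<oplus>\<^bsub>M\<^esub> h q" if "p \<in> carrier N" "q \<in> carrier N" for p q
      using hg[of "h p \<oplus>\<^bsub>M\<^esub> h q"] that by (simp add: hom_add[OF g(1)] gh)
    show "h (a \<odot>\<^bsub>N\<^esub> p) = a \<odot>\<^bsub>M\<^esub> h p" if "a \<in> carrier A" "p \<in> carrier N" for a p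
      using hg[of "a \<odot>\<^bsub>M\<^esub> h p"] that by (simp add: hom_act[OF g(1)] gh M.act_closed)
  qed (rule gh)
  moreover have "bij_betw h (carrier N) (carrier M)"
    unfolding h_def by (rule bij_betw_inv_into[OF g(2)])
  ultimately show ?thesis unfolding module_isomorphic_def by blast
qed

lemma module_isomorphic_trivial:
  assumes "module_isomorphic A M N" "additive_action A M" "additive_action A N"
  shows "carrier M = {\<zero>\<^bsub>M\<^esub>} \<longleftrightarrow> carrier N = {\<zero>\<^bsub>N\<^esub>}"
proof -
  interpret M: additive_action A M by fact
  interpret N: additive_action A N by fact
  obtain g where g: "g \<in> module_homs A M N" "bij_betw g (carrier M) (carrier N)"
    using assms unfolding module_isomorphic_def by blast
  have "g \<zero>\<^bsub>M\<^esub> = \<zero>\<^bsub>N\<^esub>" by (rule hom_zero[OF g(1)]) unfold_locales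
  then have img: "carrier N = g ` carrier M" and z: "g \<zero>\<^bsub>M\<^esub> = \<zero>\<^bsub>N\<^esub>"
    and inj: "\<And>p. p \<in> carrier M \<Longrightarrow> g p = g \<zero>\<^bsub>M\<^esub> \<Longrightarrow> p = \<zero>\<^bsub>M\<^esub>"
    using g(2) by (simp_all add: bij_betw_def inj_on_def)
  show ?thesis
  proof
    assume "carrier M = {\<zero>\<^bsub>M\<^esub>}" then show "carrier N = {\<zero>\<^bsub>N\<^esub>}" using img z by simp
  next
    assume N: "carrier N = {\<zero>\<^bsub>N\<^esub>}"
    have "p = \<zero>\<^bsub>M\<^esub>" if "p \<in> carrier M" for p
      using inj[OF that] hom_closed[OF g(1) that] N z by simp
    then show "carrier M = {\<zero>\<^bsub>M\<^esub>}" using M.M.zero_closed by blast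
  qed
qed

subsection \<open>Dual modules and cohomology\<close>

lemma left_regular_simps [simp]:
  "carrier (left_regular A) = carrier A" "zero (left_regular A) = zero A"
  "add (left_regular A) = add A" "smult (left_regular A) a b = a \<otimes>\<^bsub>A\<^esub> b"
  by (simp_all add: left_regular_def)

lemma right_regular_simps [simp]:
  "carrier (right_regular A) = carrier A" "zero (right_regular A) = zero A"
  "add (right_regular A) = add A" "smult (right_regular A) a b = b \<otimes>\<^bsub>A\<^esub> a"
  by (simp_all add: right_regular_def)

lemma (in ring) left_regular_module: "left_module R (left_regular R)"
proof -
  interpret L: abelian_group "left_regular R"
  proof (rule abelian_groupI, goal_cases)
    case (6 x)
    then show ?case by (intro bexI[of _ "\<ominus> x"]) (auto simp: l_neg)
  qed (auto simp: a_ac)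
  show ?thesis by unfold_locales (auto simp: l_distr r_distr m_assoc)
qed

lemma (in ring) right_regular_action: "additive_action R (right_regular R)"
proof -
  interpret L: abelian_group "right_regular R"
  proof (rule abelian_groupI, goal_cases)
    case (6 x)
    then show ?case by (intro bexI[of _ "\<ominus> x"]) (auto simp: l_neg)
  qed (auto simp: a_ac)
  show ?thesis by unfold_locales (auto simp: l_distr r_distr m_assoc)
qed

lemma hom_to_ring_carrier:
  "h \<in> carrier (hom_to_ring A P) \<longleftrightarrow> h \<in> module_homs A P (left_regular A) \<and> h \<in> extensional (carrier P)"
  by (simp add: hom_to_ring_def)

lemma hom_to_ring_simps:
  "zero (hom_to_ring A P) = restrict (\<lambda>p. \<zero>\<^bsub>A\<^esub>) (carrier P)"
  "add (hom_to_ring A P) g h = restrict (\<lambda>p. g p \<oplus>\<^bsub>A\<^esub> h p) (carrier P)"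
  "smult (hom_to_ring A P) a h = restrict (\<lambda>p. h p \<otimes>\<^bsub>A\<^esub> a) (carrier P)"
  by (simp_all add: hom_to_ring_def)

lemma module_homs_restrict:
  assumes "additive_action A P" "h \<in> module_homs A P N"
  shows "restrict h (carrier P) \<in> module_homs A P N"
proof -
  interpret additive_action A P by fact
  show ?thesis using assms(2) by (auto simp: module_homs_def act_closed)
qed

lemma dualD:
  assumes "h \<in> carrier (hom_to_ring A P)"
  shows "p \<in> carrier P \<Longrightarrow> h p \<in> carrier A"
    "p \<in> carrier P \<Longrightarrow> q \<in> carrier P \<Longrightarrow> h (p \<oplus>\<^bsub>P\<^esub> q) = h p \<oplus>\<^bsub>A\<^esub> h q"
    "a \<in> carrier A \<Longrightarrow> p \<in> carrier P \<Longrightarrow> h (a \<odot>\<^bsub>P\<^esub> p) = a \<otimes>\<^bsub>A\<^esub> h p"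
  using assms by (auto simp: hom_to_ring_carrier module_homs_def)

lemma dualI:
  assumes "additive_action A P" "h \<in> module_homs A P (left_regular A)"
  shows "restrict h (carrier P) \<in> carrier (hom_to_ring A P)"
  using module_homs_restrict[OF assms] by (simp add: hom_to_ring_carrier)

lemma dual_action:
  assumes "left_module A P" shows "additive_action A (hom_to_ring A P)"
proof -
  interpret P: left_module A P by fact
  let ?H = "hom_to_ring A P"
  note PA = P.additive_action_axioms
  interpret LR: left_module A "left_regular A" by (rule P.R.left_regular_module)
  note L = LR.additive_action_axioms
  have ext: "g = h" if "g \<in> carrier ?H" "h \<in> carrier ?H" "\<And>p. p \<in> carrier P \<Longrightarrow> g p = h p" for g h
    using that by (auto simp: hom_to_ring_carrier intro: extensionalityI)
  have cl_add: "g \<oplus>\<^bsub>?H\<^esub> h \<in> carrier ?H" if "g \<in> carrier ?H" "h \<in> carrier ?H" for g h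
    unfolding hom_to_ring_simps
    by (rule dualI[OF PA]) (use hom_plus[OF L, of g P h] that in \<open>auto simp: hom_to_ring_carrier\<close>)
  have cl_zero: "\<zero>\<^bsub>?H\<^esub> \<in> carrier ?H"
    unfolding hom_to_ring_simps
    by (rule dualI[OF PA]) (use hom_const_zero[OF L] in auto)
  have cl_act: "a \<odot>\<^bsub>?H\<^esub> h \<in> carrier ?H" if "a \<in> carrier A" "h \<in> carrier ?H" for a h
    unfolding hom_to_ring_simps
    by (rule dualI[OF PA], rule module_homsI)
      (use that in \<open>simp_all add: dualD[OF that(2)] P.R.l_distr P.R.m_assoc\<close>)
  have ad: "(g \<oplus>\<^bsub>?H\<^esub> h) p = g p \<oplus>\<^bsub>A\<^esub> h p" if "p \<in> carrier P" for g h p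
    using that by (simp add: hom_to_ring_simps)
  have zr: "\<zero>\<^bsub>?H\<^esub> p = \<zero>\<^bsub>A\<^esub>" if "p \<in> carrier P" for p
    using that by (simp add: hom_to_ring_simps)
  have sm: "(a \<odot>\<^bsub>?H\<^esub> h) p = h p \<otimes>\<^bsub>A\<^esub> a" if "p \<in> carrier P" for a h p
    using that by (simp add: hom_to_ring_simps)
  have "abelian_group ?H"
  proof (rule abelian_groupI, goal_cases)
    case (1 g h) then show ?case by (rule cl_add)
  next
    case 2 show ?case by (rule cl_zero)
  next
    case (3 f g h)
    show ?case by (rule ext) (simp_all add: 3 cl_add ad dualD(1)[OF 3(1)] dualD(1)[OF 3(2)] dualD(1)[OF 3(3)] P.R.a_assoc)
  next
    case (4 f g)
    show ?case by (rule ext) (simp_all add: 4 cl_add ad dualD(1)[OF 4(1)] dualD(1)[OF 4(2)] P.R.a_comm)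
  next
    case (5 f)
    show ?case by (rule ext) (simp_all add: 5 cl_add cl_zero ad zr dualD(1)[OF 5])
  next
    case (6 h)
    let ?k = "restrict (\<lambda>p. \<ominus>\<^bsub>A\<^esub> h p) (carrier P)"
    have k: "?k \<in> carrier ?H"
      by (rule dualI[OF PA], rule module_homsI)
        (simp_all add: dualD[OF 6] P.R.minus_add P.R.r_minus)
    have "?k \<oplus>\<^bsub>?H\<^esub> h = \<zero>\<^bsub>?H\<^esub>"
      by (rule ext[OF cl_add[OF k 6] cl_zero]) (simp add: ad zr dualD(1)[OF 6] P.R.l_neg)
    then show ?case using k by blast
  qed
  then interpret H: abelian_group ?H .
  show ?thesis
  proof (unfold_locales, goal_cases)
    case (1 a h) then show ?case by (rule cl_act)
  next
    case (2 a g h)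
    show ?case by (rule ext) (simp_all add: 2 cl_add cl_act ad sm dualD(1)[OF 2(2)] dualD(1)[OF 2(3)] P.R.l_distr)
  qed
qed

lemma dual_minus:
  assumes "left_module A P" "g \<in> carrier (hom_to_ring A P)" "h \<in> carrier (hom_to_ring A P)" "p \<in> carrier P"
  shows "(g \<ominus>\<^bsub>hom_to_ring A P\<^esub> h) p = g p \<ominus>\<^bsub>A\<^esub> h p"
proof -
  interpret P: left_module A P by fact
  interpret H: additive_action A "hom_to_ring A P" by (rule dual_action[OF assms(1)])
  let ?d = "g \<ominus>\<^bsub>hom_to_ring A P\<^esub> h"
  have d: "?d \<in> carrier (hom_to_ring A P)" using assms by simp
  have "(?d \<oplus>\<^bsub>hom_to_ring A P\<^esub> h) p = g p" by (simp only: H.minus_cancel_mid[OF assms(2,3)])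
  then have "?d p \<oplus>\<^bsub>A\<^esub> h p = g p" using assms(4) by (simp add: hom_to_ring_simps)
  then show ?thesis using dualD(1)[OF d assms(4)] dualD(1)[OF assms(2,4)] dualD(1)[OF assms(3,4)]
    by (simp add: P.R.minus_eq P.R.add.inv_solve_right)
qed

text \<open>
  Precomposition with \<open>\<phi>\<close>, restricted to the carrier because \<open>hom_to_ring\<close> consists of extensional
  functions.
\<close>

definition dual_map :: "('a, 'p) module \<Rightarrow> ('p \<Rightarrow> 'q) \<Rightarrow> ('q \<Rightarrow> 'a) \<Rightarrow> 'p \<Rightarrow> 'a"
  where "dual_map P \<phi> = (\<lambda>g. restrict (\<lambda>p. g (\<phi> p)) (carrier P))"

lemma dual_map_hom:
  assumes "left_module A P" "left_module A Q" "\<phi> \<in> module_homs A P Q"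
  shows "dual_map P \<phi> \<in> module_homs A (hom_to_ring A Q) (hom_to_ring A P)"
proof (rule module_homsI)
  interpret P: left_module A P by fact
  fix g assume g: "g \<in> carrier (hom_to_ring A Q)"
  show "dual_map P \<phi> g \<in> carrier (hom_to_ring A P)"
    unfolding dual_map_def using hom_comp[OF assms(3)] g
    by (intro dualI P.additive_action_axioms) (auto simp: hom_to_ring_carrier)
next
  fix g h assume "g \<in> carrier (hom_to_ring A Q)" "h \<in> carrier (hom_to_ring A Q)"
  show "dual_map P \<phi> (g \<oplus>\<^bsub>hom_to_ring A Q\<^esub> h)
      = dual_map P \<phi> g \<oplus>\<^bsub>hom_to_ring A P\<^esub> dual_map P \<phi> h"
    by (rule ext) (simp add: dual_map_def hom_to_ring_simps hom_closed[OF assms(3)])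
next
  fix a g assume "a \<in> carrier A" "g \<in> carrier (hom_to_ring A Q)"
  show "dual_map P \<phi> (a \<odot>\<^bsub>hom_to_ring A Q\<^esub> g) = a \<odot>\<^bsub>hom_to_ring A P\<^esub> dual_map P \<phi> g"
    by (rule ext) (simp add: dual_map_def hom_to_ring_simps hom_closed[OF assms(3)])
qed

subsection \<open>Cohomology and comparison of projective resolutions\<close>

lemma (in abelian_group) subgroupI_minus:
  assumes "N \<subseteq> carrier G" "\<zero> \<in> N" "\<And>a b. a \<in> N \<Longrightarrow> b \<in> N \<Longrightarrow> a \<ominus> b \<in> N"
  shows "subgroup N (add_monoid G)"
proof (rule group.subgroupI[OF a_group])
  show inv: "inv\<^bsub>add_monoid G\<^esub> a \<in> N" if "a \<in> N" for a
    using assms(3)[OF assms(2) that] assms(1) that by (auto simp: minus_eq a_inv_def[symmetric])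
  show "a \<otimes>\<^bsub>add_monoid G\<^esub> b \<in> N" if "a \<in> N" "b \<in> N" for a b
    using assms(3)[OF that(1) inv[OF that(2)]] assms(1) that
    by (auto simp: minus_eq a_inv_def[symmetric] minus_minus subset_iff)
qed (use assms in auto)

lemma update_minus:
  assumes "abelian_group H" "subgroup Z (add_monoid H)" "z \<in> Z" "z' \<in> Z"
  shows "z \<ominus>\<^bsub>H\<lparr>carrier := Z\<rparr>\<^esub> z' = z \<ominus>\<^bsub>H\<^esub> z'"
proof -
  interpret abelian_group H by fact
  have "inv\<^bsub>(add_monoid H)\<lparr>carrier := Z\<rparr>\<^esub> z' = inv\<^bsub>add_monoid H\<^esub> z'"
    by (rule group.m_inv_consistent[OF a_group assms(2,4)])
  then show ?thesis by (simp add: a_minus_def a_inv_def)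
qed

lemma sub_action_update:
  assumes "additive_action R H" "subgroup Z (add_monoid H)" "subgroup B (add_monoid H)" "B \<subseteq> Z"
    and "\<And>a z. a \<in> carrier R \<Longrightarrow> z \<in> Z \<Longrightarrow> a \<odot>\<^bsub>H\<^esub> z \<in> Z"
    and "\<And>a z. a \<in> carrier R \<Longrightarrow> z \<in> B \<Longrightarrow> a \<odot>\<^bsub>H\<^esub> z \<in> B"
  shows "sub_action R (H\<lparr>carrier := Z\<rparr>) B"
proof -
  interpret H: additive_action R H by fact
  interpret Z: abelian_group "H\<lparr>carrier := Z\<rparr>" by (rule abelian_group_subset[OF H.abelian_group_axioms assms(2)])
  have ZH: "Z \<subseteq> carrier H" using subgroup.subset[OF assms(2)] by simp
  have "subgroup B ((add_monoid H)\<lparr>carrier := Z\<rparr>)"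
    by (rule group.subgroup_incl[OF H.a_group assms(3,2,4)])
  then have sB: "subgroup B (add_monoid (H\<lparr>carrier := Z\<rparr>))" by simp
  interpret Z: additive_action R "H\<lparr>carrier := Z\<rparr>"
    using assms(5) ZH H.act_add by unfold_locales (auto simp: subset_iff)
  show ?thesis
    by (rule sub_action.intro[OF Z.additive_action_axioms sub_action_axioms.intro[OF sB]]) (simp add: assms(6))
qed

text \<open>
  The cohomology of the dual complex is a quotient of groups with a right action by \<open>A\<close>; that the
  coboundaries are cocycles is where \<open>d \<circ> d = 0\<close> enters.
\<close>

locale module_complex =
  fixes A :: "('a, 'x) ring_scheme" and P :: "nat \<Rightarrow> ('a, 'p) module" and d :: "nat \<Rightarrow> 'p \<Rightarrow> 'p"
  assumes lm: "\<And>i. left_module A (P i)"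
    and dh: "\<And>i. d i \<in> module_homs A (P (Suc i)) (P i)"
    and dd: "\<And>i p. p \<in> carrier (P (Suc (Suc i))) \<Longrightarrow> d i (d (Suc i) p) = \<zero>\<^bsub>P i\<^esub>"
begin

abbreviation "H i \<equiv> hom_to_ring A (P i)"
abbreviation "Z i \<equiv> hom_cocycles A P d i"
abbreviation "B i \<equiv> hom_coboundaries A P d i"

lemma ringA: "ring A" using lm[of 0] left_module.axioms by blast
lemma H_act: "additive_action A (H i)" by (rule dual_action[OF lm])
lemma H_grp: "abelian_group (H i)" using H_act additive_action.axioms by blast
lemma P_grp: "abelian_group (P i)" using lm left_module.axioms(2) by blast

lemma Z_iff: "h \<in> Z i \<longleftrightarrow> h \<in> carrier (H i) \<and> (\<forall>p\<in>carrier (P (Suc i)). h (d i p) = \<zero>\<^bsub>A\<^esub>)"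
  by (simp add: hom_cocycles_def)

lemma d_closed: "p \<in> carrier (P (Suc i)) \<Longrightarrow> d i p \<in> carrier (P i)"
  by (rule hom_closed[OF dh])

lemma zero_apply: "h \<in> carrier (H i) \<Longrightarrow> h \<zero>\<^bsub>P i\<^esub> = \<zero>\<^bsub>A\<^esub>"
proof -
  assume h: "h \<in> carrier (H i)"
  interpret left_module A "left_regular A" by (rule ring.left_regular_module[OF ringA])
  show ?thesis
    using hom_zero[OF _ P_grp M.abelian_group_axioms, of h A i] h by (simp add: hom_to_ring_carrier)
qed

lemma Z_subgroup: "subgroup (Z i) (add_monoid (H i))"
proof -
  interpret H: additive_action A "H i" by (rule H_act)
  interpret A: ring A by (rule ringA)
  show ?thesis
  proof (rule H.subgroupI_minus)
    fix g h assume "g \<in> Z i" "h \<in> Z i"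
    then show "g \<ominus>\<^bsub>H i\<^esub> h \<in> Z i"
      by (auto simp: Z_iff dual_minus[OF lm] d_closed A.minus_eq)
  qed (auto simp: Z_iff hom_to_ring_simps d_closed intro: H.M.zero_closed,
      use H.M.zero_closed in \<open>simp add: hom_to_ring_simps\<close>)
qed

lemma Z_stable: "a \<in> carrier A \<Longrightarrow> z \<in> Z i \<Longrightarrow> a \<odot>\<^bsub>H i\<^esub> z \<in> Z i"
proof -
  interpret H: additive_action A "H i" by (rule H_act)
  interpret A: ring A by (rule ringA)
  assume "a \<in> carrier A" "z \<in> Z i"
  then show ?thesis using H.act_closed[of a z] by (auto simp: Z_iff hom_to_ring_simps d_closed)
qed

lemma B_Suc: "B (Suc i) = dual_map (P (Suc i)) (d i) ` carrier (H i)"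
  by (simp add: hom_coboundaries_def dual_map_def)
lemma B_0: "B 0 = {\<zero>\<^bsub>H 0\<^esub>}"
  by (simp add: hom_coboundaries_def)

lemma dual_d_hom: "dual_map (P (Suc i)) (d i) \<in> module_homs A (H i) (H (Suc i))"
  by (rule dual_map_hom[OF lm lm dh])

lemma B_subgroup: "subgroup (B i) (add_monoid (H i))"
proof (cases i)
  case 0
  interpret H: additive_action A "H 0" by (rule H_act)
  show ?thesis unfolding 0 B_0 by (rule H.subgroupI_minus) (auto simp: H.minus_eq_zero_iff)
next
  case (Suc j)
  interpret H: additive_action A "H j" by (rule H_act)
  interpret H': additive_action A "H (Suc j)" by (rule H_act)
  note g = dual_d_hom[of j]
  show ?thesis unfolding Suc B_Suc
  proof (rule H'.subgroupI_minus)
    show "dual_map (P (Suc j)) (d j) ` carrier (H j) \<subseteq> carrier (H (Suc j))"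
      using hom_closed[OF g] by auto
    show "\<zero>\<^bsub>H (Suc j)\<^esub> \<in> dual_map (P (Suc j)) (d j) ` carrier (H j)"
      using hom_zero[OF g H_grp H_grp] H.M.zero_closed by (metis imageI)
    fix a b assume "a \<in> dual_map (P (Suc j)) (d j) ` carrier (H j)" "b \<in> dual_map (P (Suc j)) (d j) ` carrier (H j)"
    then obtain x y where xy: "x \<in> carrier (H j)" "a = dual_map (P (Suc j)) (d j) x"
      "y \<in> carrier (H j)" "b = dual_map (P (Suc j)) (d j) y" by blast
    then have "a \<ominus>\<^bsub>H (Suc j)\<^esub> b = dual_map (P (Suc j)) (d j) (x \<ominus>\<^bsub>H j\<^esub> y)"
      using hom_minus[OF g H_grp H_grp] by simp
    then show "a \<ominus>\<^bsub>H (Suc j)\<^esub> b \<in> dual_map (P (Suc j)) (d j) ` carrier (H j)"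
      using xy by auto
  qed
qed

lemma B_stable: "a \<in> carrier A \<Longrightarrow> z \<in> B i \<Longrightarrow> a \<odot>\<^bsub>H i\<^esub> z \<in> B i"
proof (cases i)
  case 0
  interpret H: additive_action A "H 0" by (rule H_act)
  assume "a \<in> carrier A" "z \<in> B i"
  then show ?thesis unfolding 0 B_0 by (auto simp: H.act_zero)
next
  case (Suc j)
  interpret H: additive_action A "H j" by (rule H_act)
  assume a: "a \<in> carrier A" "z \<in> B i"
  then obtain x where x: "x \<in> carrier (H j)" "z = dual_map (P (Suc j)) (d j) x"
    unfolding Suc B_Suc by blast
  then have "a \<odot>\<^bsub>H i\<^esub> z = dual_map (P (Suc j)) (d j) (a \<odot>\<^bsub>H j\<^esub> x)"
    using hom_act[OF dual_d_hom] a Suc by simp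
  then show ?thesis unfolding Suc B_Suc using a x H.act_closed by auto
qed

lemma B_sub_Z: "B i \<subseteq> Z i"
proof (cases i)
  case 0
  then show ?thesis using subgroup.one_closed[OF Z_subgroup[of 0]] by (simp add: B_0)
next
  case (Suc j)
  show ?thesis unfolding Suc B_Suc
  proof
    fix z assume "z \<in> dual_map (P (Suc j)) (d j) ` carrier (H j)"
    then obtain x where x: "x \<in> carrier (H j)" "z = dual_map (P (Suc j)) (d j) x" by blast
    have "z \<in> carrier (H (Suc j))" using x hom_closed[OF dual_d_hom] by auto
    then show "z \<in> Z (Suc j)"
      using x by (auto simp: Z_iff dual_map_def d_closed dd zero_apply)
  qed
qed

lemma cohomology_sub_action: "sub_action A (H i\<lparr>carrier := Z i\<rparr>) (B i)"
  by (rule sub_action_update[OF H_act Z_subgroup B_subgroup B_sub_Z Z_stable B_stable])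

lemma cohomology_action: "additive_action A (hom_cohomology A P d i)"
  unfolding hom_cohomology_def by (rule sub_action.quot_action[OF cohomology_sub_action])

lemma cohomology_zero_iff: "carrier (hom_cohomology A P d i) = {\<zero>\<^bsub>hom_cohomology A P d i\<^esub>} \<longleftrightarrow> Z i \<subseteq> B i"
proof -
  interpret sub_action A "H i\<lparr>carrier := Z i\<rparr>" "B i" by (rule cohomology_sub_action)
  have "\<zero>\<^bsub>H i\<^esub> \<in> Z i" using subgroup.one_closed[OF Z_subgroup[of i]] by simp
  then have ne: "Z i \<noteq> {}" by blast
  have "carrier (hom_cohomology A P d i) = {\<zero>\<^bsub>hom_cohomology A P d i\<^esub>} \<longleftrightarrow>
    (\<forall>z\<in>Z i. B i +>\<^bsub>H i\<lparr>carrier := Z i\<rparr>\<^esub> z = B i)"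
    unfolding hom_cohomology_def quot_carrier quot_zero using ne by (auto simp: image_iff)
  also have "\<dots> \<longleftrightarrow> Z i \<subseteq> B i" using coset_eq_zero_iff by auto
  finally show ?thesis .
qed

end

locale resolution =
  fixes A :: "('a, 'x) ring_scheme" and M :: "('a, 'm) module"
    and P :: "nat \<Rightarrow> ('a, 'p) module" and d :: "nat \<Rightarrow> 'p \<Rightarrow> 'p" and e :: "'p \<Rightarrow> 'm"
  assumes res: "projective_resolution A M P d e" and lmM: "left_module A M"
begin

lemma proj: "projective A (P i)" using res by (simp add: projective_resolution_def)
lemma eh: "e \<in> module_homs A (P 0) M" using res by (simp add: projective_resolution_def)
lemma e_surj: "m \<in> carrier M \<Longrightarrow> m \<in> e ` carrier (P 0)" using res by (simp add: projective_resolution_def)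
lemma exact0: "{p \<in> carrier (P 0). e p = \<zero>\<^bsub>M\<^esub>} = d 0 ` carrier (P 1)"
  using res by (simp add: projective_resolution_def)
lemma exactS: "{p \<in> carrier (P (Suc i)). d i p = \<zero>\<^bsub>P i\<^esub>} = d (Suc i) ` carrier (P (Suc (Suc i)))"
  using res by (simp add: projective_resolution_def)

sublocale module_complex A P d
proof (rule module_complex.intro)
  show "left_module A (P i)" for i using proj by (simp add: projective_def)
  show "d i \<in> module_homs A (P (Suc i)) (P i)" for i using res by (simp add: projective_resolution_def)
  show "d i (d (Suc i) p) = \<zero>\<^bsub>P i\<^esub>" if "p \<in> carrier (P (Suc (Suc i)))" for i p
    using exactS[of i] that by blast
qed

lemma ed: "p \<in> carrier (P (Suc 0)) \<Longrightarrow> e (d 0 p) = \<zero>\<^bsub>M\<^esub>" using exact0 by auto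

end

definition chain_map where
  "chain_map A P d e Q d' e' \<phi> \<longleftrightarrow> (\<forall>i. \<phi> i \<in> module_homs A (P i) (Q i)) \<and>
    (\<forall>p\<in>carrier (P 0). e' (\<phi> 0 p) = e p) \<and>
    (\<forall>i. \<forall>p\<in>carrier (P (Suc i)). d' i (\<phi> (Suc i) p) = \<phi> i (d i p))"

text \<open>
  Construction degree by degree: the composite of \<open>\<phi>\<^sub>n\<close> with the differential of \<open>P\<close> lands in the image of the
  differential of \<open>Q\<close>, by exactness of \<open>Q\<close>, and therefore lifts to \<open>\<phi>\<^sub>n\<^sub>+\<^sub>1\<close>.  The invariant carried along is
  precisely this containment.
\<close>

lemma comparison:
  assumes "resolution A M P d e" "resolution A M Q d' e'"
  shows "\<exists>\<phi>. chain_map A P d e Q d' e' \<phi>"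
proof -
  interpret P: resolution A M P d e by fact
  interpret Q: resolution A M Q d' e' by fact
  let ?Pr = "\<lambda>n \<phi>. \<phi> \<in> module_homs A (P n) (Q n) \<and> (n = 0 \<longrightarrow> (\<forall>p\<in>carrier (P 0). e' (\<phi> p) = e p)) \<and>
    (\<forall>p\<in>carrier (P (Suc n)). \<phi> (d n p) \<in> d' n ` carrier (Q (Suc n)))"
  let ?Qr = "\<lambda>n \<phi> \<psi>. \<forall>p\<in>carrier (P (Suc n)). d' n (\<psi> p) = \<phi> (d n p)"
  have "\<exists>\<phi>. \<forall>n. ?Pr n (\<phi> n) \<and> ?Qr n (\<phi> n) (\<phi> (Suc n))"
  proof (rule dependent_nat_choice)
    obtain \<phi> where \<phi>: "\<phi> \<in> module_homs A (P 0) (Q 0)" "\<And>p. p \<in> carrier (P 0) \<Longrightarrow> e' (\<phi> p) = e p"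
      using projective_lift[OF P.proj Q.lm P.lmM Q.eh P.eh] Q.e_surj hom_closed[OF P.eh] by metis
    have "\<phi> (d 0 p) \<in> d' 0 ` carrier (Q (Suc 0))" if "p \<in> carrier (P (Suc 0))" for p
      using Q.exact0 \<phi> P.ed[OF that] P.d_closed[OF that] hom_closed[OF \<phi>(1)] by auto
    then show "\<exists>\<phi>. ?Pr 0 \<phi>" using \<phi> by blast
  next
    fix \<phi> n assume \<phi>: "?Pr n \<phi>"
    have c: "(\<lambda>p. \<phi> (d n p)) \<in> module_homs A (P (Suc n)) (Q n)"
      using hom_comp[OF P.dh] \<phi> by blast
    obtain \<psi> where \<psi>: "\<psi> \<in> module_homs A (P (Suc n)) (Q (Suc n))"
      "\<And>p. p \<in> carrier (P (Suc n)) \<Longrightarrow> d' n (\<psi> p) = \<phi> (d n p)"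
      using projective_lift[OF P.proj Q.lm Q.lm Q.dh c] \<phi> by metis
    have "\<psi> (d (Suc n) p) \<in> d' (Suc n) ` carrier (Q (Suc (Suc n)))" if "p \<in> carrier (P (Suc (Suc n)))" for p
    proof -
      have "d' n (\<psi> (d (Suc n) p)) = \<phi> \<zero>\<^bsub>P n\<^esub>" using \<psi>(2)[OF P.d_closed[OF that]] P.dd[OF that] by simp
      also have "\<dots> = \<zero>\<^bsub>Q n\<^esub>" using hom_zero \<phi> P.P_grp Q.P_grp by blast
      finally show ?thesis using Q.exactS[of n] hom_closed[OF \<psi>(1) P.d_closed[OF that]] by blast
    qed
    then show "\<exists>\<psi>. ?Pr (Suc n) \<psi> \<and> ?Qr n \<phi> \<psi>" using \<psi> by blast
  qed
  then obtain \<phi> where "\<And>n. ?Pr n (\<phi> n) \<and> ?Qr n (\<phi> n) (\<phi> (Suc n))" by blast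
  then have "chain_map A P d e Q d' e' \<phi>" unfolding chain_map_def by blast
  then show ?thesis by blast
qed

context resolution
begin

text \<open>
  A lift of the identity of \<open>M\<close> is homotopic to the identity.  With \<open>\<kappa> - id - h d\<close> annihilated by the
  differential, exactness puts it into the image of the next differential, so that \<open>h\<close> can be lifted one step
  further.
\<close>

lemma homotopy:
  assumes "chain_map A P d e P d e \<kappa>"
  shows "\<exists>h. (\<forall>i. h i \<in> module_homs A (P i) (P (Suc i))) \<and>
    (\<forall>p\<in>carrier (P 0). d 0 (h 0 p) = \<kappa> 0 p \<ominus>\<^bsub>P 0\<^esub> p) \<and>
    (\<forall>i. \<forall>p\<in>carrier (P (Suc i)).
      d (Suc i) (h (Suc i) p) = (\<kappa> (Suc i) p \<ominus>\<^bsub>P (Suc i)\<^esub> p) \<ominus>\<^bsub>P (Suc i)\<^esub> h i (d i p))"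
proof -
  have ch: "\<kappa> i \<in> module_homs A (P i) (P i)" and ce: "p \<in> carrier (P 0) \<Longrightarrow> e (\<kappa> 0 p) = e p"
    and cd: "p \<in> carrier (P (Suc i)) \<Longrightarrow> d i (\<kappa> (Suc i) p) = \<kappa> i (d i p)" for i p
    using assms by (auto simp: chain_map_def)
  have act: "additive_action A (P i)" for i
  proof - interpret left_module A "P i" by (rule lm) show ?thesis by unfold_locales qed
  let ?Pr = "\<lambda>n h. h \<in> module_homs A (P n) (P (Suc n)) \<and>
    (n = 0 \<longrightarrow> (\<forall>p\<in>carrier (P 0). d 0 (h p) = \<kappa> 0 p \<ominus>\<^bsub>P 0\<^esub> p)) \<and>
    (\<forall>p\<in>carrier (P (Suc n)). d n (h (d n p)) = \<kappa> n (d n p) \<ominus>\<^bsub>P n\<^esub> d n p)"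
  let ?Qr = "\<lambda>n h h'. \<forall>p\<in>carrier (P (Suc n)).
      d (Suc n) (h' p) = (\<kappa> (Suc n) p \<ominus>\<^bsub>P (Suc n)\<^esub> p) \<ominus>\<^bsub>P (Suc n)\<^esub> h (d n p)"
  have "\<exists>h. \<forall>n. ?Pr n (h n) \<and> ?Qr n (h n) (h (Suc n))"
  proof (rule dependent_nat_choice)
    interpret P0: left_module A "P 0" by (rule lm)
    interpret M: left_module A M by (rule lmM)
    have g: "(\<lambda>p. \<kappa> 0 p \<ominus>\<^bsub>P 0\<^esub> p) \<in> module_homs A (P 0) (P 0)"
      by (rule hom_diff[OF act ch hom_id])
    have "\<kappa> 0 p \<ominus>\<^bsub>P 0\<^esub> p \<in> d 0 ` carrier (P (Suc 0))" if p: "p \<in> carrier (P 0)" for p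
    proof -
      have "e (\<kappa> 0 p \<ominus>\<^bsub>P 0\<^esub> p) = e p \<ominus>\<^bsub>M\<^esub> e p"
        using hom_minus[OF eh P0.M.abelian_group_axioms M.M.abelian_group_axioms] hom_closed[OF ch p] p ce[OF p]
        by simp
      also have "\<dots> = \<zero>\<^bsub>M\<^esub>" using M.M.minus_eq_zero_iff hom_closed[OF eh p] by blast
      finally show ?thesis using exact0 hom_closed[OF g p] by auto
    qed
    then obtain h where h: "h \<in> module_homs A (P 0) (P (Suc 0))"
      "\<And>p. p \<in> carrier (P 0) \<Longrightarrow> d 0 (h p) = \<kappa> 0 p \<ominus>\<^bsub>P 0\<^esub> p"
      using projective_lift[OF proj lm lm dh g] by metis
    then show "\<exists>h. ?Pr 0 h" using d_closed by blast
  next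
    fix h n assume h: "?Pr n h"
    then have hh: "h \<in> module_homs A (P n) (P (Suc n))" by blast
    interpret Pn: left_module A "P n" by (rule lm)
    interpret Ps: left_module A "P (Suc n)" by (rule lm)
    let ?g = "\<lambda>p. (\<kappa> (Suc n) p \<ominus>\<^bsub>P (Suc n)\<^esub> p) \<ominus>\<^bsub>P (Suc n)\<^esub> h (d n p)"
    have g1: "(\<lambda>p. \<kappa> (Suc n) p \<ominus>\<^bsub>P (Suc n)\<^esub> p) \<in> module_homs A (P (Suc n)) (P (Suc n))"
      by (rule hom_diff[OF act ch hom_id])
    have g: "?g \<in> module_homs A (P (Suc n)) (P (Suc n))"
      by (rule hom_diff[OF act g1 hom_comp[OF dh hh]])
    have "?g p \<in> d (Suc n) ` carrier (P (Suc (Suc n)))" if p: "p \<in> carrier (P (Suc n))" for p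
    proof -
      have "d n (?g p) = d n (\<kappa> (Suc n) p \<ominus>\<^bsub>P (Suc n)\<^esub> p) \<ominus>\<^bsub>P n\<^esub> d n (h (d n p))"
        using hom_minus[OF dh P_grp P_grp] hom_closed[OF g1 p] hom_closed[OF hh d_closed[OF p]] by simp
      also have "d n (\<kappa> (Suc n) p \<ominus>\<^bsub>P (Suc n)\<^esub> p) = \<kappa> n (d n p) \<ominus>\<^bsub>P n\<^esub> d n p"
        using hom_minus[OF dh P_grp P_grp] hom_closed[OF ch p] p cd[OF p] by simp
      also have "d n (h (d n p)) = \<kappa> n (d n p) \<ominus>\<^bsub>P n\<^esub> d n p" using h p by blast
      finally have "d n (?g p) = \<zero>\<^bsub>P n\<^esub>"
        using Pn.M.minus_eq_zero_iff hom_closed[OF ch d_closed[OF p]] d_closed[OF p] by simp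
      then show ?thesis using exactS[of n] hom_closed[OF g p] by blast
    qed
    then obtain h' where h': "h' \<in> module_homs A (P (Suc n)) (P (Suc (Suc n)))"
      "\<And>p. p \<in> carrier (P (Suc n)) \<Longrightarrow> d (Suc n) (h' p) = ?g p"
      using projective_lift[OF proj lm lm dh g] by metis
    have "d (Suc n) (h' (d (Suc n) p)) = \<kappa> (Suc n) (d (Suc n) p) \<ominus>\<^bsub>P (Suc n)\<^esub> d (Suc n) p"
      if p: "p \<in> carrier (P (Suc (Suc n)))" for p
    proof -
      have "h (d n (d (Suc n) p)) = \<zero>\<^bsub>P (Suc n)\<^esub>"
        using hom_zero[OF hh P_grp P_grp] dd[OF p] by simp
      then show ?thesis
        using h'(2)[OF d_closed[OF p]] hom_closed[OF g1 d_closed[OF p]]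
        by (simp add: Ps.M.minus_eq)
    qed
    then show "\<exists>h'. ?Pr (Suc n) h' \<and> ?Qr n h h'" using h' by blast
  qed
  then obtain h where "\<And>n. ?Pr n (h n) \<and> ?Qr n (h n) (h (Suc n))" by blast
  then show ?thesis by (intro exI[of _ h]) blast
qed

text \<open>
  For a cocycle \<open>z\<close> the homotopy gives \<open>z \<circ> (\<kappa> - id) = z \<circ> d \<circ> h + z \<circ> h \<circ> d\<close>, whose first term vanishes
  and whose second term is the coboundary of \<open>z \<circ> h\<close>.
\<close>

lemma chain_endo_cohomologous:
  assumes "chain_map A P d e P d e \<kappa>" and z: "z \<in> Z i"
  shows "dual_map (P i) (\<kappa> i) z \<ominus>\<^bsub>H i\<^esub> z \<in> B i"
proof -
  obtain h where hh: "\<And>i. h i \<in> module_homs A (P i) (P (Suc i))"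
    and h0: "\<And>p. p \<in> carrier (P 0) \<Longrightarrow> d 0 (h 0 p) = \<kappa> 0 p \<ominus>\<^bsub>P 0\<^esub> p"
    and hS: "\<And>i p. p \<in> carrier (P (Suc i)) \<Longrightarrow>
      d (Suc i) (h (Suc i) p) = (\<kappa> (Suc i) p \<ominus>\<^bsub>P (Suc i)\<^esub> p) \<ominus>\<^bsub>P (Suc i)\<^esub> h i (d i p)"
    using homotopy[OF assms(1)] by blast
  have ch: "\<kappa> i \<in> module_homs A (P i) (P i)" for i using assms by (auto simp: chain_map_def)
  interpret A: ring A by (rule ringA)
  interpret H: additive_action A "H i" by (rule H_act)
  interpret LR: left_module A "left_regular A" by (rule A.left_regular_module)
  have zH: "z \<in> carrier (H i)" and zd: "\<And>p. p \<in> carrier (P (Suc i)) \<Longrightarrow> z (d i p) = \<zero>\<^bsub>A\<^esub>"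
    using z by (auto simp: Z_iff)
  have lrm: "a \<ominus>\<^bsub>left_regular A\<^esub> b = a \<ominus>\<^bsub>A\<^esub> b" for a b
    by (simp add: a_minus_def a_inv_def m_inv_def)
  have zminus: "z (p \<ominus>\<^bsub>P i\<^esub> q) = z p \<ominus>\<^bsub>A\<^esub> z q" if "p \<in> carrier (P i)" "q \<in> carrier (P i)" for p q
    using hom_minus[OF _ P_grp LR.M.abelian_group_axioms, of z A i p q] zH that
    by (simp add: hom_to_ring_carrier lrm)
  have cz: "dual_map (P i) (\<kappa> i) z \<in> carrier (H i)"
    by (rule hom_closed[OF dual_map_hom[OF lm lm ch] zH])
  let ?D = "dual_map (P i) (\<kappa> i) z \<ominus>\<^bsub>H i\<^esub> z"
  have D: "?D p = z (\<kappa> i p \<ominus>\<^bsub>P i\<^esub> p)" if "p \<in> carrier (P i)" for p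
    using dual_minus[OF lm cz zH that] zminus[OF hom_closed[OF ch that] that] that by (simp add: dual_map_def)
  have DH: "?D \<in> carrier (H i)" using cz zH by simp
  have ext: "f = g" if "f \<in> carrier (H i)" "g \<in> carrier (H i)" "\<And>p. p \<in> carrier (P i) \<Longrightarrow> f p = g p" for f g
    using that by (auto simp: hom_to_ring_carrier intro: extensionalityI)
  show ?thesis
  proof (cases i)
    case 0
    have "?D = \<zero>\<^bsub>H i\<^esub>"
    proof (rule ext[OF DH H.M.zero_closed])
      fix p assume p: "p \<in> carrier (P i)"
      have "?D p = z (d 0 (h 0 p))" using D[OF p] h0 p 0 by simp
      also have "\<dots> = \<zero>\<^bsub>A\<^esub>" using zd hom_closed[OF hh] p 0 by auto
      finally show "?D p = \<zero>\<^bsub>H i\<^esub> p" using p by (simp add: hom_to_ring_simps)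
    qed
    then show ?thesis using 0 by (simp add: B_0)
  next
    case (Suc j)
    \<comment> \<open>the cochain \<open>z \<circ> h\<close> whose coboundary is the difference\<close>
    define w where "w = dual_map (P j) (h j) z"
    have w: "w \<in> carrier (H j)"
      unfolding w_def using hom_closed[OF dual_map_hom[OF lm lm hh]] zH Suc by blast
    have dw: "dual_map (P (Suc j)) (d j) w \<in> carrier (H i)"
      using hom_closed[OF dual_d_hom w] Suc by simp
    have "?D = dual_map (P (Suc j)) (d j) w"
    proof (rule ext[OF DH dw])
      fix p assume "p \<in> carrier (P i)"
      then have p: "p \<in> carrier (P (Suc j))" using Suc by simp
      interpret Ps: left_module A "P (Suc j)" by (rule lm)
      have c1: "\<kappa> (Suc j) p \<ominus>\<^bsub>P (Suc j)\<^esub> p \<in> carrier (P (Suc j))" using hom_closed[OF ch p] p by simp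
      have c2: "h j (d j p) \<in> carrier (P (Suc j))" using hom_closed[OF hh d_closed[OF p]] .
      have "z (d (Suc j) (h (Suc j) p)) = \<zero>\<^bsub>A\<^esub>" using zd hom_closed[OF hh p] Suc by simp
      then have "z (\<kappa> (Suc j) p \<ominus>\<^bsub>P (Suc j)\<^esub> p) \<ominus>\<^bsub>A\<^esub> z (h j (d j p)) = \<zero>\<^bsub>A\<^esub>"
        using hS[OF p] zminus c1 c2 Suc by simp
      then have "z (\<kappa> (Suc j) p \<ominus>\<^bsub>P (Suc j)\<^esub> p) = z (h j (d j p))"
        using A.minus_eq_zero_iff dualD(1)[OF zH] c1 c2 Suc by simp
      then show "?D p = dual_map (P (Suc j)) (d j) w p"
        using D[of p] p Suc by (simp add: dual_map_def w_def d_closed)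
    qed
    then show ?thesis using w by (simp add: Suc B_Suc)
  qed
qed

end

lemma chain_map_comp:
  assumes "chain_map A P d e Q d' e' \<phi>" "chain_map A Q d' e' P d e \<psi>"
  shows "chain_map A P d e P d e (\<lambda>i p. \<psi> i (\<phi> i p))"
proof -
  have 1: "\<phi> i \<in> module_homs A (P i) (Q i)" "\<psi> i \<in> module_homs A (Q i) (P i)" for i
    using assms by (auto simp: chain_map_def)
  show ?thesis using assms hom_comp[OF 1] hom_closed[OF 1(1)] unfolding chain_map_def by simp
qed

lemma chain_map_cocycle:
  assumes "resolution A M P d e" "resolution A M Q d' e'" and c: "chain_map A P d e Q d' e' \<phi>"
  shows "dual_map (P i) (\<phi> i) \<in> module_homs A (hom_to_ring A (Q i)\<lparr>carrier := hom_cocycles A Q d' i\<rparr>)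
          (hom_to_ring A (P i)\<lparr>carrier := hom_cocycles A P d i\<rparr>)"
    and "b \<in> hom_coboundaries A Q d' i \<Longrightarrow> dual_map (P i) (\<phi> i) b \<in> hom_coboundaries A P d i"
proof -
  interpret P: resolution A M P d e by fact
  interpret Q: resolution A M Q d' e' by fact
  have \<phi>: "\<phi> i \<in> module_homs A (P i) (Q i)" for i using c by (auto simp: chain_map_def)
  have cd: "p \<in> carrier (P (Suc i)) \<Longrightarrow> d' i (\<phi> (Suc i) p) = \<phi> i (d i p)" for i p
    using c by (auto simp: chain_map_def)
  note f = dual_map_hom[OF P.lm Q.lm \<phi>]
  have z: "dual_map (P i) (\<phi> i) g \<in> P.Z i" if g: "g \<in> Q.Z i" for g
  proof -
    have "dual_map (P i) (\<phi> i) g \<in> carrier (P.H i)" using hom_closed[OF f] g by (auto simp: Q.Z_iff)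
    moreover have "dual_map (P i) (\<phi> i) g (d i p) = \<zero>\<^bsub>A\<^esub>" if p: "p \<in> carrier (P (Suc i))" for p
      using g cd[OF p] hom_closed[OF \<phi> p] P.d_closed[OF p] by (auto simp: dual_map_def Q.Z_iff simp flip: cd)
    ultimately show ?thesis by (auto simp: P.Z_iff)
  qed
  show "dual_map (P i) (\<phi> i) \<in> module_homs A (hom_to_ring A (Q i)\<lparr>carrier := hom_cocycles A Q d' i\<rparr>)
          (hom_to_ring A (P i)\<lparr>carrier := hom_cocycles A P d i\<rparr>)"
    by (rule module_homsI) (simp_all add: z hom_add[OF f] hom_act[OF f] Q.Z_iff)
  show "dual_map (P i) (\<phi> i) b \<in> P.B i" if b: "b \<in> Q.B i"
  proof (cases i)
    case 0
    then show ?thesis using b hom_zero[OF f Q.H_grp P.H_grp] by (simp add: P.B_0 Q.B_0)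
  next
    case (Suc j)
    then obtain g where g: "g \<in> carrier (Q.H j)" "b = dual_map (Q (Suc j)) (d' j) g"
      using b by (auto simp: Q.B_Suc)
    have "dual_map (P i) (\<phi> i) b = dual_map (P (Suc j)) (d j) (dual_map (P j) (\<phi> j) g)"
      by (rule ext) (simp add: g(2) Suc dual_map_def restrict_def hom_closed[OF \<phi>] P.d_closed cd)
    then show ?thesis using hom_closed[OF f g(1)] by (simp add: P.B_Suc Suc)
  qed
qed

text \<open>
  Comparison maps in both directions exist, and both composites are homotopic to the identity.
\<close>

lemma cohomology_independent:
  assumes P: "resolution A M P d e" and Q: "resolution A M Q d' e'"
  shows "module_isomorphic A (hom_cohomology A P d i) (hom_cohomology A Q d' i)"
proof -
  interpret P: resolution A M P d e by fact
  interpret Q: resolution A M Q d' e' by fact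
  obtain \<phi> where \<phi>: "chain_map A P d e Q d' e' \<phi>" using comparison[OF P Q] by blast
  obtain \<psi> where \<psi>: "chain_map A Q d' e' P d e \<psi>" using comparison[OF Q P] by blast
  have h: "\<phi> i \<in> module_homs A (P i) (Q i)" "\<psi> i \<in> module_homs A (Q i) (P i)"
    using \<phi> \<psi> by (auto simp: chain_map_def)
  note 1 = chain_map_cocycle[OF P Q \<phi>, where i = i] and 2 = chain_map_cocycle[OF Q P \<psi>, where i = i]
  show ?thesis unfolding hom_cohomology_def
  proof (rule module_isomorphic_quotients[OF P.cohomology_sub_action Q.cohomology_sub_action 2(1) 1(1) 2(2) 1(2)])
    fix z assume "z \<in> carrier (P.H i\<lparr>carrier := P.Z i\<rparr>)"
    then have z: "z \<in> P.Z i" by simp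
    have "dual_map (P i) (\<phi> i) (dual_map (Q i) (\<psi> i) z) = dual_map (P i) (\<lambda>p. \<psi> i (\<phi> i p)) z"
      by (rule ext) (simp add: dual_map_def restrict_def hom_closed[OF h(1)])
    moreover have "dual_map (P i) (\<phi> i) (dual_map (Q i) (\<psi> i) z) \<in> P.Z i"
      using hom_closed[OF 1(1)] hom_closed[OF 2(1)] z by simp
    ultimately show "dual_map (P i) (\<phi> i) (dual_map (Q i) (\<psi> i) z) \<ominus>\<^bsub>P.H i\<lparr>carrier := P.Z i\<rparr>\<^esub> z \<in> P.B i"
      using P.chain_endo_cohomologous[OF chain_map_comp[OF \<phi> \<psi>] z]
      by (simp add: update_minus[OF P.H_grp P.Z_subgroup _ z])
  next
    fix z assume "z \<in> carrier (Q.H i\<lparr>carrier := Q.Z i\<rparr>)"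
    then have z: "z \<in> Q.Z i" by simp
    have "dual_map (Q i) (\<psi> i) (dual_map (P i) (\<phi> i) z) = dual_map (Q i) (\<lambda>p. \<phi> i (\<psi> i p)) z"
      by (rule ext) (simp add: dual_map_def restrict_def hom_closed[OF h(2)])
    moreover have "dual_map (Q i) (\<psi> i) (dual_map (P i) (\<phi> i) z) \<in> Q.Z i"
      using hom_closed[OF 1(1)] hom_closed[OF 2(1)] z by simp
    ultimately show "dual_map (Q i) (\<psi> i) (dual_map (P i) (\<phi> i) z) \<ominus>\<^bsub>Q.H i\<lparr>carrier := Q.Z i\<rparr>\<^esub> z \<in> Q.B i"
      using Q.chain_endo_cohomologous[OF chain_map_comp[OF \<psi> \<phi>] z]
      by (simp add: update_minus[OF Q.H_grp Q.Z_subgroup _ z])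
  qed
qed

text \<open>
  \<open>Ext_to_ring\<close> is computed from an unknown resolution, chosen by Hilbert's operator; any resolution on the
  same type witnesses that the choice is a genuine resolution.
\<close>

lemma Ext_to_ring_isomorphic:
  fixes M :: "('a, 'm) module" and P :: "nat \<Rightarrow> ('a, nat \<times> 'a \<times> 'm \<Rightarrow> 'a) module"
  assumes Q: "resolution A M P d e"
  shows "module_isomorphic A (Ext_to_ring A M i) (hom_cohomology A P d i)"
    and "additive_action A (Ext_to_ring A M i)"
proof -
  define X where "X = (SOME (P :: nat \<Rightarrow> ('a, nat \<times> 'a \<times> 'm \<Rightarrow> 'a) module, d, e). projective_resolution A M P d e)"
  obtain P' d' e' where X: "X = (P', d', e')" by (metis prod_cases3)
  have "case X of (P, d, e) \<Rightarrow> projective_resolution A M P d e"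
    unfolding X_def by (rule someI[of _ "(P, d, e)"]) (use Q in \<open>simp add: resolution_def\<close>)
  then have R: "resolution A M P' d' e'" using Q by (simp add: X resolution_def)
  interpret R': resolution A M P' d' e' by (rule R)
  have "Ext_to_ring A M i = hom_cohomology A P' d' i"
    unfolding Ext_to_ring_def X_def[symmetric] X by simp
  then show "module_isomorphic A (Ext_to_ring A M i) (hom_cohomology A P d i)"
    "additive_action A (Ext_to_ring A M i)"
    using cohomology_independent[OF R Q, of i] R'.cohomology_action[of i] by simp_all
qed

section \<open>The quotient of the free algebra by a quadratic form\<close>

text \<open>
  The algebra \<open>A\<close> enters only through a surjection \<open>\<pi>\<close> from the free algebra whose kernel is the ideal of
  the quadratic form, so that the module theory below is independent of the construction of \<open>T(V)\<close> and
  of its quotient.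
\<close>

locale quad_model = A?: ring A for A :: "('a, 'x) ring_scheme" (structure) +
  fixes \<pi> :: "('n::finite, 'k::field) fralg \<Rightarrow> 'a" and C :: "'k^'n^'n"
  assumes \<pi>_range: "carrier A = range \<pi>"
    and \<pi>_add: "\<pi> (p + q) = \<pi> p \<oplus> \<pi> q"
    and \<pi>_mult: "\<pi> (p * q) = \<pi> p \<otimes> \<pi> q"
    and \<pi>_one: "\<pi> 1 = \<one>"
    and \<pi>_zero_iff: "\<pi> p = \<zero> \<longleftrightarrow> p \<in> qid (qform C)"
    and not_rank1: "\<not> rank1 C"
begin

abbreviation gx :: "'n \<Rightarrow> 'a" where "gx j \<equiv> \<pi> (gen j)"
definition eta :: "'k \<Rightarrow> 'a" where "eta c = \<pi> (cst c)"

lemma \<pi>_closed [simp]: "\<pi> p \<in> carrier A" by (simp add: \<pi>_range)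
lemma \<pi>_cases: assumes "a \<in> carrier A" obtains p where "a = \<pi> p" using assms by (auto simp: \<pi>_range)
lemma \<pi>_0: "\<pi> 0 = \<zero>" by (simp add: \<pi>_zero_iff qid.zero)
lemma \<pi>_uminus: "\<pi> (- p) = \<ominus> \<pi> p"
  using \<pi>_add[of "- p" p] by (simp add: \<pi>_0 minus_equality)
lemma \<pi>_minus: "\<pi> (p - q) = \<pi> p \<ominus> \<pi> q"
  using \<pi>_add[of p "- q"] by (simp add: \<pi>_uminus minus_eq)
lemma \<pi>_eq_iff: "\<pi> p = \<pi> q \<longleftrightarrow> p - q \<in> qid (qform C)"
  by (simp add: \<pi>_zero_iff[symmetric] \<pi>_minus minus_eq_zero_iff)
lemma \<pi>_sum: "finite T \<Longrightarrow> \<pi> (\<Sum>i\<in>T. g i) = (\<Oplus>i\<in>T. \<pi> (g i))"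
  by (induction T rule: finite_induct) (auto simp: \<pi>_0 \<pi>_add)

lemma eta_closed [simp]: "eta c \<in> carrier A" by (simp add: eta_def)
lemma eta_simps: "eta (c + d) = eta c \<oplus> eta d" "eta (c * d) = eta c \<otimes> eta d" "eta 1 = \<one>" "eta 0 = \<zero>"
  "eta (- c) = \<ominus> eta c" "eta (c - d) = eta c \<ominus> eta d"
  by (simp_all add: eta_def cst_simps \<pi>_add \<pi>_mult \<pi>_one \<pi>_0 \<pi>_uminus \<pi>_minus)
lemma eta_comm: "a \<in> carrier A \<Longrightarrow> eta c \<otimes> a = a \<otimes> eta c"
  by (elim \<pi>_cases) (simp add: eta_def \<pi>_mult[symmetric] cst_comm)
lemma eta_zero_iff: "eta c = \<zero> \<longleftrightarrow> c = 0"
proof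
  assume "eta c = \<zero>"
  then have "cst c \<in> qid (qform C)" by (simp add: eta_def \<pi>_zero_iff)
  then have "hc 0 (cst c :: ('n, 'k) fralg) = 0" by (rule qid_low) auto
  then have "cst c = (0 :: ('n, 'k) fralg)" using hc_homs_eq[OF homs_cst, of 0 c] by (metis (full_types))
  then have "eps (cst c :: ('n, 'k) fralg) = eps 0" by simp
  then show "c = 0" by simp
qed (simp add: eta_simps)
lemma nzd_right:
  assumes "v j0 \<noteq> 0" "a \<in> carrier A" "a \<otimes> \<pi> (lf v) = \<zero>" shows "a = \<zero>"
  using assms(2,3) qid_nzd[of C v j0, OF not_rank1 assms(1)]
  by (elim \<pi>_cases) (auto simp: \<pi>_mult[symmetric] \<pi>_zero_iff)
lemma nzd_left:
  assumes "v j0 \<noteq> 0" "a \<in> carrier A" "\<pi> (lf v) \<otimes> a = \<zero>" shows "a = \<zero>"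
  using assms(2,3) qid_nzd_left[of C v j0, OF not_rank1 assms(1)]
  by (elim \<pi>_cases) (auto simp: \<pi>_mult[symmetric] \<pi>_zero_iff)

abbreviation cy :: "'n \<Rightarrow> 'a" where "cy j \<equiv> \<pi> (ycol C j)"
abbreviation cz :: "'n \<Rightarrow> 'a" where "cz j \<equiv> \<pi> (zrow C j)"

lemma C_nonzero: obtains i j where "C $ i $ j \<noteq> 0"
  using not_rank1 unfolding rank1_def by (metis mult_zero_left)

lemma relation: "(\<Oplus>i\<in>UNIV. gx i \<otimes> cz i) = \<zero>"
proof -
  have "\<pi> (qform C) = \<zero>" using qid_base[of 1 "qform C" 1] by (simp add: \<pi>_zero_iff)
  then show ?thesis by (simp add: qform_zrow \<pi>_sum \<pi>_mult)
qed

lemma relation': "(\<Oplus>j\<in>UNIV. cy j \<otimes> gx j) = \<zero>"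
proof -
  have "\<pi> (qform C) = \<zero>" using qid_base[of 1 "qform C" 1] by (simp add: \<pi>_zero_iff)
  then show ?thesis by (simp add: qform_ycol \<pi>_sum \<pi>_mult)
qed

lemma cy_eq: "cy j = (\<Oplus>i\<in>UNIV. gx i \<otimes> eta (C $ i $ j))"
  by (simp add: ycol_def lf_def \<pi>_sum \<pi>_mult eta_def cst_comm)
lemma cz_eq: "cz i = (\<Oplus>j\<in>UNIV. eta (C $ i $ j) \<otimes> gx j)"
  by (simp add: zrow_def lf_def \<pi>_sum \<pi>_mult eta_def)

lemma tail_exact:
  assumes "\<And>i. a i \<in> carrier A" "(\<Oplus>i\<in>UNIV. a i \<otimes> gx i) = \<zero>"
  shows "\<exists>c\<in>carrier A. \<forall>i. a i = c \<otimes> cy i"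
proof -
  have "\<forall>i. \<exists>p. a i = \<pi> p" using assms(1) by (metis \<pi>_cases)
  then obtain p where p: "\<And>i. a i = \<pi> (p i)" by metis
  have "(\<Sum>i\<in>UNIV. p i * gen i) \<in> qid (qform C)"
    using assms(2) by (simp add: \<pi>_zero_iff[symmetric] \<pi>_sum \<pi>_mult p)
  from qid_tail[OF this] obtain c where "\<And>i. p i - c * ycol C i \<in> qid (qform C)" by blast
  then have "\<forall>i. a i = \<pi> c \<otimes> cy i" by (simp add: p \<pi>_mult[symmetric] \<pi>_eq_iff)
  then show ?thesis by (intro bexI[of _ "\<pi> c"]) simp_all
qed

subsection \<open>The degree filtration\<close>

definition FA :: "nat \<Rightarrow> 'a set" where "FA m = \<pi> ` fil m"

lemma FA_closed: "a \<in> FA m \<Longrightarrow> a \<in> carrier A" by (auto simp: FA_def)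
lemma FA_zero [simp]: "\<zero> \<in> FA m"
  unfolding FA_def by (rule image_eqI[of _ _ 0]) (auto simp: \<pi>_0 fil_def)
lemma FA_0: "FA 0 = {\<zero>}" by (auto simp: FA_def \<pi>_0)
lemma FA_add: "a \<in> FA m \<Longrightarrow> b \<in> FA m \<Longrightarrow> a \<oplus> b \<in> FA m"
  unfolding FA_def by (auto simp: \<pi>_add[symmetric] fil_add)
lemma FA_eta: "a \<in> FA m \<Longrightarrow> a \<otimes> eta c \<in> FA m"
  unfolding FA_def by (auto simp: eta_def \<pi>_mult[symmetric] cst_comm[symmetric] fil_cst_mult)
lemma FA_minus: "a \<in> FA m \<Longrightarrow> b \<in> FA m \<Longrightarrow> a \<ominus> b \<in> FA m"
  using FA_add[of a m "b \<otimes> eta (- 1)"] FA_eta[of b m "- 1"] FA_closed[of b m]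
  by (simp add: eta_simps r_minus minus_eq)
lemma FA_finsum: "(\<And>i. i \<in> T \<Longrightarrow> g i \<in> FA m) \<Longrightarrow> (\<Oplus>i\<in>T. g i) \<in> FA m"
proof (induction T rule: infinite_finite_induct)
  case (insert x T)
  then have "g \<in> T \<rightarrow> carrier A" "g x \<in> carrier A" using FA_closed by auto
  then show ?case using insert by (simp add: FA_add)
qed simp_all
lemma FA_exists: "a \<in> carrier A \<Longrightarrow> \<exists>m. a \<in> FA m"
  by (elim \<pi>_cases) (metis FA_def fil_exists image_eqI)
lemma FA_mono: "a \<in> FA m \<Longrightarrow> m \<le> i \<Longrightarrow> a \<in> FA i" unfolding FA_def using fil_mono by blast
text \<open>
  The tail statement for leading terms: if the \<open>a\<^sub>j\<close> have degree at most \<open>m\<close> and \<open>\<Sum> a\<^sub>j x\<^sub>j\<close> also has degree at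
  most \<open>m\<close>, then the components of degree \<open>m\<close> of the \<open>a\<^sub>j\<close> satisfy a relation, hence are of the form \<open>c y\<^sub>j\<close> with
  \<open>c\<close> of degree \<open>m - 1\<close>.
\<close>

lemma FA_tail:
  assumes "\<And>j. a j \<in> FA (Suc m)" "(\<Oplus>j\<in>UNIV. a j \<otimes> gx j) \<in> FA (Suc m)"
  shows "\<exists>c\<in>FA m. \<forall>j. a j \<ominus> c \<otimes> cy j \<in> FA m"
proof -
  have "\<forall>j. \<exists>p. p \<in> fil (Suc m) \<and> a j = \<pi> p" using assms(1) by (auto simp: FA_def)
  then obtain p where p: "\<And>j. p j \<in> fil (Suc m)" "\<And>j. a j = \<pi> (p j)" by metis
  obtain g where g: "g \<in> fil (Suc m)" "(\<Oplus>j\<in>UNIV. a j \<otimes> gx j) = \<pi> g" using assms(2) by (auto simp: FA_def)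
  have "\<pi> (\<Sum>j\<in>UNIV. p j * gen j) = \<pi> g"
    using g(2) by (simp add: p(2) \<pi>_sum \<pi>_mult)
  then have "(\<Sum>j\<in>UNIV. p j * gen j) - g \<in> qid (qform C)" by (simp add: \<pi>_eq_iff)
  then have "hc (Suc m) ((\<Sum>j\<in>UNIV. p j * gen j) - g) \<in> qid (qform C)" by (rule qid_hc) simp
  moreover have "hc (Suc m) (p j * gen j) = hc m (p j) * gen j" for j
    using hc_mult_homs[OF homs_gen, of m "p j" j] by simp
  ultimately have "(\<Sum>j\<in>UNIV. hc m (p j) * gen j) \<in> qid (qform C)"
    using hc_fil[OF g(1)] by (simp add: hc_sum)
  from qid_tail[OF this] obtain c where c: "\<And>j. hc m (p j) - c * ycol C j \<in> qid (qform C)" by blast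
  show ?thesis
  proof (cases m)
    case 0
    \<comment> \<open>here \<open>c\<close> would have to be of degree \<open>-1\<close>: the ideal contains no linear forms, so the \<open>a j\<close> vanish\<close>
    have "p j = 0" for j
    proof -
      have "hc 1 (\<Sum>j\<in>UNIV. hc m (p j) * gen j) = 0"
        by (rule qid_low[OF \<open>(\<Sum>j\<in>UNIV. hc m (p j) * gen j) \<in> _\<close>]) simp_all
      moreover have "(\<Sum>j\<in>UNIV. hc m (p j) * gen j) \<in> homs 1"
        using homs_mult[OF hc_homs homs_gen, of 0] 0 by (intro homs_sum) simp
      then have "hc 1 (\<Sum>j\<in>UNIV. hc m (p j) * gen j) = (\<Sum>j\<in>UNIV. hc m (p j) * gen j)"
        by (simp add: hc_homs_eq)
      ultimately have "rder j (\<Sum>j\<in>UNIV. hc m (p j) * gen j) = 0" by simp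
      then have "hc m (p j) = 0" by (simp add: rder_sum_gen)
      then show ?thesis using fil_minus_hc[OF p(1)[of j]] 0 by simp
    qed
    then have "\<forall>j. a j \<ominus> \<zero> \<otimes> cy j \<in> FA m" by (simp add: p(2) \<pi>_0 minus_eq)
    then show ?thesis using FA_zero by blast
  next
    case (Suc l)
    have c': "hc m (p j) - hc l c * ycol C j \<in> qid (qform C)" for j
    proof -
      have "hc m (hc m (p j) - c * ycol C j) \<in> qid (qform C)" by (rule qid_hc[OF c]) simp
      moreover have "hc m (c * ycol C j) = hc l c * ycol C j"
        using hc_mult_homs[OF homs_lf, of l c] Suc by (simp add: ycol_def)
      ultimately show ?thesis by (simp add: hc_homs_eq[OF hc_homs])
    qed
    have "a j \<ominus> \<pi> (hc l c) \<otimes> cy j \<in> FA m" for j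
    proof -
      have "\<pi> (hc m (p j)) = \<pi> (hc l c * ycol C j)" using c'[of j] by (simp add: \<pi>_eq_iff)
      then have "a j \<ominus> \<pi> (hc l c) \<otimes> cy j = \<pi> (p j - hc m (p j))"
        by (simp add: p(2) \<pi>_minus \<pi>_mult)
      then show ?thesis using fil_minus_hc[OF p(1)[of j]] by (simp add: FA_def)
    qed
    moreover have "\<pi> (hc l c) \<in> FA m"
      using homs_fil[OF hc_homs] Suc by (auto simp: FA_def)
    ultimately show ?thesis by blast
  qed
qed

text \<open>
  Right multiplication by a nonzero column of \<open>C\<close> raises the degree by exactly one.
\<close>

lemma FA_nzd:
  assumes "c \<in> FA (Suc m)" "\<And>j. c \<otimes> cy j \<in> FA (Suc m)"
  shows "c \<in> FA m"
proof -
  obtain p where p: "p \<in> fil (Suc m)" "c = \<pi> p" using assms(1) by (auto simp: FA_def)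
  obtain i j where ij: "C $ i $ j \<noteq> 0" by (rule C_nonzero)
  obtain g where g: "g \<in> fil (Suc m)" "c \<otimes> cy j = \<pi> g" using assms(2)[of j] by (auto simp: FA_def)
  have "p * ycol C j - g \<in> qid (qform C)"
    using g(2) by (simp add: p(2) \<pi>_mult[symmetric] \<pi>_eq_iff)
  then have "hc (Suc m) (p * ycol C j - g) \<in> qid (qform C)" by (rule qid_hc) simp
  moreover have "hc (Suc m) (p * ycol C j) = hc m p * ycol C j"
    using hc_mult_homs[OF homs_lf, of m p] by (simp add: ycol_def)
  ultimately have "hc m p * lf (\<lambda>i. C $ i $ j) \<in> qid (qform C)"
    using hc_fil[OF g(1)] by (simp add: ycol_def)
  then have "hc m p \<in> qid (qform C)" using qid_nzd[OF not_rank1, of "\<lambda>i. C $ i $ j" i] ij by blast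
  then have "c = \<pi> (p - hc m p)" by (simp add: p(2) \<pi>_minus \<pi>_zero_iff[symmetric] minus_eq)
  then show ?thesis using fil_minus_hc[OF p(1)] by (simp add: FA_def)
qed

end

subsection \<open>Modules as vector spaces over the ground field\<close>

lemma (in ring) free_mod_induct [consumes 1, case_names zero smult add]:
  assumes u: "u \<in> carrier (free_mod R S)"
    and zero: "P (\<lambda>s. \<zero>)"
    and smult: "\<And>a s. a \<in> carrier R \<Longrightarrow> s \<in> S \<Longrightarrow> P (a \<odot>\<^bsub>free_mod R S\<^esub> fbasis R s)"
    and add: "\<And>u v. u \<in> carrier (free_mod R S) \<Longrightarrow> v \<in> carrier (free_mod R S) \<Longrightarrow> P u \<Longrightarrow> P v \<Longrightarrow>
      P (u \<oplus>\<^bsub>free_mod R S\<^esub> v)"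
  shows "P u"
proof -
  interpret F: left_module R "free_mod R S" by (rule left_module_free_mod)
  have uS: "{s. u s \<noteq> \<zero>} \<subseteq> S" "finite {s. u s \<noteq> \<zero>}" "\<And>s. u s \<in> carrier R"
    using u by (auto simp: free_mod_carrier)
  have "P (\<Oplus>\<^bsub>free_mod R S\<^esub>s\<in>T. u s \<odot>\<^bsub>free_mod R S\<^esub> fbasis R s)" if "finite T" "T \<subseteq> S" for T
    using that
  proof (induction T rule: finite_induct)
    case empty
    then show ?case using zero by (simp add: F.M.finsum_empty)
  next
    case (insert t T)
    have c: "u s \<odot>\<^bsub>free_mod R S\<^esub> fbasis R s \<in> carrier (free_mod R S)" if "s \<in> insert t T" for s
      using that insert uS by (intro F.smult_closed fbasis_closed) auto
    have eq: "(\<Oplus>\<^bsub>free_mod R S\<^esub>s\<in>insert t T. u s \<odot>\<^bsub>free_mod R S\<^esub> fbasis R s)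
      = u t \<odot>\<^bsub>free_mod R S\<^esub> fbasis R t \<oplus>\<^bsub>free_mod R S\<^esub> (\<Oplus>\<^bsub>free_mod R S\<^esub>s\<in>T. u s \<odot>\<^bsub>free_mod R S\<^esub> fbasis R s)"
      by (rule F.M.finsum_insert) (use insert c in auto)
    show ?case unfolding eq
    proof (rule add)
      show "P (u t \<odot>\<^bsub>free_mod R S\<^esub> fbasis R t)" by (rule smult) (use insert uS in auto)
    qed (use insert c in \<open>auto intro!: F.M.finsum_closed simp del: free_mod_simps\<close>)
  qed
  from this[OF uS(2,1)] show ?thesis
    using free_mod_expand[OF u] by (simp add: lincomb_def del: free_mod_simps)
qed

context quad_model
begin

abbreviation "AK \<equiv> A\<lparr>carrier := range eta\<rparr>"

lemma K_action: "additive_action A N \<Longrightarrow> additive_action AK N"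
  unfolding additive_action_def additive_action_axioms_def by auto

lemma K_hom: "h \<in> module_homs A N P \<Longrightarrow> h \<in> module_homs AK N P"
  unfolding module_homs_def by auto

text \<open>
  The vector space \<open>k\<^bsup>(S)\<^esup>\<close> inside the free module \<open>A\<^bsup>(S)\<^esup>\<close>.
\<close>

definition K0 :: "'s set \<Rightarrow> ('s \<Rightarrow> 'a) set"
  where "K0 S = {u \<in> carrier (free_mod A S). \<forall>s. u s \<in> range eta}"

lemma K0_free: "u \<in> K0 S \<Longrightarrow> u \<in> carrier (free_mod A S)" by (simp add: K0_def)

lemma eta_range_zero: "\<zero> \<in> range eta" unfolding eta_simps(4)[symmetric] by (rule rangeI)
lemma eta_range_one: "\<one> \<in> range eta" unfolding eta_simps(3)[symmetric] by (rule rangeI)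
lemma eta_range_add: "a \<in> range eta \<Longrightarrow> b \<in> range eta \<Longrightarrow> a \<oplus> b \<in> range eta"
  by (auto simp: eta_simps(1)[symmetric])
lemma eta_range_minus: "a \<in> range eta \<Longrightarrow> b \<in> range eta \<Longrightarrow> a \<ominus> b \<in> range eta"
  by (auto simp: eta_simps(6)[symmetric])
lemma eta_range_mult: "a \<in> range eta \<Longrightarrow> b \<in> range eta \<Longrightarrow> a \<otimes> b \<in> range eta"
  by (auto simp: eta_simps(2)[symmetric])

lemma K0_fbasis: "s \<in> S \<Longrightarrow> fbasis A s \<in> K0 S"
  using fbasis_closed[of s S] eta_range_zero eta_range_one by (auto simp: K0_def fbasis_def)

lemma K0_zero: "(\<lambda>s. \<zero>) \<in> K0 S"
  using eta_range_zero by (auto simp: K0_def free_mod_carrier)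

lemma K0_add: assumes "u \<in> K0 S" "v \<in> K0 S" shows "u \<oplus>\<^bsub>free_mod A S\<^esub> v \<in> K0 S"
proof -
  interpret F: left_module A "free_mod A S" by (rule left_module_free_mod)
  show ?thesis using assms F.M.a_closed[of u v] by (auto simp: K0_def intro: eta_range_add)
qed

lemma K0_minus: assumes "u \<in> K0 S" "v \<in> K0 S" shows "u \<ominus>\<^bsub>free_mod A S\<^esub> v \<in> K0 S"
proof -
  interpret F: left_module A "free_mod A S" by (rule left_module_free_mod)
  show ?thesis using assms F.M.minus_closed[of u v]
    by (auto simp: K0_def free_mod_minus_apply intro: eta_range_minus)
qed

lemma K0_eta: assumes "u \<in> K0 S" "a \<in> range eta" shows "a \<odot>\<^bsub>free_mod A S\<^esub> u \<in> K0 S"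
proof -
  interpret F: left_module A "free_mod A S" by (rule left_module_free_mod)
  have "a \<in> carrier A" using assms(2) by auto
  then show ?thesis using assms F.smult_closed[of a u] by (auto simp: K0_def intro: eta_range_mult)
qed

text \<open>
  A \<open>k\<close>-basis of \<open>M\<close>, expressed through the map \<open>K0 S \<rightarrow> M\<close>, which has to be bijective.
\<close>

definition kbasis :: "('a, 'm) module \<Rightarrow> 's set \<Rightarrow> ('s \<Rightarrow> 'm) \<Rightarrow> bool"
  where "kbasis M S y \<longleftrightarrow> y \<in> S \<rightarrow> carrier M \<and>
    (\<forall>m\<in>carrier M. \<exists>u\<in>K0 S. lincomb A M y u = m) \<and>
    (\<forall>u\<in>K0 S. lincomb A M y u = \<zero>\<^bsub>M\<^esub> \<longrightarrow> u = (\<lambda>s. \<zero>))"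

text \<open>
  Zorn's lemma for linearly independent subsets of a spanning family; the index set is a subset of a given
  set \<open>T\<close> because the resolution of \<open>M\<close> has to live on a prescribed type.
\<close>

lemma kbasis_exists:
  fixes T :: "'s set"
  assumes "left_module A M" and y: "y \<in> T \<rightarrow> carrier M" and onto: "carrier M \<subseteq> y ` T"
  shows "\<exists>S\<subseteq>T. kbasis M S y"
proof -
  interpret M: lmod A M using assms(1) by (rule lmod.intro)
  define I where "I = {S. S \<subseteq> T \<and> (\<forall>u\<in>K0 S. lincomb A M y u = \<zero>\<^bsub>M\<^esub> \<longrightarrow> u = (\<lambda>s. \<zero>))}"
  have "{} \<in> I" by (auto simp: I_def K0_def free_mod_carrier fun_eq_iff)
  then have "I \<noteq> {}" by blast
  then have "\<exists>S\<in>I. \<forall>X\<in>I. S \<subseteq> X \<longrightarrow> X = S"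
  proof (rule subset_Zorn_nonempty)
    fix \<C> assume C: "\<C> \<noteq> {}" "subset.chain I \<C>"
    then have CI: "\<C> \<subseteq> I" by (simp add: subset_chain_def)
    have "u = (\<lambda>s. \<zero>)" if u: "u \<in> K0 (\<Union>\<C>)" and 0: "lincomb A M y u = \<zero>\<^bsub>M\<^esub>" for u
    proof -
      have "finite {s. u s \<noteq> \<zero>}" "{s. u s \<noteq> \<zero>} \<subseteq> \<Union>\<C>"
        using u by (auto simp: K0_def free_mod_carrier)
      then obtain B where B: "B \<in> \<C>" "{s. u s \<noteq> \<zero>} \<subseteq> B"
        using finite_subset_Union_chain[OF _ _ C] by blast
      then have "u \<in> K0 B" using u by (auto simp: K0_def free_mod_carrier)
      then show ?thesis using B(1) CI 0 by (auto simp: I_def)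
    qed
    then show "\<Union>\<C> \<in> I" using CI by (auto simp: I_def)
  qed
  then obtain S where S: "S \<in> I" "\<And>X. X \<in> I \<Longrightarrow> S \<subseteq> X \<Longrightarrow> X = S" by blast
  then have ST: "S \<subseteq> T" and indep: "\<And>u. u \<in> K0 S \<Longrightarrow> lincomb A M y u = \<zero>\<^bsub>M\<^esub> \<Longrightarrow> u = (\<lambda>s. \<zero>)"
    by (auto simp: I_def)
  have yS: "y \<in> S \<rightarrow> carrier M" using y ST by auto
  have span: "\<exists>u\<in>K0 S. lincomb A M y u = y t" if t: "t \<in> T" for t
  proof (cases "t \<in> S")
    case True
    show ?thesis by (intro bexI[of _ "fbasis A t"] M.lincomb_fbasis[OF yS True] K0_fbasis[OF True])
  next
    case False
    let ?S = "insert t S"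
    have ST': "?S \<subseteq> T" using ST t by blast
    have y': "y \<in> ?S \<rightarrow> carrier M" using Pi_anti_mono[OF ST'] y by blast
    have "?S \<notin> I"
    proof
      assume "?S \<in> I" from S(2)[OF this subset_insertI] show False using False by blast
    qed
    then have "\<exists>u\<in>K0 ?S. lincomb A M y u = \<zero>\<^bsub>M\<^esub> \<and> u \<noteq> (\<lambda>s. \<zero>)"
      using ST' unfolding I_def by blast
    then obtain u where u: "u \<in> K0 ?S" "lincomb A M y u = \<zero>\<^bsub>M\<^esub>" "u \<noteq> (\<lambda>s. \<zero>)"
      by blast
    have uc: "\<And>s. u s \<in> carrier A" using u(1) by (auto simp: K0_def free_mod_carrier)
    have "u t \<noteq> \<zero>"
    proof
      assume 0: "u t = \<zero>"
      have "u \<in> K0 S" unfolding K0_def free_mod_carrier mem_Collect_eq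
      proof (intro conjI allI impI)
        show "u s = \<zero>" if "s \<notin> S" for s
          using u(1) that 0 unfolding K0_def free_mod_carrier by (cases "s = t") auto
      qed (use u(1) in \<open>simp_all add: K0_def free_mod_carrier\<close>)
      then show False using indep u by blast
    qed
    moreover have "u t \<in> range eta" using u(1) unfolding K0_def by blast
    then obtain c where c: "u t = eta c" by blast
    ultimately have c0: "c \<noteq> 0" using eta_zero_iff[of c] by simp
    let ?F = "free_mod A ?S"
    interpret F: left_module A ?F by (rule left_module_free_mod)
    \<comment> \<open>solving the dependence relation for \<open>y t\<close> expresses it through \<open>S\<close> alone\<close>
    let ?w = "eta (- inverse c) \<odot>\<^bsub>?F\<^esub> u \<oplus>\<^bsub>?F\<^esub> fbasis A t"
    have w: "?w \<in> K0 ?S" by (rule K0_add[OF K0_eta[OF u(1) rangeI] K0_fbasis[OF insertI1]])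
    have "?w t = eta (- inverse c * c + 1)"
      unfolding eta_simps(1-3) by (simp add: c fbasis_def)
    then have "?w t = \<zero>" using c0 by (simp add: eta_simps(4) del: free_mod_simps)
    have wS: "?w \<in> K0 S" unfolding K0_def free_mod_carrier mem_Collect_eq
    proof (intro conjI allI impI)
      show "?w s = \<zero>" if "s \<notin> S" for s
        using w that \<open>?w t = \<zero>\<close> unfolding K0_def free_mod_carrier by (cases "s = t") blast+
    qed (use w in \<open>simp_all add: K0_def free_mod_carrier del: free_mod_simps\<close>)
    note h = M.lincomb_hom[OF y']
    have "lincomb A M y ?w = eta (- inverse c) \<odot>\<^bsub>M\<^esub> lincomb A M y u \<oplus>\<^bsub>M\<^esub> lincomb A M y (fbasis A t)"
      using K0_free[OF u(1)] F.smult_closed[OF eta_closed K0_free[OF u(1)]] fbasis_closed[of t ?S]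
      by (simp add: hom_add[OF h] hom_act[OF h] del: free_mod_simps)
    also have "\<dots> = y t"
      using u(2) M.lincomb_fbasis[OF y', of t] y t by (simp add: M.act_zero Pi_def)
    finally show ?thesis using wS by blast
  qed
  have "kbasis M S y" unfolding kbasis_def using yS span onto indep by blast
  then show ?thesis using ST by blast
qed

text \<open>
  Maps with coefficients in \<open>k\<close> preserve the degree filtration.  This applies to the parts \<open>L0\<close> and \<open>L1\<close> of the
  differentials, which are of lower order.
\<close>

lemma lincomb_FA:
  assumes "v \<in> S \<rightarrow> K0 S'" "u \<in> carrier (free_mod A S)" "\<And>s. u s \<in> FA m"
  shows "lincomb A (free_mod A S') v u t \<in> FA m"
proof -
  interpret F: left_module A "free_mod A S'" by (rule left_module_free_mod)
  have uS: "{s. u s \<noteq> \<zero>} \<subseteq> S" "finite {s. u s \<noteq> \<zero>}" "\<And>s. u s \<in> carrier A"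
    using assms(2) by (auto simp: free_mod_carrier)
  have vc: "v s \<in> carrier (free_mod A S')" "v s t \<in> range eta" if "s \<in> S" for s
    using that assms(1) by (auto simp: K0_def)
  have "lincomb A (free_mod A S') v u t = (\<Oplus>s\<in>{s. u s \<noteq> \<zero>}. (u s \<odot>\<^bsub>free_mod A S'\<^esub> v s) t)"
    unfolding lincomb_def
    by (rule free_mod_finsum_apply) (use uS vc in \<open>auto intro!: F.smult_closed simp del: free_mod_simps\<close>)
  also have "\<dots> \<in> FA m"
  proof (rule FA_finsum)
    fix s assume "s \<in> {s. u s \<noteq> \<zero>}"
    then obtain c where "v s t = eta c" using uS vc(2) by blast
    then show "(u s \<odot>\<^bsub>free_mod A S'\<^esub> v s) t \<in> FA m" using FA_eta[OF assms(3)] by simp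
  qed
  finally show ?thesis .
qed

end

section \<open>A free resolution of length two\<close>

text \<open>
  \<open>y\<close> is a \<open>k\<close>-basis of \<open>M\<close> indexed by \<open>S\<close>, so that \<open>A \<otimes> M\<close> is the free module on \<open>S\<close>.  The index \<open>ix j s\<close> stands
  for \<open>x\<^sub>j \<otimes> y\<^sub>s\<close>, and \<open>A \<otimes> V \<otimes> M\<close> is the free module on these indices; \<open>ixj\<close> and \<open>ixs\<close> recover \<open>j\<close> and \<open>s\<close>.
  All indices live in one type because the modules of a resolution must have a common type.
\<close>

locale quad_module = quad_model A \<pi> C + Md?: lmod A M
  for A :: "('a, 'x) ring_scheme" (structure) and \<pi> :: "('n::finite, 'k::field) fralg \<Rightarrow> 'a" and C
    and M :: "('a, 'm) module" +
  fixes S :: "'s set" and y :: "'s \<Rightarrow> 'm" and ix :: "'n \<Rightarrow> 's \<Rightarrow> 's" and ixj :: "'s \<Rightarrow> 'n" and ixs :: "'s \<Rightarrow> 's"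
  assumes kb: "kbasis M S y" and ixj: "ixj (ix j s) = j" and ixs: "ixs (ix j s) = s"
begin

definition S1 where "S1 = {t. \<exists>j. \<exists>s\<in>S. t = ix j s}"
abbreviation "F0 \<equiv> free_mod A S"
abbreviation "F1 \<equiv> free_mod A S1"

sublocale F0: lmod A F0 by (rule lmod.intro[OF left_module_free_mod])
sublocale F1: lmod A F1 by (rule lmod.intro[OF left_module_free_mod])

lemma ix_S1: "s \<in> S \<Longrightarrow> ix j s \<in> S1" by (auto simp: S1_def)
lemma S1_D: "t \<in> S1 \<Longrightarrow> ixs t \<in> S" "t \<in> S1 \<Longrightarrow> ix (ixj t) (ixs t) = t"
  by (auto simp: S1_def ixj ixs)
lemma S1_cases: assumes "t \<in> S1" obtains j s where "s \<in> S" "t = ix j s" using assms by (auto simp: S1_def)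
lemma ix_eq: "ix j s = ix j' s' \<longleftrightarrow> j = j' \<and> s = s'" by (metis ixj ixs)

lemma y_in: "y \<in> S \<rightarrow> carrier M" using kb by (simp add: kbasis_def)
lemma y_closed: "s \<in> S \<Longrightarrow> y s \<in> carrier M" using y_in by auto

definition aug :: "('s \<Rightarrow> 'a) \<Rightarrow> 'm" where "aug = lincomb A M y"
lemma aug_hom: "aug \<in> module_homs A F0 M" unfolding aug_def by (rule lincomb_hom[OF y_in])
lemma aug_fbasis: "s \<in> S \<Longrightarrow> aug (fbasis A s) = y s" unfolding aug_def by (rule lincomb_fbasis[OF y_in])

lemma aug_inj: assumes "u \<in> K0 S" "v \<in> K0 S" "aug u = aug v" shows "u = v"
proof -
  have "aug (u \<ominus>\<^bsub>F0\<^esub> v) = \<zero>\<^bsub>M\<^esub>"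
    using assms hom_minus[OF aug_hom F0.M.abelian_group_axioms Md.M.abelian_group_axioms] K0_free
      hom_closed[OF aug_hom] Md.M.minus_eq_zero_iff by metis
  then have "u \<ominus>\<^bsub>F0\<^esub> v = \<zero>\<^bsub>F0\<^esub>"
    using kb K0_minus[OF assms(1,2)] unfolding kbasis_def aug_def by simp
  then show ?thesis using F0.M.minus_eq_zero_iff assms K0_free by blast
qed

text \<open>
  The inclusion \<open>m \<mapsto> 1 \<otimes> m\<close> of \<open>M\<close> into \<open>A \<otimes> M\<close>, a \<open>k\<close>-linear section of the augmentation \<open>a \<otimes> m \<mapsto> a m\<close>.
\<close>

definition ehat :: "'m \<Rightarrow> 's \<Rightarrow> 'a" where "ehat m = (SOME u. u \<in> K0 S \<and> aug u = m)"

lemma ehat: assumes "m \<in> carrier M" shows "ehat m \<in> K0 S" "aug (ehat m) = m"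
proof -
  have "\<exists>u. u \<in> K0 S \<and> aug u = m" using kb assms unfolding kbasis_def aug_def by blast
  then have "ehat m \<in> K0 S \<and> aug (ehat m) = m" unfolding ehat_def by (rule someI_ex)
  then show "ehat m \<in> K0 S" "aug (ehat m) = m" by auto
qed

lemma ehat_free: "m \<in> carrier M \<Longrightarrow> ehat m \<in> carrier F0" by (rule K0_free[OF ehat(1)])

lemma ehat_eqI: "u \<in> K0 S \<Longrightarrow> aug u = m \<Longrightarrow> ehat m = u"
  using aug_inj[of "ehat m" u] ehat[of m] hom_closed[OF aug_hom K0_free] by metis

lemma ehat_y: "s \<in> S \<Longrightarrow> ehat (y s) = fbasis A s"
  by (rule ehat_eqI[OF K0_fbasis aug_fbasis])

lemma ehat_hom: "ehat \<in> module_homs AK M F0"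
proof (rule module_homsI)
  show "ehat m \<in> carrier F0" if "m \<in> carrier M" for m by (rule ehat_free[OF that])
  show "ehat (m \<oplus>\<^bsub>M\<^esub> m') = ehat m \<oplus>\<^bsub>F0\<^esub> ehat m'" if "m \<in> carrier M" "m' \<in> carrier M" for m m'
    using that by (intro ehat_eqI K0_add ehat(1)) (simp_all add: hom_add[OF aug_hom] ehat_free ehat(2) del: free_mod_simps)
  show "ehat (a \<odot>\<^bsub>M\<^esub> m) = a \<odot>\<^bsub>F0\<^esub> ehat m" if "a \<in> carrier AK" "m \<in> carrier M" for a m
  proof (rule ehat_eqI)
    show "a \<odot>\<^bsub>F0\<^esub> ehat m \<in> K0 S" using that by (intro K0_eta ehat(1)) simp_all
    have "a \<in> carrier A" using that by auto
    then show "aug (a \<odot>\<^bsub>F0\<^esub> ehat m) = a \<odot>\<^bsub>M\<^esub> m"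
      using that(2) by (simp add: hom_act[OF aug_hom] ehat_free ehat(2) del: free_mod_simps)
  qed
qed

text \<open>
  Used to extend formulas that hold for basis elements \<open>y s\<close> to all of \<open>M\<close>, in particular to the elements
  \<open>x\<^sub>j y\<^sub>s\<close>, which in general are not basis elements.
\<close>

lemma klin_eqI:
  assumes g: "g \<in> module_homs AK M N" and h: "h \<in> module_homs AK M N" and N: "abelian_group N"
    and eq: "\<And>s. s \<in> S \<Longrightarrow> g (y s) = h (y s)" and m: "m \<in> carrier M"
  shows "g m = h m"
proof -
  let ?u = "ehat m"
  have u: "{s. ?u s \<noteq> \<zero>} \<subseteq> S" "finite {s. ?u s \<noteq> \<zero>}" "\<And>s. ?u s \<in> range eta" "\<And>s. ?u s \<in> carrier A"
    using ehat(1)[OF m] by (auto simp: K0_def free_mod_carrier)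
  have c: "(\<lambda>s. ?u s \<odot>\<^bsub>M\<^esub> y s) \<in> {s. ?u s \<noteq> \<zero>} \<rightarrow> carrier M"
    using u y_closed by (auto intro!: Md.smult_closed)
  have *: "f m = (\<Oplus>\<^bsub>N\<^esub>s\<in>{s. ?u s \<noteq> \<zero>}. ?u s \<odot>\<^bsub>N\<^esub> f (y s))"
    "\<And>s. s \<in> {s. ?u s \<noteq> \<zero>} \<Longrightarrow> ?u s \<odot>\<^bsub>N\<^esub> f (y s) \<in> carrier N" if f: "f \<in> module_homs AK M N" for f
  proof -
    have e: "f (?u s \<odot>\<^bsub>M\<^esub> y s) = ?u s \<odot>\<^bsub>N\<^esub> f (y s)" if "s \<in> {s. ?u s \<noteq> \<zero>}" for s
      by (rule hom_act[OF f]) (use that u y_closed in auto)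
    have ec: "?u s \<odot>\<^bsub>N\<^esub> f (y s) \<in> carrier N" if "s \<in> {s. ?u s \<noteq> \<zero>}" for s
      using hom_closed[OF f, of "?u s \<odot>\<^bsub>M\<^esub> y s"] c that e[OF that] by auto
    have "f m = f (\<Oplus>\<^bsub>M\<^esub>s\<in>{s. ?u s \<noteq> \<zero>}. ?u s \<odot>\<^bsub>M\<^esub> y s)"
      using ehat(2)[OF m] by (simp add: aug_def lincomb_def)
    also have "\<dots> = (\<Oplus>\<^bsub>N\<^esub>s\<in>{s. ?u s \<noteq> \<zero>}. f (?u s \<odot>\<^bsub>M\<^esub> y s))"
      by (rule hom_finsum[OF f Md.M.abelian_group_axioms N c])
    also have "\<dots> = (\<Oplus>\<^bsub>N\<^esub>s\<in>{s. ?u s \<noteq> \<zero>}. ?u s \<odot>\<^bsub>N\<^esub> f (y s))"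
      by (rule abelian_monoid.finsum_cong'[OF abelian_group.axioms(1)[OF N]]) (use e ec in auto)
    finally show "f m = (\<Oplus>\<^bsub>N\<^esub>s\<in>{s. ?u s \<noteq> \<zero>}. ?u s \<odot>\<^bsub>N\<^esub> f (y s))" .
    show "\<And>s. s \<in> {s. ?u s \<noteq> \<zero>} \<Longrightarrow> ?u s \<odot>\<^bsub>N\<^esub> f (y s) \<in> carrier N" by (rule ec)
  qed
  have "(\<Oplus>\<^bsub>N\<^esub>s\<in>{s. ?u s \<noteq> \<zero>}. ?u s \<odot>\<^bsub>N\<^esub> g (y s)) = (\<Oplus>\<^bsub>N\<^esub>s\<in>{s. ?u s \<noteq> \<zero>}. ?u s \<odot>\<^bsub>N\<^esub> h (y s))"
    by (rule abelian_monoid.finsum_cong'[OF abelian_group.axioms(1)[OF N]])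
      (use *(2)[OF h] eq u(1) in \<open>auto simp: subset_iff\<close>)
  then show ?thesis using *(1)[OF g] *(1)[OF h] by simp
qed

lemma act_klin: assumes "a \<in> carrier A" "left_module A N" shows "(\<lambda>m. a \<odot>\<^bsub>N\<^esub> m) \<in> module_homs AK N N"
proof (rule module_homsI)
  interpret N: left_module A N by fact
  show "a \<odot>\<^bsub>N\<^esub> p \<in> carrier N" if "p \<in> carrier N" for p using assms that by (intro N.smult_closed)
  show "a \<odot>\<^bsub>N\<^esub> (p \<oplus>\<^bsub>N\<^esub> q) = a \<odot>\<^bsub>N\<^esub> p \<oplus>\<^bsub>N\<^esub> a \<odot>\<^bsub>N\<^esub> q" if "p \<in> carrier N" "q \<in> carrier N" for p q
    using assms(1) that by (rule N.smult_r_distr)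
  show "a \<odot>\<^bsub>N\<^esub> (c \<odot>\<^bsub>N\<^esub> p) = c \<odot>\<^bsub>N\<^esub> (a \<odot>\<^bsub>N\<^esub> p)" if c: "c \<in> carrier AK" and p: "p \<in> carrier N" for c p
  proof -
    obtain d where "c = eta d" using c by auto
    then show ?thesis using assms(1) p eta_comm[OF assms(1), of d] N.smult_assoc[of a c p] N.smult_assoc[of c a p] by simp
  qed
qed

subsection \<open>The maps\<close>

text \<open>
  \<open>shift j\<close> is the map \<open>a \<otimes> m \<mapsto> a \<otimes> x\<^sub>j \<otimes> m\<close>.  Each differential is a sum of two parts: \<open>D0\<close> sends
  \<open>a \<otimes> x\<^sub>j \<otimes> m\<close> to \<open>a x\<^sub>j \<otimes> m\<close> and \<open>D1\<close> sends \<open>a \<otimes> m\<close> to \<open>\<Sum> a y\<^sub>j \<otimes> x\<^sub>j \<otimes> m\<close>, which raises the degree in \<open>A\<close>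
  by one; \<open>L0\<close> sends \<open>a \<otimes> x\<^sub>j \<otimes> m\<close> to \<open>a \<otimes> x\<^sub>j m\<close> and \<open>L1\<close> sends \<open>a \<otimes> m\<close> to \<open>\<Sum> a \<otimes> x\<^sub>i \<otimes> z\<^sub>i m\<close>, which
  preserves it.
\<close>

definition shift :: "'n \<Rightarrow> ('s \<Rightarrow> 'a) \<Rightarrow> 's \<Rightarrow> 'a"
  where "shift j u = (\<lambda>t. if t \<in> S1 \<and> ixj t = j then u (ixs t) else \<zero>)"

definition D0 :: "('s \<Rightarrow> 'a) \<Rightarrow> 's \<Rightarrow> 'a"
  where "D0 u = (\<lambda>s. if s \<in> S then \<Oplus>j\<in>UNIV. u (ix j s) \<otimes> gx j else \<zero>)"

definition L0 :: "('s \<Rightarrow> 'a) \<Rightarrow> 's \<Rightarrow> 'a"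
  where "L0 = lincomb A F0 (\<lambda>t. ehat (gx (ixj t) \<odot>\<^bsub>M\<^esub> y (ixs t)))"

definition d0 :: "('s \<Rightarrow> 'a) \<Rightarrow> 's \<Rightarrow> 'a" where "d0 u = D0 u \<ominus>\<^bsub>F0\<^esub> L0 u"

definition D1 :: "('s \<Rightarrow> 'a) \<Rightarrow> 's \<Rightarrow> 'a"
  where "D1 c = (\<lambda>t. if t \<in> S1 then c (ixs t) \<otimes> cy (ixj t) else \<zero>)"

definition l1 :: "'s \<Rightarrow> 's \<Rightarrow> 'a"
  where "l1 s = (\<Oplus>\<^bsub>F1\<^esub>i\<in>UNIV. shift i (ehat (cz i \<odot>\<^bsub>M\<^esub> y s)))"

definition L1 :: "('s \<Rightarrow> 'a) \<Rightarrow> 's \<Rightarrow> 'a" where "L1 = lincomb A F1 l1"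

definition d1 :: "('s \<Rightarrow> 'a) \<Rightarrow> 's \<Rightarrow> 'a" where "d1 c = D1 c \<oplus>\<^bsub>F1\<^esub> L1 c"

lemma F_grp: "abelian_group (free_mod A X)"
  using left_module.axioms(2)[OF left_module_free_mod] .
lemma F_act: "additive_action A (free_mod A X)"
proof - interpret left_module A "free_mod A X" by (rule left_module_free_mod) show ?thesis by unfold_locales qed

lemma shift_hom: "shift j \<in> module_homs A F0 F1"
proof (rule module_homsI)
  fix u assume u: "u \<in> carrier F0"
  have "{t. shift j u t \<noteq> \<zero>} \<subseteq> ix j ` {s. u s \<noteq> \<zero>}"
  proof
    fix t assume "t \<in> {t. shift j u t \<noteq> \<zero>}"
    then have "t \<in> S1" "ixj t = j" "u (ixs t) \<noteq> \<zero>" by (auto simp: shift_def split: if_splits)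
    then show "t \<in> ix j ` {s. u s \<noteq> \<zero>}" using S1_D(2)[of t] by (intro image_eqI[of _ _ "ixs t"]) auto
  qed
  then have "finite {t. shift j u t \<noteq> \<zero>}" using u finite_subset by (fastforce simp: free_mod_carrier)
  then show "shift j u \<in> carrier F1" using u by (auto simp: free_mod_carrier shift_def)
qed (auto simp: shift_def fun_eq_iff free_mod_carrier)

lemma shift_fbasis: "s \<in> S \<Longrightarrow> shift j (fbasis A s) = fbasis A (ix j s)"
  by (rule ext) (auto simp: shift_def fbasis_def ixj ixs ix_S1 dest: S1_D(2))

lemma shift_K0: "u \<in> K0 S \<Longrightarrow> shift j u \<in> K0 S1"
  using hom_closed[OF shift_hom] eta_range_zero by (auto simp: K0_def shift_def)

lemma D0_hom: "D0 \<in> module_homs A F1 F0"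
proof (rule module_homsI)
  fix u assume u: "u \<in> carrier F1"
  then have uc: "\<And>t. u t \<in> carrier A" by (simp add: free_mod_carrier)
  have "{s. D0 u s \<noteq> \<zero>} \<subseteq> ixs ` {t. u t \<noteq> \<zero>}"
  proof
    fix s assume "s \<in> {s. D0 u s \<noteq> \<zero>}"
    then have "s \<in> S" and ne: "(\<Oplus>j\<in>UNIV. u (ix j s) \<otimes> gx j) \<noteq> \<zero>" by (auto simp: D0_def split: if_splits)
    have "\<exists>j. u (ix j s) \<noteq> \<zero>"
    proof (rule ccontr)
      assume "\<nexists>j. u (ix j s) \<noteq> \<zero>"
      then have "(\<Oplus>j\<in>UNIV. u (ix j s) \<otimes> gx j) = (\<Oplus>j\<in>(UNIV::'n set). \<zero>)" by (intro A.finsum_cong') auto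
      then show False using ne by simp
    qed
    then obtain j where "u (ix j s) \<noteq> \<zero>" by blast
    then show "s \<in> ixs ` {t. u t \<noteq> \<zero>}" by (intro image_eqI[of _ _ "ix j s"]) (auto simp: ixs)
  qed
  then have "finite {s. D0 u s \<noteq> \<zero>}" using u finite_subset by (fastforce simp: free_mod_carrier)
  then show "D0 u \<in> carrier F0" using uc by (auto simp: free_mod_carrier D0_def)
  show "D0 (u \<oplus>\<^bsub>F1\<^esub> v) = D0 u \<oplus>\<^bsub>F0\<^esub> D0 v" if v: "v \<in> carrier F1" for v
  proof (rule ext)
    fix s
    have vc: "\<And>t. v t \<in> carrier A" using v by (simp add: free_mod_carrier)
    have "(\<Oplus>j\<in>UNIV. (u (ix j s) \<oplus> v (ix j s)) \<otimes> gx j) = (\<Oplus>j\<in>UNIV. u (ix j s) \<otimes> gx j \<oplus> v (ix j s) \<otimes> gx j)"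
      by (intro A.finsum_cong') (auto simp: uc vc A.l_distr)
    also have "\<dots> = (\<Oplus>j\<in>UNIV. u (ix j s) \<otimes> gx j) \<oplus> (\<Oplus>j\<in>UNIV. v (ix j s) \<otimes> gx j)"
      by (intro A.finsum_addf) (auto simp: uc vc)
    finally show "D0 (u \<oplus>\<^bsub>F1\<^esub> v) s = (D0 u \<oplus>\<^bsub>F0\<^esub> D0 v) s" by (simp add: D0_def)
  qed
  show "D0 (a \<odot>\<^bsub>F1\<^esub> u) = a \<odot>\<^bsub>F0\<^esub> D0 u" if a: "a \<in> carrier A" for a
  proof (rule ext)
    fix s
    have "(\<Oplus>j\<in>UNIV. (a \<otimes> u (ix j s)) \<otimes> gx j) = (\<Oplus>j\<in>UNIV. a \<otimes> (u (ix j s) \<otimes> gx j))"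
      by (intro A.finsum_cong') (auto simp: uc a A.m_assoc)
    also have "\<dots> = a \<otimes> (\<Oplus>j\<in>UNIV. u (ix j s) \<otimes> gx j)"
      by (rule A.finsum_rdistr[symmetric]) (auto simp: uc a)
    finally show "D0 (a \<odot>\<^bsub>F1\<^esub> u) s = (a \<odot>\<^bsub>F0\<^esub> D0 u) s" using a by (simp add: D0_def)
  qed
qed

lemma D0_fbasis: assumes "s \<in> S" shows "D0 (fbasis A (ix j s)) = gx j \<odot>\<^bsub>F0\<^esub> fbasis A s"
proof (rule ext)
  fix s'
  have "(\<Oplus>l\<in>UNIV. fbasis A (ix j s) (ix l s') \<otimes> gx l) = (\<Oplus>l\<in>UNIV. if j = l then (if s = s' then gx l else \<zero>) else \<zero>)"
    by (intro A.finsum_cong') (auto simp: fbasis_def ix_eq)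
  also have "\<dots> = (if s = s' then gx j else \<zero>)" by (rule A.finsum_singleton) auto
  finally show "D0 (fbasis A (ix j s)) s' = (gx j \<odot>\<^bsub>F0\<^esub> fbasis A s) s'"
    using assms by (auto simp: D0_def fbasis_def)
qed

lemma val0_K0: "(\<lambda>t. ehat (gx (ixj t) \<odot>\<^bsub>M\<^esub> y (ixs t))) \<in> S1 \<rightarrow> K0 S"
  using S1_D(1) y_closed by (auto intro!: ehat(1) Md.smult_closed)

lemma L0_hom: "L0 \<in> module_homs A F1 F0"
  unfolding L0_def using val0_K0 K0_free by (intro F0.lincomb_hom) blast

lemma d0_hom: "d0 \<in> module_homs A F1 F0"
  unfolding d0_def by (rule hom_diff[OF F_act D0_hom L0_hom])

lemma d0_fbasis: assumes "s \<in> S"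
  shows "d0 (fbasis A (ix j s)) = gx j \<odot>\<^bsub>F0\<^esub> fbasis A s \<ominus>\<^bsub>F0\<^esub> ehat (gx j \<odot>\<^bsub>M\<^esub> y s)"
proof -
  have "(\<lambda>t. ehat (gx (ixj t) \<odot>\<^bsub>M\<^esub> y (ixs t))) \<in> S1 \<rightarrow> carrier F0" using val0_K0 K0_free by blast
  from F0.lincomb_fbasis[OF this ix_S1[OF assms]]
  have "L0 (fbasis A (ix j s)) = ehat (gx j \<odot>\<^bsub>M\<^esub> y s)" by (simp add: L0_def ixj ixs)
  then show ?thesis by (simp only: d0_def D0_fbasis[OF assms])
qed

lemma d0_shift:
  assumes m: "m \<in> carrier M"
  shows "d0 (shift j (ehat m)) = gx j \<odot>\<^bsub>F0\<^esub> ehat m \<ominus>\<^bsub>F0\<^esub> ehat (gx j \<odot>\<^bsub>M\<^esub> m)"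
proof (rule klin_eqI[OF _ _ F_grp _ m, of "\<lambda>m. d0 (shift j (ehat m))" _ "\<lambda>m. gx j \<odot>\<^bsub>F0\<^esub> ehat m \<ominus>\<^bsub>F0\<^esub> ehat (gx j \<odot>\<^bsub>M\<^esub> m)"])
  show "(\<lambda>m. d0 (shift j (ehat m))) \<in> module_homs AK M F0"
    by (rule hom_comp[OF hom_comp[OF ehat_hom K_hom[OF shift_hom]] K_hom[OF d0_hom]])
  show "(\<lambda>m. gx j \<odot>\<^bsub>F0\<^esub> ehat m \<ominus>\<^bsub>F0\<^esub> ehat (gx j \<odot>\<^bsub>M\<^esub> m)) \<in> module_homs AK M F0"
    by (rule hom_diff[OF K_action[OF F_act] hom_comp[OF ehat_hom act_klin[OF \<pi>_closed left_module_free_mod]]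
        hom_comp[OF act_klin[OF \<pi>_closed Md.left_module_axioms] ehat_hom]])
  show "d0 (shift j (ehat (y s))) = gx j \<odot>\<^bsub>F0\<^esub> ehat (y s) \<ominus>\<^bsub>F0\<^esub> ehat (gx j \<odot>\<^bsub>M\<^esub> y s)" if "s \<in> S" for s
    by (simp only: ehat_y[OF that] shift_fbasis[OF that] d0_fbasis[OF that])
qed

lemma shift_ehat_closed: "m \<in> carrier M \<Longrightarrow> shift j (ehat m) \<in> carrier F1"
  by (rule hom_closed[OF shift_hom ehat_free])

subsection \<open>Exactness at the augmentation\<close>

lemma aug_d0: assumes "u \<in> carrier F1" shows "aug (d0 u) = \<zero>\<^bsub>M\<^esub>"
proof (rule free_hom_eqI[OF hom_comp[OF d0_hom aug_hom] hom_const_zero[OF Md.additive_action_axioms] _ assms])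
  fix t assume "t \<in> S1"
  then obtain j s where t: "s \<in> S" "t = ix j s" by (rule S1_cases)
  have c: "gx j \<odot>\<^bsub>M\<^esub> y s \<in> carrier M" using y_closed[OF t(1)] by (rule Md.smult_closed[OF \<pi>_closed])
  have f: "gx j \<odot>\<^bsub>F0\<^esub> fbasis A s \<in> carrier F0" by (rule F0.smult_closed[OF \<pi>_closed fbasis_closed[OF t(1)]])
  have "aug (d0 (fbasis A t)) = aug (gx j \<odot>\<^bsub>F0\<^esub> fbasis A s) \<ominus>\<^bsub>M\<^esub> aug (ehat (gx j \<odot>\<^bsub>M\<^esub> y s))"
    unfolding t(2) d0_fbasis[OF t(1)]
    by (rule hom_minus[OF aug_hom F_grp Md.M.abelian_group_axioms f ehat_free[OF c]])
  also have "\<dots> = \<zero>\<^bsub>M\<^esub>"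
    unfolding ehat(2)[OF c] hom_act[OF aug_hom \<pi>_closed fbasis_closed[OF t(1)]] aug_fbasis[OF t(1)]
    using c Md.M.minus_eq_zero_iff by blast
  finally show "aug (d0 (fbasis A t)) = \<zero>\<^bsub>M\<^esub>" .
qed

text \<open>
  The element \<open>a \<otimes> m - 1 \<otimes> a m\<close> of the kernel of the augmentation.
\<close>

definition defect :: "'m \<Rightarrow> 'a \<Rightarrow> 's \<Rightarrow> 'a"
  where "defect m a = a \<odot>\<^bsub>F0\<^esub> ehat m \<ominus>\<^bsub>F0\<^esub> ehat (a \<odot>\<^bsub>M\<^esub> m)"

lemma defect_hom: assumes m: "m \<in> carrier M" shows "defect m \<in> module_homs AK (left_regular A) F0"
  unfolding defect_def[abs_def]
proof (rule hom_diff[OF K_action[OF F_act]])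
  show "(\<lambda>a. a \<odot>\<^bsub>F0\<^esub> ehat m) \<in> module_homs AK (left_regular A) F0"
  proof (rule module_homsI)
    fix a b assume "a \<in> carrier (left_regular A)"
    then have a: "a \<in> carrier A" by simp
    show "a \<odot>\<^bsub>F0\<^esub> ehat m \<in> carrier F0" by (rule F0.smult_closed[OF a ehat_free[OF m]])
    show "(a \<oplus>\<^bsub>left_regular A\<^esub> b) \<odot>\<^bsub>F0\<^esub> ehat m = a \<odot>\<^bsub>F0\<^esub> ehat m \<oplus>\<^bsub>F0\<^esub> b \<odot>\<^bsub>F0\<^esub> ehat m"
      if "b \<in> carrier (left_regular A)" using F0.smult_l_distr[OF a _ ehat_free[OF m], of b] that by simp
    show "(c \<odot>\<^bsub>left_regular A\<^esub> a) \<odot>\<^bsub>F0\<^esub> ehat m = c \<odot>\<^bsub>F0\<^esub> (a \<odot>\<^bsub>F0\<^esub> ehat m)"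
      if "c \<in> carrier AK" for c
    proof -
      have "c \<in> carrier A" using that by auto
      from F0.smult_assoc[OF this a ehat_free[OF m]] show ?thesis by simp
    qed
  qed
  have "(\<lambda>a. a \<odot>\<^bsub>M\<^esub> m) \<in> module_homs AK (left_regular A) M"
    by (rule module_homsI) (use m in \<open>auto simp: Md.smult_closed Md.smult_l_distr Md.smult_assoc\<close>)
  from hom_comp[OF this ehat_hom] show "(\<lambda>a. ehat (a \<odot>\<^bsub>M\<^esub> m)) \<in> module_homs AK (left_regular A) F0" .
qed

lemma LR_grp: "abelian_group (left_regular A)"
  using left_module.axioms(2)[OF A.left_regular_module] .

lemma defect_closed: "m \<in> carrier M \<Longrightarrow> a \<in> carrier A \<Longrightarrow> defect m a \<in> carrier F0"
  using hom_closed[OF defect_hom] by simp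

lemma defect_zero: "m \<in> carrier M \<Longrightarrow> defect m \<zero> = \<zero>\<^bsub>F0\<^esub>"
  using hom_zero[OF defect_hom LR_grp F_grp] by simp

lemma left_regular_finsum: "finsum (left_regular A) f I = finsum A f I"
  by (simp add: finsum_def finprod_def left_regular_def)

lemma defect_finsum:
  "m \<in> carrier M \<Longrightarrow> f \<in> I \<rightarrow> carrier A \<Longrightarrow> defect m (\<Oplus>i\<in>I. f i) = (\<Oplus>\<^bsub>F0\<^esub>i\<in>I. defect m (f i))"
  using hom_finsum[OF defect_hom LR_grp F_grp, of m f I] by (simp add: left_regular_finsum)

text \<open>
  The identity \<open>a b \<otimes> m - 1 \<otimes> a b m = a (b \<otimes> m - 1 \<otimes> b m) + (a \<otimes> b m - 1 \<otimes> a b m)\<close>, which reduces defects to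
  those of the generators \<open>x\<^sub>j\<close>.
\<close>

lemma defect_mult:
  assumes m: "m \<in> carrier M" and a: "a \<in> carrier A" and b: "b \<in> carrier A"
  shows "defect m (a \<otimes> b) = a \<odot>\<^bsub>F0\<^esub> defect m b \<oplus>\<^bsub>F0\<^esub> defect (b \<odot>\<^bsub>M\<^esub> m) a"
proof -
  have bm: "b \<odot>\<^bsub>M\<^esub> m \<in> carrier M" by (rule Md.smult_closed[OF b m])
  have abm: "a \<odot>\<^bsub>M\<^esub> (b \<odot>\<^bsub>M\<^esub> m) \<in> carrier M" by (rule Md.smult_closed[OF a bm])
  define p where "p = a \<odot>\<^bsub>F0\<^esub> (b \<odot>\<^bsub>F0\<^esub> ehat m)"
  define q where "q = a \<odot>\<^bsub>F0\<^esub> ehat (b \<odot>\<^bsub>M\<^esub> m)"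
  define r where "r = ehat (a \<odot>\<^bsub>M\<^esub> (b \<odot>\<^bsub>M\<^esub> m))"
  have c: "p \<in> carrier F0" "q \<in> carrier F0" "r \<in> carrier F0"
    unfolding p_def q_def r_def
    by (intro F0.smult_closed a b ehat_free m bm abm)+
  have 1: "defect m (a \<otimes> b) = p \<ominus>\<^bsub>F0\<^esub> r"
    unfolding defect_def p_def r_def Md.smult_assoc[OF a b m] F0.smult_assoc[OF a b ehat_free[OF m]] ..
  have 2: "a \<odot>\<^bsub>F0\<^esub> defect m b = p \<ominus>\<^bsub>F0\<^esub> q"
    unfolding defect_def p_def q_def
    by (rule F0.act_minus[OF a F0.smult_closed[OF b ehat_free[OF m]] ehat_free[OF bm]])
  have 3: "defect (b \<odot>\<^bsub>M\<^esub> m) a = q \<ominus>\<^bsub>F0\<^esub> r" unfolding defect_def q_def r_def ..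
  have "p \<ominus>\<^bsub>F0\<^esub> q \<oplus>\<^bsub>F0\<^esub> (q \<ominus>\<^bsub>F0\<^esub> r) = ((p \<ominus>\<^bsub>F0\<^esub> q) \<oplus>\<^bsub>F0\<^esub> q) \<ominus>\<^bsub>F0\<^esub> r"
    using c by (simp only: F0.M.minus_eq F0.M.a_assoc F0.M.a_closed F0.M.a_inv_closed)
  also have "\<dots> = p \<ominus>\<^bsub>F0\<^esub> r" by (simp only: F0.M.minus_cancel_mid[OF c(1,2)])
  finally show ?thesis unfolding 1 2 3 by (rule sym)
qed

lemma d0_shift_defect: "m \<in> carrier M \<Longrightarrow> d0 (shift j (ehat m)) = defect m (gx j)"
  unfolding defect_def by (rule d0_shift)

lemma defect_eta: assumes "m \<in> carrier M" shows "defect m (eta c) = \<zero>\<^bsub>F0\<^esub>"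
proof -
  have "ehat (eta c \<odot>\<^bsub>M\<^esub> m) = eta c \<odot>\<^bsub>F0\<^esub> ehat m" by (rule hom_act[OF ehat_hom _ assms]) simp
  moreover have "eta c \<odot>\<^bsub>F0\<^esub> ehat m \<in> carrier F0" by (rule F0.smult_closed[OF eta_closed ehat_free[OF assms]])
  ultimately show ?thesis unfolding defect_def using F0.M.minus_eq_zero_iff by metis
qed

text \<open>
  The defect of \<open>x\<^sub>j\<close> at \<open>m\<close> is \<open>d\<^sub>0(1 \<otimes> x\<^sub>j \<otimes> m)\<close>; words are treated by splitting off their last letter.
\<close>

lemma defect_in_image:
  assumes "m \<in> carrier M"
  shows "defect m (\<pi> p) \<in> d0 ` carrier F1"
  using assms
proof (induction p arbitrary: m rule: pm_induct)
  case (single w c)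
  have "defect m (\<pi> (Poly_Mapping.single (TWord l) c)) \<in> d0 ` carrier F1" for l
    using single
  proof (induction l arbitrary: m rule: rev_induct)
    case Nil
    have "Poly_Mapping.single (TWord []) c = (cst c :: ('n,'k) fralg)" by (simp add: cst_def zero_tword_def)
    then have "defect m (\<pi> (Poly_Mapping.single (TWord []) c)) = \<zero>\<^bsub>F0\<^esub>"
      using defect_eta[OF Nil] by (simp add: eta_def)
    also have "\<dots> = d0 \<zero>\<^bsub>F1\<^esub>" by (rule hom_zero[OF d0_hom F_grp F_grp, symmetric])
    finally show ?case using F1.M.zero_closed by (rule image_eqI)
  next
    case (snoc j l)
    let ?q = "\<pi> (Poly_Mapping.single (TWord l) c)"
    have m': "gx j \<odot>\<^bsub>M\<^esub> m \<in> carrier M" by (rule Md.smult_closed[OF \<pi>_closed snoc.prems])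
    obtain w where w: "w \<in> carrier F1" "defect (gx j \<odot>\<^bsub>M\<^esub> m) ?q = d0 w" using snoc.IH[OF m'] by blast
    have "\<pi> (Poly_Mapping.single (TWord (l @ [j])) c) = ?q \<otimes> gx j"
      by (simp add: \<pi>_mult[symmetric] gen_def mult_single)
    then have "defect m (\<pi> (Poly_Mapping.single (TWord (l @ [j])) c))
        = ?q \<odot>\<^bsub>F0\<^esub> defect m (gx j) \<oplus>\<^bsub>F0\<^esub> defect (gx j \<odot>\<^bsub>M\<^esub> m) ?q"
      by (simp only: defect_mult[OF snoc.prems \<pi>_closed \<pi>_closed])
    also have "\<dots> = d0 (?q \<odot>\<^bsub>F1\<^esub> shift j (ehat m)) \<oplus>\<^bsub>F0\<^esub> d0 w"
      by (simp only: w(2) d0_shift_defect[OF snoc.prems, symmetric] hom_act[OF d0_hom \<pi>_closed shift_ehat_closed[OF snoc.prems]])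
    also have "\<dots> = d0 (?q \<odot>\<^bsub>F1\<^esub> shift j (ehat m) \<oplus>\<^bsub>F1\<^esub> w)"
      by (rule hom_add[OF d0_hom _ w(1), symmetric]) (rule F1.smult_closed[OF \<pi>_closed shift_ehat_closed[OF snoc.prems]])
    finally show ?case
      using F1.M.a_closed[OF F1.smult_closed[OF \<pi>_closed shift_ehat_closed[OF snoc.prems]] w(1)] by (rule image_eqI)
  qed
  then show ?case by (cases w) simp
next
  case (add p q)
  then obtain u v where u: "u \<in> carrier F1" "defect m (\<pi> p) = d0 u" and v: "v \<in> carrier F1" "defect m (\<pi> q) = d0 v"
    by blast
  have "defect m (\<pi> (p + q)) = d0 u \<oplus>\<^bsub>F0\<^esub> d0 v"
    using hom_add[OF defect_hom[OF add.prems], of "\<pi> p" "\<pi> q"] u v by (simp add: \<pi>_add del: free_mod_simps)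
  also have "\<dots> = d0 (u \<oplus>\<^bsub>F1\<^esub> v)" by (rule hom_add[OF d0_hom u(1) v(1), symmetric])
  finally show ?case using F1.M.a_closed[OF u(1) v(1)] by (rule image_eqI)
qed

text \<open>
  Every \<open>u\<close> is congruent to \<open>1 \<otimes> aug u\<close> modulo defects of basis elements.
\<close>

lemma exact_at_0:
  assumes u: "u \<in> carrier F0" and 0: "aug u = \<zero>\<^bsub>M\<^esub>"
  shows "u \<in> d0 ` carrier F1"
proof -
  have T: "(\<lambda>u. u \<ominus>\<^bsub>F0\<^esub> ehat (aug u)) \<in> module_homs AK F0 F0"
    by (rule hom_diff[OF K_action[OF F_act] hom_id hom_comp[OF K_hom[OF aug_hom] ehat_hom]])
  have "u \<ominus>\<^bsub>F0\<^esub> ehat (aug u) \<in> d0 ` carrier F1"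
    using u
  proof (induction u rule: free_mod_induct)
    case zero
    have "(\<lambda>s. \<zero>) \<ominus>\<^bsub>F0\<^esub> ehat (aug (\<lambda>s. \<zero>)) = d0 \<zero>\<^bsub>F1\<^esub>"
      using hom_zero[OF T F_grp F_grp] hom_zero[OF d0_hom F_grp F_grp] by simp
    then show ?case using F1.M.zero_closed by (rule image_eqI)
  next
    case (smult a s)
    obtain p where p: "a = \<pi> p" using smult(1) by (rule \<pi>_cases)
    have "a \<odot>\<^bsub>F0\<^esub> fbasis A s \<ominus>\<^bsub>F0\<^esub> ehat (aug (a \<odot>\<^bsub>F0\<^esub> fbasis A s)) = defect (y s) a"
      unfolding hom_act[OF aug_hom smult(1) fbasis_closed[OF smult(2)]] aug_fbasis[OF smult(2)] defect_def ehat_y[OF smult(2)] ..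
    then show ?case using defect_in_image[OF y_closed[OF smult(2)]] p by simp
  next
    case (add u v)
    then obtain w w' where w: "w \<in> carrier F1" "u \<ominus>\<^bsub>F0\<^esub> ehat (aug u) = d0 w"
      "w' \<in> carrier F1" "v \<ominus>\<^bsub>F0\<^esub> ehat (aug v) = d0 w'" by blast
    have "(u \<oplus>\<^bsub>F0\<^esub> v) \<ominus>\<^bsub>F0\<^esub> ehat (aug (u \<oplus>\<^bsub>F0\<^esub> v)) = d0 (w \<oplus>\<^bsub>F1\<^esub> w')"
      by (simp only: hom_add[OF T add.hyps] w hom_add[OF d0_hom w(1,3)])
    then show ?case using F1.M.a_closed[OF w(1,3)] by (rule image_eqI)
  qed
  moreover have "ehat (aug u) = \<zero>\<^bsub>F0\<^esub>" unfolding 0 by (rule hom_zero[OF ehat_hom Md.M.abelian_group_axioms F_grp])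
  moreover have "u \<ominus>\<^bsub>F0\<^esub> \<zero>\<^bsub>F0\<^esub> = u" using F0.M.minus_cancel_mid[OF u F0.M.zero_closed]
      F0.M.r_zero[OF F0.M.minus_closed[OF u F0.M.zero_closed]] by (simp only:)
  ultimately show ?thesis by (simp only:)
qed

subsection \<open>Exactness in the middle and on the left\<close>

lemma D1_hom: "D1 \<in> module_homs A F0 F1"
proof (rule module_homsI)
  fix u assume u: "u \<in> carrier F0"
  then have uc: "\<And>t. u t \<in> carrier A" by (simp add: free_mod_carrier)
  have "{t. D1 u t \<noteq> \<zero>} \<subseteq> (\<lambda>(j, s). ix j s) ` (UNIV \<times> {s. u s \<noteq> \<zero>})"
  proof
    fix t assume "t \<in> {t. D1 u t \<noteq> \<zero>}"
    then have "t \<in> S1" "u (ixs t) \<noteq> \<zero>" by (auto simp: D1_def split: if_splits)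
    then show "t \<in> (\<lambda>(j, s). ix j s) ` (UNIV \<times> {s. u s \<noteq> \<zero>})"
      using S1_D(2)[of t] by (intro image_eqI[of _ _ "(ixj t, ixs t)"]) auto
  qed
  moreover have "finite ((\<lambda>(j, s). ix j s) ` ((UNIV :: 'n set) \<times> {s. u s \<noteq> \<zero>}))"
    using u by (intro finite_imageI finite_cartesian_product) (auto simp: free_mod_carrier)
  ultimately have "finite {t. D1 u t \<noteq> \<zero>}" by (rule finite_subset)
  then show "D1 u \<in> carrier F1" using uc by (auto simp: free_mod_carrier D1_def)
qed (auto simp: D1_def fun_eq_iff free_mod_carrier A.l_distr A.m_assoc)

lemma l1_closed: "s \<in> S \<Longrightarrow> shift i (ehat (cz i \<odot>\<^bsub>M\<^esub> y s)) \<in> K0 S1"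
  by (intro shift_K0 ehat(1) Md.smult_closed[OF \<pi>_closed] y_closed)

lemma l1_K0: "l1 \<in> S \<rightarrow> K0 S1"
proof
  fix s assume s: "s \<in> S"
  have "(\<Oplus>\<^bsub>F1\<^esub>i\<in>I. shift i (ehat (cz i \<odot>\<^bsub>M\<^esub> y s))) \<in> K0 S1" if "finite I" for I
    using that
  proof (induction I rule: finite_induct)
    case empty
    then show ?case using K0_zero by (simp add: F1.M.finsum_empty)
  next
    case (insert i I)
    have "(\<Oplus>\<^bsub>F1\<^esub>i\<in>insert i I. shift i (ehat (cz i \<odot>\<^bsub>M\<^esub> y s)))
      = shift i (ehat (cz i \<odot>\<^bsub>M\<^esub> y s)) \<oplus>\<^bsub>F1\<^esub> (\<Oplus>\<^bsub>F1\<^esub>i\<in>I. shift i (ehat (cz i \<odot>\<^bsub>M\<^esub> y s)))"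
      by (rule F1.M.finsum_insert) (use insert K0_free[OF l1_closed[OF s]] in auto)
    then show ?case using K0_add[OF l1_closed[OF s] insert.IH] by (simp only:)
  qed
  then show "l1 s \<in> K0 S1" unfolding l1_def by simp
qed

lemma L1_hom: "L1 \<in> module_homs A F0 F1"
  unfolding L1_def using l1_K0 K0_free by (intro F1.lincomb_hom) blast

lemma d1_hom: "d1 \<in> module_homs A F0 F1"
  unfolding d1_def by (rule hom_plus[OF F_act D1_hom L1_hom])

lemma D1_fbasis:
  assumes s: "s \<in> S"
  shows "D1 (fbasis A s) =
    (\<Oplus>\<^bsub>F1\<^esub>i\<in>UNIV. gx i \<odot>\<^bsub>F1\<^esub> (\<Oplus>\<^bsub>F1\<^esub>l\<in>UNIV. eta (C $ i $ l) \<odot>\<^bsub>F1\<^esub> shift l (fbasis A s)))"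
proof (rule ext)
  fix t
  have sh: "shift l (fbasis A s) \<in> carrier F1" for l by (rule hom_closed[OF shift_hom fbasis_closed[OF s]])
  have c1: "eta (C $ i $ l) \<odot>\<^bsub>F1\<^esub> shift l (fbasis A s) \<in> carrier F1" for i l
    by (rule F1.smult_closed[OF eta_closed sh])
  have c2: "(\<Oplus>\<^bsub>F1\<^esub>l\<in>UNIV. eta (C $ i $ l) \<odot>\<^bsub>F1\<^esub> shift l (fbasis A s)) \<in> carrier F1" for i
    using c1 by (intro F1.M.finsum_closed) blast
  have c3: "gx i \<odot>\<^bsub>F1\<^esub> (\<Oplus>\<^bsub>F1\<^esub>l\<in>UNIV. eta (C $ i $ l) \<odot>\<^bsub>F1\<^esub> shift l (fbasis A s)) \<in> carrier F1" for i
    by (rule F1.smult_closed[OF \<pi>_closed c2])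
  have in1: "(\<Oplus>\<^bsub>F1\<^esub>l\<in>UNIV. eta (C $ i $ l) \<odot>\<^bsub>F1\<^esub> shift l (fbasis A s)) t
      = (if t \<in> S1 \<and> ixs t = s then eta (C $ i $ ixj t) else \<zero>)" for i
  proof -
    have "(\<Oplus>\<^bsub>F1\<^esub>l\<in>UNIV. eta (C $ i $ l) \<odot>\<^bsub>F1\<^esub> shift l (fbasis A s)) t
      = (\<Oplus>l\<in>UNIV. (eta (C $ i $ l) \<odot>\<^bsub>F1\<^esub> shift l (fbasis A s)) t)"
      using c1 by (intro A.free_mod_finsum_apply) auto
    also have "\<dots> = (\<Oplus>l\<in>UNIV. if ixj t = l then (if t \<in> S1 \<and> ixs t = s then eta (C $ i $ l) else \<zero>) else \<zero>)"
      by (intro A.finsum_cong') (auto simp: shift_def fbasis_def)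
    also have "\<dots> = (if t \<in> S1 \<and> ixs t = s then eta (C $ i $ ixj t) else \<zero>)"
      by (rule A.finsum_singleton) auto
    finally show ?thesis .
  qed
  have "(\<Oplus>\<^bsub>F1\<^esub>i\<in>UNIV. gx i \<odot>\<^bsub>F1\<^esub> (\<Oplus>\<^bsub>F1\<^esub>l\<in>UNIV. eta (C $ i $ l) \<odot>\<^bsub>F1\<^esub> shift l (fbasis A s))) t
    = (\<Oplus>i\<in>UNIV. (gx i \<odot>\<^bsub>F1\<^esub> (\<Oplus>\<^bsub>F1\<^esub>l\<in>UNIV. eta (C $ i $ l) \<odot>\<^bsub>F1\<^esub> shift l (fbasis A s))) t)"
    using c3 by (intro A.free_mod_finsum_apply) auto
  also have "\<dots> = (\<Oplus>i\<in>UNIV. gx i \<otimes> (if t \<in> S1 \<and> ixs t = s then eta (C $ i $ ixj t) else \<zero>))"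
  proof -
    have "(a \<odot>\<^bsub>F1\<^esub> X) t = a \<otimes> X t" for a X by simp
    then show ?thesis by (simp only: in1)
  qed
  also have "\<dots> = (if t \<in> S1 \<and> ixs t = s then cy (ixj t) else \<zero>)"
    by (cases "t \<in> S1 \<and> ixs t = s") (simp_all only: cy_eq if_True if_False simp_thms A.r_null \<pi>_closed A.finsum_zero)
  also have "\<dots> = D1 (fbasis A s) t" by (simp add: D1_def fbasis_def)
  finally show "D1 (fbasis A s) t = (\<Oplus>\<^bsub>F1\<^esub>i\<in>UNIV. gx i \<odot>\<^bsub>F1\<^esub> (\<Oplus>\<^bsub>F1\<^esub>l\<in>UNIV. eta (C $ i $ l) \<odot>\<^bsub>F1\<^esub> shift l (fbasis A s))) t"
    by (rule sym)
qed

lemma d1_fbasis: assumes s: "s \<in> S" shows "d1 (fbasis A s) = D1 (fbasis A s) \<oplus>\<^bsub>F1\<^esub> l1 s"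
proof -
  have "l1 \<in> S \<rightarrow> carrier F1" using l1_K0 K0_free by blast
  from F1.lincomb_fbasis[OF this s] show ?thesis by (simp only: d1_def L1_def)
qed

text \<open>
  The two parts of \<open>d\<^sub>1(1 \<otimes> m)\<close> contribute \<open>\<Sum> x\<^sub>i defect m z\<^sub>i\<close> and \<open>\<Sum> defect (z\<^sub>i m) x\<^sub>i\<close>, which add up to
  the defect of \<open>\<Sum> x\<^sub>i z\<^sub>i = 0\<close>.
\<close>

lemma d0_d1_fbasis: assumes s: "s \<in> S" shows "d0 (d1 (fbasis A s)) = \<zero>\<^bsub>F0\<^esub>"
proof -
  let ?m = "y s"
  have m: "?m \<in> carrier M" by (rule y_closed[OF s])
  have zm: "cz i \<odot>\<^bsub>M\<^esub> ?m \<in> carrier M" for i by (rule Md.smult_closed[OF \<pi>_closed m])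
  have sh: "shift l (fbasis A s) \<in> carrier F1" for l by (rule hom_closed[OF shift_hom fbasis_closed[OF s]])
  have c1: "eta (C $ i $ l) \<odot>\<^bsub>F1\<^esub> shift l (fbasis A s) \<in> carrier F1" for i l
    by (rule F1.smult_closed[OF eta_closed sh])
  have c2: "(\<Oplus>\<^bsub>F1\<^esub>l\<in>UNIV. eta (C $ i $ l) \<odot>\<^bsub>F1\<^esub> shift l (fbasis A s)) \<in> carrier F1" for i
    using c1 by (intro F1.M.finsum_closed) blast
  have c3: "gx i \<odot>\<^bsub>F1\<^esub> (\<Oplus>\<^bsub>F1\<^esub>l\<in>UNIV. eta (C $ i $ l) \<odot>\<^bsub>F1\<^esub> shift l (fbasis A s)) \<in> carrier F1" for i
    by (rule F1.smult_closed[OF \<pi>_closed c2])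
  have sl: "d0 (\<Oplus>\<^bsub>F1\<^esub>l\<in>UNIV. eta (C $ i $ l) \<odot>\<^bsub>F1\<^esub> shift l (fbasis A s)) = defect ?m (cz i)" for i
  proof -
    have e: "d0 (eta (C $ i $ l) \<odot>\<^bsub>F1\<^esub> shift l (fbasis A s)) = defect ?m (eta (C $ i $ l) \<otimes> gx l)" for l
    proof -
      have "d0 (eta (C $ i $ l) \<odot>\<^bsub>F1\<^esub> shift l (fbasis A s)) = eta (C $ i $ l) \<odot>\<^bsub>F0\<^esub> defect ?m (gx l)"
        unfolding hom_act[OF d0_hom eta_closed sh] d0_shift_defect[OF m, symmetric] ehat_y[OF s] ..
      also have "\<dots> = defect ?m (eta (C $ i $ l) \<odot>\<^bsub>left_regular A\<^esub> gx l)"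
        by (rule hom_act[OF defect_hom[OF m], symmetric]) simp_all
      finally show ?thesis by simp
    qed
    have "d0 (\<Oplus>\<^bsub>F1\<^esub>l\<in>UNIV. eta (C $ i $ l) \<odot>\<^bsub>F1\<^esub> shift l (fbasis A s))
      = (\<Oplus>\<^bsub>F0\<^esub>l\<in>UNIV. d0 (eta (C $ i $ l) \<odot>\<^bsub>F1\<^esub> shift l (fbasis A s)))"
      using c1 by (intro hom_finsum[OF d0_hom F_grp F_grp]) blast
    also have "\<dots> = defect ?m (\<Oplus>l\<in>UNIV. eta (C $ i $ l) \<otimes> gx l)"
      unfolding e by (rule defect_finsum[OF m, symmetric]) auto
    finally show ?thesis by (simp only: cz_eq)
  qed
  have 1: "d0 (D1 (fbasis A s)) = (\<Oplus>\<^bsub>F0\<^esub>i\<in>UNIV. gx i \<odot>\<^bsub>F0\<^esub> defect ?m (cz i))"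
  proof -
    have "d0 (D1 (fbasis A s)) = (\<Oplus>\<^bsub>F0\<^esub>i\<in>UNIV. d0 (gx i \<odot>\<^bsub>F1\<^esub> (\<Oplus>\<^bsub>F1\<^esub>l\<in>UNIV. eta (C $ i $ l) \<odot>\<^bsub>F1\<^esub> shift l (fbasis A s))))"
      unfolding D1_fbasis[OF s] using c3 by (intro hom_finsum[OF d0_hom F_grp F_grp]) blast
    then show ?thesis by (simp only: hom_act[OF d0_hom \<pi>_closed c2] sl)
  qed
  have 2: "d0 (l1 s) = (\<Oplus>\<^bsub>F0\<^esub>i\<in>UNIV. defect (cz i \<odot>\<^bsub>M\<^esub> ?m) (gx i))"
  proof -
    have "d0 (l1 s) = (\<Oplus>\<^bsub>F0\<^esub>i\<in>UNIV. d0 (shift i (ehat (cz i \<odot>\<^bsub>M\<^esub> ?m))))"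
      unfolding l1_def using shift_ehat_closed[OF zm] by (intro hom_finsum[OF d0_hom F_grp F_grp]) blast
    then show ?thesis by (simp only: d0_shift_defect[OF zm])
  qed
  have Dc: "D1 (fbasis A s) \<in> carrier F1" by (rule hom_closed[OF D1_hom fbasis_closed[OF s]])
  have lc: "l1 s \<in> carrier F1" using l1_K0 K0_free s by blast
  have ga: "gx i \<odot>\<^bsub>F0\<^esub> defect ?m (cz i) \<in> carrier F0" for i
    by (rule F0.smult_closed[OF \<pi>_closed defect_closed[OF m \<pi>_closed]])
  have gb: "defect (cz i \<odot>\<^bsub>M\<^esub> ?m) (gx i) \<in> carrier F0" for i by (rule defect_closed[OF zm \<pi>_closed])
  have "d0 (d1 (fbasis A s)) = d0 (D1 (fbasis A s)) \<oplus>\<^bsub>F0\<^esub> d0 (l1 s)"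
    unfolding d1_fbasis[OF s] by (rule hom_add[OF d0_hom Dc lc])
  also have "\<dots> = (\<Oplus>\<^bsub>F0\<^esub>i\<in>UNIV. gx i \<odot>\<^bsub>F0\<^esub> defect ?m (cz i) \<oplus>\<^bsub>F0\<^esub> defect (cz i \<odot>\<^bsub>M\<^esub> ?m) (gx i))"
    unfolding 1 2 using ga gb by (intro F0.M.finsum_addf[symmetric]) auto
  also have "\<dots> = (\<Oplus>\<^bsub>F0\<^esub>i\<in>UNIV. defect ?m (gx i \<otimes> cz i))"
    by (simp only: defect_mult[OF m \<pi>_closed \<pi>_closed])
  also have "\<dots> = defect ?m (\<Oplus>i\<in>UNIV. gx i \<otimes> cz i)" by (rule defect_finsum[OF m, symmetric]) auto
  also have "\<dots> = \<zero>\<^bsub>F0\<^esub>" unfolding relation by (rule defect_zero[OF m])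
  finally show ?thesis .
qed

lemma d0_d1: assumes "c \<in> carrier F0" shows "d0 (d1 c) = \<zero>\<^bsub>F0\<^esub>"
  by (rule F0.free_hom_eqI[OF hom_comp[OF d1_hom d0_hom] hom_const_zero[OF F_act] d0_d1_fbasis assms])

lemma free_FA: assumes "u \<in> carrier (free_mod A X)" shows "\<exists>m. \<forall>t. u t \<in> FA m"
proof -
  have fin: "finite {t. u t \<noteq> \<zero>}" and uc: "\<And>t. u t \<in> carrier A" using assms by (auto simp: free_mod_carrier)
  have "\<forall>t. \<exists>m. u t \<in> FA m" using FA_exists uc by blast
  then obtain m where m: "\<And>t. u t \<in> FA (m t)" by metis
  have "u t \<in> FA (Max (insert 0 (m ` {t. u t \<noteq> \<zero>})))" for t
  proof (cases "u t = \<zero>")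
    case False
    then show ?thesis using fin by (intro FA_mono[OF m[of t]] Max_ge) auto
  qed simp
  then show ?thesis by blast
qed

text \<open>
  Induction on the degree of the coefficients of \<open>u\<close>.  If \<open>d\<^sub>0 u = 0\<close>, then \<open>D0 u = L0 u\<close> has no larger degree than
  \<open>u\<close>, so the tail statement for leading terms provides \<open>c\<close> such that \<open>u - D1 c\<close>, and with it \<open>u - d\<^sub>1 c\<close>, has smaller
  degree.
\<close>

lemma exact_at_1_FA:
  assumes "u \<in> carrier F1" "\<And>t. u t \<in> FA m" "d0 u = \<zero>\<^bsub>F0\<^esub>"
  shows "u \<in> d1 ` carrier F0"
  using assms
proof (induction m arbitrary: u)
  case 0
  then have "u = \<zero>\<^bsub>F1\<^esub>" by (auto simp: FA_0)
  then have "u = d1 \<zero>\<^bsub>F0\<^esub>" using hom_zero[OF d1_hom F_grp F_grp] by simp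
  then show ?case using F0.M.zero_closed by (rule image_eqI)
next
  case (Suc m)
  have uc: "\<And>t. u t \<in> carrier A" and fin: "finite {t. u t \<noteq> \<zero>}" using Suc.prems(1) by (auto simp: free_mod_carrier)
  have top: "(\<Oplus>j\<in>UNIV. u (ix j s) \<otimes> gx j) \<in> FA (Suc m)" if s: "s \<in> S" for s
  proof -
    have "D0 u = L0 u"
      using Suc.prems(3) F0.M.minus_eq_zero_iff[OF hom_closed[OF D0_hom Suc.prems(1)] hom_closed[OF L0_hom Suc.prems(1)]]
      unfolding d0_def by blast
    moreover have "L0 u s \<in> FA (Suc m)" unfolding L0_def by (rule lincomb_FA[OF val0_K0 Suc.prems(1,2)])
    ultimately have "D0 u s \<in> FA (Suc m)" by (simp only:)
    then show ?thesis using s by (simp add: D0_def)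
  qed
  \<comment> \<open>the last clause keeps the support of \<open>c\<close> finite\<close>
  have "\<exists>c. c \<in> FA m \<and> (s \<in> S \<longrightarrow> (\<forall>j. u (ix j s) \<ominus> c \<otimes> cy j \<in> FA m)) \<and>
      (s \<notin> S \<or> (\<forall>j. u (ix j s) = \<zero>) \<longrightarrow> c = \<zero>)" for s
  proof (cases "s \<notin> S \<or> (\<forall>j. u (ix j s) = \<zero>)")
    case True
    then show ?thesis by (intro exI[of _ \<zero>]) (auto simp: A.minus_eq)
  next
    case False
    then show ?thesis using FA_tail[of "\<lambda>j. u (ix j s)" m] Suc.prems(2) top by blast
  qed
  then obtain c where c: "\<And>s. c s \<in> FA m" "\<And>s j. s \<in> S \<Longrightarrow> u (ix j s) \<ominus> c s \<otimes> cy j \<in> FA m"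
    "\<And>s. s \<notin> S \<or> (\<forall>j. u (ix j s) = \<zero>) \<Longrightarrow> c s = \<zero>" by metis
  have "{s. c s \<noteq> \<zero>} \<subseteq> ixs ` {t. u t \<noteq> \<zero>}"
  proof
    fix s assume "s \<in> {s. c s \<noteq> \<zero>}"
    then obtain j where "u (ix j s) \<noteq> \<zero>" using c(3) by blast
    then show "s \<in> ixs ` {t. u t \<noteq> \<zero>}" by (intro image_eqI[of _ _ "ix j s"]) (auto simp: ixs)
  qed
  then have "finite {s. c s \<noteq> \<zero>}" using fin finite_subset by blast
  then have cF: "c \<in> carrier F0" using c(1,3) FA_closed by (auto simp: free_mod_carrier)
  let ?v = "u \<ominus>\<^bsub>F1\<^esub> d1 c"
  have dc: "d1 c \<in> carrier F1" by (rule hom_closed[OF d1_hom cF])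
  have v: "?v \<in> carrier F1" by (rule F1.M.minus_closed[OF Suc.prems(1) dc])
  have "?v t \<in> FA m" for t
  proof (cases "t \<in> S1")
    case False
    then show ?thesis using v by (simp add: free_mod_carrier)
  next
    case True
    then obtain j s where t: "s \<in> S" "t = ix j s" by (rule S1_cases)
    have L: "L1 c t \<in> FA m" unfolding L1_def by (rule lincomb_FA[OF l1_K0 cF c(1)])
    have D: "D1 c t = c s \<otimes> cy j" using True by (simp add: D1_def t(2) ixs ixj)
    have cl: "D1 c t \<in> carrier A" "L1 c t \<in> carrier A" unfolding D using FA_closed[OF c(1)] FA_closed[OF L] by auto
    have "?v t = u t \<ominus> (D1 c t \<oplus> L1 c t)"
      using A.free_mod_minus_apply[OF Suc.prems(1) dc, of t] by (simp add: d1_def)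
    also have "\<dots> = (u t \<ominus> D1 c t) \<ominus> L1 c t"
      using cl uc[of t] by (simp add: A.minus_eq A.minus_add A.a_assoc)
    also have "\<dots> \<in> FA m" unfolding D unfolding t(2) by (rule FA_minus[OF c(2)[OF t(1)] L[unfolded t(2)]])
    finally show ?thesis .
  qed
  moreover have "d0 ?v = \<zero>\<^bsub>F0\<^esub>"
    using hom_minus[OF d0_hom F_grp F_grp Suc.prems(1) dc] Suc.prems(3) d0_d1[OF cF]
      F0.M.minus_eq_zero_iff[OF F0.M.zero_closed F0.M.zero_closed] by simp
  ultimately obtain c' where c': "c' \<in> carrier F0" "?v = d1 c'" using Suc.IH[OF v] by blast
  have "u = d1 (c' \<oplus>\<^bsub>F0\<^esub> c)"
    unfolding hom_add[OF d1_hom c'(1) cF] c'(2)[symmetric] by (rule F1.M.minus_cancel_mid[OF Suc.prems(1) dc, symmetric])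
  then show ?case using F0.M.a_closed[OF c'(1) cF] by (rule image_eqI)
qed

text \<open>
  If \<open>d\<^sub>1 c = 0\<close>, then \<open>D1 c = - L1 c\<close> has no larger degree than \<open>c\<close>, although its entries are the products
  \<open>c\<^sub>s y\<^sub>j\<close>; hence the leading terms of \<open>c\<close> vanish.
\<close>

lemma d1_inj_FA:
  assumes "c \<in> carrier F0" "\<And>s. c s \<in> FA m" "d1 c = \<zero>\<^bsub>F1\<^esub>"
  shows "c = \<zero>\<^bsub>F0\<^esub>"
  using assms(2)
proof (induction m)
  case 0
  then show ?case by (auto simp: FA_0)
next
  case (Suc m)
  have cc: "\<And>s. c s \<in> carrier A" using assms(1) by (simp add: free_mod_carrier)
  have "c s \<in> FA m" for s
  proof (cases "s \<in> S")
    case False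
    then show ?thesis using assms(1) by (simp add: free_mod_carrier)
  next
    case True
    show ?thesis
    proof (rule FA_nzd[OF Suc.prems])
      fix j
      let ?t = "ix j s"
      have L: "L1 c ?t \<in> FA (Suc m)" unfolding L1_def by (rule lincomb_FA[OF l1_K0 assms(1) Suc.prems])
      have D: "D1 c ?t = c s \<otimes> cy j" using ix_S1[OF True] by (simp add: D1_def ixs ixj)
      have "D1 c ?t \<oplus> L1 c ?t = \<zero>" using fun_cong[OF assms(3), of ?t] by (simp add: d1_def)
      then have "\<ominus> L1 c ?t = c s \<otimes> cy j"
        using cc[of s] FA_closed[OF L] D by (intro A.minus_equality) auto
      then show "c s \<otimes> cy j \<in> FA (Suc m)" using FA_minus[OF FA_zero L] cc[of s] by (simp add: A.minus_eq)
    qed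
  qed
  then show ?case by (rule Suc.IH)
qed

subsection \<open>The resolution\<close>

text \<open>
  From degree three on, the resolution consists of the free module on the empty set.
\<close>

definition resP :: "nat \<Rightarrow> ('a, 's \<Rightarrow> 'a) module"
  where "resP n = (if n = 0 then F0 else if n = 1 then F1 else if n = 2 then F0 else free_mod A {})"

definition resd :: "nat \<Rightarrow> ('s \<Rightarrow> 'a) \<Rightarrow> 's \<Rightarrow> 'a"
  where "resd n = (if n = 0 then d0 else if n = 1 then d1 else (\<lambda>_ _. \<zero>))"

lemma free_mod_empty: "carrier (free_mod A {}) = {\<lambda>s. \<zero>}"
  by (auto simp: free_mod_carrier fun_eq_iff)

lemma resP_simps: "resP 0 = F0" "resP (Suc 0) = F1" "resP (Suc (Suc 0)) = F0"
  "resP (Suc (Suc (Suc n))) = free_mod A {}"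
  by (simp_all add: resP_def)
lemma resd_simps: "resd 0 = d0" "resd (Suc 0) = d1" "resd (Suc (Suc n)) = (\<lambda>_ _. \<zero>)"
  by (simp_all add: resd_def)

lemma resolution: "projective_resolution A M resP resd aug"
  unfolding projective_resolution_def
proof (intro conjI allI)
  show "projective A (resP i)" for i
    unfolding resP_def by (simp add: projective_free A.ring_axioms)
  show "resd i \<in> module_homs A (resP (Suc i)) (resP i)" for i
  proof (cases i)
    case 0 then show ?thesis using d0_hom by (simp add: resP_simps resd_simps)
  next
    case (Suc j)
    show ?thesis
    proof (cases j)
      case 0 then show ?thesis using Suc d1_hom by (simp add: resP_simps resd_simps)
    next
      case (Suc l)
      have "(\<lambda>_ _. \<zero>) \<in> module_homs A (free_mod A {}) (resP i)"
        using hom_const_zero[OF F_act[of "if i = 2 then S else {}"], of "free_mod A {}"] Suc \<open>i = Suc j\<close>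
        by (auto simp: resP_def split: if_splits)
      then show ?thesis using Suc \<open>i = Suc j\<close> by (simp add: resP_simps resd_simps)
    qed
  qed
  show "aug \<in> module_homs A (resP 0) M" using aug_hom by (simp add: resP_simps)
  show "aug ` carrier (resP 0) = carrier M"
    unfolding resP_simps
  proof (intro equalityI subsetI)
    show "m \<in> carrier M" if "m \<in> aug ` carrier F0" for m using that hom_closed[OF aug_hom] by blast
    show "m \<in> aug ` carrier F0" if "m \<in> carrier M" for m
      using ehat(2)[OF that] ehat_free[OF that] by (intro image_eqI[of _ _ "ehat m"]) simp_all
  qed
  show "{p \<in> carrier (resP 0). aug p = \<zero>\<^bsub>M\<^esub>} = resd 0 ` carrier (resP 1)"
    unfolding One_nat_def resP_simps resd_simps
  proof (intro equalityI subsetI)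
    fix p assume "p \<in> {p \<in> carrier F0. aug p = \<zero>\<^bsub>M\<^esub>}"
    then show "p \<in> d0 ` carrier F1" using exact_at_0 by simp
  next
    fix p assume "p \<in> d0 ` carrier F1"
    then obtain u where "u \<in> carrier F1" "p = d0 u" by blast
    then show "p \<in> {p \<in> carrier F0. aug p = \<zero>\<^bsub>M\<^esub>}" using aug_d0 hom_closed[OF d0_hom] by simp
  qed
  show "{p \<in> carrier (resP (Suc i)). resd i p = \<zero>\<^bsub>resP i\<^esub>} = resd (Suc i) ` carrier (resP (Suc (Suc i)))" for i
  proof (cases i)
    case 0
    have "{p \<in> carrier F1. d0 p = \<zero>\<^bsub>F0\<^esub>} = d1 ` carrier F0"
    proof (intro equalityI subsetI)
      fix u assume u: "u \<in> {p \<in> carrier F1. d0 p = \<zero>\<^bsub>F0\<^esub>}"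
      then obtain m where m: "\<And>t. u t \<in> FA m" using free_FA by blast
      show "u \<in> d1 ` carrier F0" by (rule exact_at_1_FA[OF _ m]) (use u in simp_all)
    next
      fix u assume "u \<in> d1 ` carrier F0"
      then obtain c where "c \<in> carrier F0" "u = d1 c" by blast
      then show "u \<in> {p \<in> carrier F1. d0 p = \<zero>\<^bsub>F0\<^esub>}" using d0_d1 hom_closed[OF d1_hom] by simp
    qed
    then show ?thesis using 0 by (simp only: resP_simps resd_simps)
  next
    case (Suc j)
    show ?thesis
    proof (cases j)
      case 0
      have "{p \<in> carrier F0. d1 p = \<zero>\<^bsub>F1\<^esub>} = {\<zero>\<^bsub>F0\<^esub>}"
      proof (intro equalityI subsetI)
        fix c assume c: "c \<in> {p \<in> carrier F0. d1 p = \<zero>\<^bsub>F1\<^esub>}"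
        then obtain m where m: "\<And>t. c t \<in> FA m" using free_FA by blast
        have "c = \<zero>\<^bsub>F0\<^esub>" by (rule d1_inj_FA[OF _ m]) (use c in simp_all)
        then show "c \<in> {\<zero>\<^bsub>F0\<^esub>}" by simp
      next
        fix c assume "c \<in> {\<zero>\<^bsub>F0\<^esub>}"
        then show "c \<in> {p \<in> carrier F0. d1 p = \<zero>\<^bsub>F1\<^esub>}"
          using hom_zero[OF d1_hom F_grp F_grp] F0.M.zero_closed by (simp del: free_mod_simps)
      qed
      then show ?thesis using Suc 0 by (simp add: resP_simps resd_simps free_mod_empty)
    next
      case (Suc l)
      then show ?thesis using \<open>i = Suc j\<close> by (simp add: resP_simps resd_simps free_mod_empty) (auto simp: resP_def)
    qed
  qed
qed

end

section \<open>The dual complex for the trivial module\<close>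

lemma eps_qid: "p \<in> qid (qform C) \<Longrightarrow> eps p = 0"
  using qid_low[of p "qform C" 0] by (metis eps_def homs_qform lookup_hc lookup_zero pos2 wlen_0)

text \<open>
  The ideal begins in degree two, so the linear part of its elements is zero.
\<close>

lemma eps_rder_qid:
  assumes "p \<in> qid (qform C)" shows "eps (rder l p) = 0"
proof -
  obtain c where "rder l p - c * ycol C l \<in> qid (qform C)" using qid_rder[OF assms] by blast
  from eps_qid[OF this] show ?thesis by (simp add: ycol_def)
qed

text \<open>
  Writing \<open>\<Sum> y\<^sub>j q\<^sub>j = \<Sum> x\<^sub>i (\<Sum> C\<^sub>i\<^sub>j q\<^sub>j)\<close> and applying the head statement gives \<open>\<Sum> C\<^sub>i\<^sub>j q\<^sub>j \<equiv> z\<^sub>i c\<close>.  A left inverse of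
  \<open>C\<close> turns the \<open>z\<^sub>i\<close> back into the \<open>x\<^sub>l\<close>.
\<close>

lemma head_invertible:
  assumes N: "N ** C = mat 1" and q: "(\<Sum>j\<in>UNIV. ycol C j * q j) \<in> qid (qform C)"
  shows "\<exists>c. \<forall>l. q l - gen l * c \<in> qid (qform C)"
proof -
  have "(\<Sum>j\<in>UNIV. ycol C j * q j) = (\<Sum>i\<in>UNIV. gen i * (\<Sum>j\<in>UNIV. cst (C $ i $ j) * q j))"
    unfolding ycol_def lf_def sum_distrib_left sum_distrib_right
    by (subst sum.swap) (simp add: mult.assoc cst_left)
  then have "(\<Sum>i\<in>UNIV. gen i * (\<Sum>j\<in>UNIV. cst (C $ i $ j) * q j)) \<in> qid (qform C)" using q by simp
  from qid_head[OF this] obtain c where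
    c: "\<And>i. (\<Sum>j\<in>UNIV. cst (C $ i $ j) * q j) - zrow C i * c \<in> qid (qform C)" by blast
  have NC: "(\<Sum>i\<in>UNIV. N $ l $ i * C $ i $ j) = (if l = j then 1 else 0)" for l j
    using arg_cong[OF N, of "\<lambda>X. X $ l $ j"] by (simp add: matrix_matrix_mult_def mat_def)
  have "q l - gen l * c \<in> qid (qform C)" for l
  proof -
    have "(\<Sum>i\<in>UNIV. cst (N $ l $ i) * (\<Sum>j\<in>UNIV. cst (C $ i $ j) * q j))
        = (\<Sum>j\<in>UNIV. cst (\<Sum>i\<in>UNIV. N $ l $ i * C $ i $ j) * q j)"
      unfolding sum_distrib_left cst_sum sum_distrib_right
      by (subst sum.swap) (simp add: cst_simps(6) mult.assoc)
    also have "\<dots> = (\<Sum>j\<in>UNIV. if l = j then q j else 0)"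
      unfolding NC by (intro sum.cong) (auto simp: cst_simps)
    finally have 1: "(\<Sum>i\<in>UNIV. cst (N $ l $ i) * (\<Sum>j\<in>UNIV. cst (C $ i $ j) * q j)) = q l" by simp
    have "(\<Sum>i\<in>UNIV. cst (N $ l $ i) * zrow C i) = (\<Sum>j\<in>UNIV. cst (\<Sum>i\<in>UNIV. N $ l $ i * C $ i $ j) * gen j)"
      unfolding zrow_def lf_def sum_distrib_left cst_sum sum_distrib_right
      by (subst sum.swap) (simp add: cst_simps(6) mult.assoc)
    also have "\<dots> = (\<Sum>j\<in>UNIV. if l = j then gen j else 0)"
      unfolding NC by (intro sum.cong) (auto simp: cst_simps)
    finally have 2: "(\<Sum>i\<in>UNIV. cst (N $ l $ i) * (zrow C i * c)) = gen l * c"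
      by (simp add: mult.assoc[symmetric] sum_distrib_right[symmetric])
    have "(\<Sum>i\<in>UNIV. cst (N $ l $ i) * ((\<Sum>j\<in>UNIV. cst (C $ i $ j) * q j) - zrow C i * c)) \<in> qid (qform C)"
      by (intro qid_sum qid_mult_left c)
    then show ?thesis by (simp add: right_diff_distrib sum_subtractf 1 2)
  qed
  then show ?thesis by blast
qed

context quad_model
begin

definition Apos :: "'a set" where "Apos = \<pi> ` {p. eps p = 0}"

lemma Apos_iff: "\<pi> p \<in> Apos \<longleftrightarrow> eps p = 0"
proof
  assume "\<pi> p \<in> Apos"
  then obtain q where "\<pi> p = \<pi> q" "eps q = 0" by (auto simp: Apos_def)
  then show "eps p = 0" using eps_qid[of "p - q" C] by (simp add: \<pi>_eq_iff)
qed (auto simp: Apos_def)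

lemma Apos_closed: "a \<in> Apos \<Longrightarrow> a \<in> carrier A" by (auto simp: Apos_def)

lemma left_regular_minus: "a \<ominus>\<^bsub>left_regular A\<^esub> b = a \<ominus> b"
  by (simp add: a_minus_def a_inv_def m_inv_def)
lemma right_regular_minus: "a \<ominus>\<^bsub>right_regular A\<^esub> b = a \<ominus> b"
  by (simp add: a_minus_def a_inv_def m_inv_def)

lemma Apos_sub:
  "sub_action A (left_regular A) Apos" "sub_action A (right_regular A) Apos"
proof -
  interpret L: left_module A "left_regular A" by (rule A.left_regular_module)
  interpret R: additive_action A "right_regular A" by (rule A.right_regular_action)
  have m: "a \<ominus> b \<in> Apos" if "a \<in> Apos" "b \<in> Apos" for a b
    using that by (auto simp: Apos_def \<pi>_minus[symmetric])
  have z: "\<zero> \<in> Apos" unfolding \<pi>_0[symmetric] Apos_iff by simp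
  have mult: "a \<otimes> b \<in> Apos" "b \<otimes> a \<in> Apos" if "a \<in> carrier A" "b \<in> Apos" for a b
    using that by (auto simp: Apos_def \<pi>_mult[symmetric] elim!: \<pi>_cases)
  have "subgroup Apos (add_monoid (left_regular A))"
    by (rule L.M.subgroupI_minus) (use m z in \<open>auto simp: Apos_closed left_regular_minus\<close>)
  then show "sub_action A (left_regular A) Apos"
    using mult by (intro sub_action.intro L.additive_action_axioms sub_action_axioms.intro) simp_all
  have "subgroup Apos (add_monoid (right_regular A))"
    by (rule R.M.subgroupI_minus) (use m z in \<open>auto simp: Apos_closed right_regular_minus\<close>)
  then show "sub_action A (right_regular A) Apos"
    using mult by (intro sub_action.intro R.additive_action_axioms sub_action_axioms.intro) simp_all
qed

lemma Apos_gx: "a \<in> carrier A \<Longrightarrow> a \<otimes> gx i \<in> Apos"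
  by (elim \<pi>_cases) (simp add: \<pi>_mult[symmetric] Apos_iff)

lemma one_not_Apos: "\<one> \<notin> Apos" unfolding \<pi>_one[symmetric] Apos_iff by simp

end

text \<open>
  A module with a basis of one element that is annihilated by all \<open>x\<^sub>j\<close> is a copy of the trivial module \<open>k\<close>.  The
  isomorphic copies are treated together because global dimension and \<open>Ext\<close> use different types.
\<close>

locale quad_triv = quad_module A \<pi> C M S y ix ixj ixs
  for A :: "('a, 'x) ring_scheme" (structure) and \<pi> :: "('n::finite, 'k::field) fralg \<Rightarrow> 'a" and C
    and M :: "('a, 'm) module" and S :: "'s set" and y ix ixj ixs +
  fixes s0 :: 's
  assumes S_eq: "S = {s0}" and triv: "gx j \<odot>\<^bsub>M\<^esub> y s0 = \<zero>\<^bsub>M\<^esub>"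
begin

sublocale Res: resolution A M resP resd aug
  by (rule resolution.intro[OF resolution Md.left_module_axioms])

abbreviation "e0 \<equiv> fbasis A s0"
abbreviation "e1 j \<equiv> fbasis A (ix j s0)"

lemma s0: "s0 \<in> S" by (simp add: S_eq)
lemma e0: "e0 \<in> carrier F0" by (rule fbasis_closed[OF s0])
lemma e1: "e1 j \<in> carrier F1" by (rule fbasis_closed[OF ix_S1[OF s0]])
lemma S_iff: "s \<in> S \<longleftrightarrow> s = s0" by (simp add: S_eq)
lemma S1_eq: "S1 = range (\<lambda>j. ix j s0)" using ix_S1[OF s0] by (auto simp: S_iff elim!: S1_cases)

lemma pi_lin_triv: "\<pi> (lf v) \<odot>\<^bsub>M\<^esub> y s0 = \<zero>\<^bsub>M\<^esub>"
proof -
  have y: "y s0 \<in> carrier M" by (rule y_closed[OF s0])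
  have "\<pi> (lf v) = (\<Oplus>j\<in>UNIV. eta (v j) \<otimes> gx j)" by (simp add: lf_def \<pi>_sum \<pi>_mult eta_def)
  then have "\<pi> (lf v) \<odot>\<^bsub>M\<^esub> y s0 = (\<Oplus>\<^bsub>M\<^esub>j\<in>UNIV. (eta (v j) \<otimes> gx j) \<odot>\<^bsub>M\<^esub> y s0)"
    using Md.smult_finsum_left[OF y, of "\<lambda>j. eta (v j) \<otimes> gx j" UNIV] by simp
  also have "\<dots> = (\<Oplus>\<^bsub>M\<^esub>j\<in>(UNIV::'n set). \<zero>\<^bsub>M\<^esub>)"
    by (intro Md.M.finsum_cong') (simp_all add: Md.smult_assoc[OF eta_closed \<pi>_closed y] triv Md.act_zero)
  finally show ?thesis by (simp add: Md.M.finsum_zero)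
qed

lemma ehat_zero: "ehat \<zero>\<^bsub>M\<^esub> = \<zero>\<^bsub>F0\<^esub>"
  by (rule hom_zero[OF ehat_hom Md.M.abelian_group_axioms F_grp])

lemma d0_e1: "d0 (e1 j) = gx j \<odot>\<^bsub>F0\<^esub> e0"
proof -
  have c: "gx j \<odot>\<^bsub>F0\<^esub> e0 \<in> carrier F0" by (rule F0.smult_closed[OF \<pi>_closed e0])
  have "gx j \<odot>\<^bsub>F0\<^esub> e0 \<ominus>\<^bsub>F0\<^esub> \<zero>\<^bsub>F0\<^esub> = gx j \<odot>\<^bsub>F0\<^esub> e0"
    using F0.M.minus_cancel_mid[OF c F0.M.zero_closed] F0.M.r_zero[OF F0.M.minus_closed[OF c F0.M.zero_closed]]
    by (simp only:)
  then show ?thesis unfolding d0_fbasis[OF s0] triv ehat_zero .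
qed

lemma d1_e0: "d1 e0 = (\<Oplus>\<^bsub>F1\<^esub>j\<in>UNIV. cy j \<odot>\<^bsub>F1\<^esub> e1 j)"
proof -
  have D: "D1 e0 \<in> carrier F1" by (rule hom_closed[OF D1_hom e0])
  have "l1 s0 = (\<Oplus>\<^bsub>F1\<^esub>i\<in>(UNIV::'n set). \<zero>\<^bsub>F1\<^esub>)"
    unfolding l1_def zrow_def pi_lin_triv ehat_zero hom_zero[OF shift_hom F_grp F_grp] ..
  then have "l1 s0 = \<zero>\<^bsub>F1\<^esub>" by (simp only: F1.M.finsum_zero)
  then have "d1 e0 = D1 e0" unfolding d1_fbasis[OF s0] using F1.M.r_zero[OF D] by (simp only:)
  also have "\<dots> = (\<Oplus>\<^bsub>F1\<^esub>j\<in>UNIV. cy j \<odot>\<^bsub>F1\<^esub> e1 j)"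
  proof (rule ext)
    fix t
    have c: "cy j \<odot>\<^bsub>F1\<^esub> e1 j \<in> carrier F1" for j by (rule F1.smult_closed[OF \<pi>_closed e1])
    have "(\<Oplus>\<^bsub>F1\<^esub>j\<in>UNIV. cy j \<odot>\<^bsub>F1\<^esub> e1 j) t = (\<Oplus>j\<in>UNIV. (cy j \<odot>\<^bsub>F1\<^esub> e1 j) t)"
      using c by (intro A.free_mod_finsum_apply) auto
    also have "\<dots> = (\<Oplus>j\<in>UNIV. if ixj t = j then (if t \<in> S1 then cy j else \<zero>) else \<zero>)"
    proof (intro A.finsum_cong')
      fix j
      have "t = ix j s0 \<longleftrightarrow> t \<in> S1 \<and> ixj t = j" by (auto simp: S1_eq ixj)
      then show "(cy j \<odot>\<^bsub>F1\<^esub> e1 j) t = (if ixj t = j then (if t \<in> S1 then cy j else \<zero>) else \<zero>)"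
        by (auto simp: fbasis_def)
    qed auto
    also have "\<dots> = (if t \<in> S1 then cy (ixj t) else \<zero>)" by (rule A.finsum_singleton) auto
    also have "\<dots> = D1 e0 t" by (auto simp: D1_def fbasis_def S1_eq ixs)
    finally show "D1 e0 t = (\<Oplus>\<^bsub>F1\<^esub>j\<in>UNIV. cy j \<odot>\<^bsub>F1\<^esub> e1 j) t" by (rule sym)
  qed
  finally show ?thesis .
qed

sublocale LR: lmod A "left_regular A" by (rule lmod.intro[OF A.left_regular_module])

abbreviation "H0 \<equiv> hom_to_ring A F0"
abbreviation "H1 \<equiv> hom_to_ring A F1"

lemma dual_free_eqI:
  assumes "g \<in> carrier (hom_to_ring A (free_mod A X))" "h \<in> carrier (hom_to_ring A (free_mod A X))"
    and "\<And>s. s \<in> X \<Longrightarrow> g (fbasis A s) = h (fbasis A s)"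
  shows "g = h"
proof (rule extensionalityI[of _ "carrier (free_mod A X)"])
  show "g u = h u" if "u \<in> carrier (free_mod A X)" for u
    by (rule LR.free_hom_eqI[of g X h u, OF _ _ assms(3) that]) (use assms(1,2) in \<open>simp_all add: hom_to_ring_carrier\<close>)
qed (use assms(1,2) in \<open>simp_all add: hom_to_ring_carrier\<close>)

text \<open>
  The homomorphism to \<open>A\<close> with prescribed values on the basis.  Through these values, the dual complex becomes
  \<open>A \<rightarrow> A\<^sup>n \<rightarrow> A\<close> with maps \<open>a \<mapsto> (x\<^sub>j a)\<^sub>j\<close> and \<open>(b\<^sub>j) \<mapsto> \<Sum> y\<^sub>j b\<^sub>j\<close>.
\<close>

definition dualv :: "'t set \<Rightarrow> ('t \<Rightarrow> 'a) \<Rightarrow> ('t \<Rightarrow> 'a) \<Rightarrow> 'a"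
  where "dualv X v = restrict (lincomb A (left_regular A) v) (carrier (free_mod A X))"

lemma dualv:
  assumes "v \<in> X \<rightarrow> carrier A"
  shows "dualv X v \<in> carrier (hom_to_ring A (free_mod A X))" "s \<in> X \<Longrightarrow> dualv X v (fbasis A s) = v s"
proof -
  have v: "v \<in> X \<rightarrow> carrier (left_regular A)" using assms by simp
  show "dualv X v \<in> carrier (hom_to_ring A (free_mod A X))"
    unfolding dualv_def by (rule dualI[OF F_act LR.lincomb_hom[OF v]])
  show "dualv X v (fbasis A s) = v s" if "s \<in> X"
    unfolding dualv_def using LR.lincomb_fbasis[OF v that] A.fbasis_closed[OF that] by simp
qed

lemma d1_eval:
  assumes "h \<in> carrier H1" shows "h (d1 e0) = (\<Oplus>j\<in>UNIV. cy j \<otimes> h (e1 j))"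
proof -
  have h: "h \<in> module_homs A F1 (left_regular A)" using assms by (simp add: hom_to_ring_carrier)
  have c: "cy j \<odot>\<^bsub>F1\<^esub> e1 j \<in> carrier F1" for j by (rule F1.smult_closed[OF \<pi>_closed e1])
  have "h (d1 e0) = (\<Oplus>\<^bsub>left_regular A\<^esub>j\<in>UNIV. h (cy j \<odot>\<^bsub>F1\<^esub> e1 j))"
    unfolding d1_e0 using c by (intro hom_finsum[OF h F_grp LR_grp]) blast
  also have "\<dots> = (\<Oplus>\<^bsub>left_regular A\<^esub>j\<in>UNIV. cy j \<otimes> h (e1 j))"
    by (simp only: hom_act[OF h \<pi>_closed e1] left_regular_simps(4))
  finally show ?thesis by (simp only: left_regular_finsum)
qed

lemma d0_eval: "h \<in> carrier H0 \<Longrightarrow> h (d0 (e1 j)) = gx j \<otimes> h e0"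
  unfolding d0_e1 by (rule dualD(3)[OF _ \<pi>_closed e0])

text \<open>
  \<open>x\<^sub>j\<close> is not a left zerodivisor.
\<close>

lemma H0_vanish: "Res.Z 0 \<subseteq> Res.B 0"
proof
  fix h assume "h \<in> Res.Z 0"
  then have h: "h \<in> carrier H0" and 0: "\<And>p. p \<in> carrier F1 \<Longrightarrow> h (d0 p) = \<zero>"
    by (simp_all add: Res.Z_iff resP_simps resd_simps)
  obtain j :: 'n where True by blast
  have "\<pi> (lf (\<lambda>l. if l = j then 1 else 0)) = gx j"
  proof -
    have "lf (\<lambda>l. if l = j then 1 else 0) = (gen j :: ('n, 'k) fralg)"
      by (simp add: lf_def if_distrib[of cst] cst_simps if_distrib[of "\<lambda>x. x * _"] cong: if_cong)
    then show ?thesis by simp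
  qed
  then have "\<pi> (lf (\<lambda>l. if l = j then 1 else 0)) \<otimes> h e0 = \<zero>"
    using 0[OF e1[of j]] d0_eval[OF h] by simp
  then have "h e0 = \<zero>" using nzd_left[of "\<lambda>l. if l = j then 1 else 0" j] dualD(1)[OF h e0] by simp
  moreover have "\<zero>\<^bsub>H0\<^esub> e0 = \<zero>" using e0 by (simp add: hom_to_ring_simps)
  ultimately have "h = \<zero>\<^bsub>H0\<^esub>"
    using dual_free_eqI[OF h abelian_monoid.zero_closed[OF abelian_group.axioms(1)[OF Res.H_grp[of 0, unfolded resP_simps]]]]
    by (simp add: S_iff)
  then show "h \<in> Res.B 0" by (simp add: Res.B_0 resP_simps)
qed

lemma H_high_vanish: "Res.Z (Suc (Suc (Suc n))) \<subseteq> Res.B (Suc (Suc (Suc n)))"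
proof
  fix h assume "h \<in> Res.Z (Suc (Suc (Suc n)))"
  then have h: "h \<in> carrier (hom_to_ring A (free_mod A {}))" by (simp add: Res.Z_iff resP_simps)
  have "h = \<zero>\<^bsub>Res.H (Suc (Suc (Suc n)))\<^esub>"
    using dual_free_eqI[OF h abelian_monoid.zero_closed[OF abelian_group.axioms(1)[OF Res.H_grp[of "Suc (Suc (Suc n))", unfolded resP_simps]]]]
    by (simp add: resP_simps)
  then show "h \<in> Res.B (Suc (Suc (Suc n)))" using subgroup.one_closed[OF Res.B_subgroup] by simp
qed

text \<open>
  A cocycle is a family with \<open>\<Sum> y\<^sub>j b\<^sub>j = 0\<close>; for invertible \<open>C\<close> it has the form \<open>b\<^sub>j = x\<^sub>j c\<close>, the coboundary of \<open>c\<close>.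
\<close>

lemma H1_vanish:
  assumes N: "N ** C = mat 1"
  shows "Res.Z (Suc 0) \<subseteq> Res.B (Suc 0)"
proof
  fix h assume "h \<in> Res.Z (Suc 0)"
  then have h: "h \<in> carrier H1" and 0: "\<And>p. p \<in> carrier F0 \<Longrightarrow> h (d1 p) = \<zero>"
    by (simp_all add: Res.Z_iff resP_simps resd_simps)
  have "\<forall>j. \<exists>p. h (e1 j) = \<pi> p" using dualD(1)[OF h e1] \<pi>_cases by metis
  then obtain q where q: "\<And>j. h (e1 j) = \<pi> (q j)" by metis
  have "(\<Oplus>j\<in>UNIV. cy j \<otimes> h (e1 j)) = \<zero>" using 0[OF e0] d1_eval[OF h] by simp
  then have "(\<Sum>j\<in>UNIV. ycol C j * q j) \<in> qid (qform C)"
    by (simp add: \<pi>_zero_iff[symmetric] \<pi>_sum \<pi>_mult q)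
  from head_invertible[OF N this] obtain c where "\<And>l. q l - gen l * c \<in> qid (qform C)" by blast
  then have hq: "h (e1 l) = gx l \<otimes> \<pi> c" for l by (simp add: q \<pi>_mult[symmetric] \<pi>_eq_iff)
  define g where "g = dualv S (\<lambda>_. \<pi> c)"
  have g: "g \<in> carrier H0" "g e0 = \<pi> c" unfolding g_def using dualv[of "\<lambda>_. \<pi> c" S] s0 by auto
  have dg: "dual_map F1 d0 g \<in> carrier H1"
    by (rule hom_closed[OF dual_map_hom[OF left_module_free_mod left_module_free_mod d0_hom] g(1)])
  have "h = dual_map F1 d0 g"
  proof (rule dual_free_eqI[OF h dg])
    fix t assume "t \<in> S1"
    then obtain j where t: "t = ix j s0" by (auto simp: S1_eq)
    show "h (fbasis A t) = dual_map F1 d0 g (fbasis A t)"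
      using e1[of j] by (simp add: t dual_map_def d0_eval[OF g(1)] g(2) hq)
  qed
  then show "h \<in> Res.B (Suc 0)" using g(1) by (auto simp: Res.B_Suc resP_simps resd_simps)
qed

lemma Z2: "Res.Z (Suc (Suc 0)) = carrier H0"
proof -
  have "h (\<lambda>_. \<zero>) = \<zero>" if "h \<in> carrier H0" for h
    using Res.zero_apply[of h 0] that by (simp add: resP_simps)
  then show ?thesis by (auto simp: Res.Z_iff resP_simps resd_simps)
qed

lemma B2_iff: assumes h: "h \<in> carrier H0"
  shows "h \<in> Res.B (Suc (Suc 0)) \<longleftrightarrow> (\<exists>c. (\<forall>j. c j \<in> carrier A) \<and> h e0 = (\<Oplus>j\<in>UNIV. cy j \<otimes> c j))"
proof
  assume "h \<in> Res.B (Suc (Suc 0))"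
  then obtain g where g: "g \<in> carrier H1" "h = dual_map F0 d1 g"
    by (auto simp: Res.B_Suc resP_simps resd_simps)
  have "h e0 = (\<Oplus>j\<in>UNIV. cy j \<otimes> g (e1 j))" using e0 by (simp add: g(2) dual_map_def d1_eval[OF g(1)])
  then show "\<exists>c. (\<forall>j. c j \<in> carrier A) \<and> h e0 = (\<Oplus>j\<in>UNIV. cy j \<otimes> c j)"
    using dualD(1)[OF g(1) e1] by (intro exI[of _ "\<lambda>j. g (e1 j)"]) auto
next
  assume "\<exists>c. (\<forall>j. c j \<in> carrier A) \<and> h e0 = (\<Oplus>j\<in>UNIV. cy j \<otimes> c j)"
  then obtain c where c: "\<And>j. c j \<in> carrier A" "h e0 = (\<Oplus>j\<in>UNIV. cy j \<otimes> c j)" by blast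
  define g where "g = dualv S1 (\<lambda>t. c (ixj t))"
  have v: "(\<lambda>t. c (ixj t)) \<in> S1 \<rightarrow> carrier A" using c(1) by auto
  have g: "g \<in> carrier H1" "g (e1 j) = c j" for j
    unfolding g_def using dualv[OF v] ix_S1[OF s0] by (auto simp: ixj)
  have dg: "dual_map F0 d1 g \<in> carrier H0"
    by (rule hom_closed[OF dual_map_hom[OF left_module_free_mod left_module_free_mod d1_hom] g(1)])
  have "h = dual_map F0 d1 g"
  proof (rule dual_free_eqI[OF h dg])
    fix t assume "t \<in> S"
    then show "h (fbasis A t) = dual_map F0 d1 g (fbasis A t)"
      using e0 by (simp add: S_iff dual_map_def d1_eval[OF g(1)] g(2) c(2))
  qed
  then show "h \<in> Res.B (Suc (Suc 0))" using g(1) by (auto simp: Res.B_Suc resP_simps resd_simps)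
qed

lemma B2_Apos: assumes "h \<in> carrier H0" "h \<in> Res.B (Suc (Suc 0))" shows "h e0 \<in> Apos"
proof -
  obtain c where c: "\<And>j. c j \<in> carrier A" "h e0 = (\<Oplus>j\<in>UNIV. cy j \<otimes> c j)"
    using assms B2_iff by blast
  have "\<forall>j. \<exists>p. c j = \<pi> p" using c(1) \<pi>_cases by metis
  then obtain q where q: "\<And>j. c j = \<pi> (q j)" by metis
  have "h e0 = \<pi> (\<Sum>j\<in>UNIV. ycol C j * q j)" using c(2) by (simp add: q \<pi>_sum \<pi>_mult)
  then show ?thesis by (simp add: Apos_iff eps_sum ycol_def)
qed

lemma H2_nonzero: "\<not> Res.Z (Suc (Suc 0)) \<subseteq> Res.B (Suc (Suc 0))"
proof
  assume *: "Res.Z (Suc (Suc 0)) \<subseteq> Res.B (Suc (Suc 0))"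
  have "dualv S (\<lambda>_. \<one>) \<in> carrier H0" "dualv S (\<lambda>_. \<one>) e0 = \<one>"
    using dualv[of "\<lambda>_. \<one>" S] s0 by auto
  then show False using B2_Apos[of "dualv S (\<lambda>_. \<one>)"] * one_not_Apos by (auto simp: Z2)
qed

text \<open>
  A right inverse of \<open>C\<close> expresses every \<open>x\<^sub>i\<close> through the columns \<open>y\<^sub>j\<close>.
\<close>

lemma Apos_span:
  assumes N: "C ** N = mat 1" and a: "a \<in> Apos"
  shows "\<exists>c. (\<forall>j. c j \<in> carrier A) \<and> a = (\<Oplus>j\<in>UNIV. cy j \<otimes> c j)"
proof -
  obtain p where p: "eps p = 0" "a = \<pi> p" using a by (auto simp: Apos_def)
  have CN: "(\<Sum>j\<in>UNIV. C $ i $ j * N $ j $ l) = (if i = l then 1 else 0)" for i l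
    using arg_cong[OF N, of "\<lambda>X. X $ i $ l"] by (simp add: matrix_matrix_mult_def mat_def)
  define q where "q j = (\<Sum>l\<in>UNIV. cst (N $ j $ l) * lder l p)" for j
  have "(\<Sum>j\<in>UNIV. ycol C j * q j) = (\<Sum>i\<in>UNIV. \<Sum>l\<in>UNIV. gen i * (cst (\<Sum>j\<in>UNIV. C $ i $ j * N $ j $ l) * lder l p))"
  proof -
    have "(\<Sum>j\<in>UNIV. ycol C j * q j) = (\<Sum>j\<in>UNIV. \<Sum>l\<in>UNIV. \<Sum>i\<in>UNIV. gen i * (cst (C $ i $ j * N $ j $ l) * lder l p))"
      unfolding ycol_def lf_def q_def sum_distrib_right sum_distrib_left
      by (intro sum.cong refl) (simp only: cst_simps(6) mult.assoc cst_left[of "gen _"])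
    also have "\<dots> = (\<Sum>l\<in>UNIV. \<Sum>j\<in>UNIV. \<Sum>i\<in>UNIV. gen i * (cst (C $ i $ j * N $ j $ l) * lder l p))"
      by (rule sum.swap)
    also have "\<dots> = (\<Sum>l\<in>UNIV. \<Sum>i\<in>UNIV. \<Sum>j\<in>UNIV. gen i * (cst (C $ i $ j * N $ j $ l) * lder l p))"
      by (intro sum.cong refl sum.swap)
    also have "\<dots> = (\<Sum>i\<in>UNIV. \<Sum>l\<in>UNIV. \<Sum>j\<in>UNIV. gen i * (cst (C $ i $ j * N $ j $ l) * lder l p))"
      by (rule sum.swap)
    finally show ?thesis by (simp add: cst_sum sum_distrib_left sum_distrib_right)
  qed
  also have "\<dots> = (\<Sum>i\<in>UNIV. \<Sum>l\<in>UNIV. if i = l then gen i * lder l p else 0)"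
    unfolding CN by (intro sum.cong refl) (auto simp: cst_simps)
  also have "\<dots> = (\<Sum>i\<in>UNIV. gen i * lder i p)" by simp
  also have "\<dots> = p" using lder_decomp[of p] p(1) by (simp add: cst_simps)
  finally have "a = (\<Oplus>j\<in>UNIV. cy j \<otimes> \<pi> (q j))" using p(2) by (simp add: \<pi>_sum[symmetric] \<pi>_mult[symmetric])
  then show ?thesis by (intro exI[of _ "\<lambda>j. \<pi> (q j)"]) simp
qed

text \<open>
  Evaluation at the basis element identifies the second cohomology with \<open>A / \<Sum> y\<^sub>j A\<close>, and \<open>\<Sum> y\<^sub>j A = A\<^sub>+\<close>.
\<close>

lemma H2_iso:
  assumes N: "C ** N = mat 1"
  shows "module_isomorphic A (hom_cohomology A resP resd 2) (quotient_module (right_regular A) Apos)"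
  unfolding hom_cohomology_def numeral_2_eq_2
proof (rule module_isomorphic_quotients[OF Res.cohomology_sub_action Apos_sub(2)])
  let ?Z = "Res.H (Suc (Suc 0))\<lparr>carrier := Res.Z (Suc (Suc 0))\<rparr>"
  have Hc: "Res.H (Suc (Suc 0)) = H0" by (simp add: resP_simps)
  show 1: "(\<lambda>h. h e0) \<in> module_homs A ?Z (right_regular A)"
    by (rule module_homsI) (simp_all add: Z2 Hc dualD(1)[OF _ e0] hom_to_ring_simps e0)
  define b where "b a = dualv S (\<lambda>_. a)" for a
  have b: "b a \<in> carrier H0" "b a e0 = a" if "a \<in> carrier A" for a
    unfolding b_def using dualv[of "\<lambda>_. a" S] that s0 by auto
  interpret H: additive_action A H0 by (rule dual_action[OF left_module_free_mod])
  have eqI: "g = h" if "g \<in> carrier H0" "h \<in> carrier H0" "g e0 = h e0" for g h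
    by (rule dual_free_eqI[OF that(1,2)]) (use that(3) in \<open>simp add: S_iff\<close>)
  show 2: "b \<in> module_homs A (right_regular A) ?Z"
  proof (rule module_homsI)
    show "b p \<in> carrier ?Z" if "p \<in> carrier (right_regular A)" for p using b that by (simp add: Z2)
    show "b (p \<oplus>\<^bsub>right_regular A\<^esub> q) = b p \<oplus>\<^bsub>?Z\<^esub> b q"
      if "p \<in> carrier (right_regular A)" "q \<in> carrier (right_regular A)" for p q
    proof -
      have pq: "p \<in> carrier A" "q \<in> carrier A" using that by auto
      have "b (p \<oplus> q) = b p \<oplus>\<^bsub>H0\<^esub> b q"
        by (rule eqI[OF b(1) H.M.a_closed[OF b(1) b(1)]]) (use pq b e0 in \<open>simp_all add: hom_to_ring_simps(2)\<close>)
      then show ?thesis by (simp add: Hc)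
    qed
    show "b (a \<odot>\<^bsub>right_regular A\<^esub> p) = a \<odot>\<^bsub>?Z\<^esub> b p"
      if "a \<in> carrier A" "p \<in> carrier (right_regular A)" for a p
    proof -
      have p: "p \<in> carrier A" using that by auto
      have "b (p \<otimes> a) = a \<odot>\<^bsub>H0\<^esub> b p"
        by (rule eqI[OF b(1) H.act_closed[OF _ b(1)]]) (use p that b e0 in \<open>simp_all add: hom_to_ring_simps(3)\<close>)
      then show ?thesis by (simp add: Hc)
    qed
  qed
  have BZ: "h \<in> carrier H0" if "h \<in> Res.B (Suc (Suc 0))" for h using Res.B_sub_Z that Z2 by blast
  show "h e0 \<in> Apos" if "h \<in> Res.B (Suc (Suc 0))" for h using B2_Apos BZ that by blast
  show "b a \<in> Res.B (Suc (Suc 0))" if "a \<in> Apos" for a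
    using B2_iff[OF b(1)] b(2) Apos_span[OF N that] Apos_closed[OF that] by simp
  show "b (z e0) \<ominus>\<^bsub>?Z\<^esub> z \<in> Res.B (Suc (Suc 0))" if "z \<in> carrier ?Z" for z
  proof -
    have z: "z \<in> carrier H0" using that by (simp add: Z2)
    have "b (z e0) = z" using b[OF dualD(1)[OF z e0]] z by (intro eqI) auto
    then have "b (z e0) \<ominus>\<^bsub>?Z\<^esub> z = \<zero>\<^bsub>Res.H (Suc (Suc 0))\<^esub>"
      using that abelian_group.minus_eq_zero_iff[OF abelian_group_subset[OF Res.H_grp Res.Z_subgroup], of z "Suc (Suc 0)" z] by simp
    then show ?thesis using subgroup.one_closed[OF Res.B_subgroup] by simp
  qed
  show "b z e0 \<ominus>\<^bsub>right_regular A\<^esub> z \<in> Apos" if "z \<in> carrier (right_regular A)" for z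
  proof -
    have z: "z \<in> carrier A" using that by simp
    have "z \<ominus>\<^bsub>right_regular A\<^esub> z = \<zero>"
      using abelian_group.minus_eq_zero_iff[of "right_regular A" z z] A.right_regular_action z
      by (simp add: additive_action_def)
    then show ?thesis using b(2)[OF z] Apos_iff[of 0] by (simp add: \<pi>_0)
  qed
qed

text \<open>
  In \<open>A / A\<^sub>+\<close> every \<open>x\<^sub>i\<close> acts as zero, so under an isomorphism \<open>x\<^sub>i\<close> annihilates the class of \<open>1\<close> in
  \<open>A / \<Sum> y\<^sub>j A\<close>.  Thus \<open>x\<^sub>i = \<Sum> y\<^sub>j c\<^sub>i\<^sub>j\<close> in \<open>A\<close>, and the linear parts of both sides say that the constant terms of
  the \<open>c\<^sub>i\<^sub>j\<close> form a right inverse of \<open>C\<close>.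
\<close>

lemma H2_iso_imp_invertible:
  assumes "module_isomorphic A (hom_cohomology A resP resd 2) (quotient_module (right_regular A) Apos)"
  shows "invertible C"
proof -
  let ?H = "hom_cohomology A resP resd 2"
  let ?K = "Res.H (Suc (Suc 0))\<lparr>carrier := Res.Z (Suc (Suc 0))\<rparr>"
  let ?Q = "quotient_module (right_regular A) Apos"
  let ?B = "Res.B (Suc (Suc 0))"
  interpret K: sub_action A ?K ?B by (rule Res.cohomology_sub_action)
  interpret Q: sub_action A "right_regular A" Apos by (rule Apos_sub(2))
  have Heq: "?H = quotient_module ?K ?B" by (simp add: hom_cohomology_def numeral_2_eq_2)
  interpret Ha: additive_action A ?H unfolding Heq by (rule K.quot_action)
  interpret Qa: additive_action A ?Q by (rule Q.quot_action)
  obtain g where g: "g \<in> module_homs A ?H ?Q" "bij_betw g (carrier ?H) (carrier ?Q)"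
    using assms unfolding module_isomorphic_def by blast
  have kill: "gx i \<odot>\<^bsub>?Q\<^esub> X = \<zero>\<^bsub>?Q\<^esub>" if "X \<in> carrier ?Q" for X i
    using that
  proof (rule Q.quot_carrierE)
    fix m assume m: "m \<in> carrier (right_regular A)" "X = Apos +>\<^bsub>right_regular A\<^esub> m"
    have "m \<otimes> gx i \<in> Apos" using m(1) by (simp add: Apos_gx)
    then show ?thesis
      using Q.quot_act[OF \<pi>_closed m(1)] m Q.coset_eq_zero_iff[of "m \<otimes> gx i"] by (simp add: Q.quot_zero)
  qed
  have one: "dualv S (\<lambda>_. \<one>) \<in> carrier H0" "dualv S (\<lambda>_. \<one>) e0 = \<one>"
    using dualv[of "\<lambda>_. \<one>" S] s0 by auto
  have "\<exists>c. (\<forall>j. c j \<in> carrier A) \<and> gx i = (\<Oplus>j\<in>UNIV. cy j \<otimes> c j)" for i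
  proof -
    have z: "dualv S (\<lambda>_. \<one>) \<in> carrier ?K" using one by (simp add: Z2)
    define X where "X = ?B +>\<^bsub>?K\<^esub> dualv S (\<lambda>_. \<one>)"
    have X: "X \<in> carrier ?H" unfolding Heq X_def by (rule K.coset_closed[OF z])
    have gX: "gx i \<odot>\<^bsub>?H\<^esub> X \<in> carrier ?H" by (rule Ha.act_closed[OF \<pi>_closed X])
    have "g (gx i \<odot>\<^bsub>?H\<^esub> X) = g \<zero>\<^bsub>?H\<^esub>"
      using hom_act[OF g(1) \<pi>_closed X] kill[OF hom_closed[OF g(1) X]]
        hom_zero[OF g(1) Ha.abelian_group_axioms Qa.abelian_group_axioms] by simp
    then have "gx i \<odot>\<^bsub>?H\<^esub> X = \<zero>\<^bsub>?H\<^esub>"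
      using g(2) gX Ha.M.zero_closed by (auto simp: bij_betw_def inj_on_def)
    then have "?B +>\<^bsub>?K\<^esub> (gx i \<odot>\<^bsub>?K\<^esub> dualv S (\<lambda>_. \<one>)) = ?B"
      using K.quot_act[OF \<pi>_closed z] unfolding Heq X_def K.quot_zero by simp
    then have B: "gx i \<odot>\<^bsub>?K\<^esub> dualv S (\<lambda>_. \<one>) \<in> ?B"
      using K.coset_eq_zero_iff[OF K.act_closed[OF \<pi>_closed z]] by simp
    have eq: "gx i \<odot>\<^bsub>?K\<^esub> dualv S (\<lambda>_. \<one>) = gx i \<odot>\<^bsub>H0\<^esub> dualv S (\<lambda>_. \<one>)" by (simp add: resP_simps)
    have c: "gx i \<odot>\<^bsub>H0\<^esub> dualv S (\<lambda>_. \<one>) \<in> carrier H0" using K.act_closed[OF \<pi>_closed z] by (simp add: Z2 resP_simps)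
    have "(gx i \<odot>\<^bsub>H0\<^esub> dualv S (\<lambda>_. \<one>)) e0 = gx i" using e0 one(2) by (simp add: hom_to_ring_simps)
    then show ?thesis using B2_iff[OF c] B unfolding eq by simp
  qed
  then have "\<forall>i. \<exists>c. (\<forall>j. c j \<in> carrier A) \<and> gx i = (\<Oplus>j\<in>UNIV. cy j \<otimes> c j)" by blast
  then obtain c where c: "\<And>i j. c i j \<in> carrier A" "\<And>i. gx i = (\<Oplus>j\<in>UNIV. cy j \<otimes> c i j)" by metis
  have "\<forall>i j. \<exists>p. c i j = \<pi> p" using c(1) \<pi>_cases by metis
  then obtain q where q: "\<And>i j. c i j = \<pi> (q i j)" by metis
  have I: "gen i - (\<Sum>j\<in>UNIV. ycol C j * q i j) \<in> qid (qform C)" for i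
    using c(2)[of i] by (simp add: q \<pi>_eq_iff[symmetric] \<pi>_sum \<pi>_mult)
  have "(\<Sum>j\<in>UNIV. C $ l $ j * eps (q i j)) = (if l = i then 1 else 0)" for i l
  proof -
    have "eps (rder l (\<Sum>j\<in>UNIV. ycol C j * q i j)) = (\<Sum>j\<in>UNIV. C $ l $ j * eps (q i j))"
      by (simp add: rder_sum eps_sum rder_mult ycol_def mult.commute)
    moreover have "eps (rder l (gen i :: ('n, 'k) fralg)) = (if l = i then 1 else 0)" by simp
    ultimately show ?thesis using eps_rder_qid[OF I[of i], of l] by (simp split: if_splits)
  qed
  then have "C ** (\<chi> j i. eps (q i j)) = mat 1"
    by (simp add: matrix_matrix_mult_def mat_def vec_eq_iff)
  then show ?thesis unfolding invertible_def using matrix_left_right_inverse by blast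
qed

end

section \<open>Global dimension and the Gorenstein property\<close>

text \<open>
  The resolving modules in \<open>proj_dim\<close> live on \<open>nat \<times> 'a \<times> 'm \<Rightarrow> 'a\<close>, so the index \<open>x\<^sub>j \<otimes> y\<^sub>s\<close> must again be an element of
  \<open>nat \<times> 'a \<times> 'm\<close>; the number of \<open>j\<close> is paired into the first component.
\<close>

definition code_nat :: "'n::finite \<Rightarrow> nat" where "code_nat = (SOME f. inj f)"

lemma inj_code_nat: "inj (code_nat :: 'n::finite \<Rightarrow> nat)"
proof -
  obtain n and f :: "'n \<Rightarrow> nat" where "inj f"
    using finite_imp_inj_to_nat_seg[OF finite_class.finite_UNIV] by blast
  then have "\<exists>f :: 'n \<Rightarrow> nat. inj f" by blast
  then show ?thesis unfolding code_nat_def by (rule someI_ex)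
qed

definition cix :: "'n::finite \<Rightarrow> nat \<times> 'a \<times> 'm \<Rightarrow> nat \<times> 'a \<times> 'm"
  where "cix j t = (prod_encode (code_nat j, fst t), snd t)"
definition cixj :: "nat \<times> 'a \<times> 'm \<Rightarrow> 'n::finite"
  where "cixj t = inv_into UNIV code_nat (fst (prod_decode (fst t)))"
definition cixs :: "nat \<times> 'a \<times> 'm \<Rightarrow> nat \<times> 'a \<times> 'm"
  where "cixs t = (snd (prod_decode (fst t)), snd t)"

lemma cix: "cixj (cix j t) = j" "cixs (cix j t) = t"
  by (simp_all add: cix_def cixj_def cixs_def inj_code_nat)

text \<open>
  The trivial module \<open>A / A\<^sub>+\<close> is a set of cosets, whereas \<open>left_global_dim\<close> ranges over modules on a sum type.
\<close>

definition transport_Inr :: "('a, 'm) module \<Rightarrow> ('a, 'u + 'm) module"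
  where "transport_Inr M = \<lparr>carrier = Inr ` carrier M, mult = undefined, one = undefined, zero = Inr \<zero>\<^bsub>M\<^esub>,
    add = (\<lambda>x y. Inr (projr x \<oplus>\<^bsub>M\<^esub> projr y)), smult = (\<lambda>a x. Inr (a \<odot>\<^bsub>M\<^esub> projr x))\<rparr>"

lemma transport_Inr_module:
  assumes "left_module A M" shows "left_module A (transport_Inr M :: ('a, 'u + 'm) module)"
proof -
  interpret M: left_module A M by fact
  let ?T = "transport_Inr M :: ('a, 'u + 'm) module"
  have simps: "carrier ?T = Inr ` carrier M" "\<zero>\<^bsub>?T\<^esub> = Inr \<zero>\<^bsub>M\<^esub>"
    "Inr x \<oplus>\<^bsub>?T\<^esub> Inr y = Inr (x \<oplus>\<^bsub>M\<^esub> y)" "a \<odot>\<^bsub>?T\<^esub> Inr x = Inr (a \<odot>\<^bsub>M\<^esub> x)" for x y a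
    by (simp_all add: transport_Inr_def)
  have "abelian_group ?T"
  proof (rule abelian_groupI, goal_cases)
    case (6 x)
    then obtain m where "m \<in> carrier M" "x = Inr m" by (auto simp: simps)
    then show ?case by (intro bexI[of _ "Inr (\<ominus>\<^bsub>M\<^esub> m)"]) (simp_all add: simps M.M.l_neg)
  qed (auto simp: simps M.M.a_ac)
  then interpret T: abelian_group ?T .
  show ?thesis
    by unfold_locales (auto simp: simps M.smult_closed M.smult_l_distr M.smult_r_distr M.smult_assoc M.smult_one)
qed

context quad_model
begin

lemma proj_dim_le_2:
  fixes M :: "('a, 'm) module"
  assumes "left_module A M" shows "proj_dim A M \<le> 2"
proof -
  let ?T = "{(0 :: nat, \<one>, m) | m. m \<in> carrier M}" and ?y = "\<lambda>t :: nat \<times> 'a \<times> 'm. snd (snd t)"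
  have "\<exists>S\<subseteq>?T. kbasis M S ?y"
  proof (rule kbasis_exists[OF assms])
    show "?y \<in> ?T \<rightarrow> carrier M" by auto
    show "carrier M \<subseteq> ?y ` ?T" by force
  qed
  then obtain S where kb: "kbasis M S ?y" by blast
  interpret quad_module A \<pi> C M S ?y cix cixj cixs
    by (intro quad_module.intro quad_model_axioms lmod.intro assms quad_module_axioms.intro kb cix)
  have "\<forall>i>2. carrier (resP i) = {\<zero>\<^bsub>resP i\<^esub>}"
    by (auto simp: resP_def free_mod_empty)
  then have "enat 2 \<in> {enat n | n. \<exists>(P :: nat \<Rightarrow> ('a, nat \<times> 'a \<times> 'm \<Rightarrow> 'a) module) d e.
      projective_resolution A M P d e \<and> (\<forall>i>n. carrier (P i) = {\<zero>\<^bsub>P i\<^esub>})}"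
    using resolution by blast
  then have "proj_dim A M \<le> enat 2" unfolding proj_dim_def by (rule Inf_lower)
  then show ?thesis by (simp add: numeral_eq_enat)
qed

text \<open>
  A copy of the trivial module \<open>k\<close> with basis vector \<open>b\<close>.
\<close>

definition trivial_on :: "('a, 'm) module \<Rightarrow> 'm \<Rightarrow> bool"
  where "trivial_on M b \<longleftrightarrow> left_module A M \<and> b \<in> carrier M \<and> (\<forall>m\<in>carrier M. \<exists>c. m = eta c \<odot>\<^bsub>M\<^esub> b) \<and>
    (\<forall>c. eta c \<odot>\<^bsub>M\<^esub> b = \<zero>\<^bsub>M\<^esub> \<longrightarrow> c = 0) \<and> (\<forall>j. gx j \<odot>\<^bsub>M\<^esub> b = \<zero>\<^bsub>M\<^esub>)"

lemma trivial_on_quad_triv: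
  fixes M :: "('a, 'm) module"
  assumes "trivial_on M b"
  shows "quad_triv A \<pi> C M {(0, \<one>, b)} (\<lambda>t :: nat \<times> 'a \<times> 'm. snd (snd t)) cix cixj cixs (0, \<one>, b)"
proof -
  let ?s = "(0 :: nat, \<one>, b)" and ?y = "\<lambda>t :: nat \<times> 'a \<times> 'm. snd (snd t)"
  let ?F = "free_mod A {?s}"
  have lm: "left_module A M" and b: "b \<in> carrier M"
    and span: "\<And>m. m \<in> carrier M \<Longrightarrow> \<exists>c. m = eta c \<odot>\<^bsub>M\<^esub> b"
    and ind: "\<And>c. eta c \<odot>\<^bsub>M\<^esub> b = \<zero>\<^bsub>M\<^esub> \<Longrightarrow> c = 0" and gx0: "\<And>j. gx j \<odot>\<^bsub>M\<^esub> b = \<zero>\<^bsub>M\<^esub>"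
    using assms by (auto simp: trivial_on_def)
  interpret M: lmod A M by (rule lmod.intro[OF lm])
  have y: "?y \<in> {?s} \<rightarrow> carrier M" using b by simp
  note h = M.lincomb_hom[OF y]
  have lc: "lincomb A M ?y (eta c \<odot>\<^bsub>?F\<^esub> fbasis A ?s) = eta c \<odot>\<^bsub>M\<^esub> b" for c
    using hom_act[OF h eta_closed fbasis_closed[of ?s "{?s}"]] M.lincomb_fbasis[OF y, of ?s] by simp
  have "kbasis M {?s} ?y" unfolding kbasis_def
  proof (intro conjI ballI impI y)
    fix m assume "m \<in> carrier M"
    then obtain c where "m = eta c \<odot>\<^bsub>M\<^esub> b" using span by blast
    then show "\<exists>u\<in>K0 {?s}. lincomb A M ?y u = m"
      using lc by (intro bexI[of _ "eta c \<odot>\<^bsub>?F\<^esub> fbasis A ?s"] K0_eta K0_fbasis) auto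
  next
    fix u assume u: "u \<in> K0 {?s}" "lincomb A M ?y u = \<zero>\<^bsub>M\<^esub>"
    have "u ?s \<in> range eta" using u(1) unfolding K0_def by blast
    then obtain c where c: "u ?s = eta c" by blast
    have "u = eta c \<odot>\<^bsub>?F\<^esub> fbasis A ?s"
    proof (rule ext)
      fix t
      have "u t = \<zero>" if "t \<noteq> ?s" using u(1) that unfolding K0_def free_mod_carrier by blast
      then show "u t = (eta c \<odot>\<^bsub>?F\<^esub> fbasis A ?s) t"
        using c by (cases "t = ?s") (simp_all add: fbasis_def)
    qed
    then have "c = 0" using u(2) lc ind by simp
    then show "u = (\<lambda>s. \<zero>)" using \<open>u = _\<close> by (auto simp: eta_simps fbasis_def)
  qed
  then have "quad_module A \<pi> C M {?s} ?y cix cixj cixs"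
    by (intro quad_module.intro quad_model_axioms lmod.intro lm quad_module_axioms.intro cix)
  then show ?thesis
    by (intro quad_triv.intro quad_triv_axioms.intro) (simp_all add: gx0)
qed

text \<open>
  A resolution of length at most one has no second cohomology, but that of the resolution above is not
  zero.
\<close>

lemma proj_dim_ge_2:
  fixes M :: "('a, 'm) module"
  assumes "trivial_on M b" shows "2 \<le> proj_dim A M"
  unfolding proj_dim_def
proof (rule Inf_greatest)
  interpret Q: quad_triv A \<pi> C M "{(0, \<one>, b)}" "\<lambda>t :: nat \<times> 'a \<times> 'm. snd (snd t)" cix cixj cixs "(0, \<one>, b)"
    by (rule trivial_on_quad_triv[OF assms])
  fix x assume "x \<in> {enat n | n. \<exists>(P :: nat \<Rightarrow> ('a, nat \<times> 'a \<times> 'm \<Rightarrow> 'a) module) d e.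
      projective_resolution A M P d e \<and> (\<forall>i>n. carrier (P i) = {\<zero>\<^bsub>P i\<^esub>})}"
  then obtain n P d e where x: "x = enat n"
    and P: "projective_resolution A M (P :: nat \<Rightarrow> ('a, nat \<times> 'a \<times> 'm \<Rightarrow> 'a) module) d e"
    and van: "\<forall>i>n. carrier (P i) = {\<zero>\<^bsub>P i\<^esub>}" by blast
  show "2 \<le> x"
  proof (rule ccontr)
    assume "\<not> 2 \<le> x"
    then have "n < 2" by (simp add: x numeral_eq_enat)
    then have 0: "carrier (P 2) = {\<zero>\<^bsub>P 2\<^esub>}" using van by blast
    have RP: "resolution A M P d e" using P assms by (simp add: resolution_def trivial_on_def)
    interpret P: resolution A M P d e by (rule RP)
    have "P.Z 2 \<subseteq> P.B 2"
    proof
      fix h assume "h \<in> P.Z 2"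
      then have h: "h \<in> carrier (P.H 2)" by (simp add: P.Z_iff)
      have "h = \<zero>\<^bsub>P.H 2\<^esub>"
      proof (rule extensionalityI[of _ "carrier (P 2)"])
        show "h \<in> extensional (carrier (P 2))" using h by (simp add: hom_to_ring_carrier)
        show "h p = \<zero>\<^bsub>P.H 2\<^esub> p" if "p \<in> carrier (P 2)" for p
          using P.zero_apply[OF h] that 0 by (simp add: hom_to_ring_simps)
      qed (simp add: hom_to_ring_simps)
      then show "h \<in> P.B 2" using subgroup.one_closed[OF P.B_subgroup[of 2]] by simp
    qed
    then have "carrier (hom_cohomology A P d 2) = {\<zero>\<^bsub>hom_cohomology A P d 2\<^esub>}"
      by (simp add: P.cohomology_zero_iff)
    then have "carrier (hom_cohomology A Q.resP Q.resd 2) = {\<zero>\<^bsub>hom_cohomology A Q.resP Q.resd 2\<^esub>}"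
      using module_isomorphic_trivial[OF cohomology_independent[OF RP Q.Res.resolution_axioms]
        P.cohomology_action Q.Res.cohomology_action] by blast
    then show False using Q.Res.cohomology_zero_iff[of 2] Q.H2_nonzero by (simp add: numeral_2_eq_2)
  qed
qed

lemma trivial_on_left:
  "trivial_on (quotient_module (left_regular A) Apos) (Apos +>\<^bsub>left_regular A\<^esub> \<one>)"
proof -
  let ?L = "left_regular A" and ?Q = "quotient_module (left_regular A) Apos"
  interpret Q: sub_action A ?L Apos by (rule Apos_sub(1))
  have lm: "left_module A ?Q" by (rule quot_left_module[OF A.left_regular_module Apos_sub(1)])
  have act: "a \<odot>\<^bsub>?Q\<^esub> (Apos +>\<^bsub>?L\<^esub> \<one>) = Apos +>\<^bsub>?L\<^esub> a" if "a \<in> carrier A" for a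
    using Q.quot_act[OF that, of \<one>] that by simp
  have "\<exists>c. m = eta c \<odot>\<^bsub>?Q\<^esub> (Apos +>\<^bsub>?L\<^esub> \<one>)" if "m \<in> carrier ?Q" for m
    using that
  proof (rule Q.quot_carrierE)
    fix a assume a: "a \<in> carrier ?L" "m = Apos +>\<^bsub>?L\<^esub> a"
    then obtain p where p: "a = \<pi> p" using \<pi>_cases by auto
    have "a \<ominus> eta (eps p) \<in> Apos" unfolding p eta_def \<pi>_minus[symmetric] Apos_iff by simp
    then have "Apos +>\<^bsub>?L\<^esub> a = Apos +>\<^bsub>?L\<^esub> eta (eps p)"
      using Q.coset_eq_iff[of a "eta (eps p)"] a(1) by (simp add: left_regular_minus)
    then show ?thesis using a(2) act[OF eta_closed] by auto
  qed
  moreover have "c = 0" if "eta c \<odot>\<^bsub>?Q\<^esub> (Apos +>\<^bsub>?L\<^esub> \<one>) = \<zero>\<^bsub>?Q\<^esub>" for c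
  proof -
    have "eta c \<in> Apos" using that act[OF eta_closed] Q.coset_eq_zero_iff[of "eta c"] by (simp add: Q.quot_zero)
    then show ?thesis by (simp add: eta_def Apos_iff)
  qed
  moreover have "gx j \<odot>\<^bsub>?Q\<^esub> (Apos +>\<^bsub>?L\<^esub> \<one>) = \<zero>\<^bsub>?Q\<^esub>" for j
    using act[OF \<pi>_closed, of "gen j"] Q.coset_eq_zero_iff[of "gx j"] by (simp add: Q.quot_zero Apos_iff)
  moreover have "Apos +>\<^bsub>?L\<^esub> \<one> \<in> carrier ?Q" by (rule Q.coset_closed) simp
  ultimately show ?thesis using lm unfolding trivial_on_def by blast
qed

lemma trivial_on_transport:
  assumes "trivial_on M b" shows "trivial_on (transport_Inr M :: ('a, 'u + 'm) module) (Inr b)"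
proof -
  let ?T = "transport_Inr M :: ('a, 'u + 'm) module"
  have simps: "carrier ?T = Inr ` carrier M" "\<zero>\<^bsub>?T\<^esub> = Inr \<zero>\<^bsub>M\<^esub>"
    "a \<odot>\<^bsub>?T\<^esub> Inr x = Inr (a \<odot>\<^bsub>M\<^esub> x)" for x a
    by (simp_all add: transport_Inr_def)
  show ?thesis using assms transport_Inr_module[of A M] unfolding trivial_on_def simps by auto
qed

theorem global_dim_2: "left_global_dim TYPE('u) A = 2"
  unfolding left_global_dim_def
proof (rule antisym)
  show "Sup (proj_dim A ` {M :: ('a, 'u + 'a set) module. left_module A M}) \<le> 2"
    using proj_dim_le_2 by (intro Sup_least) auto
  let ?M = "transport_Inr (quotient_module (left_regular A) Apos) :: ('a, 'u + 'a set) module"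
  have t: "trivial_on ?M (Inr (Apos +>\<^bsub>left_regular A\<^esub> \<one>))" by (rule trivial_on_transport[OF trivial_on_left])
  have "2 \<le> proj_dim A ?M" by (rule proj_dim_ge_2[OF t])
  moreover have "left_module A ?M" using t by (simp add: trivial_on_def)
  ultimately show "2 \<le> Sup (proj_dim A ` {M :: ('a, 'u + 'a set) module. left_module A M})"
    by (intro Sup_upper2[of "proj_dim A ?M"]) auto
qed

theorem AS_Gorenstein_iff:
  assumes G: "connected_graded A \<eta> G" and pos: "positive_part A G = Apos"
  shows "AS_Gorenstein TYPE('u) A \<eta> G \<longleftrightarrow> invertible C"
proof -
  let ?k = "quotient_module (left_regular A) Apos" and ?b = "Apos +>\<^bsub>left_regular A\<^esub> \<one>"
  have k: "trivial_left A G = ?k" "trivial_right A G = quotient_module (right_regular A) Apos"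
    by (simp_all add: trivial_left_def trivial_right_def pos)
  interpret Q: quad_triv A \<pi> C ?k "{(0, \<one>, ?b)}" "\<lambda>t :: nat \<times> 'a \<times> 'a set. snd (snd t)" cix cixj cixs "(0, \<one>, ?b)"
    by (rule trivial_on_quad_triv[OF trivial_on_left])
  note E = Ext_to_ring_isomorphic[OF Q.Res.resolution_axioms]
  have Ez: "carrier (Ext_to_ring A ?k i) = {\<zero>\<^bsub>Ext_to_ring A ?k i\<^esub>} \<longleftrightarrow> Q.Res.Z i \<subseteq> Q.Res.B i" for i
    using module_isomorphic_trivial[OF E(1) E(2) Q.Res.cohomology_action] Q.Res.cohomology_zero_iff by simp
  show ?thesis
  proof
    assume "AS_Gorenstein TYPE('u) A \<eta> G"
    then obtain d where d: "left_global_dim TYPE('u) A = enat d"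
      and iso: "module_isomorphic A (Ext_to_ring A (trivial_left A G) d) (trivial_right A G)"
      unfolding AS_Gorenstein_def by blast
    have "d = 2" using d by (simp add: global_dim_2 numeral_eq_enat)
    then have iso: "module_isomorphic A (Ext_to_ring A ?k 2) (quotient_module (right_regular A) Apos)"
      using iso by (simp only: k)
    have "module_isomorphic A (hom_cohomology A Q.resP Q.resd 2) (quotient_module (right_regular A) Apos)"
      by (rule module_isomorphic_trans[OF module_isomorphic_sym[OF E(1) E(2)] iso])
    then show "invertible C" by (rule Q.H2_iso_imp_invertible)
  next
    assume "invertible C"
    then obtain N where N: "C ** N = mat 1" "N ** C = mat 1" by (auto simp: invertible_def)
    have van: "carrier (Ext_to_ring A ?k i) = {\<zero>\<^bsub>Ext_to_ring A ?k i\<^esub>}" if "i \<noteq> 2" for i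
    proof -
      have "i = 0 \<or> i = Suc 0 \<or> (\<exists>n. i = Suc (Suc (Suc n)))" using that by presburger
      then consider "i = 0" | "i = Suc 0" | n where "i = Suc (Suc (Suc n))" by blast
      then show ?thesis unfolding Ez
      proof cases
        case 1 then show "Q.Res.Z i \<subseteq> Q.Res.B i" using Q.H0_vanish by (simp only:)
      next
        case 2 then show "Q.Res.Z i \<subseteq> Q.Res.B i" using Q.H1_vanish[OF N(2)] by (simp only:)
      next
        case 3 then show "Q.Res.Z i \<subseteq> Q.Res.B i" using Q.H_high_vanish by (simp only:)
      qed
    qed
    have iso: "module_isomorphic A (Ext_to_ring A ?k 2) (quotient_module (right_regular A) Apos)"
      by (rule module_isomorphic_trans[OF E(1) Q.H2_iso[OF N(1)]])
    have "1 \<le> (2 :: nat) \<and> left_global_dim TYPE('u) A = enat 2 \<and>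
      (\<forall>i. i \<noteq> 2 \<longrightarrow> carrier (Ext_to_ring A ?k i) = {\<zero>\<^bsub>Ext_to_ring A ?k i\<^esub>}) \<and>
      module_isomorphic A (Ext_to_ring A ?k 2) (quotient_module (right_regular A) Apos)"
      using van iso global_dim_2[where 'u = 'u] by (simp add: numeral_eq_enat)
    then have "\<exists>d\<ge>1. left_global_dim TYPE('u) A = enat d \<and>
      (\<forall>i. i \<noteq> d \<longrightarrow> carrier (Ext_to_ring A ?k i) = {\<zero>\<^bsub>Ext_to_ring A ?k i\<^esub>}) \<and>
      module_isomorphic A (Ext_to_ring A ?k d) (quotient_module (right_regular A) Apos)"
      by (rule exI[of _ 2])
    then show "AS_Gorenstein TYPE('u) A \<eta> G"
      unfolding AS_Gorenstein_def k by (rule conjI[OF G])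
  qed
qed

end

section \<open>The tensor algebra and its quadratic quotient\<close>

subsection \<open>The grading\<close>

context quad_model
begin

text \<open>
  The homogeneous components of an element of \<open>A\<close> are well defined because the ideal contains the homogeneous
  components of its elements.
\<close>

lemma eta_connected: "connected_graded A eta (\<lambda>m. \<pi> ` homs m)"
  unfolding connected_graded_def
proof (intro conjI allI ballI)
  show "k_algebra A eta"
    unfolding k_algebra_def
  proof (intro conjI allI ballI)
    show "ring A" by (rule A.ring_axioms)
    show "eta \<in> ring_hom type_ring A"
      by (rule ring_hom_memI) (simp_all add: type_ring_def eta_simps)
    show "eta c \<otimes> a = a \<otimes> eta c" if "a \<in> carrier A" for c a by (rule eta_comm[OF that])
  qed
  show "subgroup (\<pi> ` homs m) (add_monoid A)" for m
  proof (rule A.subgroupI_minus)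
    show "\<zero> \<in> \<pi> ` homs m" by (rule image_eqI[of _ _ 0]) (simp_all add: \<pi>_0)
    show "a \<ominus> b \<in> \<pi> ` homs m" if "a \<in> \<pi> ` homs m" "b \<in> \<pi> ` homs m" for a b
      using that by (auto simp: \<pi>_minus[symmetric] homs_minus)
  qed auto
  show "a \<otimes> b \<in> \<pi> ` homs (i + j)" if "a \<in> \<pi> ` homs i" "b \<in> \<pi> ` homs j" for i j a b
    using that by (auto simp: \<pi>_mult[symmetric] homs_mult)
  show "inj eta"
  proof (rule injI)
    fix c d assume "eta c = eta d"
    then have "eta (c - d) = \<zero>" using eta_simps(6)[of c d] A.minus_eq_zero_iff[of "eta c" "eta d"] by simp
    then show "c = d" by (simp add: eta_zero_iff)
  qed
  show "\<pi> ` homs 0 = range eta"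
  proof
    show "\<pi> ` homs 0 \<subseteq> range eta"
    proof
      fix a assume "a \<in> \<pi> ` homs 0"
      then obtain p where p: "p \<in> homs 0" "a = \<pi> p" by auto
      have "p = cst (eps p)" by (rule homs_0_cst[OF p(1)])
      then show "a \<in> range eta" using p(2) by (metis eta_def rangeI)
    qed
  qed (auto simp: eta_def)
  fix a assume "a \<in> carrier A"
  then obtain p where p: "a = \<pi> p" by (rule \<pi>_cases)
  obtain N where N: "p \<in> fil N" using fil_exists by blast
  let ?P = "\<lambda>c. (\<forall>m. c m \<in> \<pi> ` homs m) \<and> finite {m. c m \<noteq> \<zero>} \<and> a = (\<Oplus>m\<in>{m. c m \<noteq> \<zero>}. c m)"
  have sub: "{m. \<pi> (hc m p) \<noteq> \<zero>} \<subseteq> {..<N}"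
  proof
    fix m assume "m \<in> {m. \<pi> (hc m p) \<noteq> \<zero>}"
    then have "hc m p \<noteq> 0" by (auto simp: \<pi>_0)
    then show "m \<in> {..<N}" using hc_fil fil_mono[OF N] by (metis lessThan_iff not_less)
  qed
  have "a = (\<Oplus>m\<in>{..<N}. \<pi> (hc m p))"
    using hc_sum_all[OF N] p \<pi>_sum[of "{..<N}" "\<lambda>m. hc m p"] by simp
  also have "\<dots> = (\<Oplus>m\<in>{m. \<pi> (hc m p) \<noteq> \<zero>}. \<pi> (hc m p))"
    by (rule A.add.finprod_mono_neutral_cong_left[symmetric]) (use sub in auto)
  finally have ex: "?P (\<lambda>m. \<pi> (hc m p))" using finite_subset[OF sub] by simp
  show "\<exists>!c. ?P c"
  proof (rule ex1I[of ?P, OF ex])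
    fix c assume c: "?P c"
    let ?S = "{m. c m \<noteq> \<zero>}"
    have "\<forall>m. \<exists>r. r \<in> homs m \<and> c m = \<pi> r" using c by blast
    then obtain r where r: "\<And>m. r m \<in> homs m" "\<And>m. c m = \<pi> (r m)" by metis
    have fin: "finite ?S" using c by blast
    have "(\<Oplus>m\<in>?S. c m) = (\<Oplus>m\<in>?S. \<pi> (r m))" by (rule A.add.finprod_cong') (auto simp: r(2))
    also have "\<dots> = \<pi> (\<Sum>m\<in>?S. r m)" by (rule \<pi>_sum[OF fin, symmetric])
    finally have "\<pi> p = \<pi> (\<Sum>m\<in>?S. r m)" using c p by simp
    then have I: "p - (\<Sum>m\<in>?S. r m) \<in> qid (qform C)" by (simp add: \<pi>_eq_iff)
    show "c = (\<lambda>m. \<pi> (hc m p))"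
    proof (rule ext)
      fix j
      have "hc j (p - (\<Sum>m\<in>?S. r m)) \<in> qid (qform C)" by (rule qid_hc[OF I]) simp
      then have "\<pi> (hc j p) = \<pi> (hc j (\<Sum>m\<in>?S. r m))" by (simp add: \<pi>_eq_iff)
      also have "hc j (\<Sum>m\<in>?S. r m) = (\<Sum>m\<in>?S. if j = m then r m else 0)"
        unfolding hc_sum by (intro sum.cong refl hc_homs_eq r(1))
      also have "\<dots> = (if j \<in> ?S then r j else 0)" using fin by (simp add: sum.delta)
      also have "\<pi> (if j \<in> ?S then r j else 0) = c j" using r(2)[of j] by (auto simp: \<pi>_0)
      finally show "c j = \<pi> (hc j p)" by (rule sym)
    qed
  qed
qed

lemma eta_positive_part: "positive_part A (\<lambda>m. \<pi> ` homs m) = Apos"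
proof -
  have sg: "subgroup Apos (add_monoid A)"
  proof (rule A.subgroupI_minus)
    show "\<zero> \<in> Apos" unfolding \<pi>_0[symmetric] Apos_iff by simp
    show "a \<ominus> b \<in> Apos" if "a \<in> Apos" "b \<in> Apos" for a b
      using that by (auto simp: Apos_def \<pi>_minus[symmetric])
  qed (auto simp: Apos_closed)
  have hA: "\<pi> ` homs m \<subseteq> Apos" if "m \<ge> 1" for m
    using that by (auto simp: Apos_iff eps_def homs_def)
  show ?thesis unfolding positive_part_def
  proof
    show "generate (add_monoid A) (\<Union>m\<in>{1..}. \<pi> ` homs m) \<subseteq> Apos"
      by (rule group.generate_subgroup_incl[OF A.add.is_group _ sg]) (use hA in auto)
    show "Apos \<subseteq> generate (add_monoid A) (\<Union>m\<in>{1..}. \<pi> ` homs m)"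
    proof
      fix a assume "a \<in> Apos"
      then obtain p where p: "eps p = 0" "a = \<pi> p" by (auto simp: Apos_def)
      obtain N where N: "p \<in> fil N" using fil_exists by blast
      let ?G = "generate (add_monoid A) (\<Union>m\<in>{1..}. \<pi> ` homs m)"
      have sgG: "subgroup ?G (add_monoid A)"
        by (rule group.generate_is_subgroup[OF A.add.is_group]) auto
      have 0: "hc 0 p = 0"
        by (rule poly_mapping_eqI) (use p(1) in \<open>auto simp: lookup_hc eps_def\<close>)
      have gG: "\<pi> (hc m p) \<in> ?G" for m
      proof (cases "m = 0")
        case True then show ?thesis using subgroup.one_closed[OF sgG] 0 by (simp add: \<pi>_0)
      next
        case False then show ?thesis by (intro generate.incl UN_I[of m]) auto
      qed
      have sumG: "\<pi> (\<Sum>m\<in>I. hc m p) \<in> ?G" if "finite I" for I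
        using that
      proof (induction I rule: finite_induct)
        case empty then show ?case using subgroup.one_closed[OF sgG] by (simp add: \<pi>_0)
      next
        case (insert m I)
        then show ?case using subgroup.m_closed[OF sgG gG[of m] insert.IH] by (simp add: \<pi>_add)
      qed
      from sumG[of "{..<N}"] show "a \<in> ?G" using hc_sum_all[OF N] p(2) by simp
    qed
  qed
qed

end

subsection \<open>Quotient rings\<close>

lemma type_ring_simps [simp]:
  "carrier type_ring = UNIV" "mult type_ring = (*)" "one type_ring = 1" "zero type_ring = 0" "add type_ring = (+)"
  by (simp_all add: type_ring_def)

lemma ring_type_ring: "ring (type_ring :: 'a::ring_1 ring)"
proof (rule ringI)
  show "abelian_group (type_ring :: 'a ring)"
    by (rule abelian_groupI) (auto simp: algebra_simps intro: exI[of _ "- x" for x])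
  show "monoid (type_ring :: 'a ring)" by (rule monoidI) (auto simp: algebra_simps)
qed (auto simp: algebra_simps)

lemma type_ring_minus: "a \<ominus>\<^bsub>type_ring\<^esub> b = a - (b :: 'a::ring_1)"
proof -
  interpret ring "type_ring :: 'a ring" by (rule ring_type_ring)
  have "(a \<ominus>\<^bsub>type_ring\<^esub> b) + b = a" using minus_cancel_mid[of a b] by simp
  then show ?thesis by (simp add: algebra_simps)
qed

text \<open>
  Working rules for both quotients that occur, the one defining \<open>T(V)\<close> and the one defining \<open>A\<close>.
\<close>

lemma quotient_ring_facts:
  assumes "ideal I R"
  shows "ring (R Quot I)" "carrier (R Quot I) = (\<lambda>a. I +>\<^bsub>R\<^esub> a) ` carrier R"
    "\<And>a b. a \<in> carrier R \<Longrightarrow> b \<in> carrier R \<Longrightarrow> (I +>\<^bsub>R\<^esub> a) \<oplus>\<^bsub>R Quot I\<^esub> (I +>\<^bsub>R\<^esub> b) = I +>\<^bsub>R\<^esub> (a \<oplus>\<^bsub>R\<^esub> b)"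
    "\<And>a b. a \<in> carrier R \<Longrightarrow> b \<in> carrier R \<Longrightarrow> (I +>\<^bsub>R\<^esub> a) \<otimes>\<^bsub>R Quot I\<^esub> (I +>\<^bsub>R\<^esub> b) = I +>\<^bsub>R\<^esub> (a \<otimes>\<^bsub>R\<^esub> b)"
    "\<one>\<^bsub>R Quot I\<^esub> = I +>\<^bsub>R\<^esub> \<one>\<^bsub>R\<^esub>"
    "\<And>a. a \<in> carrier R \<Longrightarrow> I +>\<^bsub>R\<^esub> a = \<zero>\<^bsub>R Quot I\<^esub> \<longleftrightarrow> a \<in> I"
    "\<And>a b. a \<in> carrier R \<Longrightarrow> b \<in> carrier R \<Longrightarrow> I +>\<^bsub>R\<^esub> a = I +>\<^bsub>R\<^esub> b \<longleftrightarrow> a \<ominus>\<^bsub>R\<^esub> b \<in> I"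
proof -
  interpret ideal I R by fact
  note h = rcos_ring_hom
  show "ring (R Quot I)" by (rule quotient_is_ring)
  show "carrier (R Quot I) = (\<lambda>a. I +>\<^bsub>R\<^esub> a) ` carrier R"
    by (auto simp: FactRing_def A_RCOSETS_def')
  show "\<And>a b. a \<in> carrier R \<Longrightarrow> b \<in> carrier R \<Longrightarrow> (I +>\<^bsub>R\<^esub> a) \<oplus>\<^bsub>R Quot I\<^esub> (I +>\<^bsub>R\<^esub> b) = I +>\<^bsub>R\<^esub> (a \<oplus>\<^bsub>R\<^esub> b)"
    using ring_hom_add[OF h] by simp
  show "\<And>a b. a \<in> carrier R \<Longrightarrow> b \<in> carrier R \<Longrightarrow> (I +>\<^bsub>R\<^esub> a) \<otimes>\<^bsub>R Quot I\<^esub> (I +>\<^bsub>R\<^esub> b) = I +>\<^bsub>R\<^esub> (a \<otimes>\<^bsub>R\<^esub> b)"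
    using ring_hom_mult[OF h] by simp
  show "\<one>\<^bsub>R Quot I\<^esub> = I +>\<^bsub>R\<^esub> \<one>\<^bsub>R\<^esub>" using ring_hom_one[OF h] by simp
  have sg: "abelian_subgroup I R" by (rule abelian_subgroupI3) unfold_locales
  have z: "\<zero>\<^bsub>R Quot I\<^esub> = I" by (simp add: FactRing_def)
  show eq: "I +>\<^bsub>R\<^esub> a = I +>\<^bsub>R\<^esub> b \<longleftrightarrow> a \<ominus>\<^bsub>R\<^esub> b \<in> I" if "a \<in> carrier R" "b \<in> carrier R" for a b
  proof -
    have "a \<in> I +>\<^bsub>R\<^esub> b \<longleftrightarrow> a \<ominus>\<^bsub>R\<^esub> b \<in> I"
      using that by (simp add: minus_eq abelian_subgroup.a_rcos_module[OF sg])
    moreover have "I +>\<^bsub>R\<^esub> a = I +>\<^bsub>R\<^esub> b \<longleftrightarrow> a \<in> I +>\<^bsub>R\<^esub> b"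
      using abelian_subgroup.a_rcos_self[OF sg that(1)] a_repr_independence[OF _ that(2) a_subgroup] by metis
    ultimately show ?thesis by simp
  qed
  show "I +>\<^bsub>R\<^esub> a = \<zero>\<^bsub>R Quot I\<^esub> \<longleftrightarrow> a \<in> I" if "a \<in> carrier R" for a
    using eq[OF that zero_closed] that a_coset_add_zero[OF a_subset] by (simp add: z minus_eq)
qed

lemma ideal_type_ringD:
  fixes L :: "'a::ring_1 set"
  assumes "ideal L type_ring"
  shows "0 \<in> L" "a \<in> L \<Longrightarrow> b \<in> L \<Longrightarrow> a + b \<in> L" "a \<in> L \<Longrightarrow> b \<in> L \<Longrightarrow> a - b \<in> L"
    "a \<in> L \<Longrightarrow> r * a \<in> L" "a \<in> L \<Longrightarrow> a * r \<in> L"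
proof -
  interpret ideal L type_ring by fact
  show "0 \<in> L" using subgroup.one_closed[OF a_subgroup] by simp
  show 1: "a + b \<in> L" if "a \<in> L" "b \<in> L" for a b
    using subgroup.m_closed[OF a_subgroup that] by simp
  show 2: "r * a \<in> L" if "a \<in> L" for a r using I_l_closed[OF that, of r] by simp
  show "a * r \<in> L" if "a \<in> L" using I_r_closed[OF that, of r] by simp
  show "a - b \<in> L" if "a \<in> L" "b \<in> L" using 1[OF that(1) 2[OF that(2), of "- 1"]] by simp
qed

lemma ideal_type_ringI:
  fixes L :: "'a::ring_1 set"
  assumes "0 \<in> L" "\<And>a b. a \<in> L \<Longrightarrow> b \<in> L \<Longrightarrow> a - b \<in> L"
    "\<And>a r. a \<in> L \<Longrightarrow> r * a \<in> L" "\<And>a r. a \<in> L \<Longrightarrow> a * r \<in> L"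
  shows "ideal L type_ring"
proof -
  interpret ring "type_ring :: 'a ring" by (rule ring_type_ring)
  show ?thesis
    by (rule idealI[OF ring_axioms subgroupI_minus]) (use assms in \<open>auto simp: type_ring_minus\<close>)
qed

subsection \<open>The tensor algebra is the free algebra\<close>

locale tensor_basis = vector_space sc for sc :: "'k::field \<Rightarrow> 'v::ab_group_add \<Rightarrow> 'v" +
  fixes x :: "'n::finite \<Rightarrow> 'v"
  assumes basis: "is_basis sc x"
begin

definition coord :: "'v \<Rightarrow> 'n \<Rightarrow> 'k" where "coord v i = representation (range x) v (x i)"

lemma inj_x: "inj x" and indep: "independent (range x)" and span: "span (range x) = UNIV"
  using basis by (auto simp: is_basis_def)

lemma coord_add: "coord (u + v) i = coord u i + coord v i"
  unfolding coord_def using span by (subst representation_add[OF indep]) auto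
lemma coord_scale: "coord (sc c v) i = c * coord v i"
  unfolding coord_def using span by (subst representation_scale[OF indep]) auto
lemma coord_x: "coord (x i) j = (if j = i then 1 else 0)"
  unfolding coord_def using representation_basis[OF indep, of "x i"] inj_x by (auto simp: inj_eq)
lemma coord_sum: "(\<Sum>i\<in>UNIV. sc (coord v i) (x i)) = v"
proof -
  have "(\<Sum>i\<in>UNIV. sc (coord v i) (x i)) = (\<Sum>b\<in>range x. sc (representation (range x) v b) b)"
    unfolding coord_def by (rule sum.reindex_cong[OF inj_x, symmetric]) auto
  also have "\<dots> = (\<Sum>b | representation (range x) v b \<noteq> 0. sc (representation (range x) v b) b)"
    by (rule sum.mono_neutral_right) (auto dest: representation_ne_zero)
  also have "\<dots> = v" using sum_nonzero_representation_eq[OF indep] span by auto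
  finally show ?thesis .
qed
lemma coord_nonzero: assumes "v \<noteq> 0" obtains j where "coord v j \<noteq> 0"
proof -
  have "\<exists>j. coord v j \<noteq> 0"
  proof (rule ccontr)
    assume "\<nexists>j. coord v j \<noteq> 0"
    then have "(\<Sum>i\<in>UNIV. sc (coord v i) (x i)) = 0" by simp
    then show False using assms by (simp only: coord_sum)
  qed
  then show ?thesis using that by blast
qed

text \<open>
  \<open>\<rho>\<close> expands every vector of a word in the basis, \<open>\<iota>\<close> views a word in the basis indices as a word of vectors.  They
  induce mutually inverse isomorphisms between \<open>T(V)\<close> and the free algebra; \<open>\<sigma>\<close> is the one induced by \<open>\<iota>\<close>.
\<close>

definition lv :: "'v \<Rightarrow> ('n, 'k) fralg" where "lv v = lf (coord v)"

lemma lv_x: "lv (x i) = gen i"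
proof -
  have "lv (x i) = (\<Sum>j\<in>UNIV. if j = i then gen j else 0)"
    unfolding lv_def lf_def by (intro sum.cong) (auto simp: coord_x cst_simps)
  then show ?thesis by simp
qed
lemma lv_add: "lv (u + v) = lv u + lv v"
proof -
  have "coord (u + v) = (\<lambda>j. coord u j + coord v j)" by (rule ext) (rule coord_add)
  then show ?thesis by (simp add: lv_def lf_add)
qed
lemma lv_scale: "lv (sc c v) = cst c * lv v"
proof -
  have "coord (sc c v) = (\<lambda>j. c * coord v j)" by (rule ext) (rule coord_scale)
  then show ?thesis by (simp add: lv_def lf_scale)
qed

fun rhow :: "'v tword \<Rightarrow> ('n, 'k) fralg" where "rhow (TWord l) = prod_list (map lv l)"

lemma rhow_plus: "rhow (u + v) = rhow u * rhow v" by (cases u; cases v) simp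

definition \<rho> :: "('v tword \<Rightarrow>\<^sub>0 'k) \<Rightarrow> ('n, 'k) fralg"
  where "\<rho> g = (\<Sum>w\<in>keys g. cst (lookup g w) * rhow w)"

lemma \<rho>_add: "\<rho> (p + q) = \<rho> p + \<rho> q"
  unfolding \<rho>_def by (rule setsum_keys_plus_distrib) (simp_all add: cst_simps algebra_simps)
lemma \<rho>_single: "\<rho> (Poly_Mapping.single w c) = cst c * rhow w"
  by (cases "c = 0") (simp_all add: \<rho>_def cst_simps)
lemma \<rho>_minus: "\<rho> (p - q) = \<rho> p - \<rho> q" by (metis \<rho>_add add_diff_cancel diff_add_cancel)
lemma \<rho>_mult: "\<rho> (p * q) = \<rho> p * \<rho> q"
proof (induction p rule: pm_induct)
  case (single u c)
  show ?case
  proof (induction q rule: pm_induct)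
    case (single v d)
    have "cst c * rhow u * (cst d * rhow v) = cst c * (cst d * (rhow u * rhow v))"
      by (simp only: mult.assoc cst_left[of "rhow u"])
    then show ?case by (simp add: mult_single \<rho>_single rhow_plus cst_simps(6) mult.assoc)
  qed (simp add: algebra_simps \<rho>_add)
qed (simp add: algebra_simps \<rho>_add)

fun mapx :: "'n tword \<Rightarrow> 'v tword" where "mapx (TWord l) = TWord (map x l)"

definition \<iota> :: "('n, 'k) fralg \<Rightarrow> 'v tword \<Rightarrow>\<^sub>0 'k"
  where "\<iota> p = (\<Sum>w\<in>keys p. Poly_Mapping.single (mapx w) (lookup p w))"

lemma mapx_plus: "mapx (u + v) = mapx u + mapx v" by (cases u; cases v) simp
lemma \<iota>_add: "\<iota> (p + q) = \<iota> p + \<iota> q"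
  unfolding \<iota>_def by (rule setsum_keys_plus_distrib) (simp_all add: single_add)
lemma \<iota>_single: "\<iota> (Poly_Mapping.single w c) = Poly_Mapping.single (mapx w) c"
  by (cases "c = 0") (simp_all add: \<iota>_def)
lemma \<iota>_mult: "\<iota> (p * q) = \<iota> p * \<iota> q"
proof (induction p rule: pm_induct)
  case (single u c)
  show ?case
    by (induction q rule: pm_induct) (simp_all add: mult_single \<iota>_single mapx_plus algebra_simps \<iota>_add)
qed (simp add: algebra_simps \<iota>_add)

lemma gen_word: "prod_list (map gen l) = (Poly_Mapping.single (TWord l) 1 :: ('n, 'k) fralg)"
  by (induction l) (simp_all add: gen_def mult_single zero_tword_def[symmetric])

lemma \<rho>_\<iota>: "\<rho> (\<iota> p) = p"
proof (induction p rule: pm_induct)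
  case (single w c)
  show ?case
  proof (cases w)
    case (TWord l)
    have "map lv (map x l) = map gen l" by (simp add: lv_x)
    then show ?thesis unfolding TWord by (simp add: \<iota>_single \<rho>_single gen_word cst_def mult_single del: map_map)
  qed
qed (simp add: \<iota>_add \<rho>_add)

abbreviation "LI \<equiv> Idl\<^bsub>type_ring\<^esub> (linearity_relations sc)"

lemma LI_ideal: "ideal LI type_ring" by (rule ring.genideal_ideal[OF ring_type_ring]) simp
lemmas LI = ideal_type_ringD[OF LI_ideal]
lemma LI_gen: "r \<in> linearity_relations sc \<Longrightarrow> r \<in> LI"
  using ring.genideal_self[OF ring_type_ring, of "linearity_relations sc"] by auto

lemma LI_add_rel: "Poly_Mapping.single (TWord [u + v]) 1 - Poly_Mapping.single (TWord [u]) 1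
    - Poly_Mapping.single (TWord [v]) 1 \<in> LI"
  by (rule LI_gen) (unfold linearity_relations_def, blast)
lemma LI_scale_rel: "Poly_Mapping.single (TWord [sc c v]) 1 - Poly_Mapping.single (TWord [v]) c \<in> LI"
  by (rule LI_gen) (unfold linearity_relations_def, blast)

lemma LI_\<rho>: assumes "g \<in> LI" shows "\<rho> g = 0"
proof -
  have 0: "\<rho> 0 = 0" by (simp add: \<rho>_def)
  have "ideal {g. \<rho> g = 0} type_ring"
    by (rule ideal_type_ringI) (simp_all add: 0 \<rho>_minus \<rho>_mult)
  moreover have "linearity_relations sc \<subseteq> {g. \<rho> g = 0}"
    by (auto simp: linearity_relations_def \<rho>_minus \<rho>_single lv_add lv_scale cst_simps)
  ultimately have "LI \<subseteq> {g. \<rho> g = 0}" by (rule ring.genideal_minimal[OF ring_type_ring])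
  then show ?thesis using assms by blast
qed

lemma LI_vec_sum:
  "finite T \<Longrightarrow> Poly_Mapping.single (TWord [\<Sum>i\<in>T. sc (c i) (x i)]) 1
     - (\<Sum>i\<in>T. Poly_Mapping.single (TWord [x i]) (c i)) \<in> LI"
proof (induction T rule: finite_induct)
  case empty
  show ?case using LI_scale_rel[of 0 0] by simp
next
  case (insert i T)
  let ?s = "\<lambda>v. Poly_Mapping.single (TWord [v]) (1::'k)"
  let ?u = "sc (c i) (x i)" and ?v = "\<Sum>i\<in>T. sc (c i) (x i)"
  have 1: "?s (?u + ?v) - ?s ?u - ?s ?v \<in> LI" by (rule LI_add_rel)
  have 2: "?s ?u - Poly_Mapping.single (TWord [x i]) (c i) \<in> LI" by (rule LI_scale_rel)
  show ?case using LI(2)[OF LI(2)[OF 1 2] insert.IH] insert by (simp add: algebra_simps)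
qed

lemma \<iota>_sum: "\<iota> (\<Sum>i\<in>T. g i) = (\<Sum>i\<in>T. \<iota> (g i))" by (rule pm_additive_sum) (rule \<iota>_add)

lemma LI_vec: "Poly_Mapping.single (TWord [v]) 1 - \<iota> (lv v) \<in> LI"
proof -
  have "\<iota> (cst c * gen i) = Poly_Mapping.single (TWord [x i]) c" for c i
    by (simp add: cst_def gen_def mult_single \<iota>_single)
  then have "\<iota> (lv v) = (\<Sum>i\<in>UNIV. Poly_Mapping.single (TWord [x i]) (coord v i))"
    by (simp add: lv_def lf_def \<iota>_sum)
  then show ?thesis using LI_vec_sum[of UNIV "coord v"] by (simp add: coord_sum)
qed

text \<open>
  Modulo the linearity relations every vector is the linear combination of basis vectors given by its
  coordinates; for words this follows letter by letter.
\<close>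

lemma LI_cong: "g - \<iota> (\<rho> g) \<in> LI"
proof (induction g rule: pm_induct)
  case (single w c)
  have "Poly_Mapping.single (TWord l) c - \<iota> (\<rho> (Poly_Mapping.single (TWord l) c)) \<in> LI" for l
  proof (induction l)
    case Nil
    have "\<rho> (Poly_Mapping.single (TWord []) c) = Poly_Mapping.single (TWord []) c"
      by (simp add: \<rho>_single cst_def zero_tword_def)
    then show ?case by (simp add: \<iota>_single LI(1))
  next
    case (Cons v l)
    let ?v = "Poly_Mapping.single (TWord [v]) (1::'k)" and ?l = "Poly_Mapping.single (TWord l) c"
    have eq: "Poly_Mapping.single (TWord (v # l)) c = ?v * ?l" by (simp add: mult_single)
    have \<rho>v: "\<rho> ?v = lv v" by (simp add: \<rho>_single cst_simps)
    have "?v * ?l - \<iota> (\<rho> (?v * ?l)) = (?v - \<iota> (lv v)) * ?l + \<iota> (lv v) * (?l - \<iota> (\<rho> ?l))"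
      by (simp add: \<rho>_mult \<iota>_mult \<rho>v algebra_simps)
    then show ?case unfolding eq using LI(2)[OF LI(5)[OF LI_vec] LI(4)[OF Cons]] by simp
  qed
  then show ?case by (cases w) simp
next
  case (add p q)
  then show ?case using LI(2)[OF add] by (simp add: \<rho>_add \<iota>_add algebra_simps)
qed

lemma LI_iff: "g \<in> LI \<longleftrightarrow> \<rho> g = 0"
  using LI_\<rho> LI_cong[of g] by (auto simp: \<iota>_def)

abbreviation "T \<equiv> tensor_algebra sc"

definition \<sigma> :: "('n, 'k) fralg \<Rightarrow> ('k, 'v) tensor" where "\<sigma> p = LI +>\<^bsub>type_ring\<^esub> \<iota> p"

lemmas Tq = quotient_ring_facts[OF LI_ideal, folded tensor_algebra_def, unfolded type_ring_simps type_ring_minus, simplified]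

lemma T_ring: "ring T" by (rule Tq(1))

lemma \<sigma>_coset: "LI +>\<^bsub>type_ring\<^esub> g = \<sigma> (\<rho> g)"
  unfolding \<sigma>_def using Tq(7)[of g "\<iota> (\<rho> g)"] LI_cong by simp
lemma T_carrier: "carrier T = range \<sigma>"
  unfolding Tq(2) using \<sigma>_coset by (auto simp: \<sigma>_def)
lemma \<sigma>_add: "\<sigma> (p + q) = \<sigma> p \<oplus>\<^bsub>T\<^esub> \<sigma> q" by (simp add: \<sigma>_def Tq(3) \<iota>_add)
lemma \<sigma>_mult: "\<sigma> (p * q) = \<sigma> p \<otimes>\<^bsub>T\<^esub> \<sigma> q" by (simp add: \<sigma>_def Tq(4) \<iota>_mult)
lemma \<sigma>_one: "\<sigma> 1 = \<one>\<^bsub>T\<^esub>"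
proof -
  have "mapx 0 = 0" by (simp add: zero_tword_def)
  then have "\<iota> 1 = 1" using \<iota>_single[of 0 1] by simp
  then show ?thesis by (simp add: \<sigma>_def Tq(5))
qed
lemma \<sigma>_eq_iff: "\<sigma> p = \<sigma> q \<longleftrightarrow> p = q"
  unfolding \<sigma>_def Tq(7) LI_iff by (simp add: \<rho>_minus \<rho>_\<iota>)
lemma \<sigma>_zero: "\<sigma> 0 = \<zero>\<^bsub>T\<^esub>"
proof -
  have "\<sigma> 0 = \<zero>\<^bsub>T\<^esub>" unfolding \<sigma>_def using Tq(6)[of "\<iota> 0"] LI(1) by (simp add: \<iota>_def)
  then show ?thesis .
qed
lemma \<sigma>_closed [simp]: "\<sigma> p \<in> carrier T" by (simp add: T_carrier)
lemma \<sigma>_minus: "\<sigma> (p - q) = \<sigma> p \<ominus>\<^bsub>T\<^esub> \<sigma> q"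
proof -
  interpret ring T by (rule T_ring)
  have "\<sigma> (p - q) \<oplus>\<^bsub>T\<^esub> \<sigma> q = \<sigma> p" unfolding \<sigma>_add[symmetric] by simp
  then have "\<sigma> (p - q) \<oplus>\<^bsub>T\<^esub> \<sigma> q \<ominus>\<^bsub>T\<^esub> \<sigma> q = \<sigma> p \<ominus>\<^bsub>T\<^esub> \<sigma> q" by simp
  then show ?thesis by (simp add: minus_eq a_assoc r_neg)
qed
lemma \<sigma>_sum: "finite I \<Longrightarrow> \<sigma> (\<Sum>i\<in>I. g i) = (\<Oplus>\<^bsub>T\<^esub>i\<in>I. \<sigma> (g i))"
proof -
  interpret ring T by (rule T_ring)
  show "finite I \<Longrightarrow> ?thesis"
    by (induction I rule: finite_induct) (simp_all add: \<sigma>_zero \<sigma>_add)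
qed

lemma tensor_vec_\<sigma>: "tensor_vec sc v = \<sigma> (lv v)"
  unfolding tensor_vec_def \<sigma>_coset by (simp add: \<rho>_single cst_simps)
lemma tensor_unit_\<sigma>: "tensor_unit sc c = \<sigma> (cst c)"
  unfolding tensor_unit_def \<sigma>_coset by (simp add: \<rho>_single)

lemma tensor_of_matrix_\<sigma>: "tensor_of_matrix sc x M = \<sigma> (qform M)"
  unfolding tensor_of_matrix_def qform_def tensor_vec_\<sigma> tensor_unit_\<sigma> lv_x
  by (simp add: \<sigma>_sum \<sigma>_mult)

lemma lv_range: "range lv = homs 1"
proof
  show "range lv \<subseteq> homs 1"
  proof
    fix p assume "p \<in> range lv"
    then obtain v where "p = lv v" by blast
    then show "p \<in> homs 1" by (simp only: lv_def homs_lf)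
  qed
  show "homs 1 \<subseteq> range lv"
  proof
    fix p :: "('n, 'k) fralg" assume p: "p \<in> homs 1"
    have e: "eps p = 0" using p by (auto simp: eps_def homs_def)
    have "rder j p = cst (eps (rder j p))" for j
    proof (rule poly_mapping_eqI)
      fix w
      have "lookup (rder j p) w = 0" if "w \<noteq> 0"
        using p that by (cases w) (auto simp: homs_def lookup_rder zero_tword_def)
      then show "lookup (rder j p) w = lookup (cst (eps (rder j p))) w"
        by (cases "w = 0") (simp_all add: cst_def lookup_single eps_def)
    qed
    then have pl: "p = lf (\<lambda>j. eps (rder j p))" using rder_decomp[of p] e by (simp add: lf_def cst_simps)
    have cc: "coord (\<Sum>i\<in>UNIV. sc (c i) (x i)) = c" for c
    proof -
      have "lv (\<Sum>i\<in>I. sc (c i) (x i)) = (\<Sum>i\<in>I. cst (c i) * gen i)" if "finite I" for I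
        using that
      proof (induction I rule: finite_induct)
        case empty
        have "lv 0 = 0" using lv_add[of 0 0] by simp
        then show ?case by simp
      qed (simp add: lv_add lv_scale lv_x)
      from this[of UNIV] have "lv (\<Sum>i\<in>UNIV. sc (c i) (x i)) = lf c" by (simp add: lf_def)
      then have "rder j (lf (coord (\<Sum>i\<in>UNIV. sc (c i) (x i)))) = rder j (lf c)" for j by (simp add: lv_def)
      then have "eps (cst (coord (\<Sum>i\<in>UNIV. sc (c i) (x i)) j) :: ('n, 'k) fralg) = eps (cst (c j) :: ('n, 'k) fralg)" for j
        by (simp only: rder_lf)
      then show ?thesis by (simp add: fun_eq_iff)
    qed
    have "p = lv (\<Sum>i\<in>UNIV. sc (eps (rder i p)) (x i))"
      unfolding lv_def cc by (rule pl)
    then show "p \<in> range lv" by (rule range_eqI)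
  qed
qed

subsection \<open>Products of subspaces\<close>

text \<open>
  The subspaces of \<open>T(V)\<close> in the definition of the Koszul complex are computed inside the free algebra, as
  images under \<open>\<sigma>\<close>.
\<close>

lemma subspace_prod_subset:
  assumes "0 \<in> Z" "\<And>a b. a \<in> Z \<Longrightarrow> b \<in> Z \<Longrightarrow> a - b \<in> Z"
    and "\<And>a b. a \<in> X \<Longrightarrow> b \<in> Y \<Longrightarrow> a * b \<in> Z"
  shows "subspace_prod T (\<sigma> ` X) (\<sigma> ` Y) \<subseteq> \<sigma> ` Z"
proof -
  interpret ring T by (rule T_ring)
  have "subgroup (\<sigma> ` Z) (add_monoid T)"
  proof (rule subgroupI_minus)
    show "\<sigma> ` Z \<subseteq> carrier T" by auto
    show "\<zero>\<^bsub>T\<^esub> \<in> \<sigma> ` Z" unfolding \<sigma>_zero[symmetric] by (rule imageI[OF assms(1)])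
    show "a \<ominus>\<^bsub>T\<^esub> b \<in> \<sigma> ` Z" if "a \<in> \<sigma> ` Z" "b \<in> \<sigma> ` Z" for a b
      using that by (elim imageE) (simp only: \<sigma>_minus[symmetric], rule imageI, rule assms(2))
  qed
  moreover have "{s \<otimes>\<^bsub>T\<^esub> s' | s s'. s \<in> \<sigma> ` X \<and> s' \<in> \<sigma> ` Y} \<subseteq> \<sigma> ` Z"
    using assms(3) by (auto simp: \<sigma>_mult[symmetric])
  ultimately show ?thesis
    unfolding subspace_prod_def by (intro group.generate_subgroup_incl[OF a_group])
qed

lemma subspace_prod_sum:
  assumes "finite I" "\<And>i. i \<in> I \<Longrightarrow> a i \<in> X" "\<And>i. i \<in> I \<Longrightarrow> b i \<in> Y"
  shows "\<sigma> (\<Sum>i\<in>I. a i * b i) \<in> subspace_prod T (\<sigma> ` X) (\<sigma> ` Y)"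
  using assms
proof (induction I rule: finite_induct)
  case empty
  then show ?case using generate.one[of "add_monoid T"] by (simp add: \<sigma>_zero subspace_prod_def)
next
  case (insert i I)
  interpret ring T by (rule T_ring)
  have "\<sigma> (a i * b i) \<in> subspace_prod T (\<sigma> ` X) (\<sigma> ` Y)"
    unfolding subspace_prod_def \<sigma>_mult
    by (intro generate.incl CollectI exI[of _ "\<sigma> (a i)"] exI[of _ "\<sigma> (b i)"] conjI refl imageI insert.prems insertI1)
  then show ?case using insert generate.eng[of "\<sigma> (a i * b i)" "add_monoid T" _ "\<sigma> (\<Sum>i\<in>I. a i * b i)"]
    by (simp add: subspace_prod_def \<sigma>_add)
qed

lemma lder_homs: "p \<in> homs (Suc m) \<Longrightarrow> lder j p \<in> homs m"
proof -
  assume p: "p \<in> homs (Suc m)"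
  have "hc m (lder j p) = lder j (hc (Suc m) p)"
  proof (induction p rule: pm_induct)
    case (single w c)
    show ?case
    proof (cases w)
      case (TWord l)
      show ?thesis
      proof (cases l)
        case Nil
        have "Poly_Mapping.single w c = cst c" by (simp add: TWord Nil cst_def zero_tword_def)
        then show ?thesis by (simp add: hc_homs_eq[OF homs_cst])
      next
        case (Cons i l')
        have "Poly_Mapping.single w c = gen i * Poly_Mapping.single (TWord l') c"
          by (simp add: TWord Cons gen_def mult_single)
        then have "lder j (Poly_Mapping.single w c) = (if i = j then Poly_Mapping.single (TWord l') c else 0)"
          by (simp only: lder_gen_mult)
        then show ?thesis by (auto simp: hc_single TWord Cons)
      qed
    qed
  qed simp
  then show ?thesis using hc_homs_eq[OF p, of "Suc m"] hc_homs[of m "lder j p"] by simp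
qed

lemma tensor_power_\<sigma>: "tensor_power sc m = \<sigma> ` homs m"
proof (induction m)
  case 0
  have "homs 0 = range (cst :: 'k \<Rightarrow> ('n, 'k) fralg)"
  proof
    show "homs 0 \<subseteq> range (cst :: 'k \<Rightarrow> ('n, 'k) fralg)"
    proof
      fix p :: "('n, 'k) fralg" assume "p \<in> homs 0"
      then have "p = cst (eps p)" by (rule homs_0_cst)
      then show "p \<in> range cst" by (rule range_eqI)
    qed
  qed auto
  then show ?case by (simp add: tensor_unit_\<sigma> image_image)
next
  case (Suc m)
  have r: "range (tensor_vec sc) = \<sigma> ` homs 1"
    unfolding lv_range[symmetric] by (simp add: tensor_vec_\<sigma> image_image)
  have "subspace_prod T (\<sigma> ` homs 1) (\<sigma> ` homs m) = \<sigma> ` homs (Suc m)"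
  proof
    show "subspace_prod T (\<sigma> ` homs 1) (\<sigma> ` homs m) \<subseteq> \<sigma> ` homs (Suc m)"
      using homs_mult[of _ 1 _ m] by (intro subspace_prod_subset) (auto simp: homs_minus)
    show "\<sigma> ` homs (Suc m) \<subseteq> subspace_prod T (\<sigma> ` homs 1) (\<sigma> ` homs m)"
    proof
      fix t assume "t \<in> \<sigma> ` homs (Suc m)"
      then obtain p where p: "p \<in> homs (Suc m)" "t = \<sigma> p" by auto
      have "eps p = 0" using p by (auto simp: eps_def homs_def)
      then have "p = (\<Sum>j\<in>UNIV. gen j * lder j p)" using lder_decomp[of p] by (simp add: cst_simps)
      moreover have "\<sigma> (\<Sum>j\<in>UNIV. gen j * lder j p) \<in> subspace_prod T (\<sigma> ` homs 1) (\<sigma> ` homs m)"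
        by (rule subspace_prod_sum[OF finite_class.finite_UNIV homs_gen lder_homs[OF p(1)]])
      ultimately show "t \<in> subspace_prod T (\<sigma> ` homs 1) (\<sigma> ` homs m)"
        using p(2) by (simp only:)
    qed
  qed
  then show ?case by (simp add: Suc.IH r)
qed

end

section \<open>Tensor products over the ground field\<close>

text \<open>
  \<open>\<eta>\<close> is the structure map of a \<open>k\<close>-algebra and \<open>W\<close> a \<open>k\<close>-vector space. The remaining vector space laws are
  imposed on \<open>A \<otimes> W\<close> by the bilinearity relations.
\<close>

locale tensor_setting = A?: ring A for A :: "('a, 'x) ring_scheme" (structure) +
  fixes \<eta> :: "'k::field \<Rightarrow> 'a" and W :: "('k, 'w) module"
  assumes \<eta>_closed [simp]: "\<eta> c \<in> carrier A"
    and \<eta>_add: "\<eta> (c + d) = \<eta> c \<oplus> \<eta> d" and \<eta>_mult: "\<eta> (c * d) = \<eta> c \<otimes> \<eta> d" and \<eta>_one: "\<eta> 1 = \<one>"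
    and \<eta>_central: "a \<in> carrier A \<Longrightarrow> \<eta> c \<otimes> a = a \<otimes> \<eta> c"
    and W_grp: "abelian_group W"
    and W_smult: "w \<in> carrier W \<Longrightarrow> c \<odot>\<^bsub>W\<^esub> w \<in> carrier W"
begin

interpretation W: abelian_group W by (rule W_grp)

abbreviation "P \<equiv> pairs_module A W"
abbreviation "N \<equiv> tensor_null A \<eta> W"
abbreviation "TP \<equiv> tensor_product A \<eta> W"
abbreviation "pure \<equiv> pure_tensor A \<eta> W"

lemma P_simps: "carrier P = {g. keys g \<subseteq> carrier A \<times> carrier W}" "zero P = 0" "add P = (+)"
  by (simp_all add: pairs_module_def)

lemma P_induct [consumes 1, case_names zero single add]:
  assumes g: "g \<in> carrier P" and zero: "Q 0"
    and single: "\<And>a w e. a \<in> carrier A \<Longrightarrow> w \<in> carrier W \<Longrightarrow> Q (Poly_Mapping.single (a, w) e)"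
    and add: "\<And>g h. g \<in> carrier P \<Longrightarrow> h \<in> carrier P \<Longrightarrow> Q g \<Longrightarrow> Q h \<Longrightarrow> Q (g + h)"
  shows "Q g"
proof -
  have "Q (\<Sum>k\<in>K. Poly_Mapping.single k (lookup g k)) \<and> (\<Sum>k\<in>K. Poly_Mapping.single k (lookup g k)) \<in> carrier P"
    if "finite K" "K \<subseteq> keys g" for K
    using that
  proof (induction K rule: finite_induct)
    case empty
    then show ?case using zero by (simp add: P_simps)
  next
    case (insert k K)
    have k: "k \<in> carrier A \<times> carrier W" using insert g by (auto simp: P_simps)
    then obtain a w where aw: "k = (a, w)" "a \<in> carrier A" "w \<in> carrier W" by auto
    have s: "Poly_Mapping.single k (lookup g k) \<in> carrier P" using k by (simp add: P_simps)
    have ih: "Q (\<Sum>k\<in>K. Poly_Mapping.single k (lookup g k))" "(\<Sum>k\<in>K. Poly_Mapping.single k (lookup g k)) \<in> carrier P"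
      using insert by auto
    have "Q (Poly_Mapping.single k (lookup g k) + (\<Sum>k\<in>K. Poly_Mapping.single k (lookup g k)))"
      by (rule add[OF s ih(2) _ ih(1)]) (use single aw in simp)
    moreover have "Poly_Mapping.single k (lookup g k) + (\<Sum>k\<in>K. Poly_Mapping.single k (lookup g k)) \<in> carrier P"
      using s ih(2) Poly_Mapping.keys_add[of "Poly_Mapping.single k (lookup g k)" "\<Sum>k\<in>K. Poly_Mapping.single k (lookup g k)"]
      unfolding P_simps by blast
    ultimately show ?case using insert by simp
  qed
  moreover have "g = (\<Sum>k\<in>keys g. Poly_Mapping.single k (lookup g k))"
    by (rule poly_mapping_eqI) (simp add: lookup_sum lookup_single when_def in_keys_iff)
  ultimately show ?thesis by (metis finite_keys order_refl)
qed

lemma P_act_add: "a \<odot>\<^bsub>P\<^esub> (g + h) = a \<odot>\<^bsub>P\<^esub> g + a \<odot>\<^bsub>P\<^esub> h"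
proof -
  have "a \<odot>\<^bsub>P\<^esub> g = (\<Sum>k\<in>keys g. Poly_Mapping.single (a \<otimes> fst k, snd k) (lookup g k))" for g
    by (simp add: pairs_module_def case_prod_beta)
  then show ?thesis
    using setsum_keys_plus_distrib[of "\<lambda>k e. Poly_Mapping.single (a \<otimes> fst k, snd k) e" g h]
    by (simp add: single_add)
qed

lemma P_act_single: "a \<odot>\<^bsub>P\<^esub> Poly_Mapping.single (b, w) e = Poly_Mapping.single (a \<otimes> b, w) e"
  by (cases "e = 0") (simp_all add: pairs_module_def)

lemma P_act_minus: "a \<odot>\<^bsub>P\<^esub> (g - h) = a \<odot>\<^bsub>P\<^esub> g - a \<odot>\<^bsub>P\<^esub> h"
  by (metis P_act_add add_diff_cancel diff_add_cancel)

lemma P_act_0: "a \<odot>\<^bsub>P\<^esub> 0 = 0" by (metis P_act_add add_cancel_right_right)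

lemma P_action: "additive_action A P"
proof -
  have add_closed: "g + h \<in> carrier P" if "g \<in> carrier P" "h \<in> carrier P" for g h
    using that Poly_Mapping.keys_add[of g h] unfolding P_simps by blast
  have "abelian_group P"
  proof (rule abelian_groupI, goal_cases)
    case (6 g)
    have "keys (- g) = keys g" by (auto simp: in_keys_iff)
    then show ?case using 6 by (intro bexI[of _ "- g"]) (simp_all add: P_simps)
  qed (use add_closed in \<open>auto simp: P_simps(2,3) algebra_simps\<close>, simp add: P_simps)
  then interpret P: abelian_group P .
  have act: "a \<odot>\<^bsub>P\<^esub> g \<in> carrier P" if a: "a \<in> carrier A" and g: "g \<in> carrier P" for a g
    using g
  proof (induction g rule: P_induct)
    case zero then show ?case by (simp add: P_act_0 P_simps)
  next
    case (single b w e) then show ?case using a by (simp add: P_act_single P_simps)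
  next
    case (add g h) then show ?case unfolding P_act_add by (intro add_closed)
  qed
  show ?thesis by unfold_locales (simp_all add: act P_act_add P_simps(3))
qed

lemma P_minus: "g \<in> carrier P \<Longrightarrow> h \<in> carrier P \<Longrightarrow> g \<ominus>\<^bsub>P\<^esub> h = g - h"
proof -
  interpret P: additive_action A P by (rule P_action)
  assume gh: "g \<in> carrier P" "h \<in> carrier P"
  have "(g \<ominus>\<^bsub>P\<^esub> h) + h = g" using P.minus_cancel_mid[OF gh] by (simp add: P_simps)
  then show ?thesis by (simp add: algebra_simps)
qed

abbreviation "Rel \<equiv> bilinearity_relations A \<eta> W"

lemma Rel_P: "Rel \<subseteq> carrier P"
proof -
  have s: "Poly_Mapping.single (a, w) e \<in> carrier P" if "a \<in> carrier A" "w \<in> carrier W" for a w e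
    using that by (simp add: P_simps)
  have m: "g - h \<in> carrier P" if "g \<in> carrier P" "h \<in> carrier P" for g h
  proof -
    interpret P: additive_action A P by (rule P_action)
    show ?thesis using P.M.minus_closed[OF that] P_minus[OF that] by simp
  qed
  show ?thesis unfolding bilinearity_relations_def
    by (intro Un_least subsetI; elim CollectE exE conjE; simp only:)
      (intro m s A.a_closed A.m_closed \<eta>_closed W.a_closed W_smult; assumption)+
qed

lemma N_subgroup: "subgroup N (add_monoid P)"
proof -
  interpret P: additive_action A P by (rule P_action)
  show ?thesis unfolding tensor_null_def
    by (rule group.generate_is_subgroup[OF P.a_group]) (use Rel_P in simp)
qed

lemma N_Rel: "r \<in> Rel \<Longrightarrow> r \<in> N" unfolding tensor_null_def by (rule generate.incl)

lemma relI:
  "a \<in> carrier A \<Longrightarrow> b \<in> carrier A \<Longrightarrow> w \<in> carrier W \<Longrightarrow>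
    Poly_Mapping.single (a \<oplus> b, w) e - Poly_Mapping.single (a, w) e - Poly_Mapping.single (b, w) e \<in> Rel"
  "a \<in> carrier A \<Longrightarrow> u \<in> carrier W \<Longrightarrow> w \<in> carrier W \<Longrightarrow>
    Poly_Mapping.single (a, u \<oplus>\<^bsub>W\<^esub> w) e - Poly_Mapping.single (a, u) e - Poly_Mapping.single (a, w) e \<in> Rel"
  "a \<in> carrier A \<Longrightarrow> w \<in> carrier W \<Longrightarrow>
    Poly_Mapping.single (\<eta> c \<otimes> a, w) e - Poly_Mapping.single (a, w) (c * e) \<in> Rel"
  "a \<in> carrier A \<Longrightarrow> w \<in> carrier W \<Longrightarrow>
    Poly_Mapping.single (a, c \<odot>\<^bsub>W\<^esub> w) e - Poly_Mapping.single (a, w) (c * e) \<in> Rel"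
proof goal_cases
  case 1 show ?case unfolding bilinearity_relations_def
    by (rule UnI1, rule UnI1, rule UnI1, rule CollectI, rule exI[of _ a], rule exI[of _ b], rule exI[of _ w], rule exI[of _ e]) (simp add: 1)
next
  case 2 show ?case unfolding bilinearity_relations_def
    by (rule UnI1, rule UnI1, rule UnI2, rule CollectI, rule exI[of _ a], rule exI[of _ u], rule exI[of _ w], rule exI[of _ e]) (simp add: 2)
next
  case 3 show ?case unfolding bilinearity_relations_def
    by (rule UnI1, rule UnI2, rule CollectI, rule exI[of _ a], rule exI[of _ w], rule exI[of _ c], rule exI[of _ e]) (simp add: 3)
next
  case 4 show ?case unfolding bilinearity_relations_def
    by (rule UnI2, rule CollectI, rule exI[of _ a], rule exI[of _ w], rule exI[of _ c], rule exI[of _ e]) (simp add: 4)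
qed

lemma RelE:
  assumes "r \<in> Rel"
  obtains a b w e where "a \<in> carrier A" "b \<in> carrier A" "w \<in> carrier W"
      "r = Poly_Mapping.single (a \<oplus> b, w) e - Poly_Mapping.single (a, w) e - Poly_Mapping.single (b, w) e"
  | a u w e where "a \<in> carrier A" "u \<in> carrier W" "w \<in> carrier W"
      "r = Poly_Mapping.single (a, u \<oplus>\<^bsub>W\<^esub> w) e - Poly_Mapping.single (a, u) e - Poly_Mapping.single (a, w) e"
  | a w c e where "a \<in> carrier A" "w \<in> carrier W"
      "r = Poly_Mapping.single (\<eta> c \<otimes> a, w) e - Poly_Mapping.single (a, w) (c * e)"
  | a w c e where "a \<in> carrier A" "w \<in> carrier W"
      "r = Poly_Mapping.single (a, c \<odot>\<^bsub>W\<^esub> w) e - Poly_Mapping.single (a, w) (c * e)"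
  using assms unfolding bilinearity_relations_def
  by (elim UnE CollectE exE conjE) (rule that; assumption)+

lemma Rel_act: assumes a: "a \<in> carrier A" and r: "r \<in> Rel" shows "a \<odot>\<^bsub>P\<^esub> r \<in> Rel"
  using r
proof (cases rule: RelE)
  case (1 b b' w e)
  then show ?thesis using a relI(1)[of "a \<otimes> b" "a \<otimes> b'" w e] by (simp add: P_act_minus P_act_single A.r_distr)
next
  case (2 b u w e)
  then show ?thesis using a relI(2)[of "a \<otimes> b" u w e] by (simp add: P_act_minus P_act_single)
next
  case (3 b w c e)
  have "a \<otimes> (\<eta> c \<otimes> b) = \<eta> c \<otimes> (a \<otimes> b)"
    using a 3 \<eta>_central[OF a, of c] by (simp add: A.m_assoc[symmetric])
  then show ?thesis using a 3 relI(3)[of "a \<otimes> b" w c e] by (simp add: P_act_minus P_act_single)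
next
  case (4 b w c e)
  then show ?thesis using a relI(4)[of "a \<otimes> b" w c e] by (simp add: P_act_minus P_act_single)
qed

lemma N_sub_action: "sub_action A P N"
proof (intro sub_action.intro P_action sub_action_axioms.intro N_subgroup)
  interpret P: additive_action A P by (rule P_action)
  fix a n assume a: "a \<in> carrier A" and "n \<in> N"
  then have "n \<in> generate (add_monoid P) Rel" by (simp add: tensor_null_def)
  then have "a \<odot>\<^bsub>P\<^esub> n \<in> N \<and> n \<in> carrier P"
  proof (induction rule: generate.induct)
    case one
    then show ?case using subgroup.one_closed[OF N_subgroup] by (simp add: P_simps P_act_0)
  next
    case (incl r)
    then show ?case using Rel_act[OF a] N_Rel Rel_P by blast
  next
    case (inv r)
    have rP: "r \<in> carrier P" using inv Rel_P by blast
    have "inv\<^bsub>add_monoid P\<^esub> r = - r"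
    proof -
      have "\<zero>\<^bsub>P\<^esub> \<ominus>\<^bsub>P\<^esub> r = 0 - r" using P_minus[OF P.M.zero_closed rP] by (simp add: P_simps)
      then show ?thesis using rP by (simp add: P.M.minus_eq a_inv_def)
    qed
    moreover have "inv\<^bsub>add_monoid P\<^esub> (a \<odot>\<^bsub>P\<^esub> r) = - (a \<odot>\<^bsub>P\<^esub> r)"
    proof -
      have aP: "a \<odot>\<^bsub>P\<^esub> r \<in> carrier P" by (rule P.act_closed[OF a rP])
      have "\<zero>\<^bsub>P\<^esub> \<ominus>\<^bsub>P\<^esub> (a \<odot>\<^bsub>P\<^esub> r) = 0 - (a \<odot>\<^bsub>P\<^esub> r)" using P_minus[OF P.M.zero_closed aP] by (simp add: P_simps)
      then show ?thesis using aP by (simp add: P.M.minus_eq a_inv_def)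
    qed
    moreover have "a \<odot>\<^bsub>P\<^esub> (- r) = - (a \<odot>\<^bsub>P\<^esub> r)" using P_act_minus[of a 0 r] by (simp add: P_act_0)
    moreover have "inv\<^bsub>add_monoid P\<^esub> (a \<odot>\<^bsub>P\<^esub> r) \<in> N"
      by (rule subgroup.m_inv_closed[OF N_subgroup N_Rel[OF Rel_act[OF a inv]]])
    moreover have "inv\<^bsub>add_monoid P\<^esub> r \<in> carrier P" using P.M.a_inv_closed[OF rP] by (simp add: a_inv_def)
    ultimately show ?case by simp
  next
    case (eng g h)
    then show ?case using subgroup.m_closed[OF N_subgroup, of "a \<odot>\<^bsub>P\<^esub> g" "a \<odot>\<^bsub>P\<^esub> h"] P.M.a_closed[of g h]
      by (simp add: P_simps(3) P_act_add)
  qed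
  then show "a \<odot>\<^bsub>P\<^esub> n \<in> N" by blast
qed

interpretation Q: sub_action A P N by (rule N_sub_action)

lemma TP_eq: "TP = quotient_module P N" by (simp add: tensor_product_def)
lemma TP_action: "additive_action A TP" unfolding TP_eq by (rule Q.quot_action)
lemma single_P: "a \<in> carrier A \<Longrightarrow> w \<in> carrier W \<Longrightarrow> Poly_Mapping.single (a, w) e \<in> carrier P"
  by (simp add: P_simps)

lemma pure_closed: "a \<in> carrier A \<Longrightarrow> w \<in> carrier W \<Longrightarrow> pure a w \<in> carrier TP"
  unfolding pure_tensor_def TP_eq by (rule Q.coset_closed[OF single_P])

lemma coset_eqI: "g \<in> carrier P \<Longrightarrow> h \<in> carrier P \<Longrightarrow> g - h \<in> N \<Longrightarrow> N +>\<^bsub>P\<^esub> g = N +>\<^bsub>P\<^esub> h"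
  by (simp add: Q.coset_eq_iff P_minus)

lemma coset_add: "g \<in> carrier P \<Longrightarrow> h \<in> carrier P \<Longrightarrow> N +>\<^bsub>P\<^esub> (g + h) = (N +>\<^bsub>P\<^esub> g) \<oplus>\<^bsub>TP\<^esub> (N +>\<^bsub>P\<^esub> h)"
  unfolding TP_eq by (simp add: Q.quot_add P_simps(3))

lemma sum_P: "g \<in> carrier P \<Longrightarrow> h \<in> carrier P \<Longrightarrow> g + h \<in> carrier P"
  using Q.M.a_closed[of g h] by (simp add: P_simps(3))

lemma pure_add_left:
  assumes "a \<in> carrier A" "b \<in> carrier A" "w \<in> carrier W"
  shows "pure (a \<oplus> b) w = pure a w \<oplus>\<^bsub>TP\<^esub> pure b w"
proof -
  have "N +>\<^bsub>P\<^esub> Poly_Mapping.single (a \<oplus> b, w) 1 = N +>\<^bsub>P\<^esub> (Poly_Mapping.single (a, w) 1 + Poly_Mapping.single (b, w) 1)"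
    using N_Rel[OF relI(1)[OF assms, of 1]] assms
    by (intro coset_eqI sum_P single_P) (simp_all add: algebra_simps)
  then show ?thesis unfolding pure_tensor_def by (simp add: coset_add single_P assms)
qed

lemma pure_add_right:
  assumes "a \<in> carrier A" "u \<in> carrier W" "w \<in> carrier W"
  shows "pure a (u \<oplus>\<^bsub>W\<^esub> w) = pure a u \<oplus>\<^bsub>TP\<^esub> pure a w"
proof -
  have "N +>\<^bsub>P\<^esub> Poly_Mapping.single (a, u \<oplus>\<^bsub>W\<^esub> w) 1 = N +>\<^bsub>P\<^esub> (Poly_Mapping.single (a, u) 1 + Poly_Mapping.single (a, w) 1)"
    using N_Rel[OF relI(2)[OF assms, of 1]] assms
    by (intro coset_eqI sum_P single_P) (simp_all add: algebra_simps)
  then show ?thesis unfolding pure_tensor_def by (simp add: coset_add single_P assms)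
qed

lemma coset_single:
  assumes "a \<in> carrier A" "w \<in> carrier W"
  shows "N +>\<^bsub>P\<^esub> Poly_Mapping.single (a, w) e = pure (\<eta> e \<otimes> a) w"
    "N +>\<^bsub>P\<^esub> Poly_Mapping.single (a, w) e = pure a (e \<odot>\<^bsub>W\<^esub> w)"
proof -
  have "N +>\<^bsub>P\<^esub> Poly_Mapping.single (\<eta> e \<otimes> a, w) 1 = N +>\<^bsub>P\<^esub> Poly_Mapping.single (a, w) e"
    using N_Rel[OF relI(3)[OF assms, of e 1]] assms by (intro coset_eqI single_P) simp_all
  then show "N +>\<^bsub>P\<^esub> Poly_Mapping.single (a, w) e = pure (\<eta> e \<otimes> a) w" by (simp add: pure_tensor_def)
  have "N +>\<^bsub>P\<^esub> Poly_Mapping.single (a, e \<odot>\<^bsub>W\<^esub> w) 1 = N +>\<^bsub>P\<^esub> Poly_Mapping.single (a, w) e"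
    using N_Rel[OF relI(4)[OF assms, of e 1]] assms by (intro coset_eqI single_P W_smult) simp_all
  then show "N +>\<^bsub>P\<^esub> Poly_Mapping.single (a, w) e = pure a (e \<odot>\<^bsub>W\<^esub> w)" by (simp add: pure_tensor_def)
qed

lemma pure_scale: "a \<in> carrier A \<Longrightarrow> w \<in> carrier W \<Longrightarrow> pure a (c \<odot>\<^bsub>W\<^esub> w) = pure (\<eta> c \<otimes> a) w"
  using coset_single by metis

lemma pure_act: "a \<in> carrier A \<Longrightarrow> b \<in> carrier A \<Longrightarrow> w \<in> carrier W \<Longrightarrow> a \<odot>\<^bsub>TP\<^esub> pure b w = pure (a \<otimes> b) w"
  unfolding TP_eq pure_tensor_def by (simp add: Q.quot_act single_P P_act_single)

lemma TP_induct [consumes 1, case_names pure add]: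
  assumes z: "z \<in> carrier TP"
    and pure: "\<And>a w. a \<in> carrier A \<Longrightarrow> w \<in> carrier W \<Longrightarrow> Q (pure a w)"
    and add: "\<And>y z. y \<in> carrier TP \<Longrightarrow> z \<in> carrier TP \<Longrightarrow> Q y \<Longrightarrow> Q z \<Longrightarrow> Q (y \<oplus>\<^bsub>TP\<^esub> z)"
  shows "Q z"
proof -
  obtain g where g: "g \<in> carrier P" "z = N +>\<^bsub>P\<^esub> g" using z unfolding TP_eq by (rule Q.quot_carrierE)
  have "Q (N +>\<^bsub>P\<^esub> g)" using g(1)
  proof (induction g rule: P_induct)
    case zero
    have "N +>\<^bsub>P\<^esub> 0 = N +>\<^bsub>P\<^esub> Poly_Mapping.single (\<zero>, \<zero>\<^bsub>W\<^esub>) 0" by simp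
    also have "\<dots> = pure (\<eta> 0 \<otimes> \<zero>) \<zero>\<^bsub>W\<^esub>" by (rule coset_single(1)) simp_all
    finally show ?case using pure[of "\<eta> 0 \<otimes> \<zero>" "\<zero>\<^bsub>W\<^esub>"] by simp
  next
    case (single a w e)
    then show ?case using pure[of "\<eta> e \<otimes> a" w] by (simp add: coset_single(1))
  next
    case (add g h)
    then show ?case using assms(3)[of "N +>\<^bsub>P\<^esub> g" "N +>\<^bsub>P\<^esub> h"] Q.coset_closed
      by (simp add: coset_add TP_eq)
  qed
  then show ?thesis using g(2) by simp
qed

text \<open>
  The universal property: a balanced biadditive map that is \<open>A\<close>-linear in the first argument extends to the
  free module on pairs, and there it annihilates the four kinds of bilinearity relations.
\<close>

lemma TP_universal:
  assumes B: "additive_action A B"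
    and cl: "\<And>a w. a \<in> carrier A \<Longrightarrow> w \<in> carrier W \<Longrightarrow> \<beta> a w \<in> carrier B"
    and addl: "\<And>a b w. a \<in> carrier A \<Longrightarrow> b \<in> carrier A \<Longrightarrow> w \<in> carrier W \<Longrightarrow> \<beta> (a \<oplus> b) w = \<beta> a w \<oplus>\<^bsub>B\<^esub> \<beta> b w"
    and addr: "\<And>a u w. a \<in> carrier A \<Longrightarrow> u \<in> carrier W \<Longrightarrow> w \<in> carrier W \<Longrightarrow> \<beta> a (u \<oplus>\<^bsub>W\<^esub> w) = \<beta> a u \<oplus>\<^bsub>B\<^esub> \<beta> a w"
    and bal: "\<And>a c w. a \<in> carrier A \<Longrightarrow> w \<in> carrier W \<Longrightarrow> \<beta> a (c \<odot>\<^bsub>W\<^esub> w) = \<beta> (\<eta> c \<otimes> a) w"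
    and act: "\<And>a b w. a \<in> carrier A \<Longrightarrow> b \<in> carrier A \<Longrightarrow> w \<in> carrier W \<Longrightarrow> \<beta> (b \<otimes> a) w = b \<odot>\<^bsub>B\<^esub> \<beta> a w"
  shows "\<exists>h\<in>module_homs A TP B. \<forall>a\<in>carrier A. \<forall>w\<in>carrier W. h (pure a w) = \<beta> a w"
proof -
  interpret B: additive_action A B by (rule B)
  define F where "F k e = \<beta> (\<eta> e \<otimes> fst k) (snd k)" for k e
  define hh where "hh g = (\<Oplus>\<^bsub>B\<^esub>k\<in>keys g. F k (lookup g k))" for g
  have Fc: "F k e \<in> carrier B" if "k \<in> carrier A \<times> carrier W" for k e
    unfolding F_def using that by (intro cl) auto
  have Fadd: "F k (e + e') = F k e \<oplus>\<^bsub>B\<^esub> F k e'" if "k \<in> carrier A \<times> carrier W" for k e e'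
    unfolding F_def using that by (subst addl[symmetric]) (auto simp: \<eta>_add A.l_distr)
  have F0: "F k 0 = \<zero>\<^bsub>B\<^esub>" if "k \<in> carrier A \<times> carrier W" for k
    using Fadd[OF that, of 0 0] Fc[OF that, of 0] by (metis B.M.add.l_cancel_one' B.M.r_zero B.M.zero_closed add_0)
  have sup: "hh g = (\<Oplus>\<^bsub>B\<^esub>k\<in>K. F k (lookup g k))"
    if "finite K" "keys g \<subseteq> K" "K \<subseteq> carrier A \<times> carrier W" for g K
    unfolding hh_def
  proof (rule B.M.add.finprod_mono_neutral_cong_left)
    fix i assume "i \<in> K - keys g"
    then have "lookup g i = 0" "i \<in> carrier A \<times> carrier W" using that by (auto simp: in_keys_iff)
    then show "F i (lookup g i) = \<zero>\<^bsub>B\<^esub>" using F0 by simp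
  qed (use that Fc in auto)
  have hadd: "hh (g + h) = hh g \<oplus>\<^bsub>B\<^esub> hh h" if g: "g \<in> carrier P" and h: "h \<in> carrier P" for g h
  proof -
    let ?K = "keys g \<union> keys h"
    have K: "finite ?K" "keys g \<subseteq> ?K" "keys h \<subseteq> ?K" "keys (g + h) \<subseteq> ?K" "?K \<subseteq> carrier A \<times> carrier W"
      using g h Poly_Mapping.keys_add[of g h] unfolding P_simps by auto
    have "hh (g + h) = (\<Oplus>\<^bsub>B\<^esub>k\<in>?K. F k (lookup g k) \<oplus>\<^bsub>B\<^esub> F k (lookup h k))"
      unfolding sup[OF K(1,4,5)] lookup_add
      by (rule B.M.finsum_cong') (use Fadd Fc K(5) in \<open>auto simp: subset_iff\<close>)
    also have "\<dots> = hh g \<oplus>\<^bsub>B\<^esub> hh h"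
      unfolding sup[OF K(1,2,5)] sup[OF K(1,3,5)]
      by (rule B.M.finsum_addf) (use Fc K(5) in auto)
    finally show ?thesis .
  qed
  have hs: "hh (Poly_Mapping.single (a, w) e) = \<beta> (\<eta> e \<otimes> a) w" if "a \<in> carrier A" "w \<in> carrier W" for a w e
  proof -
    have "hh (Poly_Mapping.single (a, w) e) = (\<Oplus>\<^bsub>B\<^esub>k\<in>{(a, w)}. F k (lookup (Poly_Mapping.single (a, w) e) k))"
      by (rule sup) (use that in auto)
    also have "\<dots> = F (a, w) e" using Fc[of "(a, w)" e] that by (simp add: B.M.finsum_insert)
    finally show ?thesis by (simp add: F_def)
  qed
  have h0: "hh 0 = \<zero>\<^bsub>B\<^esub>" by (simp add: hh_def)
  have hc: "hh g \<in> carrier B" if "g \<in> carrier P" for g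
    unfolding hh_def using that Fc by (intro B.M.finsum_closed) (auto simp: P_simps)
  have hact: "hh (a \<odot>\<^bsub>P\<^esub> g) = a \<odot>\<^bsub>B\<^esub> hh g" if a: "a \<in> carrier A" and g: "g \<in> carrier P" for a g
    using g
  proof (induction g rule: P_induct)
    case zero then show ?case by (simp add: P_act_0 h0 B.act_zero[OF a])
  next
    case (single b w e)
    have "\<eta> e \<otimes> (a \<otimes> b) = a \<otimes> (\<eta> e \<otimes> b)"
      using a single \<eta>_central[OF a, of e] by (simp add: A.m_assoc[symmetric])
    then show ?case using a single by (simp add: P_act_single hs act)
  next
    case (add g h)
    then show ?case using Q.act_closed[OF a]
      by (simp add: P_act_add hadd B.act_add[OF a hc hc])
  qed
  have hP: "hh \<in> module_homs A P B"
    by (rule module_homsI) (simp_all add: hc hadd hact P_simps(3))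
  have hminus: "hh (g - h) = hh g \<ominus>\<^bsub>B\<^esub> hh h" if "g \<in> carrier P" "h \<in> carrier P" for g h
    using hom_minus[OF hP Q.M.abelian_group_axioms B.M.abelian_group_axioms that] by (simp add: P_minus[OF that])
  have hRel: "hh r = \<zero>\<^bsub>B\<^esub>" if r: "r \<in> Rel" for r
    using r
  proof (cases rule: RelE)
    case (1 a b w e)
    have m: "Poly_Mapping.single (a \<oplus> b, w) e - Poly_Mapping.single (a, w) e - Poly_Mapping.single (b, w) e
      = Poly_Mapping.single (a \<oplus> b, w) e - (Poly_Mapping.single (a, w) e + Poly_Mapping.single (b, w) e)" by (simp add: algebra_simps)
    have "hh r = \<beta> (\<eta> e \<otimes> (a \<oplus> b)) w \<ominus>\<^bsub>B\<^esub> (\<beta> (\<eta> e \<otimes> a) w \<oplus>\<^bsub>B\<^esub> \<beta> (\<eta> e \<otimes> b) w)"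
      using 1 unfolding 1(4) m by (simp add: hminus hadd single_P sum_P hs)
    then show ?thesis using 1 by (simp add: A.r_distr addl B.M.minus_eq_zero_iff cl)
  next
    case (2 a u w e)
    have m: "Poly_Mapping.single (a, u \<oplus>\<^bsub>W\<^esub> w) e - Poly_Mapping.single (a, u) e - Poly_Mapping.single (a, w) e
      = Poly_Mapping.single (a, u \<oplus>\<^bsub>W\<^esub> w) e - (Poly_Mapping.single (a, u) e + Poly_Mapping.single (a, w) e)" by (simp add: algebra_simps)
    have "hh r = \<beta> (\<eta> e \<otimes> a) (u \<oplus>\<^bsub>W\<^esub> w) \<ominus>\<^bsub>B\<^esub> (\<beta> (\<eta> e \<otimes> a) u \<oplus>\<^bsub>B\<^esub> \<beta> (\<eta> e \<otimes> a) w)"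
      using 2 unfolding 2(4) m by (simp add: hminus hadd single_P sum_P hs)
    then show ?thesis using 2 by (simp add: addr B.M.minus_eq_zero_iff cl)
  next
    case (3 a w c e)
    have "hh r = \<beta> (\<eta> e \<otimes> (\<eta> c \<otimes> a)) w \<ominus>\<^bsub>B\<^esub> \<beta> (\<eta> (c * e) \<otimes> a) w"
      using 3 unfolding 3(3) by (simp add: hminus single_P hs)
    moreover have "\<eta> e \<otimes> (\<eta> c \<otimes> a) = \<eta> (c * e) \<otimes> a"
      using 3 by (simp add: A.m_assoc[symmetric] \<eta>_mult[symmetric] mult.commute)
    ultimately show ?thesis using 3 by (simp add: B.M.minus_eq_zero_iff cl)
  next
    case (4 a w c e)
    have "hh r = \<beta> (\<eta> e \<otimes> a) (c \<odot>\<^bsub>W\<^esub> w) \<ominus>\<^bsub>B\<^esub> \<beta> (\<eta> (c * e) \<otimes> a) w"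
      using 4 unfolding 4(3) by (simp add: hminus single_P hs W_smult)
    moreover have "\<beta> (\<eta> e \<otimes> a) (c \<odot>\<^bsub>W\<^esub> w) = \<beta> (\<eta> (c * e) \<otimes> a) w"
      using 4 by (simp add: bal \<eta>_mult A.m_assoc)
    ultimately show ?thesis using 4 by (simp add: B.M.minus_eq_zero_iff cl)
  qed
  have hN: "hh n = \<zero>\<^bsub>B\<^esub>" if "n \<in> N" for n
  proof -
    have ker: "subgroup {g \<in> carrier P. hh g = \<zero>\<^bsub>B\<^esub>} (add_monoid P)"
    proof (rule Q.M.subgroupI_minus)
      show "g \<ominus>\<^bsub>P\<^esub> h \<in> {g \<in> carrier P. hh g = \<zero>\<^bsub>B\<^esub>}"
        if "g \<in> {g \<in> carrier P. hh g = \<zero>\<^bsub>B\<^esub>}" "h \<in> {g \<in> carrier P. hh g = \<zero>\<^bsub>B\<^esub>}" for g h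
        using that hminus[of g h] P_minus[of g h] Q.M.minus_closed[of g h] by (simp add: B.M.minus_eq_zero_iff)
    qed (use h0 Q.M.zero_closed in \<open>auto simp: P_simps(2)\<close>)
    have "N \<subseteq> {g \<in> carrier P. hh g = \<zero>\<^bsub>B\<^esub>}"
      unfolding tensor_null_def
      by (rule group.generate_subgroup_incl[OF Q.M.a_group _ ker]) (use hRel Rel_P in auto)
    then show ?thesis using that by blast
  qed
  obtain h where h: "h \<in> module_homs A (quotient_module P N) B" "\<And>g. g \<in> carrier P \<Longrightarrow> h (N +>\<^bsub>P\<^esub> g) = hh g"
    using Q.quot_hom_exists[OF B hP hN] by blast
  have "h (pure a w) = \<beta> a w" if "a \<in> carrier A" "w \<in> carrier W" for a w
    unfolding pure_tensor_def using h(2)[OF single_P[OF that]] that by (simp add: hs \<eta>_one)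
  then show ?thesis using h(1) unfolding TP_eq by blast
qed

end

section \<open>The Koszul complex\<close>

locale koszul_setup = tensor_basis sc x
  for sc :: "'k::field \<Rightarrow> 'v::ab_group_add \<Rightarrow> 'v" and x :: "'n::finite \<Rightarrow> 'v" +
  fixes C :: "'k^'n^'n"
  assumes nr: "\<not> rank1 C"
begin

abbreviation "f \<equiv> qform C"
definition "R = tensor_line sc (\<sigma> f)"
abbreviation "A \<equiv> quad_algebra sc R"

lemma R_eq: "R = \<sigma> ` range (\<lambda>c. cst c * f)"
  by (simp add: R_def tensor_line_def tensor_unit_\<sigma> \<sigma>_mult[symmetric] image_image)

lemma R_carrier: "R \<subseteq> carrier T" by (auto simp: R_eq)

lemma ideal_R: "Idl\<^bsub>T\<^esub> R = \<sigma> ` qid f"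
proof
  interpret T: ring T by (rule T_ring)
  have "ideal (\<sigma> ` qid f) T"
  proof (rule idealI[OF T_ring])
    show "subgroup (\<sigma> ` qid f) (add_monoid T)"
    proof (rule T.subgroupI_minus)
      show "\<sigma> ` qid f \<subseteq> carrier T" by auto
      show "\<zero>\<^bsub>T\<^esub> \<in> \<sigma> ` qid f" unfolding \<sigma>_zero[symmetric] by (rule imageI[OF qid.zero])
      show "a \<ominus>\<^bsub>T\<^esub> b \<in> \<sigma> ` qid f" if "a \<in> \<sigma> ` qid f" "b \<in> \<sigma> ` qid f" for a b
        using that by (elim imageE) (simp only: \<sigma>_minus[symmetric], rule imageI, rule qid_minus)
    qed
    show "t \<otimes>\<^bsub>T\<^esub> a \<in> \<sigma> ` qid f" if "a \<in> \<sigma> ` qid f" "t \<in> carrier T" for a t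
      using that unfolding T_carrier by (elim imageE) (simp only: \<sigma>_mult[symmetric], rule imageI, rule qid_mult_left)
    show "a \<otimes>\<^bsub>T\<^esub> t \<in> \<sigma> ` qid f" if "a \<in> \<sigma> ` qid f" "t \<in> carrier T" for a t
      using that unfolding T_carrier by (elim imageE) (simp only: \<sigma>_mult[symmetric], rule imageI, rule qid_mult_right)
  qed
  moreover have "R \<subseteq> \<sigma> ` qid f"
  proof
    fix r assume "r \<in> R"
    then obtain c where "r = \<sigma> (cst c * f)" by (auto simp: R_eq)
    then show "r \<in> \<sigma> ` qid f" using qid_base[of "cst c" f 1] by simp
  qed
  ultimately show "Idl\<^bsub>T\<^esub> R \<subseteq> \<sigma> ` qid f" by (rule T.genideal_minimal)
  interpret I: ideal "Idl\<^bsub>T\<^esub> R" T by (rule T.genideal_ideal[OF R_carrier])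
  have f: "\<sigma> f \<in> Idl\<^bsub>T\<^esub> R"
  proof -
    have "\<sigma> (cst 1 * f) \<in> R" unfolding R_eq by (intro imageI rangeI)
    then show ?thesis using T.genideal_self[OF R_carrier] by (auto simp: cst_simps)
  qed
  show "\<sigma> ` qid f \<subseteq> Idl\<^bsub>T\<^esub> R"
  proof
    fix t assume "t \<in> \<sigma> ` qid f"
    then obtain p where "p \<in> qid f" and t: "t = \<sigma> p" by auto
    from this(1) have "\<sigma> p \<in> Idl\<^bsub>T\<^esub> R"
    proof induction
      case zero
      show ?case unfolding \<sigma>_zero using subgroup.one_closed[OF I.a_subgroup] by simp
    next
      case (step p u w)
      have "\<sigma> u \<otimes>\<^bsub>T\<^esub> \<sigma> f \<otimes>\<^bsub>T\<^esub> \<sigma> w \<in> Idl\<^bsub>T\<^esub> R"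
        by (rule I.I_r_closed[OF I.I_l_closed[OF f \<sigma>_closed] \<sigma>_closed])
      then show ?case unfolding \<sigma>_add \<sigma>_mult using subgroup.m_closed[OF I.a_subgroup step.IH] by simp
    qed
    then show "t \<in> Idl\<^bsub>T\<^esub> R" using t by simp
  qed
qed

lemma J_ideal: "ideal (Idl\<^bsub>T\<^esub> R) T" by (rule ring.genideal_ideal[OF T_ring R_carrier])

lemmas Aq = quotient_ring_facts[OF J_ideal, folded quad_algebra_def]

definition \<pi> :: "('n, 'k) fralg \<Rightarrow> ('k, 'v) tensor set" where "\<pi> p = quad_proj sc R (\<sigma> p)"

sublocale quad_model A \<pi> C
proof (intro quad_model.intro quad_model_axioms.intro)
  show "ring A" by (rule Aq(1))
  show "carrier A = range \<pi>" unfolding Aq(2) T_carrier by (simp add: \<pi>_def[abs_def] quad_proj_def image_image)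
  show "\<pi> (p + q) = \<pi> p \<oplus>\<^bsub>A\<^esub> \<pi> q" for p q by (simp add: \<pi>_def quad_proj_def \<sigma>_add Aq(3))
  show "\<pi> (p * q) = \<pi> p \<otimes>\<^bsub>A\<^esub> \<pi> q" for p q by (simp add: \<pi>_def quad_proj_def \<sigma>_mult Aq(4))
  show "\<pi> 1 = \<one>\<^bsub>A\<^esub>" by (simp add: \<pi>_def quad_proj_def \<sigma>_one Aq(5))
  show "\<pi> p = \<zero>\<^bsub>A\<^esub> \<longleftrightarrow> p \<in> qid f" for p
  proof -
    have "\<pi> p = \<zero>\<^bsub>A\<^esub> \<longleftrightarrow> \<sigma> p \<in> Idl\<^bsub>T\<^esub> R" by (simp only: \<pi>_def quad_proj_def Aq(6)[OF \<sigma>_closed])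
    then show ?thesis unfolding ideal_R by (auto simp: \<sigma>_eq_iff)
  qed
  show "\<not> rank1 C" by (rule nr)
qed

lemma quad_vec_\<pi>: "quad_vec sc R v = \<pi> (lv v)" by (simp add: quad_vec_def \<pi>_def tensor_vec_\<sigma>)
lemma quad_unit_eta: "quad_unit sc R = eta"
  by (rule ext) (simp add: quad_unit_def eta_def \<pi>_def tensor_unit_\<sigma>)
lemma quad_grading_\<pi>: "quad_grading sc R = (\<lambda>m. \<pi> ` homs m)"
  by (rule ext) (simp add: quad_grading_def \<pi>_def[abs_def] tensor_power_\<sigma> image_image)

lemma no_zerodivisors:
  assumes "v \<noteq> 0"
  shows "\<not> left_zerodivisor A (quad_vec sc R v)" "\<not> right_zerodivisor A (quad_vec sc R v)"
proof -
  obtain j where j: "coord v j \<noteq> 0" using coord_nonzero[OF assms] .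
  show "\<not> left_zerodivisor A (quad_vec sc R v)" "\<not> right_zerodivisor A (quad_vec sc R v)"
    unfolding left_zerodivisor_def right_zerodivisor_def quad_vec_\<pi> lv_def
    using nzd_left[of "coord v" j, OF j] nzd_right[of "coord v" j, OF j] by blast+
qed

subsection \<open>The spaces of the Koszul complex\<close>

text \<open>
  The preimages of the spaces \<open>W\<^sub>m\<close> in the free algebra: \<open>k\<close>, \<open>V\<close>, \<open>k f\<close> and then zero.
\<close>

definition WF :: "nat \<Rightarrow> ('n, 'k) fralg set"
  where "WF m = (if m = 0 then homs 0 else if m = 1 then homs 1 else if m = 2 then range (\<lambda>c. cst c * f) else {0})"

lemma WF_simps: "WF 0 = homs 0" "WF (Suc 0) = homs 1" "WF (Suc (Suc 0)) = range (\<lambda>c. cst c * f)"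
  "WF (Suc (Suc (Suc m))) = {0}"
  by (simp_all add: WF_def)

lemma subspace_prod_mono: "Y \<subseteq> Y' \<Longrightarrow> subspace_prod T X Y \<subseteq> subspace_prod T X Y'"
  unfolding subspace_prod_def
proof
  fix t assume Y: "Y \<subseteq> Y'" and "t \<in> generate (add_monoid T) {s \<otimes>\<^bsub>T\<^esub> s' | s s'. s \<in> X \<and> s' \<in> Y}"
  from this(2) show "t \<in> generate (add_monoid T) {s \<otimes>\<^bsub>T\<^esub> s' | s s'. s \<in> X \<and> s' \<in> Y'}"
  proof induction
    case one show ?case by (rule generate.one)
  next
    case (incl h) then show ?case using Y by (intro generate.incl) auto
  next
    case (inv h) then show ?case using Y by (intro generate.inv) auto
  next
    case (eng g h) then show ?case by (intro generate.eng)
  qed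
qed

lemma subspace_prod_zero: "\<zero>\<^bsub>T\<^esub> \<in> subspace_prod T X Y"
  unfolding subspace_prod_def using generate.one[of "add_monoid T"] by simp

lemma line_f: "a \<in> range (\<lambda>c. cst c * f) \<Longrightarrow> b \<in> range (\<lambda>c. cst c * f) \<Longrightarrow> a - b \<in> range (\<lambda>c. cst c * f)"
  by (elim rangeE, rule range_eqI[of _ _ "c - d" for c d]) (simp add: cst_simps left_diff_distrib)

lemma koszul_W_2: "koszul_W sc R (Suc (Suc 0)) = \<sigma> ` range (\<lambda>c. cst c * f)"
proof -
  let ?Z = "range (\<lambda>c. cst c * f)"
  have idx: "{(i, j). i + 2 + j = Suc (Suc 0)} = {(0, 0)}" by auto
  have "subspace_prod T (\<sigma> ` homs 0) (subspace_prod T R (\<sigma> ` homs 0)) = \<sigma> ` ?Z"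
  proof
    have z: "(0 :: ('n, 'k) fralg) \<in> ?Z" by (rule range_eqI[of _ _ 0]) (simp add: cst_simps)
    have m1: "a * b \<in> ?Z" if a: "a \<in> ?Z" and b: "b \<in> homs 0" for a b
    proof -
      obtain c where "a = cst c * f" using a by blast
      moreover have "b = cst (eps b)" by (rule homs_0_cst[OF b])
      ultimately have "a * b = cst (c * eps b) * f" by (metis cst_comm cst_simps(6) mult.assoc mult.commute)
      then show ?thesis by (rule range_eqI)
    qed
    have m2: "a * b \<in> ?Z" if a: "a \<in> homs 0" and b: "b \<in> ?Z" for a b
    proof -
      obtain c where "b = cst c * f" using b by blast
      moreover have "a = cst (eps a)" by (rule homs_0_cst[OF a])
      ultimately have "a * b = cst (eps a * c) * f" by (metis cst_simps(6) mult.assoc)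
      then show ?thesis by (rule range_eqI)
    qed
    have "subspace_prod T R (\<sigma> ` homs 0) \<subseteq> \<sigma> ` ?Z"
      unfolding R_eq by (rule subspace_prod_subset[OF z line_f m1])
    then have "subspace_prod T (\<sigma> ` homs 0) (subspace_prod T R (\<sigma> ` homs 0)) \<subseteq> subspace_prod T (\<sigma> ` homs 0) (\<sigma> ` ?Z)"
      by (rule subspace_prod_mono)
    also have "\<dots> \<subseteq> \<sigma> ` ?Z" by (rule subspace_prod_subset[OF z line_f m2])
    finally show "subspace_prod T (\<sigma> ` homs 0) (subspace_prod T R (\<sigma> ` homs 0)) \<subseteq> \<sigma> ` ?Z" .
    have one: "(1 :: ('n, 'k) fralg) \<in> homs 0" using homs_cst[of 1] by (simp only: cst_simps)
    have 1: "\<sigma> r \<in> subspace_prod T R (\<sigma> ` homs 0)" if "r \<in> ?Z" for r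
      using subspace_prod_sum[of "{()}" "\<lambda>_. r" ?Z "\<lambda>_. 1" "homs 0"] that one unfolding R_eq by simp
    show "\<sigma> ` ?Z \<subseteq> subspace_prod T (\<sigma> ` homs 0) (subspace_prod T R (\<sigma> ` homs 0))"
    proof
      fix t assume t: "t \<in> \<sigma> ` ?Z"
      then obtain r where r: "r \<in> ?Z" "t = \<sigma> r" by blast
      have "\<sigma> 1 \<otimes>\<^bsub>T\<^esub> \<sigma> r \<in> generate (add_monoid T) {s \<otimes>\<^bsub>T\<^esub> s' | s s'. s \<in> \<sigma> ` homs 0 \<and> s' \<in> subspace_prod T R (\<sigma> ` homs 0)}"
        by (intro generate.incl CollectI exI[of _ "\<sigma> 1"] exI[of _ "\<sigma> r"] conjI refl imageI one 1[OF r(1)])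
      then show "t \<in> subspace_prod T (\<sigma> ` homs 0) (subspace_prod T R (\<sigma> ` homs 0))"
        unfolding subspace_prod_def[of T "\<sigma> ` homs 0" "subspace_prod T R (\<sigma> ` homs 0)"]
        using r(2) by (simp add: \<sigma>_mult[symmetric])
    qed
  qed
  moreover have "\<sigma> ` ?Z \<subseteq> \<sigma> ` homs 2" by (intro image_mono) (auto intro: homs_cst_mult)
  ultimately show ?thesis
    unfolding koszul_W_def idx tensor_power_\<sigma> by (simp add: numeral_2_eq_2 Int_absorb1)
qed

text \<open>
  Already the first two of the intersected subspaces, those with \<open>R\<close> in the first and in the second place, meet in zero.
\<close>

lemma koszul_W_3: "koszul_W sc R (Suc (Suc (Suc m))) = \<sigma> ` {0}"
proof
  let ?m = "Suc (Suc (Suc m))"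
  show "\<sigma> ` {0} \<subseteq> koszul_W sc R ?m"
    unfolding koszul_W_def tensor_power_\<sigma>
    using subspace_prod_zero by (auto simp: \<sigma>_zero[symmetric] intro!: imageI)
  show "koszul_W sc R ?m \<subseteq> \<sigma> ` {0}"
  proof
    fix t assume t: "t \<in> koszul_W sc R ?m"
    let ?Z1 = "(\<lambda>p. f * p) ` homs (Suc m)"
    let ?Z2 = "{p. \<exists>q. p = (\<Sum>i\<in>UNIV. gen i * (f * q i))}"
    have z: "0 \<in> ?Z1" by (rule image_eqI[of _ _ 0]) simp_all
    have d: "a - b \<in> ?Z1" if "a \<in> ?Z1" "b \<in> ?Z1" for a b
      using that by (auto simp: right_diff_distrib[symmetric] homs_minus)
    have m1: "a * b \<in> ?Z1" if a: "a \<in> range (\<lambda>c. cst c * f)" and b: "b \<in> homs (Suc m)" for a b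
    proof -
      obtain c where "a = cst c * f" using a by blast
      then have "a * b = f * (cst c * b)" by (simp add: mult.assoc cst_left[of f])
      then show ?thesis using homs_cst_mult[OF b] by blast
    qed
    have m1': "a * b \<in> ?Z1" if a: "a \<in> homs 0" and b: "b \<in> ?Z1" for a b
    proof -
      obtain p where p: "p \<in> homs (Suc m)" "b = f * p" using b by blast
      have "a = cst (eps a)" by (rule homs_0_cst[OF a])
      then have "a * b = f * (cst (eps a) * p)" using p(2) cst_left[of f "eps a" p] by simp
      then show ?thesis using homs_cst_mult[OF p(1)] by blast
    qed
    have idx0: "(0, Suc m) \<in> {(i, j). i + 2 + j = ?m}" by simp
    have "t \<in> subspace_prod T (tensor_power sc 0) (subspace_prod T R (tensor_power sc (Suc m)))"
      using t idx0 unfolding koszul_W_def by blast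
    also have "\<dots> \<subseteq> subspace_prod T (\<sigma> ` homs 0) (\<sigma> ` ?Z1)"
      unfolding tensor_power_\<sigma> R_eq by (rule subspace_prod_mono[OF subspace_prod_subset[OF z d m1]])
    also have "\<dots> \<subseteq> \<sigma> ` ?Z1" by (rule subspace_prod_subset[OF z d m1'])
    finally obtain p where p: "p \<in> homs (Suc m)" "t = \<sigma> (f * p)" by blast
    let ?Y = "range (\<lambda>q. f * q)"
    have zY: "0 \<in> ?Y" by (rule range_eqI[of _ _ 0]) simp
    have dY: "a - b \<in> ?Y" if "a \<in> ?Y" "b \<in> ?Y" for a b
      using that by (auto simp: right_diff_distrib[symmetric])
    have mY: "a * b \<in> ?Y" if a: "a \<in> range (\<lambda>c. cst c * f)" and b: "b \<in> homs m" for a b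
    proof -
      obtain c where "a = cst c * f" using a by blast
      then have "a * b = f * (cst c * b)" by (simp add: mult.assoc cst_left[of f])
      then show ?thesis by blast
    qed
    have z2: "0 \<in> ?Z2" by (auto intro!: exI[of _ "\<lambda>_. 0"])
    have d2: "a - b \<in> ?Z2" if a: "a \<in> ?Z2" and b: "b \<in> ?Z2" for a b
    proof -
      obtain q r where "a = (\<Sum>i\<in>UNIV. gen i * (f * q i))" "b = (\<Sum>i\<in>UNIV. gen i * (f * r i))" using a b by auto
      then have "a - b = (\<Sum>i\<in>UNIV. gen i * (f * (q i - r i)))" by (simp add: right_diff_distrib sum_subtractf)
      then show ?thesis by (intro CollectI exI[of _ "\<lambda>i. q i - r i"])
    qed
    have m2: "a * b \<in> ?Z2" if a: "a \<in> homs 1" and b: "b \<in> ?Y" for a b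
    proof -
      obtain v where v: "a = lv v" using a unfolding lv_range[symmetric] by blast
      obtain q where q: "b = f * q" using b by blast
      have "a * b = (\<Sum>i\<in>UNIV. gen i * (f * (cst (coord v i) * q)))"
        unfolding v q lv_def lf_def sum_distrib_right
        by (intro sum.cong refl) (simp only: mult.assoc cst_left[of f] cst_left[of "gen _"])
      then show ?thesis by (intro CollectI exI[of _ "\<lambda>i. cst (coord v i) * q"])
    qed
    have idx: "(Suc 0, m) \<in> {(i, j). i + 2 + j = ?m}" by simp
    have "t \<in> subspace_prod T (tensor_power sc (Suc 0)) (subspace_prod T R (tensor_power sc m))"
      using t idx unfolding koszul_W_def by blast
    also have "\<dots> \<subseteq> subspace_prod T (\<sigma> ` homs 1) (\<sigma> ` ?Y)"
      unfolding tensor_power_\<sigma> R_eq One_nat_def by (rule subspace_prod_mono[OF subspace_prod_subset[OF zY dY mY]])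
    also have "\<dots> \<subseteq> \<sigma> ` ?Z2" by (rule subspace_prod_subset[OF z2 d2 m2])
    finally obtain q where "t = \<sigma> (\<Sum>i\<in>UNIV. gen i * (f * q i))" by blast
    then have "f * p = (\<Sum>i\<in>UNIV. gen i * (f * q i))" using p(2) by (simp add: \<sigma>_eq_iff)
    moreover have "eps p = 0" using p(1) by (auto simp: eps_def homs_def)
    ultimately have "p = 0" by (rule W3_trivial[OF nr])
    then show "t \<in> \<sigma> ` {0}" using p(2) by simp
  qed
qed

lemma WF_cases: obtains "m = 0" | "m = Suc 0" | "m = Suc (Suc 0)" | l where "m = Suc (Suc (Suc l))"
proof -
  have "m = 0 \<or> m = Suc 0 \<or> m = Suc (Suc 0) \<or> (\<exists>l. m = Suc (Suc (Suc l)))" by presburger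
  then show ?thesis using that by blast
qed

lemma koszul_W_\<sigma>: "koszul_W sc R m = \<sigma> ` WF m"
proof (cases m rule: WF_cases)
    case 1
    have "{(i, j). i + 2 + j = (0 :: nat)} = {}" by auto
    then show ?thesis unfolding 1 koszul_W_def tensor_power_\<sigma> WF_simps by simp
  next
    case 2
    have "{(i, j). i + 2 + j = Suc 0} = {}" by auto
    then show ?thesis unfolding 2 koszul_W_def tensor_power_\<sigma> WF_simps One_nat_def by simp
  next
    case 3 then show ?thesis using koszul_W_2 by (simp only: WF_simps)
  next
    case 4 then show ?thesis using koszul_W_3 by (simp only: WF_simps)
qed

lemma WF_0: "0 \<in> WF m"
proof (cases m rule: WF_cases)
  case 3
  have "(0 :: ('n, 'k) fralg) = cst 0 * f" by (simp add: cst_simps)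
  then show ?thesis unfolding 3 WF_simps by (rule range_eqI)
qed (simp_all add: WF_simps)
lemma WF_minus: assumes "p \<in> WF m" "q \<in> WF m" shows "p - q \<in> WF m"
proof (cases m rule: WF_cases)
  case 3 show ?thesis using assms unfolding 3 WF_simps by (rule line_f)
next
  case 1 show ?thesis using assms unfolding 1 WF_simps by (rule homs_minus)
next
  case 2 show ?thesis using assms unfolding 2 WF_simps by (rule homs_minus)
next
  case (4 l) show ?thesis using assms unfolding 4 WF_simps by simp
qed
lemma WF_scale: "p \<in> WF m \<Longrightarrow> cst c * p \<in> WF m"
proof (cases m rule: WF_cases)
  case 3
  assume "p \<in> WF m"
  then obtain d where "p = cst d * f" using 3 by (auto simp: WF_simps)
  then have "cst c * p = cst (c * d) * f" by (simp add: cst_simps(6) mult.assoc)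
  then show ?thesis unfolding 3 WF_simps by (rule range_eqI)
next
  case 1
  assume "p \<in> WF m" then show ?thesis unfolding 1 WF_simps by (rule homs_cst_mult)
next
  case 2
  assume "p \<in> WF m" then show ?thesis unfolding 2 WF_simps by (rule homs_cst_mult)
next
  case (4 l)
  assume "p \<in> WF m" then show ?thesis unfolding 4 WF_simps by simp
qed
lemma WF_add: "p \<in> WF m \<Longrightarrow> q \<in> WF m \<Longrightarrow> p + q \<in> WF m"
  using WF_minus[of p m "cst (- 1) * q"] WF_scale[of q m "- 1"] by (simp add: cst_simps)
lemma WF_sum: "(\<And>i. i \<in> I \<Longrightarrow> g i \<in> WF m) \<Longrightarrow> (\<Sum>i\<in>I. g i) \<in> WF m"
  by (induction I rule: infinite_finite_induct) (simp_all add: WF_0 WF_add)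

lemma lder_scale: "lder i (cst c * p) = cst c * lder i p" by (simp add: lder_mult)

lemma WF_lder: "p \<in> WF (Suc m) \<Longrightarrow> lder i p \<in> WF m"
proof (cases m rule: WF_cases)
  case 1
  assume "p \<in> WF (Suc m)"
  then show ?thesis using lder_homs[of p 0] 1 by (simp add: WF_simps)
next
  case 2
  assume "p \<in> WF (Suc m)"
  then obtain c where "p = cst c * f" using 2 by (auto simp: WF_simps)
  then have "lder i p = cst c * zrow C i" by (simp add: lder_scale lder_qform)
  then show ?thesis using 2 homs_cst_mult[OF homs_lf] by (simp add: WF_simps zrow_def)
next
  case 3
  assume "p \<in> WF (Suc m)"
  then have "lder i p = 0" using 3 by (simp add: WF_simps)
  then show ?thesis using WF_0 by simp
next
  case (4 l)
  assume "p \<in> WF (Suc m)"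
  then have "lder i p = 0" using 4 by (simp add: WF_simps)
  then show ?thesis using WF_0 by simp
qed

lemma WF_eps: "p \<in> WF (Suc m) \<Longrightarrow> eps p = 0"
  by (cases m rule: WF_cases) (auto simp: WF_simps eps_def homs_def, auto simp: eps_def[symmetric])

lemma WF_decomp: "p \<in> WF (Suc m) \<Longrightarrow> p = (\<Sum>i\<in>UNIV. gen i * lder i p)"
  using lder_decomp[of p] WF_eps[of p m] by (simp add: cst_simps)

subsection \<open>The modules of the Koszul complex\<close>

abbreviation "Wm m \<equiv> koszul_space sc R m"
abbreviation "K m \<equiv> koszul_module sc R m"

lemma Wm_simps: "carrier (Wm m) = \<sigma> ` WF m" "zero (Wm m) = \<sigma> 0"
  "\<sigma> p \<oplus>\<^bsub>Wm m\<^esub> \<sigma> q = \<sigma> (p + q)" "c \<odot>\<^bsub>Wm m\<^esub> \<sigma> p = \<sigma> (cst c * p)"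
  by (simp_all add: koszul_space_def koszul_W_\<sigma> \<sigma>_zero \<sigma>_add \<sigma>_mult tensor_unit_\<sigma>)

lemma W_tensor_setting: "tensor_setting A eta (Wm m)"
proof (intro tensor_setting.intro tensor_setting_axioms.intro)
  show "ring A" by (rule ring_axioms)
  show "abelian_group (Wm m)"
  proof (rule abelian_groupI, goal_cases)
    case (1 s t) then show ?case by (auto simp: Wm_simps intro: WF_add)
  next
    case 2 show ?case by (auto simp: Wm_simps WF_0)
  next
    case (3 s t u) then show ?case by (auto simp: Wm_simps add.assoc)
  next
    case (4 s t) then show ?case by (auto simp: Wm_simps add.commute)
  next
    case (5 s) then show ?case by (auto simp: Wm_simps)
  next
    case (6 s)
    then obtain p where p: "p \<in> WF m" "s = \<sigma> p" by (auto simp: Wm_simps)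
    then show ?case using WF_minus[OF WF_0 p(1)] by (intro bexI[of _ "\<sigma> (0 - p)"]) (simp_all add: Wm_simps)
  qed
  show "c \<odot>\<^bsub>Wm m\<^esub> w \<in> carrier (Wm m)" if "w \<in> carrier (Wm m)" for c w
    using that by (auto simp: Wm_simps intro: WF_scale)
qed (simp_all add: eta_simps, rule eta_comm)

lemma K_eq: "K m = tensor_product A eta (Wm m)" by (simp add: koszul_module_def quad_unit_eta)

text \<open>
  Pure tensors \<open>a \<otimes> w\<close> with \<open>w \<in> W\<^sub>m\<close> given by an element of the free algebra.
\<close>

definition pt :: "nat \<Rightarrow> ('k, 'v) tensor set \<Rightarrow> ('n, 'k) fralg \<Rightarrow> (('k, 'v) tensor set \<times> ('k, 'v) tensor \<Rightarrow>\<^sub>0 'k) set"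
  where "pt m a p = koszul_tensor sc R m a (\<sigma> p)"

lemma pt_pure: "pt m a p = pure_tensor A eta (Wm m) a (\<sigma> p)" by (simp add: pt_def quad_unit_eta)

lemma K_action: "additive_action A (K m)" unfolding K_eq by (rule tensor_setting.TP_action[OF W_tensor_setting])
lemma K_grp: "abelian_group (K m)" using K_action additive_action.axioms by blast
lemma pt_closed [simp]: "a \<in> carrier A \<Longrightarrow> p \<in> WF m \<Longrightarrow> pt m a p \<in> carrier (K m)"
  unfolding pt_pure K_eq by (rule tensor_setting.pure_closed[OF W_tensor_setting]) (simp_all add: Wm_simps)
lemma pt_addl: "a \<in> carrier A \<Longrightarrow> b \<in> carrier A \<Longrightarrow> p \<in> WF m \<Longrightarrow> pt m (a \<oplus>\<^bsub>A\<^esub> b) p = pt m a p \<oplus>\<^bsub>K m\<^esub> pt m b p"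
  unfolding pt_pure K_eq by (rule tensor_setting.pure_add_left[OF W_tensor_setting]) (simp_all add: Wm_simps)
lemma pt_addr: "a \<in> carrier A \<Longrightarrow> p \<in> WF m \<Longrightarrow> q \<in> WF m \<Longrightarrow> pt m a (p + q) = pt m a p \<oplus>\<^bsub>K m\<^esub> pt m a q"
  unfolding pt_pure K_eq Wm_simps(3)[of m p q, symmetric]
  by (rule tensor_setting.pure_add_right[OF W_tensor_setting]) (simp_all add: Wm_simps)
lemma pt_scale: "a \<in> carrier A \<Longrightarrow> p \<in> WF m \<Longrightarrow> pt m a (cst c * p) = pt m (eta c \<otimes>\<^bsub>A\<^esub> a) p"
  unfolding pt_pure Wm_simps(4)[of m c p, symmetric]
  by (rule tensor_setting.pure_scale[OF W_tensor_setting]) (simp_all add: Wm_simps)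
lemma pt_act: "a \<in> carrier A \<Longrightarrow> b \<in> carrier A \<Longrightarrow> p \<in> WF m \<Longrightarrow> a \<odot>\<^bsub>K m\<^esub> pt m b p = pt m (a \<otimes>\<^bsub>A\<^esub> b) p"
  unfolding pt_pure K_eq by (rule tensor_setting.pure_act[OF W_tensor_setting]) (simp_all add: Wm_simps)

lemma K_induct [consumes 1, case_names pure add]:
  assumes z: "z \<in> carrier (K m)"
    and pure': "\<And>a p. a \<in> carrier A \<Longrightarrow> p \<in> WF m \<Longrightarrow> Q (pt m a p)"
    and add': "\<And>y z. y \<in> carrier (K m) \<Longrightarrow> z \<in> carrier (K m) \<Longrightarrow> Q y \<Longrightarrow> Q z \<Longrightarrow> Q (y \<oplus>\<^bsub>K m\<^esub> z)"
  shows "Q z"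
proof -
  interpret tensor_setting A eta "Wm m" by (rule W_tensor_setting)
  from z[unfolded K_eq] show ?thesis
  proof (induction rule: TP_induct)
    case (pure a w)
    then obtain p where "p \<in> WF m" "w = \<sigma> p" by (auto simp: Wm_simps)
    then show ?case using pure'[OF pure(1), of p] by (simp add: pt_pure)
  next
    case (add y z) then show ?case using add' by (simp add: K_eq)
  qed
qed

lemma pt_zero_right: "a \<in> carrier A \<Longrightarrow> pt m a 0 = \<zero>\<^bsub>K m\<^esub>"
proof -
  interpret K: abelian_group "K m" by (rule K_grp)
  assume a: "a \<in> carrier A"
  then have "pt m a 0 = pt m a 0 \<oplus>\<^bsub>K m\<^esub> pt m a 0" using pt_addr[OF a WF_0 WF_0, of m] by simp
  then show ?thesis using K.add.l_cancel_one[OF pt_closed[OF a WF_0, of m] pt_closed[OF a WF_0, of m]] by simp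
qed

lemma pt_zero_left: "p \<in> WF m \<Longrightarrow> pt m \<zero>\<^bsub>A\<^esub> p = \<zero>\<^bsub>K m\<^esub>"
proof -
  interpret K: abelian_group "K m" by (rule K_grp)
  assume p: "p \<in> WF m"
  then have "pt m \<zero>\<^bsub>A\<^esub> p = pt m \<zero>\<^bsub>A\<^esub> p \<oplus>\<^bsub>K m\<^esub> pt m \<zero>\<^bsub>A\<^esub> p" using pt_addl[OF zero_closed zero_closed p] by simp
  then show ?thesis using K.add.l_cancel_one[OF pt_closed[OF zero_closed p] pt_closed[OF zero_closed p]] by simp
qed

lemma pt_finsum_left:
  assumes p: "p \<in> WF m" and g: "\<And>i. g i \<in> carrier A" and I: "finite I"
  shows "pt m (\<Oplus>\<^bsub>A\<^esub>i\<in>I. g i) p = (\<Oplus>\<^bsub>K m\<^esub>i\<in>I. pt m (g i) p)"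
proof -
  interpret K: abelian_group "K m" by (rule K_grp)
  show ?thesis using I
  proof (induction I rule: finite_induct)
    case empty
    then show ?case by (simp add: pt_zero_left[OF p])
  next
    case (insert i I)
    then show ?case using g p by (simp add: pt_addl)
  qed
qed

text \<open>
  This yields the differentials as well as the coordinate functions by which elements of the Koszul modules
  are compared.
\<close>

lemma K_universal:
  assumes B: "additive_action A B"
    and cl: "\<And>a p. a \<in> carrier A \<Longrightarrow> p \<in> WF m \<Longrightarrow> \<beta> a p \<in> carrier B"
    and addl: "\<And>a b p. a \<in> carrier A \<Longrightarrow> b \<in> carrier A \<Longrightarrow> p \<in> WF m \<Longrightarrow> \<beta> (a \<oplus>\<^bsub>A\<^esub> b) p = \<beta> a p \<oplus>\<^bsub>B\<^esub> \<beta> b p"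
    and addr: "\<And>a p q. a \<in> carrier A \<Longrightarrow> p \<in> WF m \<Longrightarrow> q \<in> WF m \<Longrightarrow> \<beta> a (p + q) = \<beta> a p \<oplus>\<^bsub>B\<^esub> \<beta> a q"
    and bal: "\<And>a c p. a \<in> carrier A \<Longrightarrow> p \<in> WF m \<Longrightarrow> \<beta> a (cst c * p) = \<beta> (eta c \<otimes>\<^bsub>A\<^esub> a) p"
    and act: "\<And>a b p. a \<in> carrier A \<Longrightarrow> b \<in> carrier A \<Longrightarrow> p \<in> WF m \<Longrightarrow> \<beta> (b \<otimes>\<^bsub>A\<^esub> a) p = b \<odot>\<^bsub>B\<^esub> \<beta> a p"
  shows "\<exists>h\<in>module_homs A (K m) B. \<forall>a\<in>carrier A. \<forall>p\<in>WF m. h (pt m a p) = \<beta> a p"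
proof -
  define \<tau> where "\<tau> = inv_into UNIV \<sigma>"
  have \<tau>: "\<tau> (\<sigma> p) = p" for p unfolding \<tau>_def by (rule inv_into_f_f) (auto simp: inj_def \<sigma>_eq_iff)
  have "\<exists>h\<in>module_homs A (tensor_product A eta (Wm m)) B. \<forall>a\<in>carrier A. \<forall>w\<in>carrier (Wm m).
      h (pure_tensor A eta (Wm m) a w) = \<beta> a (\<tau> w)"
  proof (rule tensor_setting.TP_universal[OF W_tensor_setting B])
    show "\<beta> a (\<tau> w) \<in> carrier B" if "a \<in> carrier A" "w \<in> carrier (Wm m)" for a w
      using that cl unfolding Wm_simps by (elim imageE) (simp only: \<tau>)
    show "\<beta> (a \<oplus>\<^bsub>A\<^esub> b) (\<tau> w) = \<beta> a (\<tau> w) \<oplus>\<^bsub>B\<^esub> \<beta> b (\<tau> w)"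
      if "a \<in> carrier A" "b \<in> carrier A" "w \<in> carrier (Wm m)" for a b w
      using that addl unfolding Wm_simps by (elim imageE) (simp only: \<tau>)
    show "\<beta> a (\<tau> (u \<oplus>\<^bsub>Wm m\<^esub> w)) = \<beta> a (\<tau> u) \<oplus>\<^bsub>B\<^esub> \<beta> a (\<tau> w)"
      if "a \<in> carrier A" "u \<in> carrier (Wm m)" "w \<in> carrier (Wm m)" for a u w
      using that addr unfolding Wm_simps(1) by (elim imageE) (simp only: \<tau> Wm_simps(3))
    show "\<beta> a (\<tau> (c \<odot>\<^bsub>Wm m\<^esub> w)) = \<beta> (eta c \<otimes>\<^bsub>A\<^esub> a) (\<tau> w)"
      if "a \<in> carrier A" "w \<in> carrier (Wm m)" for a c w
      using that bal unfolding Wm_simps(1) by (elim imageE) (simp only: \<tau> Wm_simps(4))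
    show "\<beta> (b \<otimes>\<^bsub>A\<^esub> a) (\<tau> w) = b \<odot>\<^bsub>B\<^esub> \<beta> a (\<tau> w)"
      if "a \<in> carrier A" "b \<in> carrier A" "w \<in> carrier (Wm m)" for a b w
      using that act unfolding Wm_simps by (elim imageE) (simp only: \<tau>)
  qed
  then obtain h where h: "h \<in> module_homs A (tensor_product A eta (Wm m)) B"
    "\<And>a w. a \<in> carrier A \<Longrightarrow> w \<in> carrier (Wm m) \<Longrightarrow> h (pure_tensor A eta (Wm m) a w) = \<beta> a (\<tau> w)" by blast
  have "h (pt m a p) = \<beta> a p" if "a \<in> carrier A" "p \<in> WF m" for a p
    using h(2)[of a "\<sigma> p"] that by (simp add: pt_pure Wm_simps \<tau>)
  then show ?thesis using h(1) unfolding K_eq by blast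
qed

subsection \<open>The differential\<close>

text \<open>
  The value of the differential at \<open>a \<otimes> p\<close>, from the canonical expansion \<open>p = \<Sum> x\<^sub>i \<partial>\<^sub>i p\<close>.
\<close>

definition dK_pure :: "nat \<Rightarrow> ('k, 'v) tensor set \<Rightarrow> ('n, 'k) fralg \<Rightarrow> (('k, 'v) tensor set \<times> ('k, 'v) tensor \<Rightarrow>\<^sub>0 'k) set"
  where "dK_pure m a p = (\<Oplus>\<^bsub>K m\<^esub>i\<in>UNIV. pt m (a \<otimes>\<^bsub>A\<^esub> gx i) (lder i p))"

lemma differential_exists:
  "\<exists>h\<in>module_homs A (K (Suc m)) (K m). \<forall>a\<in>carrier A. \<forall>p\<in>WF (Suc m). h (pt (Suc m) a p) = dK_pure m a p"
proof (rule K_universal[OF K_action])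
  interpret K: additive_action A "K m" by (rule K_action)
  have c: "pt m (a \<otimes>\<^bsub>A\<^esub> gx i) (lder i p) \<in> carrier (K m)" if "a \<in> carrier A" "p \<in> WF (Suc m)" for a p i
    using that by (simp add: WF_lder)
  show "dK_pure m a p \<in> carrier (K m)" if "a \<in> carrier A" "p \<in> WF (Suc m)" for a p
    unfolding dK_pure_def using c[OF that] by (intro K.M.finsum_closed) blast
  show "dK_pure m (a \<oplus>\<^bsub>A\<^esub> b) p = dK_pure m a p \<oplus>\<^bsub>K m\<^esub> dK_pure m b p"
    if "a \<in> carrier A" "b \<in> carrier A" "p \<in> WF (Suc m)" for a b p
  proof -
    have "dK_pure m (a \<oplus>\<^bsub>A\<^esub> b) p = (\<Oplus>\<^bsub>K m\<^esub>i\<in>UNIV. pt m (a \<otimes>\<^bsub>A\<^esub> gx i) (lder i p) \<oplus>\<^bsub>K m\<^esub> pt m (b \<otimes>\<^bsub>A\<^esub> gx i) (lder i p))"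
      unfolding dK_pure_def using that by (simp add: l_distr pt_addl WF_lder)
    then show ?thesis unfolding dK_pure_def using K.M.finsum_addf[of "\<lambda>i. pt m (a \<otimes>\<^bsub>A\<^esub> gx i) (lder i p)" UNIV "\<lambda>i. pt m (b \<otimes>\<^bsub>A\<^esub> gx i) (lder i p)"]
        c[OF that(1,3)] c[OF that(2,3)] by simp
  qed
  show "dK_pure m a (p + q) = dK_pure m a p \<oplus>\<^bsub>K m\<^esub> dK_pure m a q"
    if "a \<in> carrier A" "p \<in> WF (Suc m)" "q \<in> WF (Suc m)" for a p q
  proof -
    have "dK_pure m a (p + q) = (\<Oplus>\<^bsub>K m\<^esub>i\<in>UNIV. pt m (a \<otimes>\<^bsub>A\<^esub> gx i) (lder i p) \<oplus>\<^bsub>K m\<^esub> pt m (a \<otimes>\<^bsub>A\<^esub> gx i) (lder i q))"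
      unfolding dK_pure_def using that by (simp add: pt_addr WF_lder)
    then show ?thesis unfolding dK_pure_def using K.M.finsum_addf[of "\<lambda>i. pt m (a \<otimes>\<^bsub>A\<^esub> gx i) (lder i p)" UNIV "\<lambda>i. pt m (a \<otimes>\<^bsub>A\<^esub> gx i) (lder i q)"]
        c[OF that(1,2)] c[OF that(1,3)] by simp
  qed
  show "dK_pure m a (cst c * p) = dK_pure m (eta c \<otimes>\<^bsub>A\<^esub> a) p" if "a \<in> carrier A" "p \<in> WF (Suc m)" for a c p
    unfolding dK_pure_def using that by (simp add: lder_scale pt_scale WF_lder m_assoc)
  show "dK_pure m (b \<otimes>\<^bsub>A\<^esub> a) p = b \<odot>\<^bsub>K m\<^esub> dK_pure m a p"
    if "a \<in> carrier A" "b \<in> carrier A" "p \<in> WF (Suc m)" for a b p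
  proof -
    have "b \<odot>\<^bsub>K m\<^esub> dK_pure m a p = (\<Oplus>\<^bsub>K m\<^esub>i\<in>UNIV. b \<odot>\<^bsub>K m\<^esub> pt m (a \<otimes>\<^bsub>A\<^esub> gx i) (lder i p))"
      unfolding dK_pure_def using c[OF that(1,3)] by (intro K.act_finsum[OF that(2)]) blast
    then show ?thesis unfolding dK_pure_def using that by (simp add: pt_act WF_lder m_assoc)
  qed
qed

definition dK :: "nat \<Rightarrow> (('k, 'v) tensor set \<times> ('k, 'v) tensor \<Rightarrow>\<^sub>0 'k) set \<Rightarrow> (('k, 'v) tensor set \<times> ('k, 'v) tensor \<Rightarrow>\<^sub>0 'k) set"
  where "dK m = restrict (SOME h. h \<in> module_homs A (K (Suc m)) (K m) \<and>
    (\<forall>a\<in>carrier A. \<forall>p\<in>WF (Suc m). h (pt (Suc m) a p) = dK_pure m a p)) (carrier (K (Suc m)))"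

lemma dK: "dK m \<in> module_homs A (K (Suc m)) (K m)" "dK m \<in> extensional (carrier (K (Suc m)))"
  "a \<in> carrier A \<Longrightarrow> p \<in> WF (Suc m) \<Longrightarrow> dK m (pt (Suc m) a p) = dK_pure m a p"
proof -
  define h where "h = (SOME h. h \<in> module_homs A (K (Suc m)) (K m) \<and>
    (\<forall>a\<in>carrier A. \<forall>p\<in>WF (Suc m). h (pt (Suc m) a p) = dK_pure m a p))"
  have "\<exists>h. h \<in> module_homs A (K (Suc m)) (K m) \<and>
    (\<forall>a\<in>carrier A. \<forall>p\<in>WF (Suc m). h (pt (Suc m) a p) = dK_pure m a p)" using differential_exists[of m] by blast
  from someI_ex[OF this] have h: "h \<in> module_homs A (K (Suc m)) (K m)"
    "\<And>a p. a \<in> carrier A \<Longrightarrow> p \<in> WF (Suc m) \<Longrightarrow> h (pt (Suc m) a p) = dK_pure m a p" by (simp_all add: h_def)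
  have d: "dK m = restrict h (carrier (K (Suc m)))" by (simp add: dK_def h_def)
  show "dK m \<in> module_homs A (K (Suc m)) (K m)" unfolding d by (rule module_homs_restrict[OF K_action h(1)])
  show "dK m \<in> extensional (carrier (K (Suc m)))" unfolding d by simp
  show "dK m (pt (Suc m) a p) = dK_pure m a p" if "a \<in> carrier A" "p \<in> WF (Suc m)"
    unfolding d using that h(2) by simp
qed

text \<open>
  Scalars move across the tensor sign, so the value may be computed from any expansion of \<open>p\<close> as a sum of
  products of vectors with elements of \<open>W\<^sub>m\<close>, as the definition of the Koszul differential demands.
\<close>

lemma dK_pure_sum:
  assumes a: "a \<in> carrier A" and r: "\<And>j. j \<in> J \<Longrightarrow> r j \<in> WF m" and J: "finite J"
  shows "(\<Oplus>\<^bsub>K m\<^esub>i\<in>UNIV. pt m (a \<otimes>\<^bsub>A\<^esub> gx i) (\<Sum>j\<in>J. cst (c j i) * r j))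
    = (\<Oplus>\<^bsub>K m\<^esub>j\<in>J. pt m (a \<otimes>\<^bsub>A\<^esub> \<pi> (lf (c j))) (r j))"
  using J r
proof (induction J rule: finite_induct)
  case empty
  interpret K: abelian_group "K m" by (rule K_grp)
  show ?case using a by (simp add: pt_zero_right K.finsum_zero)
next
  case (insert j J)
  interpret K: abelian_group "K m" by (rule K_grp)
  have rj: "r j \<in> WF m" and rJ: "\<And>l. l \<in> J \<Longrightarrow> r l \<in> WF m" using insert by auto
  have s: "(\<Sum>l\<in>J. cst (c l i) * r l) \<in> WF m" for i using rJ by (intro WF_sum WF_scale)
  have ag: "a \<otimes>\<^bsub>A\<^esub> gx i \<in> carrier A" for i using a by simp
  have "(\<Oplus>\<^bsub>K m\<^esub>i\<in>UNIV. pt m (a \<otimes>\<^bsub>A\<^esub> gx i) (\<Sum>l\<in>insert j J. cst (c l i) * r l))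
    = (\<Oplus>\<^bsub>K m\<^esub>i\<in>UNIV. pt m (a \<otimes>\<^bsub>A\<^esub> gx i) (cst (c j i) * r j) \<oplus>\<^bsub>K m\<^esub> pt m (a \<otimes>\<^bsub>A\<^esub> gx i) (\<Sum>l\<in>J. cst (c l i) * r l))"
    using insert(1,2) by (simp add: pt_addr[OF ag WF_scale[OF rj] s])
  also have "\<dots> = (\<Oplus>\<^bsub>K m\<^esub>i\<in>UNIV. pt m (a \<otimes>\<^bsub>A\<^esub> gx i) (cst (c j i) * r j))
      \<oplus>\<^bsub>K m\<^esub> (\<Oplus>\<^bsub>K m\<^esub>i\<in>UNIV. pt m (a \<otimes>\<^bsub>A\<^esub> gx i) (\<Sum>l\<in>J. cst (c l i) * r l))"
    using pt_closed[OF ag WF_scale[OF rj]] pt_closed[OF ag s] by (intro K.finsum_addf) blast+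
  also have "(\<Oplus>\<^bsub>K m\<^esub>i\<in>UNIV. pt m (a \<otimes>\<^bsub>A\<^esub> gx i) (cst (c j i) * r j)) = pt m (a \<otimes>\<^bsub>A\<^esub> \<pi> (lf (c j))) (r j)"
  proof -
    have e: "eta (c j i) \<otimes>\<^bsub>A\<^esub> (a \<otimes>\<^bsub>A\<^esub> gx i) = a \<otimes>\<^bsub>A\<^esub> (eta (c j i) \<otimes>\<^bsub>A\<^esub> gx i)" for i
      using a eta_comm[OF a, of "c j i"] by (simp add: m_assoc[symmetric])
    have "(\<Oplus>\<^bsub>K m\<^esub>i\<in>UNIV. pt m (a \<otimes>\<^bsub>A\<^esub> gx i) (cst (c j i) * r j))
      = (\<Oplus>\<^bsub>K m\<^esub>i\<in>UNIV. pt m (a \<otimes>\<^bsub>A\<^esub> (eta (c j i) \<otimes>\<^bsub>A\<^esub> gx i)) (r j))"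
      by (simp only: pt_scale[OF ag rj] e)
    also have "\<dots> = pt m (\<Oplus>\<^bsub>A\<^esub>i\<in>UNIV. a \<otimes>\<^bsub>A\<^esub> (eta (c j i) \<otimes>\<^bsub>A\<^esub> gx i)) (r j)"
      by (rule pt_finsum_left[OF rj, symmetric]) (use a in simp_all)
    also have "(\<Oplus>\<^bsub>A\<^esub>i\<in>UNIV. a \<otimes>\<^bsub>A\<^esub> (eta (c j i) \<otimes>\<^bsub>A\<^esub> gx i)) = a \<otimes>\<^bsub>A\<^esub> \<pi> (lf (c j))"
      unfolding lf_def by (simp add: \<pi>_sum \<pi>_mult eta_def[symmetric] finsum_rdistr[OF _ a, symmetric] Pi_def)
    finally show ?thesis .
  qed
  finally show ?case
    using insert.IH[OF rJ] insert(1,2) K.finsum_insert[OF insert(1,2), of "\<lambda>j. pt m (a \<otimes>\<^bsub>A\<^esub> \<pi> (lf (c j))) (r j)"] rj rJ a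
    by (simp add: Pi_def)
qed

lemma tensor_sum_\<sigma>:
  fixes N :: nat
  shows "(\<Oplus>\<^bsub>T\<^esub>j\<in>{..<N}. tensor_vec sc (v j) \<otimes>\<^bsub>T\<^esub> \<sigma> (r j)) = \<sigma> (\<Sum>j<N. lv (v j) * r j)"
  by (simp only: \<sigma>_sum[OF finite_lessThan] \<sigma>_mult tensor_vec_\<sigma>)

lemma dK_is_differential: "is_koszul_differential sc R m (dK m)"
  unfolding is_koszul_differential_def
proof (intro conjI ballI allI impI dK(1,2))
  fix a and N :: nat and v :: "nat \<Rightarrow> 'v" and w
  assume a: "a \<in> carrier A"
    and "(\<forall>j<N. w j \<in> koszul_W sc R m) \<and> (\<Oplus>\<^bsub>T\<^esub>j\<in>{..<N}. tensor_vec sc (v j) \<otimes>\<^bsub>T\<^esub> w j) \<in> koszul_W sc R (Suc m)"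
  then have w: "\<forall>j<N. w j \<in> koszul_W sc R m"
    and s: "(\<Oplus>\<^bsub>T\<^esub>j\<in>{..<N}. tensor_vec sc (v j) \<otimes>\<^bsub>T\<^esub> w j) \<in> koszul_W sc R (Suc m)" by auto
  have "\<forall>j. \<exists>r. r \<in> WF m \<and> (j < N \<longrightarrow> w j = \<sigma> r)"
    using w WF_0 unfolding koszul_W_\<sigma> by blast
  then obtain r where r: "\<And>j. r j \<in> WF m" "\<And>j. j < N \<Longrightarrow> w j = \<sigma> (r j)" by metis
  interpret T: ring T by (rule T_ring)
  interpret K: abelian_group "K m" by (rule K_grp)
  let ?p = "\<Sum>j<N. lv (v j) * r j"
  have ws: "(\<Oplus>\<^bsub>T\<^esub>j\<in>{..<N}. tensor_vec sc (v j) \<otimes>\<^bsub>T\<^esub> w j) = \<sigma> ?p"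
    unfolding tensor_sum_\<sigma>[symmetric] by (rule T.finsum_cong') (simp_all add: r(2) tensor_vec_\<sigma>)
  have p: "?p \<in> WF (Suc m)" using s unfolding ws koszul_W_\<sigma> by (auto simp: \<sigma>_eq_iff)
  have ld: "lder i ?p = (\<Sum>j<N. cst (coord (v j) i) * r j)" for i
    by (simp add: lder_sum lder_mult lv_def cst_simps)
  have "dK m (koszul_tensor sc R (Suc m) a (\<sigma> ?p)) = dK_pure m a ?p"
    using dK(3)[OF a p] by (simp add: pt_def)
  also have "\<dots> = (\<Oplus>\<^bsub>K m\<^esub>j\<in>{..<N}. pt m (a \<otimes>\<^bsub>A\<^esub> \<pi> (lf (coord (v j)))) (r j))"
    unfolding dK_pure_def ld by (rule dK_pure_sum[OF a r(1)]) simp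
  also have "\<dots> = (\<Oplus>\<^bsub>K m\<^esub>j\<in>{..<N}. koszul_tensor sc R m (a \<otimes>\<^bsub>A\<^esub> quad_vec sc R (v j)) (w j))"
  proof (rule K.finsum_cong')
    fix j assume "j \<in> {..<N}"
    then have j: "w j = \<sigma> (r j)" using r(2) by simp
    show "pt m (a \<otimes>\<^bsub>A\<^esub> \<pi> (lf (coord (v j)))) (r j) = koszul_tensor sc R m (a \<otimes>\<^bsub>A\<^esub> quad_vec sc R (v j)) (w j)"
      by (simp add: j pt_def quad_vec_\<pi> lv_def)
  next
    show "(\<lambda>j. koszul_tensor sc R m (a \<otimes>\<^bsub>A\<^esub> quad_vec sc R (v j)) (w j)) \<in> {..<N} \<rightarrow> carrier (K m)"
    proof
      fix j assume "j \<in> {..<N}"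
      then have j: "w j = \<sigma> (r j)" using r(2) by simp
      have "pt m (a \<otimes>\<^bsub>A\<^esub> \<pi> (lv (v j))) (r j) \<in> carrier (K m)" using a r(1) by simp
      then show "koszul_tensor sc R m (a \<otimes>\<^bsub>A\<^esub> quad_vec sc R (v j)) (w j) \<in> carrier (K m)"
        by (simp add: j pt_def quad_vec_\<pi>)
    qed
  qed simp
  finally show "dK m (koszul_tensor sc R (Suc m) a (\<Oplus>\<^bsub>T\<^esub>j\<in>{..<N}. tensor_vec sc (v j) \<otimes>\<^bsub>T\<^esub> w j))
    = (\<Oplus>\<^bsub>K m\<^esub>j\<in>{..<N}. koszul_tensor sc R m (a \<otimes>\<^bsub>A\<^esub> quad_vec sc R (v j)) (w j))"
    unfolding ws .
qed

text \<open>
  A differential is determined on pure tensors by its defining property applied to the expansion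
  \<open>p = \<Sum> x\<^sub>i \<partial>\<^sub>i p\<close>.
\<close>

lemma differential_unique:
  assumes "is_koszul_differential sc R m d" "is_koszul_differential sc R m d'"
  shows "d = d'"
proof -
  \<comment> \<open>the definition numbers the summands by \<open>0, \<dots>, N - 1\<close>\<close>
  obtain e where e: "bij_betw e {..<CARD('n)} (UNIV :: 'n set)"
    using ex_bij_betw_nat_finite[OF finite_class.finite_UNIV] by (auto simp: atLeast0LessThan)
  have hom: "d \<in> module_homs A (K (Suc m)) (K m)" "d' \<in> module_homs A (K (Suc m)) (K m)"
    and ext: "d \<in> extensional (carrier (K (Suc m)))" "d' \<in> extensional (carrier (K (Suc m)))"
    using assms by (simp_all add: is_koszul_differential_def)
  have pure: "d (pt (Suc m) a p) = d' (pt (Suc m) a p)" if a: "a \<in> carrier A" and p: "p \<in> WF (Suc m)" for a p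
  proof -
    have "p = (\<Sum>j<CARD('n). lv (x (e j)) * lder (e j) p)"
      unfolding lv_x using WF_decomp[OF p] sum.reindex_bij_betw[OF e, of "\<lambda>i. gen i * lder i p"] by simp
    then have s: "(\<Oplus>\<^bsub>T\<^esub>j\<in>{..<CARD('n)}. tensor_vec sc (x (e j)) \<otimes>\<^bsub>T\<^esub> \<sigma> (lder (e j) p)) = \<sigma> p"
      using tensor_sum_\<sigma>[of "\<lambda>j. x (e j)" "\<lambda>j. lder (e j) p" "CARD('n)"] by simp
    let ?v = "\<lambda>j. x (e j)" and ?w = "\<lambda>j. \<sigma> (lder (e j) p)"
    have W: "(\<forall>j<CARD('n). ?w j \<in> koszul_W sc R m) \<and>
      (\<Oplus>\<^bsub>T\<^esub>j\<in>{..<CARD('n)}. tensor_vec sc (?v j) \<otimes>\<^bsub>T\<^esub> ?w j) \<in> koszul_W sc R (Suc m)"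
      unfolding s koszul_W_\<sigma> using p WF_lder[OF p] by blast
    have "\<delta> (koszul_tensor sc R (Suc m) a (\<sigma> p)) = (\<Oplus>\<^bsub>K m\<^esub>j\<in>{..<CARD('n)}.
        koszul_tensor sc R m (a \<otimes>\<^bsub>A\<^esub> quad_vec sc R (?v j)) (?w j))"
      if D: "is_koszul_differential sc R m \<delta>" for \<delta>
      using D[unfolded is_koszul_differential_def, THEN conjunct2, THEN conjunct2, THEN bspec, OF a,
          THEN spec, of "CARD('n)", THEN spec, of ?v, THEN spec, of ?w, THEN mp, OF W]
      unfolding s .
    from this[OF assms(1)] this[OF assms(2)] show ?thesis by (simp add: pt_def)
  qed
  show ?thesis
  proof (rule extensionalityI[OF ext])
    fix z assume "z \<in> carrier (K (Suc m))"
    then show "d z = d' z"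
      by (induction z rule: K_induct) (simp_all add: pure hom_add[OF hom(1)] hom_add[OF hom(2)])
  qed
qed

lemma koszul_differential_dK: "koszul_differential sc R m = dK m"
  unfolding koszul_differential_def
  by (rule the_equality, rule dK_is_differential) (rule differential_unique[OF _ dK_is_differential])

subsection \<open>Exactness of the Koszul complex\<close>

lemma K_high_trivial: "carrier (K (Suc (Suc (Suc m)))) = {\<zero>\<^bsub>K (Suc (Suc (Suc m)))\<^esub>}"
proof -
  interpret K: abelian_group "K (Suc (Suc (Suc m)))" by (rule K_grp)
  have "z = \<zero>\<^bsub>K (Suc (Suc (Suc m)))\<^esub>" if "z \<in> carrier (K (Suc (Suc (Suc m))))" for z
    using that
  proof (induction z rule: K_induct)
    case (pure a p) then show ?case by (simp add: WF_simps pt_zero_right)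
  next
    case (add y z) then show ?case by simp
  qed
  then show ?thesis by auto
qed

lemma left_regular_act: "additive_action A (left_regular A)"
proof -
  interpret left_module A "left_regular A" by (rule left_regular_module)
  show ?thesis by unfold_locales
qed

text \<open>
  Linear forms on \<open>W\<^sub>m\<close> give coordinates on \<open>A \<otimes> W\<^sub>m\<close>: since \<open>k\<close> is central in \<open>A\<close>, the map
  \<open>(a, p) \<mapsto> \<phi>(p) a\<close> is balanced and \<open>A\<close>-linear.
\<close>

lemma coordinate_exists:
  assumes \<phi>: "\<And>p q. \<phi> (p + q) = \<phi> p + \<phi> q" "\<And>c p. \<phi> (cst c * p) = c * \<phi> p"
  shows "\<exists>h\<in>module_homs A (K m) (left_regular A). \<forall>a\<in>carrier A. \<forall>p\<in>WF m. h (pt m a p) = eta (\<phi> p) \<otimes>\<^bsub>A\<^esub> a"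
proof (rule K_universal[OF left_regular_act])
  show "eta (\<phi> p) \<otimes>\<^bsub>A\<^esub> (b \<otimes>\<^bsub>A\<^esub> a) = b \<odot>\<^bsub>left_regular A\<^esub> (eta (\<phi> p) \<otimes>\<^bsub>A\<^esub> a)"
    if "a \<in> carrier A" "b \<in> carrier A" for a b p
    using that eta_comm[OF that(2), of "\<phi> p"] by (simp add: m_assoc[symmetric])
  show "eta (\<phi> (cst c * p)) \<otimes>\<^bsub>A\<^esub> a = eta (\<phi> p) \<otimes>\<^bsub>A\<^esub> (eta c \<otimes>\<^bsub>A\<^esub> a)" if "a \<in> carrier A" for a c p
  proof -
    have "eta (\<phi> (cst c * p)) = eta (\<phi> p) \<otimes>\<^bsub>A\<^esub> eta c" unfolding \<phi>(2) eta_simps(2)[symmetric] by (simp add: mult.commute)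
    then show ?thesis using that by (simp add: m_assoc)
  qed
qed (simp_all add: \<phi> eta_simps l_distr r_distr)

text \<open>
  The constant term of \<open>\<partial>\<^sub>j p\<close> is the \<open>j\<close>-th coefficient of the linear form \<open>p\<close>.
\<close>

definition K1_coord :: "'n \<Rightarrow> (('k, 'v) tensor set \<times> ('k, 'v) tensor \<Rightarrow>\<^sub>0 'k) set \<Rightarrow> ('k, 'v) tensor set"
  where "K1_coord j = (SOME h. h \<in> module_homs A (K (Suc 0)) (left_regular A) \<and>
    (\<forall>a\<in>carrier A. \<forall>p\<in>WF (Suc 0). h (pt (Suc 0) a p) = eta (eps (rder j p)) \<otimes>\<^bsub>A\<^esub> a))"

lemma K1_coord: "K1_coord j \<in> module_homs A (K (Suc 0)) (left_regular A)"
  "a \<in> carrier A \<Longrightarrow> p \<in> WF (Suc 0) \<Longrightarrow> K1_coord j (pt (Suc 0) a p) = eta (eps (rder j p)) \<otimes>\<^bsub>A\<^esub> a"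
proof -
  have "\<exists>h. h \<in> module_homs A (K (Suc 0)) (left_regular A) \<and>
    (\<forall>a\<in>carrier A. \<forall>p\<in>WF (Suc 0). h (pt (Suc 0) a p) = eta (eps (rder j p)) \<otimes>\<^bsub>A\<^esub> a)"
    using coordinate_exists[of "\<lambda>p. eps (rder j p)" "Suc 0"] by (simp add: rder_mult Bex_def)
  from someI_ex[OF this] show "K1_coord j \<in> module_homs A (K (Suc 0)) (left_regular A)"
    "a \<in> carrier A \<Longrightarrow> p \<in> WF (Suc 0) \<Longrightarrow> K1_coord j (pt (Suc 0) a p) = eta (eps (rder j p)) \<otimes>\<^bsub>A\<^esub> a"
    by (simp_all add: K1_coord_def)
qed

lemma K1_coord_closed: "z \<in> carrier (K (Suc 0)) \<Longrightarrow> K1_coord j z \<in> carrier A" using hom_closed[OF K1_coord(1)] by simp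

lemma gen_WF: "gen j \<in> WF (Suc 0)" by (simp add: WF_simps del: One_nat_def)
lemma one_WF: "1 \<in> WF 0" using homs_cst[of 1] by (simp add: WF_simps cst_simps)

text \<open>
  The coordinates identify \<open>A \<otimes> V\<close> with \<open>A\<^sup>n\<close>.
\<close>

lemma K1_expand: assumes "z \<in> carrier (K (Suc 0))"
  shows "z = (\<Oplus>\<^bsub>K (Suc 0)\<^esub>j\<in>UNIV. pt (Suc 0) (K1_coord j z) (gen j))"
proof -
  interpret K: abelian_group "K (Suc 0)" by (rule K_grp)
  show ?thesis using assms
  proof (induction z rule: K_induct)
    case (pure a p)
    have "p \<in> homs 1" using pure(2) by (simp add: WF_simps)
    then obtain v where "p = lv v" unfolding lv_range[symmetric] by blast
    then have p: "p = lf (coord v)" by (simp add: lv_def)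
    have "pt (Suc 0) a (\<Sum>j\<in>J. cst (coord v j) * gen j) = (\<Oplus>\<^bsub>K (Suc 0)\<^esub>j\<in>J. pt (Suc 0) (eta (coord v j) \<otimes>\<^bsub>A\<^esub> a) (gen j))"
      if "finite J" for J
      using that
    proof (induction J rule: finite_induct)
      case empty then show ?case using pure(1) by (simp add: pt_zero_right)
    next
      case (insert j J)
      have "(\<Sum>j\<in>J. cst (coord v j) * gen j) \<in> WF (Suc 0)" by (intro WF_sum WF_scale gen_WF)
      then show ?case using insert pure(1)
        by (simp add: pt_addr WF_scale gen_WF pt_scale Pi_def)
    qed
    from this[of UNIV] have "pt (Suc 0) a p = (\<Oplus>\<^bsub>K (Suc 0)\<^esub>j\<in>UNIV. pt (Suc 0) (eta (coord v j) \<otimes>\<^bsub>A\<^esub> a) (gen j))"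
      by (simp add: p lf_def)
    moreover have "K1_coord j (pt (Suc 0) a p) = eta (coord v j) \<otimes>\<^bsub>A\<^esub> a" for j
      using K1_coord(2)[OF pure] by (simp add: p)
    ultimately show ?case by simp
  next
    case (add y z)
    have "(\<Oplus>\<^bsub>K (Suc 0)\<^esub>j\<in>UNIV. pt (Suc 0) (K1_coord j (y \<oplus>\<^bsub>K (Suc 0)\<^esub> z)) (gen j))
      = (\<Oplus>\<^bsub>K (Suc 0)\<^esub>j\<in>UNIV. pt (Suc 0) (K1_coord j y) (gen j) \<oplus>\<^bsub>K (Suc 0)\<^esub> pt (Suc 0) (K1_coord j z) (gen j))"
      using hom_add[OF K1_coord(1) add(1,2)] by (simp add: pt_addl K1_coord_closed add(1,2) gen_WF)
    also have "\<dots> = (\<Oplus>\<^bsub>K (Suc 0)\<^esub>j\<in>UNIV. pt (Suc 0) (K1_coord j y) (gen j)) \<oplus>\<^bsub>K (Suc 0)\<^esub> (\<Oplus>\<^bsub>K (Suc 0)\<^esub>j\<in>UNIV. pt (Suc 0) (K1_coord j z) (gen j))"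
      by (rule K.finsum_addf) (simp_all add: K1_coord_closed add(1,2) gen_WF)
    also have "\<dots> = y \<oplus>\<^bsub>K (Suc 0)\<^esub> z" by (simp only: add(3)[symmetric] add(4)[symmetric])
    finally show ?case by (rule sym)
  qed
qed

lemma K1_eqI:
  assumes "y \<in> carrier (K (Suc 0))" "z \<in> carrier (K (Suc 0))" "\<And>j. K1_coord j y = K1_coord j z"
  shows "y = z"
proof -
  have "y = (\<Oplus>\<^bsub>K (Suc 0)\<^esub>j\<in>UNIV. pt (Suc 0) (K1_coord j y) (gen j))" by (rule K1_expand[OF assms(1)])
  also have "\<dots> = (\<Oplus>\<^bsub>K (Suc 0)\<^esub>j\<in>UNIV. pt (Suc 0) (K1_coord j z) (gen j))" by (simp only: assms(3))
  also have "\<dots> = z" by (rule K1_expand[OF assms(2), symmetric])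
  finally show ?thesis .
qed

lemma dK0: assumes z: "z \<in> carrier (K (Suc 0))"
  shows "dK 0 z = pt 0 (\<Oplus>\<^bsub>A\<^esub>j\<in>UNIV. K1_coord j z \<otimes>\<^bsub>A\<^esub> gx j) 1"
proof -
  interpret K0: abelian_group "K 0" by (rule K_grp)
  have g: "dK 0 (pt (Suc 0) a (gen j)) = pt 0 (a \<otimes>\<^bsub>A\<^esub> gx j) 1" if a: "a \<in> carrier A" for a j
  proof -
    have ld: "lder i (gen j) = (if j = i then 1 else 0 :: ('n, 'k) fralg)" for i
      using lder_gen_mult[of i j 1] by simp
    have "dK 0 (pt (Suc 0) a (gen j)) = (\<Oplus>\<^bsub>K 0\<^esub>i\<in>UNIV. if j = i then pt 0 (a \<otimes>\<^bsub>A\<^esub> gx i) 1 else \<zero>\<^bsub>K 0\<^esub>)"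
      unfolding dK(3)[OF a gen_WF] dK_pure_def ld using a one_WF
      by (intro K0.finsum_cong') (auto simp: pt_zero_right)
    also have "\<dots> = pt 0 (a \<otimes>\<^bsub>A\<^esub> gx j) 1" by (rule K0.finsum_singleton) (use a one_WF in auto)
    finally show ?thesis .
  qed
  have c: "(\<lambda>j. pt (Suc 0) (K1_coord j z) (gen j)) \<in> UNIV \<rightarrow> carrier (K (Suc 0))"
    using K1_coord_closed[OF z] gen_WF by simp
  have "dK 0 z = dK 0 (\<Oplus>\<^bsub>K (Suc 0)\<^esub>j\<in>UNIV. pt (Suc 0) (K1_coord j z) (gen j))"
    by (rule arg_cong[OF K1_expand[OF z]])
  also have "\<dots> = (\<Oplus>\<^bsub>K 0\<^esub>j\<in>UNIV. pt 0 (K1_coord j z \<otimes>\<^bsub>A\<^esub> gx j) 1)"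
    unfolding hom_finsum[OF dK(1) K_grp K_grp c] by (simp only: g[OF K1_coord_closed[OF z]])
  also have "\<dots> = pt 0 (\<Oplus>\<^bsub>A\<^esub>j\<in>UNIV. K1_coord j z \<otimes>\<^bsub>A\<^esub> gx j) 1"
    by (rule pt_finsum_left[OF one_WF, symmetric]) (use K1_coord_closed[OF z] in simp_all)
  finally show ?thesis .
qed

lemma pt0_injective: assumes "a \<in> carrier A" "pt 0 a 1 = \<zero>\<^bsub>K 0\<^esub>" shows "a = \<zero>\<^bsub>A\<^esub>"
proof -
  obtain h where h: "h \<in> module_homs A (K 0) (left_regular A)"
    "\<And>a p. a \<in> carrier A \<Longrightarrow> p \<in> WF 0 \<Longrightarrow> h (pt 0 a p) = eta (eps p) \<otimes>\<^bsub>A\<^esub> a"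
    using coordinate_exists[of eps 0] by auto
  have "h (pt 0 a 1) = a" using h(2)[OF assms(1) one_WF] assms(1) by (simp add: eta_simps)
  moreover have "h \<zero>\<^bsub>K 0\<^esub> = \<zero>\<^bsub>A\<^esub>"
    using hom_zero[OF h(1) K_grp] left_module.axioms(2)[OF left_regular_module] by simp
  ultimately show ?thesis using assms(2) by simp
qed

lemma f_WF: "f \<in> WF (Suc (Suc 0))" unfolding WF_simps by (rule range_eqI[of _ _ 1]) (simp add: cst_simps)

lemma K2_form: assumes "z \<in> carrier (K (Suc (Suc 0)))"
  obtains a where "a \<in> carrier A" "z = pt (Suc (Suc 0)) a f"
proof -
  have "\<exists>a\<in>carrier A. z = pt (Suc (Suc 0)) a f" using assms
  proof (induction z rule: K_induct)
    case (pure a p)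
    then obtain c where "p = cst c * f" by (auto simp: WF_simps)
    then show ?case using pt_scale[OF pure(1) f_WF, of c] pure(1) by (intro bexI[of _ "eta c \<otimes>\<^bsub>A\<^esub> a"]) simp_all
  next
    case (add y z)
    then obtain a b where "a \<in> carrier A" "b \<in> carrier A" "y = pt (Suc (Suc 0)) a f" "z = pt (Suc (Suc 0)) b f" by blast
    then show ?case using pt_addl[OF _ _ f_WF] by (intro bexI[of _ "a \<oplus>\<^bsub>A\<^esub> b"]) simp_all
  qed
  then show ?thesis using that by blast
qed

text \<open>
  In coordinates the differential \<open>A \<otimes> k f \<rightarrow> A \<otimes> V\<close> is \<open>a \<mapsto> (a y\<^sub>j)\<^sub>j\<close>.
\<close>

lemma K1_coord_dK: assumes a: "a \<in> carrier A" shows "K1_coord j (dK (Suc 0) (pt (Suc (Suc 0)) a f)) = a \<otimes>\<^bsub>A\<^esub> cy j"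
proof -
  have z: "zrow C i \<in> WF (Suc 0)" for i by (simp add: WF_simps zrow_def del: One_nat_def)
  have c: "(\<lambda>i. pt (Suc 0) (a \<otimes>\<^bsub>A\<^esub> gx i) (zrow C i)) \<in> UNIV \<rightarrow> carrier (K (Suc 0))" using a z by simp
  have "K1_coord j (dK (Suc 0) (pt (Suc (Suc 0)) a f)) = (\<Oplus>\<^bsub>left_regular A\<^esub>i\<in>UNIV. K1_coord j (pt (Suc 0) (a \<otimes>\<^bsub>A\<^esub> gx i) (zrow C i)))"
    unfolding dK(3)[OF a f_WF] dK_pure_def lder_qform
    by (rule hom_finsum[OF K1_coord(1) K_grp _ c]) (rule left_module.axioms(2)[OF left_regular_module])
  also have "\<dots> = (\<Oplus>\<^bsub>A\<^esub>i\<in>UNIV. a \<otimes>\<^bsub>A\<^esub> (gx i \<otimes>\<^bsub>A\<^esub> eta (C $ i $ j)))"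
  proof -
    have "K1_coord j (pt (Suc 0) (a \<otimes>\<^bsub>A\<^esub> gx i) (zrow C i)) = a \<otimes>\<^bsub>A\<^esub> (gx i \<otimes>\<^bsub>A\<^esub> eta (C $ i $ j))" for i
      using K1_coord(2)[of "a \<otimes>\<^bsub>A\<^esub> gx i" "zrow C i" j] a z eta_comm[of "a \<otimes>\<^bsub>A\<^esub> gx i" "C $ i $ j"]
      by (simp add: zrow_def m_assoc)
    then show ?thesis by (simp add: finsum_def finprod_def left_regular_def)
  qed
  also have "\<dots> = a \<otimes>\<^bsub>A\<^esub> cy j" unfolding cy_eq by (rule finsum_rdistr[symmetric]) (use a in auto)
  finally show ?thesis .
qed

text \<open>
  In degree one, the kernel of \<open>(a\<^sub>j) \<mapsto> \<Sum> a\<^sub>j x\<^sub>j\<close> is described by the tail statement; in degree two, some column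
  \<open>y\<^sub>j\<close> is not zero and hence not a zerodivisor; all modules of higher degree vanish.
\<close>

lemma koszul_exact:
  "{z \<in> carrier (K (Suc m)). dK m z = \<zero>\<^bsub>K m\<^esub>} = dK (Suc m) ` carrier (K (Suc (Suc m)))"
proof -
  have "m = 0 \<or> m = Suc 0 \<or> (\<exists>l. m = Suc (Suc l))" by presburger
  then consider "m = 0" | "m = Suc 0" | l where "m = Suc (Suc l)" by blast
  then show ?thesis
  proof cases
    case 1
    show ?thesis unfolding 1
    proof (intro equalityI subsetI)
      fix z assume "z \<in> {z \<in> carrier (K (Suc 0)). dK 0 z = \<zero>\<^bsub>K 0\<^esub>}"
      then have z: "z \<in> carrier (K (Suc 0))" and 0: "dK 0 z = \<zero>\<^bsub>K 0\<^esub>" by auto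
      have "(\<Oplus>\<^bsub>A\<^esub>j\<in>UNIV. K1_coord j z \<otimes>\<^bsub>A\<^esub> gx j) = \<zero>\<^bsub>A\<^esub>"
        by (rule pt0_injective) (use 0 dK0[OF z] K1_coord_closed[OF z] in \<open>auto intro!: finsum_closed\<close>)
      then obtain c where c: "c \<in> carrier A" "\<And>j. K1_coord j z = c \<otimes>\<^bsub>A\<^esub> cy j"
        using tail_exact[of "\<lambda>j. K1_coord j z"] K1_coord_closed[OF z] by blast
      have p: "pt (Suc (Suc 0)) c f \<in> carrier (K (Suc (Suc 0)))" by (rule pt_closed[OF c(1) f_WF])
      have "z = dK (Suc 0) (pt (Suc (Suc 0)) c f)"
        by (rule K1_eqI[OF z hom_closed[OF dK(1) p]]) (simp add: c(2) K1_coord_dK[OF c(1)])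
      then show "z \<in> dK (Suc 0) ` carrier (K (Suc (Suc 0)))" using p by (rule image_eqI)
    next
      fix z assume "z \<in> dK (Suc 0) ` carrier (K (Suc (Suc 0)))"
      then obtain y where y: "y \<in> carrier (K (Suc (Suc 0)))" "z = dK (Suc 0) y" by blast
      obtain a where a: "a \<in> carrier A" "y = pt (Suc (Suc 0)) a f" using K2_form[OF y(1)] .
      have z: "z \<in> carrier (K (Suc 0))" using hom_closed[OF dK(1) y(1)] y(2) by simp
      have "(\<Oplus>\<^bsub>A\<^esub>j\<in>UNIV. K1_coord j z \<otimes>\<^bsub>A\<^esub> gx j) = (\<Oplus>\<^bsub>A\<^esub>j\<in>UNIV. a \<otimes>\<^bsub>A\<^esub> (cy j \<otimes>\<^bsub>A\<^esub> gx j))"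
        using a by (simp add: y(2) a(2) K1_coord_dK[OF a(1)] m_assoc)
      also have "\<dots> = a \<otimes>\<^bsub>A\<^esub> (\<Oplus>\<^bsub>A\<^esub>j\<in>UNIV. cy j \<otimes>\<^bsub>A\<^esub> gx j)"
        by (rule finsum_rdistr[symmetric]) (use a in auto)
      also have "\<dots> = \<zero>\<^bsub>A\<^esub>" using a by (simp add: relation')
      finally have "dK 0 z = \<zero>\<^bsub>K 0\<^esub>" using dK0[OF z] pt_zero_left[OF one_WF] by simp
      then show "z \<in> {z \<in> carrier (K (Suc 0)). dK 0 z = \<zero>\<^bsub>K 0\<^esub>}" using z by simp
    qed
  next
    case 2
    interpret K2: abelian_group "K (Suc (Suc 0))" by (rule K_grp)
    have k: "z = \<zero>\<^bsub>K (Suc (Suc 0))\<^esub>" if z: "z \<in> carrier (K (Suc (Suc 0)))" and 0: "dK (Suc 0) z = \<zero>\<^bsub>K (Suc 0)\<^esub>" for z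
    proof -
      obtain a where a: "a \<in> carrier A" "z = pt (Suc (Suc 0)) a f" using K2_form[OF z] .
      obtain i j where ij: "C $ i $ j \<noteq> 0" by (rule C_nonzero)
      have "K1_coord j \<zero>\<^bsub>K (Suc 0)\<^esub> = \<zero>\<^bsub>A\<^esub>"
        using hom_zero[OF K1_coord(1) K_grp] left_module.axioms(2)[OF left_regular_module] by simp
      then have "a \<otimes>\<^bsub>A\<^esub> cy j = \<zero>\<^bsub>A\<^esub>" using K1_coord_dK[OF a(1), of j] 0 a(2) by simp
      then have "a = \<zero>\<^bsub>A\<^esub>" using nzd_right[of "\<lambda>i. C $ i $ j" i a] ij a(1) by (simp add: ycol_def)
      then show ?thesis using a(2) pt_zero_left[OF f_WF] by simp
    qed
    have "{z \<in> carrier (K (Suc (Suc 0))). dK (Suc 0) z = \<zero>\<^bsub>K (Suc 0)\<^esub>} = {\<zero>\<^bsub>K (Suc (Suc 0))\<^esub>}"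
      using k hom_zero[OF dK(1) K_grp K_grp, of "Suc 0"] by auto
    moreover have "dK (Suc (Suc 0)) ` carrier (K (Suc (Suc (Suc 0)))) = {\<zero>\<^bsub>K (Suc (Suc 0))\<^esub>}"
      unfolding K_high_trivial using hom_zero[OF dK(1) K_grp K_grp, of "Suc (Suc 0)"] by simp
    ultimately show ?thesis unfolding 2 by simp
  next
    case (3 l)
    have "{z \<in> carrier (K (Suc m)). dK m z = \<zero>\<^bsub>K m\<^esub>} = {\<zero>\<^bsub>K (Suc m)\<^esub>}"
      unfolding 3 K_high_trivial using hom_zero[OF dK(1) K_grp K_grp, of "Suc (Suc l)"] by auto
    moreover have "dK (Suc m) ` carrier (K (Suc (Suc m))) = {\<zero>\<^bsub>K (Suc m)\<^esub>}"
      unfolding 3 K_high_trivial using hom_zero[OF dK(1) K_grp K_grp, of "Suc (Suc (Suc l))"] by simp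
    ultimately show ?thesis by simp
  qed
qed

theorem koszul_quadratic: "koszul sc R"
  unfolding koszul_def koszul_differential_dK using koszul_exact by blast

end

section \<open>Quadratic algebras with one relation\<close>

text \<open>
  All rows are multiples of one vector.
\<close>

lemma rank1_imp_rank_le_1:
  fixes M :: "'k::field^'n^'n"
  assumes "rank1 M" shows "rank M \<le> 1"
proof -
  obtain a b where ab: "\<And>i j. M $ i $ j = a i * b j" using assms by (auto simp: rank1_def)
  have "row i M \<in> vec.span {\<chi> j. b j}" for i
  proof -
    have "row i M = a i *s (\<chi> j. b j)" by (simp add: row_def vec_eq_iff ab)
    then show ?thesis by (simp only:) (intro vec.span_scale vec.span_base singletonI)
  qed
  then have "rows M \<subseteq> vec.span {\<chi> j. b j}" unfolding rows_def by blast
  then have "vec.dim (rows M) \<le> vec.dim {\<chi> j. b j}"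
    by (metis vec.dim_span vec.dim_subset)
  also have "\<dots> \<le> card {\<chi> j. b j}" by (rule vec.dim_le_card') simp
  finally show ?thesis by (simp add: row_rank_def_gen)
qed

theorem proposition5p4:
  fixes sc :: "'k::field \<Rightarrow> 'v::ab_group_add \<Rightarrow> 'v"
    and x :: "'n::finite \<Rightarrow> 'v"
    and f :: "('k, 'v) tensor"
    and M :: "'k^'n^'n"
  assumes "vector_space sc"
    and "is_basis sc x"
    and "f \<in> tensor_power sc 2"
    and "f \<noteq> \<zero>\<^bsub>tensor_algebra sc\<^esub>"
    and "f = tensor_of_matrix sc x M"
    and "rank M > 1"
    and "R = tensor_line sc f"
    and "A = quad_algebra sc R"
  shows "(\<forall>v. v \<noteq> 0 \<longrightarrow> \<not> left_zerodivisor A (quad_vec sc R v) \<and>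
                       \<not> right_zerodivisor A (quad_vec sc R v)) \<and>
         left_global_dim TYPE('u) A = 2 \<and>
         koszul sc R \<and>
         (AS_Gorenstein TYPE('u) A (quad_unit sc R) (quad_grading sc R) \<longleftrightarrow> invertible M)"
proof -
  have nr: "\<not> rank1 M" using rank1_imp_rank_le_1[of M] assms(6) by auto
  interpret Q: koszul_setup sc x M
    by (intro koszul_setup.intro tensor_basis.intro tensor_basis_axioms.intro koszul_setup_axioms.intro assms(1,2) nr)
  have R: "R = Q.R" using assms(5,7) by (simp add: Q.R_def Q.tensor_of_matrix_\<sigma>)
  have A: "A = quad_algebra sc Q.R" using assms(8) R by simp
  have "AS_Gorenstein TYPE('u) A (quad_unit sc R) (quad_grading sc R) \<longleftrightarrow> invertible M"
    unfolding A R Q.quad_unit_eta Q.quad_grading_\<pi>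
    by (rule Q.AS_Gorenstein_iff[OF Q.eta_connected Q.eta_positive_part])
  then show ?thesis
    unfolding A R using Q.no_zerodivisors Q.global_dim_2 Q.koszul_quadratic by blast
qed

end
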